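(* Let $n\ge2$, let $F\in \mathrm{GL}_n(\mathbb C)$ be generic, let $\mathcal H=\mathcal H(F)$ and let $\tau\colon \mathcal H\to\mathbb C$ be a character. Set $S:=\tau(u)$ and $T:=\tau(v)=S^{-t}$ (entrywise application of $\tau$), and let $\mathcal K\subset M_n(\mathbb C)$ be the space of matrices commuting with $F^tS$. Let $d=\dim\mathcal K$, let $p=1$ if $S=T=I_n$ and $p=0$ otherwise, and let $t=1$ if $F^2=\alpha T$ for some $\alpha\in\mathbb C$ and $t=2$ otherwise. Then the Hochschild cohomology of $\mathcal H$ with coefficients in ${}_\varepsilon\mathbb C_\tau$ satisfies $$\dim \mathrm H^0(\mathcal H,{}_\varepsilon\mathbb C_\tau)=p,\quad \dim \mathrm H^1(\mathcal H,{}_\varepsilon\mathbb C_\tau)=d+p-1,\quad \dim \mathrm H^2(\mathcal H,{}_\varepsilon\mathbb C_\tau)=d-t,\quad \dim \mathrm H^3(\mathcal H,{}_\varepsilon\mathbb C_\tau)=2-t,$$ and $\dim \mathrm H^k(\mathcal H,{}_\varepsilon\mathbb C_\tau)=0$ for all $k\ge4$.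
   Context: All vector spaces and algebras are over $\mathbb C$. For a matrix $A$, $A^t$ is the transpose and, for $A\in\mathrm{GL}_n(\mathbb C)$, $A^{-t}:=(A^{-1})^t$. For $F\in\mathrm{GL}_n(\mathbb C)$, $n\ge 2$, $\mathcal H(F)$ is the universal unital algebra generated by the entries of $u=(u_{ij})_{i,j=1}^n$ and $v=(v_{ij})_{i,j=1}^n$ subject to $uv^t=v^tu=I$, $vFu^tF^{-1}=Fu^tF^{-1}v=I$. It is a Hopf algebra with $\Delta(u_{ij})=\sum_k u_{ik}\otimes u_{kj}$, $\Delta(v_{ij})=\sum_k v_{ik}\otimes v_{kj}$, $\varepsilon(u_{ij})=\varepsilon(v_{ij})=\delta_{ij}$, $S(u)=v^t$, $S(v)=Fu^tF^{-1}$ (in the claim, however, $S$ denotes the scalar matrix $\tau(u)$). $F$ is called normalizable if either $\mathrm{tr}(F)\ne0$ and $\mathrm{tr}(F^{-1})\neq 0$, or $\mathrm{tr}(F)=0=\mathrm{tr}(F^{-1})$. $F$ is called generic if it is normalizable and the solutions $q$ of $q^2-\sqrt{\mathrm{tr}(F)\mathrm{tr}(F^{-1})}\,q+1=0$ are not roots of unity of order $\ge 3$. A character is a unital algebra homomorphism to $\mathbb C$. The bimodule ${}_\varepsilon\mathbb C_\tau$ is $\mathbb C$ with actions $a\cdot z\cdot b=\varepsilon(a)z\tau(b)$. $\mathrm H^k(A,M)$ is the usual Hochschild cohomology of the algebra $A$ with coefficients in the $A$-bimodule $M$; for a Hopf algebra $A$ it satisfies $\mathrm H^k(A,{}_\varepsilon\mathbb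 C_\tau)\cong\mathrm{Ext}^k_A(\mathbb C_\varepsilon,\mathbb C_\tau)$ (Ext of right modules, where $\mathbb C_\sigma$ denotes $\mathbb C$ with $z\cdot a=z\sigma(a)$). *)

theory Defs
  imports
    "Jordan_Normal_Form.VS_Connect"
    "HOL-Algebra.QuotRing"
    "HOL-Library.Poly_Mapping"
    "HOL-Analysis.Analysis"
begin

(* Jordan_Normal_Form is used only for its vector spaces over carrier sets; square matrices are the
   type-indexed ones of HOL-Analysis. *)
no_notation Matrix.vec_index (infixl "$" 100)
hide_const (open) Matrix.mat Matrix.row Matrix.rows Matrix.col Matrix.vec Determinant.det
  Multiset.mult Polynomial.smult Modules.module

section \<open>Quotients of algebras and of vector spaces\<close>

text \<open>
  Algebras and vector spaces over the complex numbers are both records of type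
  \<^typ>\<open>(complex, 'a) module\<close>; the multiplicative fields are irrelevant for a mere vector space.
  The quotient extends \<^const>\<open>FactRing\<close> by the induced scalar multiplication.
\<close>

definition quotient_module ::
    "('c, 'a, 'b) module_scheme \<Rightarrow> 'a set \<Rightarrow> ('c, 'a set) module" where
  "quotient_module M N =
     \<lparr>carrier = carrier (M Quot N), mult = mult (M Quot N), one = one (M Quot N),
      zero = zero (M Quot N), add = add (M Quot N),
      smult = (\<lambda>c X. \<Union>x\<in>X. N +>\<^bsub>M\<^esub> (c \<odot>\<^bsub>M\<^esub> x))\<rparr>"

definition character :: "(complex, 'a, 'b) module_scheme \<Rightarrow> ('a \<Rightarrow> complex) \<Rightarrow> bool" where
  "character A \<phi> \<longleftrightarrow>
     \<phi> \<in> Ring.ring_hom A class_ring \<and> (\<forall>c. \<forall>a \<in> carrier A. \<phi> (c \<odot>\<^bsub>A\<^esub> a) = c * \<phi> a)"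


section \<open>Hochschild cohomology\<close>

record ('a, 'm) bimodule = "(complex, 'm) module" +
  lact :: "'a \<Rightarrow> 'm \<Rightarrow> 'm"
  ract :: "'m \<Rightarrow> 'a \<Rightarrow> 'm"

definition tuples :: "('a, 'b) partial_object_scheme \<Rightarrow> nat \<Rightarrow> 'a list set" where
  "tuples A k = {xs. set xs \<subseteq> carrier A \<and> length xs = k}"

definition multilinear ::
    "(complex, 'a, 'b) module_scheme \<Rightarrow> (complex, 'm, 'd) module_scheme \<Rightarrow> nat \<Rightarrow>
     ('a list \<Rightarrow> 'm) \<Rightarrow> bool" where
  "multilinear A M k f \<longleftrightarrow>
     (\<forall>xs ys a b c. set xs \<subseteq> carrier A \<and> set ys \<subseteq> carrier A \<and> a \<in> carrier A \<and> b \<in> carrier A \<and>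
        length xs + 1 + length ys = k \<longrightarrow>
        f (xs @ (a \<oplus>\<^bsub>A\<^esub> b) # ys) = f (xs @ a # ys) \<oplus>\<^bsub>M\<^esub> f (xs @ b # ys) \<and>
        f (xs @ (c \<odot>\<^bsub>A\<^esub> a) # ys) = c \<odot>\<^bsub>M\<^esub> f (xs @ a # ys))"

text \<open>The \<open>k\<close>-cochains are the \<open>k\<close>-linear maps from \<open>A\<close> to \<open>M\<close>, as extensional functions on lists
  of length \<open>k\<close>; in particular the \<open>0\<close>-cochains are the functions \<open>{[]} \<rightarrow> M\<close>.\<close>

definition cochains ::
    "(complex, 'a, 'b) module_scheme \<Rightarrow> (complex, 'm, 'd) module_scheme \<Rightarrow> nat \<Rightarrow>
     (complex, 'a list \<Rightarrow> 'm) module" where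
  "cochains A M k =
     \<lparr>carrier = {f \<in> tuples A k \<rightarrow>\<^sub>E carrier M. multilinear A M k f},
      mult = undefined, one = undefined,
      zero = (\<lambda>xs \<in> tuples A k. \<zero>\<^bsub>M\<^esub>),
      add = (\<lambda>f g. \<lambda>xs \<in> tuples A k. f xs \<oplus>\<^bsub>M\<^esub> g xs),
      smult = (\<lambda>c f. \<lambda>xs \<in> tuples A k. c \<odot>\<^bsub>M\<^esub> f xs)\<rparr>"

text \<open>With \<open>xs = [a\<^sub>1, \<dots>, a\<^sub>k\<^sub>+\<^sub>1]\<close> this is
  \<open>a\<^sub>1 f(a\<^sub>2,\<dots>,a\<^sub>k\<^sub>+\<^sub>1) + (\<Sum>i=1..k. (-1)\<^sup>i f(a\<^sub>1,\<dots>,a\<^sub>i a\<^sub>i\<^sub>+\<^sub>1,\<dots>,a\<^sub>k\<^sub>+\<^sub>1)) + (-1)\<^sup>k\<^sup>+\<^sup>1 f(a\<^sub>1,\<dots>,a\<^sub>k) a\<^sub>k\<^sub>+\<^sub>1\<close>;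
  list positions start at \<open>0\<close>, so \<open>a\<^sub>i\<close> is \<open>xs ! (i - 1)\<close>.\<close>

definition hochschild_d ::
    "(complex, 'a, 'b) module_scheme \<Rightarrow> ('a, 'm, 'd) bimodule_scheme \<Rightarrow> nat \<Rightarrow>
     ('a list \<Rightarrow> 'm) \<Rightarrow> 'a list \<Rightarrow> 'm" where
  "hochschild_d A M k f = (\<lambda>xs \<in> tuples A (Suc k).
      lact M (hd xs) (f (tl xs))
      \<oplus>\<^bsub>M\<^esub> (\<Oplus>\<^bsub>M\<^esub>i\<in>{1..k}. (-1) ^ i \<odot>\<^bsub>M\<^esub>
            f (take (i - 1) xs @ (xs ! (i - 1) \<otimes>\<^bsub>A\<^esub> xs ! i) # drop (i + 1) xs))
      \<oplus>\<^bsub>M\<^esub> (-1) ^ (k + 1) \<odot>\<^bsub>M\<^esub> ract M (f (butlast xs)) (last xs))"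

definition cocycles ::
    "(complex, 'a, 'b) module_scheme \<Rightarrow> ('a, 'm, 'd) bimodule_scheme \<Rightarrow> nat \<Rightarrow>
     ('a list \<Rightarrow> 'm) set" where
  "cocycles A M k =
     {f \<in> carrier (cochains A M k). hochschild_d A M k f = \<zero>\<^bsub>cochains A M (Suc k)\<^esub>}"

fun coboundaries ::
    "(complex, 'a, 'b) module_scheme \<Rightarrow> ('a, 'm, 'd) bimodule_scheme \<Rightarrow> nat \<Rightarrow>
     ('a list \<Rightarrow> 'm) set" where
  "coboundaries A M 0 = {\<zero>\<^bsub>cochains A M 0\<^esub>}"
| "coboundaries A M (Suc k) = hochschild_d A M k ` carrier (cochains A M k)"

definition hochschild_cohomology ::
    "(complex, 'a, 'b) module_scheme \<Rightarrow> ('a, 'm, 'd) bimodule_scheme \<Rightarrow> nat \<Rightarrow>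
     (complex, ('a list \<Rightarrow> 'm) set) module" where
  "hochschild_cohomology A M k =
     quotient_module (cochains A M k \<lparr>carrier := cocycles A M k\<rparr>) (coboundaries A M k)"

definition character_bimodule :: "('a \<Rightarrow> complex) \<Rightarrow> ('a \<Rightarrow> complex) \<Rightarrow> ('a, complex) bimodule" where
  "character_bimodule \<sigma> \<tau> =
     \<lparr>carrier = UNIV, mult = (*), one = 1, zero = 0, add = (+), smult = (*),
      lact = (\<lambda>a z. \<sigma> a * z), ract = (\<lambda>z b. z * \<tau> b)\<rparr>"


section \<open>Free algebras\<close>

text \<open>The free algebra is the monoid algebra of the free monoid. The latter is a copy of the type of
  lists, written additively because \<^typ>\<open>'a \<Rightarrow>\<^sub>0 'b\<close> takes exponents from a \<^class>\<open>monoid_add\<close>.\<close>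

datatype 'g free_monoid = Word (letters: "'g list")

instantiation free_monoid :: (type) monoid_add
begin
definition zero_free_monoid :: "'a free_monoid" where "0 = Word []"
definition plus_free_monoid :: "'a free_monoid \<Rightarrow> 'a free_monoid \<Rightarrow> 'a free_monoid" where
  "v + w = Word (letters v @ letters w)"
instance
  by standard (simp_all add: zero_free_monoid_def plus_free_monoid_def)
end

type_synonym 'g free_algebra = "'g free_monoid \<Rightarrow>\<^sub>0 complex"

definition scalar :: "complex \<Rightarrow> 'g free_algebra" where
  "scalar c = Poly_Mapping.single 0 c"

definition gen :: "'g \<Rightarrow> 'g free_algebra" where
  "gen g = Poly_Mapping.single (Word [g]) 1"

definition free_algebra :: "(complex, 'g free_algebra) module" where
  "free_algebra =
     \<lparr>carrier = UNIV, mult = (*), one = 1, zero = 0, add = (+), smult = (\<lambda>c x. scalar c * x)\<rparr>"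


section \<open>The algebras \<open>\<H>(F)\<close>\<close>

datatype 'n generator = U 'n 'n | V 'n 'n

definition u_mat :: "'n generator free_algebra ^ 'n ^ 'n" where
  "u_mat = (\<chi> i j. gen (U i j))"

definition v_mat :: "'n generator free_algebra ^ 'n ^ 'n" where
  "v_mat = (\<chi> i j. gen (V i j))"

definition entries :: "'a ^ 'n ^ 'm \<Rightarrow> 'a set" where
  "entries A = {A $ i $ j | i j. True}"

definition relations :: "complex ^ 'n ^ 'n \<Rightarrow> 'n generator free_algebra set" where
  "relations F =
    (let u = u_mat; v = v_mat; G = map_matrix scalar F; G' = map_matrix scalar (matrix_inv F) in
       entries (u ** transpose v - mat 1) \<union>
       entries (transpose v ** u - mat 1) \<union>
       entries (v ** G ** transpose u ** G' - mat 1) \<union>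
       entries (G ** transpose u ** G' ** v - mat 1))"

definition rel_ideal :: "complex ^ 'n ^ 'n \<Rightarrow> 'n generator free_algebra set" where
  "rel_ideal F = Idl\<^bsub>free_algebra\<^esub> (relations F)"

definition \<H> :: "complex ^ 'n ^ 'n \<Rightarrow> (complex, 'n generator free_algebra set) module" where
  "\<H> F = quotient_module free_algebra (rel_ideal F)"

abbreviation coset_of :: "complex ^ 'n ^ 'n \<Rightarrow> 'n generator free_algebra \<Rightarrow> 'n generator free_algebra set" where
  "coset_of F x \<equiv> rel_ideal F +>\<^bsub>free_algebra\<^esub> x"

definition \<H>_u :: "complex ^ 'n ^ 'n \<Rightarrow> 'n generator free_algebra set ^ 'n ^ 'n" where
  "\<H>_u F = map_matrix (coset_of F) u_mat"

definition \<H>_v :: "complex ^ 'n ^ 'n \<Rightarrow> 'n generator free_algebra set ^ 'n ^ 'n" where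
  "\<H>_v F = map_matrix (coset_of F) v_mat"

text \<open>The counit; existence and uniqueness are shown in \<open>counit_ex1\<close> below, for invertible \<open>F\<close>.\<close>

definition counit :: "complex ^ 'n ^ 'n \<Rightarrow> 'n generator free_algebra set \<Rightarrow> complex" where
  "counit F = (THE \<epsilon>. \<epsilon> \<in> extensional (carrier (\<H> F)) \<and> character (\<H> F) \<epsilon> \<and>
      map_matrix \<epsilon> (\<H>_u F) = mat 1 \<and> map_matrix \<epsilon> (\<H>_v F) = mat 1)"


section \<open>Conditions on matrices\<close>

definition normalizable :: "complex ^ 'n ^ 'n \<Rightarrow> bool" where
  "normalizable F \<longleftrightarrow>
     (trace F \<noteq> 0 \<and> trace (matrix_inv F) \<noteq> 0) \<or> (trace F = 0 \<and> trace (matrix_inv F) = 0)"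

definition root_of_unity_of_order :: "nat \<Rightarrow> complex \<Rightarrow> bool" where
  "root_of_unity_of_order m q \<longleftrightarrow> m > 0 \<and> q ^ m = 1 \<and> (\<forall>k. 0 < k \<and> k < m \<longrightarrow> q ^ k \<noteq> 1)"

text \<open>The choice of the square root does not matter: the other one replaces the solutions \<open>q\<close> by
  \<open>-q\<close>, and \<open>q\<close> is a root of unity of order at least 3 iff \<open>-q\<close> is.\<close>

definition generic :: "complex ^ 'n ^ 'n \<Rightarrow> bool" where
  "generic F \<longleftrightarrow> normalizable F \<and>
     (\<forall>q. q\<^sup>2 - csqrt (trace F * trace (matrix_inv F)) * q + 1 = 0 \<longrightarrow>
        \<not> (\<exists>m\<ge>3. root_of_unity_of_order m q))"

definition mat_scale :: "complex \<Rightarrow> complex ^ 'n ^ 'n \<Rightarrow> complex ^ 'n ^ 'n" where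
  "mat_scale c = map_matrix ((*) c)"

text \<open>The commutant of a matrix, as a complex vector space; the function \<^const>\<open>Real_Vector_Spaces.dim\<close>
  on the type of complex matrices would be the dimension over the reals.\<close>

definition commutant :: "complex ^ 'n ^ 'n \<Rightarrow> (complex, complex ^ 'n ^ 'n) module" where
  "commutant A =
     \<lparr>carrier = {X. X ** A = A ** X}, mult = (**), one = mat 1, zero = 0, add = (+),
      smult = mat_scale\<rparr>"


section \<open>Characters of \<open>\<H>(F)\<close> and existence of the counit\<close>

lemma ring_free_algebra: "ring (free_algebra :: (complex, 'g free_algebra) module)"
proof (rule ringI)
  show "abelian_group (free_algebra :: (complex, 'g free_algebra) module)"
  proof (rule abelian_groupI)
    fix x :: "'g free_algebra"
    have "- x \<oplus>\<^bsub>free_algebra\<^esub> x = \<zero>\<^bsub>free_algebra\<^esub>" "- x \<in> carrier free_algebra"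
      by (simp_all add: free_algebra_def)
    then show "\<exists>y\<in>carrier free_algebra. y \<oplus>\<^bsub>free_algebra\<^esub> x = \<zero>\<^bsub>free_algebra\<^esub>"
      by blast
  qed (simp_all add: free_algebra_def ac_simps)
  show "monoid (free_algebra :: (complex, 'g free_algebra) module)"
    by (rule monoidI) (auto simp: free_algebra_def mult.assoc)
qed (auto simp: free_algebra_def algebra_simps)

lemma ideal_rel_ideal: "ideal (rel_ideal F) free_algebra"
  unfolding rel_ideal_def
  by (rule ring.genideal_ideal[OF ring_free_algebra]) (simp add: free_algebra_def)

definition eval_free :: "('g \<Rightarrow> complex) \<Rightarrow> 'g free_algebra \<Rightarrow> complex" where
  "eval_free h x =
     (\<Sum>w \<in> Poly_Mapping.keys x. Poly_Mapping.lookup x w * prod_list (map h (letters w)))"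

lemma eval_free_add: "eval_free h (x + y) = eval_free h x + eval_free h y"
  unfolding eval_free_def
  by (rule setsum_keys_plus_distrib) (auto simp: algebra_simps)

lemma eval_free_0 [simp]: "eval_free h 0 = 0"
  by (simp add: eval_free_def)

lemma eval_free_single:
  "eval_free h (Poly_Mapping.single w c) = c * prod_list (map h (letters w))"
  by (simp add: eval_free_def)

lemma eval_free_sum: "eval_free h (sum f A) = (\<Sum>x\<in>A. eval_free h (f x))"
  by (induction A rule: infinite_finite_induct) (auto simp: eval_free_add)

lemma eval_free_diff: "eval_free h (x - y) = eval_free h x - eval_free h y"
  using eval_free_add[of h "x - y" y] by simp

lemma free_algebra_eq_sum:
  "x = (\<Sum>w \<in> Poly_Mapping.keys x. Poly_Mapping.single w (Poly_Mapping.lookup x w))"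
proof (rule poly_mapping_eqI)
  fix k
  have "Poly_Mapping.lookup (\<Sum>w \<in> Poly_Mapping.keys x. Poly_Mapping.single w (Poly_Mapping.lookup x w)) k
      = (\<Sum>w \<in> Poly_Mapping.keys x. if w = k then Poly_Mapping.lookup x w else 0)"
    by (simp add: lookup_sum lookup_single when_def)
  also have "\<dots> = Poly_Mapping.lookup x k"
    by (simp add: in_keys_iff)
  finally show "Poly_Mapping.lookup x k = Poly_Mapping.lookup
      (\<Sum>w \<in> Poly_Mapping.keys x. Poly_Mapping.single w (Poly_Mapping.lookup x w)) k" ..
qed

lemma eval_free_mult: "eval_free h (x * y) = eval_free h x * eval_free h y"
proof -
  have "eval_free h (x * y) =
      eval_free h ((\<Sum>v \<in> Poly_Mapping.keys x. Poly_Mapping.single v (Poly_Mapping.lookup x v)) *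
        (\<Sum>w \<in> Poly_Mapping.keys y. Poly_Mapping.single w (Poly_Mapping.lookup y w)))"
    by (rule arg_cong2[where f = "\<lambda>x y. eval_free h (x * y)", OF free_algebra_eq_sum free_algebra_eq_sum])
  also have "\<dots> = (\<Sum>v \<in> Poly_Mapping.keys x. \<Sum>w \<in> Poly_Mapping.keys y.
      (Poly_Mapping.lookup x v * prod_list (map h (letters v))) *
      (Poly_Mapping.lookup y w * prod_list (map h (letters w))))"
    unfolding sum_product eval_free_sum
    by (simp add: mult_single eval_free_single plus_free_monoid_def mult_ac)
  also have "\<dots> = eval_free h x * eval_free h y"
    by (simp add: eval_free_def sum_product)
  finally show ?thesis .
qed

lemma eval_free_scalar [simp]: "eval_free h (scalar c) = c"
  by (simp add: scalar_def eval_free_single zero_free_monoid_def)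

lemma eval_free_1 [simp]: "eval_free h 1 = 1"
  using eval_free_scalar[of h 1] by (simp add: scalar_def)

lemma eval_free_gen [simp]: "eval_free h (gen g) = h g"
  by (simp add: gen_def eval_free_single)

lemma eval_free_matrix_mult:
  "map_matrix (eval_free h) (A ** B) = map_matrix (eval_free h) A ** map_matrix (eval_free h) B"
  by (simp add: vec_eq_iff matrix_matrix_mult_def eval_free_sum eval_free_mult)

lemma free_algebra_hom_unique:
  fixes \<phi> :: "'g free_algebra \<Rightarrow> complex"
  assumes add: "\<And>x y. \<phi> (x + y) = \<phi> x + \<phi> y" and mult: "\<And>x y. \<phi> (x * y) = \<phi> x * \<phi> y"
    and scal: "\<And>c. \<phi> (scalar c) = c"
  shows "\<phi> x = eval_free (\<lambda>g. \<phi> (gen g)) x"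
proof -
  have zero: "\<phi> 0 = 0" using add[of 0 0] by simp
  have sum: "\<phi> (sum f A) = (\<Sum>x\<in>A. \<phi> (f x))" for f :: "'g free_monoid \<Rightarrow> _" and A
    by (induction A rule: infinite_finite_induct) (auto simp: add zero)
  have word: "\<phi> (Poly_Mapping.single (Word gs) 1) = prod_list (map (\<lambda>g. \<phi> (gen g)) gs)" for gs
  proof (induction gs)
    case Nil
    then show ?case using scal[of 1] by (simp add: scalar_def zero_free_monoid_def)
  next
    case (Cons g gs)
    have "Poly_Mapping.single (Word (g # gs)) (1::complex) =
        gen g * Poly_Mapping.single (Word gs) 1"
      by (simp add: gen_def mult_single plus_free_monoid_def)
    then show ?case using Cons by (simp add: mult)
  qed
  have single: "\<phi> (Poly_Mapping.single w c) = c * prod_list (map (\<lambda>g. \<phi> (gen g)) (letters w))"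
    for w c
  proof -
    have "Poly_Mapping.single w c = scalar c * Poly_Mapping.single (Word (letters w)) 1"
      by (simp add: scalar_def mult_single)
    then show ?thesis by (simp only: mult scal word)
  qed
  have "\<phi> x = \<phi> (\<Sum>w \<in> Poly_Mapping.keys x. Poly_Mapping.single w (Poly_Mapping.lookup x w))"
    by (rule arg_cong[OF free_algebra_eq_sum])
  then show ?thesis by (simp add: sum single eval_free_def)
qed

lemma free_algebra_simps [simp]:
  "carrier free_algebra = UNIV"
  "x \<otimes>\<^bsub>free_algebra\<^esub> y = x * y" "x \<oplus>\<^bsub>free_algebra\<^esub> y = x + y"
  "\<one>\<^bsub>free_algebra\<^esub> = 1" "\<zero>\<^bsub>free_algebra\<^esub> = 0" "c \<odot>\<^bsub>free_algebra\<^esub> x = scalar c * x"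
  by (simp_all add: free_algebra_def)

lemma \<H>_simps:
  shows "carrier (\<H> F) = range (coset_of F)"
    and "coset_of F x \<otimes>\<^bsub>\<H> F\<^esub> coset_of F y = coset_of F (x * y)"
    and "coset_of F x \<oplus>\<^bsub>\<H> F\<^esub> coset_of F y = coset_of F (x + y)"
    and "\<one>\<^bsub>\<H> F\<^esub> = coset_of F 1"
    and "c \<odot>\<^bsub>\<H> F\<^esub> coset_of F x = coset_of F (scalar c * x)"
proof -
  interpret I: ideal "rel_ideal F" free_algebra by (rule ideal_rel_ideal)
  show "carrier (\<H> F) = range (coset_of F)"
    unfolding \<H>_def quotient_module_def FactRing_def
    by (simp add: A_RCOSETS_def' UNION_singleton_eq_range)
  show "coset_of F x \<otimes>\<^bsub>\<H> F\<^esub> coset_of F y = coset_of F (x * y)"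
    unfolding \<H>_def quotient_module_def FactRing_def using I.rcoset_mult_add[of x y] by simp
  show "coset_of F x \<oplus>\<^bsub>\<H> F\<^esub> coset_of F y = coset_of F (x + y)"
    unfolding \<H>_def quotient_module_def FactRing_def using I.a_rcos_sum[of x y] by simp
  show "\<one>\<^bsub>\<H> F\<^esub> = coset_of F 1"
    unfolding \<H>_def quotient_module_def FactRing_def by simp
  have *: "coset_of F (scalar c * z) = coset_of F (scalar c * x)" if z: "z \<in> coset_of F x" for z
  proof -
    obtain i where i: "i \<in> rel_ideal F" "z = i + x"
    proof -
      have "z \<in> (\<Union>i \<in> rel_ideal F. {i + x})"
        using z by (simp only: a_r_coset_def' free_algebra_simps)
      then show ?thesis using that by blast
    qed
    have "scalar c * i \<in> rel_ideal F"
      using I.I_l_closed[OF i(1), of "scalar c"] by simp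
    then have "scalar c * z \<in> coset_of F (scalar c * x)"
      unfolding a_r_coset_def' i(2) by (auto simp: distrib_left)
    then show ?thesis
      by (intro I.a_repr_independence'[symmetric]) auto
  qed
  have "x \<in> coset_of F x"
    by (rule I.a_rcos_self) simp
  then have "(\<Union>z \<in> coset_of F x. coset_of F (scalar c * z)) = coset_of F (scalar c * x)"
    using * by blast
  then show "c \<odot>\<^bsub>\<H> F\<^esub> coset_of F x = coset_of F (scalar c * x)"
    by (simp add: \<H>_def quotient_module_def)
qed

lemma coset_of_self: "x \<in> coset_of F x"
proof -
  interpret I: ideal "rel_ideal F" free_algebra by (rule ideal_rel_ideal)
  show ?thesis by (rule I.a_rcos_self) simp
qed

lemma coset_of_relation:
  assumes "r \<in> relations F"
  shows "coset_of F r = coset_of F 0"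
proof -
  interpret I: ideal "rel_ideal F" free_algebra by (rule ideal_rel_ideal)
  have "r \<in> rel_ideal F"
    using assms ring.genideal_self[OF ring_free_algebra, of "relations F"]
    unfolding rel_ideal_def by auto
  moreover have "0 \<in> rel_ideal F"
    using additive_subgroup.zero_closed[OF ideal.axioms(1)[OF ideal_rel_ideal], of F]
    unfolding free_algebra_simps .
  ultimately show ?thesis
    by (simp only: I.a_rcos_const)
qed

lemma character_\<H>_iff:
  "character (\<H> F) \<phi> \<longleftrightarrow>
     (\<exists>h. (\<forall>r \<in> relations F. eval_free h r = 0) \<and>
          (\<forall>x. \<phi> (coset_of F x) = eval_free h x))" (is "?L \<longleftrightarrow> ?R")
proof
  assume L: ?L
  have car: "coset_of F x \<in> carrier (\<H> F)" for x by (simp add: \<H>_simps)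
  have hom: "\<phi> \<in> Ring.ring_hom (\<H> F) class_ring"
    and sc: "\<And>c a. a \<in> carrier (\<H> F) \<Longrightarrow> \<phi> (c \<odot>\<^bsub>\<H> F\<^esub> a) = c * \<phi> a"
    using L by (auto simp: character_def)
  have one: "\<phi> (coset_of F 1) = 1" using ring_hom_one[OF hom] by (simp add: \<H>_simps)
  have add: "\<phi> (coset_of F (x + y)) = \<phi> (coset_of F x) + \<phi> (coset_of F y)" for x y
    using ring_hom_add[OF hom car car, of x y] by (simp add: \<H>_simps)
  have mult: "\<phi> (coset_of F (x * y)) = \<phi> (coset_of F x) * \<phi> (coset_of F y)" for x y
    using ring_hom_mult[OF hom car car, of x y] by (simp add: \<H>_simps)
  have scal: "\<phi> (coset_of F (scalar c)) = c" for c
    using sc[OF car, of c 1] by (simp add: \<H>_simps one)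
  have ev: "\<phi> (coset_of F x) = eval_free (\<lambda>g. \<phi> (coset_of F (gen g))) x" for x
    by (rule free_algebra_hom_unique[of "\<lambda>x. \<phi> (coset_of F x)", OF add mult scal])
  have "eval_free (\<lambda>g. \<phi> (coset_of F (gen g))) r = 0" if "r \<in> relations F" for r
    using ev[of r] ev[of 0] coset_of_relation[OF that] by simp
  with ev show ?R
    by (intro exI[of _ "\<lambda>g. \<phi> (coset_of F (gen g))"] conjI ballI allI)
next
  assume ?R
  then obtain h where ev: "\<And>x. \<phi> (coset_of F x) = eval_free h x" by blast
  show ?L
    unfolding character_def
  proof
    show "\<phi> \<in> Ring.ring_hom (\<H> F) class_ring"
      by (rule ring_hom_memI)
        (auto simp: \<H>_simps ev eval_free_add eval_free_mult)
    show "\<forall>c. \<forall>a\<in>carrier (\<H> F). \<phi> (c \<odot>\<^bsub>\<H> F\<^esub> a) = c * \<phi> a"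
      by (auto simp: \<H>_simps ev eval_free_mult)
  qed
qed

lemma eval_free_rel_ideal:
  assumes "\<And>r. r \<in> relations F \<Longrightarrow> eval_free h r = 0" and "x \<in> rel_ideal F"
  shows "eval_free h x = 0"
proof -
  have "group (add_monoid (free_algebra :: (complex, 'a generator free_algebra) module))"
    by (rule abelian_group.a_group[OF ring.is_abelian_group[OF ring_free_algebra]])
  note G = this
  have neg: "inv\<^bsub>add_monoid free_algebra\<^esub> y = - y" for y :: "'a generator free_algebra"
    by (rule group.inv_equality[OF G]) simp_all
  have "ideal {x. eval_free h x = 0} free_algebra"
  proof (rule idealI)
    show "subgroup {x. eval_free h x = 0} (add_monoid free_algebra)"
    proof (rule group.subgroupI[OF G])
      show "{x. eval_free h x = 0} \<noteq> {}" using eval_free_0 by blast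
      show "inv\<^bsub>add_monoid free_algebra\<^esub> y \<in> {x. eval_free h x = 0}"
        if "y \<in> {x. eval_free h x = 0}" for y
        unfolding neg using that eval_free_diff[of h 0 y] by simp
    qed (simp_all add: eval_free_add)
  qed (simp_all add: ring_free_algebra eval_free_mult)
  moreover have "relations F \<subseteq> {x. eval_free h x = 0}"
    using assms(1) by auto
  ultimately have "rel_ideal F \<subseteq> {x. eval_free h x = 0}"
    unfolding rel_ideal_def by (rule ring.genideal_minimal[OF ring_free_algebra])
  with assms(2) show ?thesis by auto
qed

lemma counit_ex1:
  assumes "invertible F"
  shows "\<exists>!\<epsilon>. \<epsilon> \<in> extensional (carrier (\<H> F)) \<and> character (\<H> F) \<epsilon> \<and>
      map_matrix \<epsilon> (\<H>_u F) = mat 1 \<and> map_matrix \<epsilon> (\<H>_v F) = mat 1"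
proof (rule ex_ex1I)
  define h :: "'a generator \<Rightarrow> complex" where
    "h g = (case g of U i j \<Rightarrow> mat 1 $ i $ j | V i j \<Rightarrow> mat 1 $ i $ j)" for g
  let ?m = "map_matrix (eval_free h)"
  have m: "?m u_mat = mat 1" "?m v_mat = mat 1" "?m (transpose u_mat) = mat 1"
    "?m (transpose v_mat) = mat 1" "?m (mat 1) = mat 1" "?m (map_matrix scalar A) = A" for A
    by (auto simp: vec_eq_iff u_mat_def v_mat_def h_def transpose_def mat_def)
  have inv: "F ** matrix_inv F = mat 1" "matrix_inv F ** F = mat 1"
    using someI_ex[OF assms[unfolded invertible_def]] by (auto simp: matrix_inv_def)
  have ent: "eval_free h r = 0" if "r \<in> entries (A - B)" "?m A = ?m B" for A B r
    using that by (auto simp: entries_def eval_free_diff vec_eq_iff)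
  have rel: "eval_free h r = 0" if "r \<in> relations F" for r
    using that unfolding relations_def Let_def
    by (elim UnE; elim ent) (simp_all add: eval_free_matrix_mult m inv)
  define \<epsilon> where "\<epsilon> = (\<lambda>X \<in> carrier (\<H> F). the_elem (eval_free h ` X))"
  have ev: "\<epsilon> (coset_of F x) = eval_free h x" for x
  proof -
    have "eval_free h z = eval_free h x" if "z \<in> coset_of F x" for z
    proof -
      have "z \<in> (\<Union>i \<in> rel_ideal F. {i + x})"
        using that by (simp only: a_r_coset_def' free_algebra_simps)
      then show ?thesis by (auto simp: eval_free_add eval_free_rel_ideal[OF rel])
    qed
    moreover have "x \<in> coset_of F x"
      by (rule coset_of_self)
    ultimately have "eval_free h ` coset_of F x = {eval_free h x}"
      by blast
    then show ?thesis by (simp add: \<epsilon>_def \<H>_simps)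
  qed
  have "character (\<H> F) \<epsilon>" using ev rel by (auto simp: character_\<H>_iff)
  moreover have "map_matrix \<epsilon> (\<H>_u F) = mat 1" "map_matrix \<epsilon> (\<H>_v F) = mat 1"
    using m(1,2) by (simp_all add: vec_eq_iff \<H>_u_def \<H>_v_def ev)
  ultimately show "\<exists>\<epsilon>. \<epsilon> \<in> extensional (carrier (\<H> F)) \<and> character (\<H> F) \<epsilon> \<and>
      map_matrix \<epsilon> (\<H>_u F) = mat 1 \<and> map_matrix \<epsilon> (\<H>_v F) = mat 1"
    by (auto simp: \<epsilon>_def)
next
  fix \<sigma> \<tau>
  assume \<sigma>: "\<sigma> \<in> extensional (carrier (\<H> F)) \<and> character (\<H> F) \<sigma> \<and>
      map_matrix \<sigma> (\<H>_u F) = mat 1 \<and> map_matrix \<sigma> (\<H>_v F) = mat 1"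
    and \<tau>: "\<tau> \<in> extensional (carrier (\<H> F)) \<and> character (\<H> F) \<tau> \<and>
      map_matrix \<tau> (\<H>_u F) = mat 1 \<and> map_matrix \<tau> (\<H>_v F) = mat 1"
  obtain h where h: "\<And>x. \<sigma> (coset_of F x) = eval_free h x"
    using \<sigma> unfolding character_\<H>_iff by blast
  obtain k where k: "\<And>x. \<tau> (coset_of F x) = eval_free k x"
    using \<tau> unfolding character_\<H>_iff by blast
  have "h g = k g" for g
    using \<sigma> \<tau>
    by (cases g) (auto simp: vec_eq_iff \<H>_u_def \<H>_v_def u_mat_def v_mat_def h k)
  then have "h = k" by blast
  then have "\<sigma> X = \<tau> X" if "X \<in> carrier (\<H> F)" for X
    using that h k by (auto simp: \<H>_simps)
  then show "\<sigma> = \<tau>"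
    using \<sigma> \<tau> by (auto intro: extensionalityI)
qed

lemma character_\<H>_v:
  assumes "character (\<H> F) \<tau>"
  shows "map_matrix \<tau> (\<H>_v F) = transpose (matrix_inv (map_matrix \<tau> (\<H>_u F)))"
proof -
  obtain h where rel: "\<And>r. r \<in> relations F \<Longrightarrow> eval_free h r = 0"
    and h: "\<And>x. \<tau> (coset_of F x) = eval_free h x"
    using assms unfolding character_\<H>_iff by blast
  let ?m = "map_matrix (eval_free h)"
  have uv: "map_matrix \<tau> (\<H>_u F) = ?m u_mat" "map_matrix \<tau> (\<H>_v F) = ?m v_mat"
    by (simp_all add: vec_eq_iff \<H>_u_def \<H>_v_def h)
  have tr: "?m (transpose v_mat) = transpose (?m v_mat)" and one: "?m (mat 1) = mat 1"
    by (simp_all add: vec_eq_iff transpose_def mat_def)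
  have ent: "?m A = ?m B" if "entries (A - B) \<subseteq> relations F" for A B
  proof -
    have "eval_free h ((A - B) $ i $ j) = 0" for i j
      using that by (intro rel) (auto simp: entries_def)
    then show ?thesis by (simp add: vec_eq_iff eval_free_diff)
  qed
  have "?m (u_mat ** transpose v_mat) = ?m (mat 1)" "?m (transpose v_mat ** u_mat) = ?m (mat 1)"
    by (rule ent; auto simp: relations_def Let_def)+
  then have inv: "?m u_mat ** transpose (?m v_mat) = mat 1" "transpose (?m v_mat) ** ?m u_mat = mat 1"
    by (simp_all add: eval_free_matrix_mult tr one)
  have "matrix_inv (?m u_mat) = transpose (?m v_mat)"
    unfolding matrix_inv_def
  proof (rule some_equality)
    fix A assume A: "?m u_mat ** A = mat 1 \<and> A ** ?m u_mat = mat 1"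
    then show "A = transpose (?m v_mat)"
      using inv by (metis matrix_mul_assoc matrix_mul_lid matrix_mul_rid)
  qed (use inv in auto)
  then show ?thesis by (simp add: uv transpose_transpose)
qed

lemmas counit = theI'[OF counit_ex1, folded counit_def]

end

theory Submission
  imports Defs "HOL-Library.Function_Algebras"
begin

text \<open>
  The resolution \<open>0 \<rightarrow> \<H>\<^sup>2 \<rightarrow> M\<^sub>n(\<H>)\<^sup>2 \<rightarrow> M\<^sub>n(\<H>)\<^sup>2 \<rightarrow> \<H> \<rightarrow> \<complex>\<^sub>\<epsilon> \<rightarrow> 0\<close> by free right modules is written down
  explicitly: its maps come from the generators, the relations, and the identities
  between the relations on the two sides.

  Exactness on the right holds for every presentation and uses Fox derivatives. Exactness on the left needs
  a normal form of \<open>\<H>\<close>. Let \<open>\<H>\<close> act on pairs of words in two copies of \<open>\<complex>\<^sup>n\<close>, one for \<open>u\<close> and one for \<open>v\<close>, a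
  generator creating a letter in both words and contracting the first letters, with a correction by Wenzl
  coefficients. For generic \<open>F\<close> none of these coefficients vanishes, the operators satisfy the relations,
  and \<open>\<H>\<close> is identified with the pairs of tensors of equal colours that are annihilated by all contractions
  of neighbours. In this model a cycle is seen to be a boundary by its part of highest degree.

  A double complex compares the Hochschild complex with \<open>Hom(_, \<complex>\<^sub>\<tau>)\<close> of the resolution. There the
  second map has kernel isomorphic to the commutant of \<open>F\<^sup>tS\<close>, the last map has rank \<open>t\<close>, and the
  remaining dimensions follow by rank-nullity.
\<close>

section \<open>Creation operators on traceless words\<close>

text \<open>In terms of the two colours the defining relations form two families, mirror images of
  each other: row indices contracted with forms \<open>E\<close>, column indices contracted with
  forms \<open>G\<close>. Exchanging \<open>E\<close> with \<open>G\<close> and the two words of a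
  pair is a symmetry, so a statement about one word carries its mirror image with it. The obstacle
  on the left is that the relations are not homogeneous: the algebra is only filtered, and leading
  terms mean nothing modulo an ideal that is known by generators alone. The model by pairs of words
  decides membership in the ideal and restores a degree, because a generator acts as the sum of an
  operator of degree 1 and one of degree -1. Functions on words may have infinite support, so the
  operators need no side conditions. On the right only the relations between rows enter the
  resolution. Those between columns follow from them to first order: associativity of a threefold
  product of generators ties the families together, and the counit turns left factors into scalars
  in a Fox derivative. This is why the two middle modules have the same rank.\<close>

text \<open>A letter carries a colour, \<^const>\<open>True\<close> for \<open>u\<close> and \<^const>\<open>False\<close> for \<open>v\<close>; a function on words is an element of the
  (completed) tensor algebra.\<close>

type_synonym 'n cword = "(bool \<times> 'n) list"

abbreviation cols :: "'n cword \<Rightarrow> bool list" where "cols \<equiv> map fst"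

text \<open>The scalar of a closed circle, a cup closed by a cap of the same colour. For
  \<open>cup F\<close> and \<open>cap F\<close> the two colours give
  \<open>trace (matrix_inv F)\<close> and \<open>trace F\<close>; genericity only speaks of their
  product.\<close>

definition loop_value :: "(bool \<Rightarrow> complex ^ 'n ^ 'n) \<Rightarrow> (bool \<Rightarrow> complex ^ 'n ^ 'n) \<Rightarrow> bool \<Rightarrow> complex" where
  "loop_value E G c = (\<Sum>k\<in>UNIV. \<Sum>l\<in>UNIV. E c $ k $ l * G c $ k $ l)"

text \<open>The partial trace of a Jones-Wenzl idempotent over its first strand: by
  \<open>sum_flat_create\<close>, creating a letter of colour \<open>\<not> c\<close> and closing it
  with a cup multiplies by this number. The subtracted term occurs only when the next letter has
  colour \<open>c\<close>, since only letters of different colours are contracted.\<close>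

primrec wenzl :: "(bool \<Rightarrow> complex) \<Rightarrow> bool \<Rightarrow> bool list \<Rightarrow> complex" where
  "wenzl \<delta> c [] = \<delta> c"
| "wenzl \<delta> c (c' # cs) = \<delta> c - (if c' = c then inverse (wenzl \<delta> (\<not> c) cs) else 0)"

definition strip :: "bool \<Rightarrow> 'n \<Rightarrow> ('n cword \<Rightarrow> complex) \<Rightarrow> 'n cword \<Rightarrow> complex" where
  "strip c i q w = q ((c, i) # w)"

text \<open>The letter \<open>(c, i)\<close> is put in front of the word and contracted with the old
  first letter.\<close>

definition flat :: "(bool \<Rightarrow> complex ^ 'n ^ 'n) \<Rightarrow> bool \<Rightarrow> 'n \<Rightarrow> ('n cword \<Rightarrow> complex) \<Rightarrow> 'n cword \<Rightarrow> complex" where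
  "flat G c i q w = (\<Sum>l\<in>UNIV. G c $ i $ l * q ((\<not> c, l) # w))"

definition damp :: "(bool \<Rightarrow> complex) \<Rightarrow> bool \<Rightarrow> ('n cword \<Rightarrow> complex) \<Rightarrow> 'n cword \<Rightarrow> complex" where
  "damp \<delta> c q w = inverse (wenzl \<delta> c (cols w)) * q w"

text \<open>The projection of \<open>v\<^sub>i \<otimes> q\<close> onto the traceless tensors, by the recursion that defines the
  Jones--Wenzl idempotents.\<close>

primrec create :: "(bool \<Rightarrow> complex ^ 'n ^ 'n) \<Rightarrow> (bool \<Rightarrow> complex ^ 'n ^ 'n) \<Rightarrow> bool \<Rightarrow> 'n \<Rightarrow>
    ('n cword \<Rightarrow> complex) \<Rightarrow> 'n cword \<Rightarrow> complex" where
  "create E G c i q [] = 0"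
| "create E G c i q (x # w) =
    (if fst x = c then (if snd x = i then q w else 0) -
       (\<Sum>l\<in>UNIV. E c $ snd x $ l *
          create E G (\<not> c) l (damp (loop_value E G) c (flat G c i q)) w)
     else 0)"

definition traceless :: "(bool \<Rightarrow> complex ^ 'n ^ 'n) \<Rightarrow> ('n cword \<Rightarrow> complex) \<Rightarrow> bool" where
  "traceless G q \<longleftrightarrow>
    (\<forall>p c w. (\<Sum>m\<in>UNIV. \<Sum>l\<in>UNIV. G c $ m $ l * q (p @ (c, m) # (\<not> c, l) # w)) = 0)"

section \<open>Linearity of the creation operators and dependence on colours\<close>

lemma sum_swap3: "(\<Sum>m\<in>A. \<Sum>l\<in>B. \<Sum>k\<in>K. f m l k) = (\<Sum>k\<in>K. \<Sum>m\<in>A. \<Sum>l\<in>B. f m l k)"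
proof -
  have "(\<Sum>l\<in>B. \<Sum>k\<in>K. f m l k) = (\<Sum>k\<in>K. \<Sum>l\<in>B. f m l k)" for m
    by (rule sum.swap)
  then show ?thesis by (simp only:) (rule sum.swap)
qed

lemma flat_lincomb:
  "flat G c i (\<lambda>w. \<Sum>k\<in>K. a k * q k w) = (\<lambda>w. \<Sum>k\<in>K. a k * flat G c i (q k) w)"
  unfolding flat_def sum_distrib_left by (subst sum.swap) (simp add: algebra_simps)

lemma damp_lincomb:
  "damp \<delta> c (\<lambda>w. \<Sum>k\<in>K. a k * q k w) = (\<lambda>w. \<Sum>k\<in>K. a k * damp \<delta> c (q k) w)"
  unfolding damp_def sum_distrib_left by (simp add: algebra_simps)

lemma create_lincomb:
  "create E G c i (\<lambda>w. \<Sum>k\<in>K. a k * q k w) w = (\<Sum>k\<in>K. a k * create E G c i (q k) w)"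
proof (induction w arbitrary: q c i)
  case (Cons x w)
  have "(\<Sum>l\<in>UNIV. E c $ snd x $ l * (\<Sum>k\<in>K. a k * g k l)) = (\<Sum>k\<in>K. a k * (\<Sum>l\<in>UNIV. E c $ snd x $ l * g k l))"
    for g :: "_ \<Rightarrow> _ \<Rightarrow> complex"
    unfolding sum_distrib_left by (subst sum.swap) (simp add: algebra_simps)
  then show ?case
    by (auto simp: Cons flat_lincomb damp_lincomb right_diff_distrib sum_subtractf)
qed simp

lemma create_0 [simp]: "create E G c i (\<lambda>_. 0) w = 0"
  using create_lincomb[of E G c i "\<lambda>_. 0" "\<lambda>_ _. 0" "{} :: nat set" w] by simp

lemma create_scale: "create E G c i (\<lambda>w. a * q w) w = a * create E G c i q w"
  using create_lincomb[of E G c i "\<lambda>_. a" "\<lambda>_. q" "{()}" w] by simp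

text \<open>Creation adds exactly one letter of colour \<open>c\<close> in front, whatever happens
  to the indices. Hence factors that depend only on colours pass through it
  (\<open>create_weight\<close>), and degrees can be followed.\<close>

lemma create_cong:
  fixes q q' :: "'n :: finite cword \<Rightarrow> complex"
  assumes "\<And>w'. cols w' = tl (cols w) \<Longrightarrow> q w' = q' w'"
  shows "create E G c i q w = create E G c i q' w"
  using assms
proof (induction w arbitrary: q q' c i)
  case (Cons x w)
  have "create E G (\<not> c) l (damp \<delta> c (flat G c i q)) w = create E G (\<not> c) l (damp \<delta> c (flat G c i q')) w" for \<delta> l
  proof (cases "w = [] \<or> fst (hd w) = c")
    case True
    then show ?thesis by (cases w) auto
  next
    case False
    then obtain m w1 where w: "w = (\<not> c, m) # w1" by (cases w) auto
    show ?thesis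
    proof (rule Cons.IH)
      fix w' :: "'n cword" assume "cols w' = tl (cols w)"
      then have "q ((\<not> c, l) # w') = q' ((\<not> c, l) # w')" for l by (intro Cons.prems) (simp add: w)
      then show "damp \<delta> c (flat G c i q) w' = damp \<delta> c (flat G c i q') w'"
        by (simp add: damp_def flat_def)
    qed
  qed
  with Cons.prems show ?case by (cases x) simp
qed simp

lemma create_weight:
  "create E G c i (\<lambda>w. f (cols w) * q w) w = f (tl (cols w)) * create E G c i q w"
proof -
  have "create E G c i (\<lambda>w. f (cols w) * q w) w = create E G c i (\<lambda>w'. f (tl (cols w)) * q w') w"
    by (rule create_cong) simp
  then show ?thesis by (simp add: create_scale)
qed

lemma traceless_strip: "traceless G q \<Longrightarrow> traceless G (strip c i q)"
  unfolding traceless_def strip_def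
proof (intro allI, goal_cases)
  case (1 p c' w)
  then show ?case by (elim allE[of _ "(c, i) # p"] allE[of _ c'] allE[of _ w]) simp
qed

lemma traceless_lincomb:
  assumes "\<And>k. k \<in> K \<Longrightarrow> traceless G (q k)"
  shows "traceless G (\<lambda>w. \<Sum>k\<in>K. a k * q k w)"
proof -
  have "(\<Sum>m\<in>UNIV. \<Sum>l\<in>UNIV. G c $ m $ l * (\<Sum>k\<in>K. a k * q k (p @ (c, m) # (\<not> c, l) # w))) =
    (\<Sum>k\<in>K. a k * (\<Sum>m\<in>UNIV. \<Sum>l\<in>UNIV. G c $ m $ l * q k (p @ (c, m) # (\<not> c, l) # w)))" for p c w
    unfolding sum_distrib_left by (subst sum_swap3) (simp add: mult_ac)
  with assms show ?thesis unfolding traceless_def by simp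
qed

lemma traceless_flat: "traceless G q \<Longrightarrow> traceless G (flat G c i q)"
  using traceless_lincomb[of UNIV G "\<lambda>l. strip (\<not> c) l q" "\<lambda>l. G c $ i $ l"] traceless_strip[of G q]
  by (auto simp: flat_def[abs_def] strip_def)

lemma traceless_weight: "traceless G q \<Longrightarrow> traceless G (\<lambda>w. f (cols w) * q w)"
proof -
  assume q: "traceless G q"
  have "(\<Sum>m\<in>UNIV. \<Sum>l\<in>UNIV. G c $ m $ l * (f (cols (p @ (c, m) # (\<not> c, l) # w)) * q (p @ (c, m) # (\<not> c, l) # w))) =
    f (cols p @ c # (\<not> c) # cols w) * (\<Sum>m\<in>UNIV. \<Sum>l\<in>UNIV. G c $ m $ l * q (p @ (c, m) # (\<not> c, l) # w))" for p c w
    by (simp add: sum_distrib_left mult_ac)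
  with q show ?thesis unfolding traceless_def by simp
qed

lemma traceless_damp: "traceless G q \<Longrightarrow> traceless G (damp \<delta> c q)"
  unfolding damp_def[abs_def] by (rule traceless_weight)

text \<open>The first two assumptions are the zigzag identities that straighten a cup against a cap.
  The third one makes every division in \<open>damp\<close> meaningful.\<close>

locale cup_cap =
  fixes E G :: "bool \<Rightarrow> complex ^ 'n :: finite ^ 'n"
  assumes EG: "(\<Sum>l\<in>UNIV. E c $ k $ l * G (\<not> c) $ l $ m) = (if k = m then 1 else 0)"
    and GE: "(\<Sum>l\<in>UNIV. G c $ k $ l * E (\<not> c) $ l $ m) = (if k = m then 1 else 0)"
    and wenzl_nonzero: "wenzl (loop_value E G) c cs \<noteq> 0"
begin

abbreviation \<delta> where "\<delta> \<equiv> loop_value E G"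

text \<open>The source of all mirror images: the assumptions are symmetric in \<open>E\<close> and
  \<open>G\<close>, and the loop values do not change.\<close>

lemma dual: "cup_cap G E"
proof -
  have "loop_value G E = loop_value E G"
    by (auto simp: loop_value_def fun_eq_iff mult.commute)
  then show ?thesis using EG GE wenzl_nonzero by unfold_locales auto
qed

lemma EG_vec: "(\<Sum>l\<in>UNIV. E c $ k $ l * (\<Sum>m\<in>UNIV. G (\<not> c) $ l $ m * f m)) = f k"
proof -
  have "(\<Sum>l\<in>UNIV. E c $ k $ l * (\<Sum>m\<in>UNIV. G (\<not> c) $ l $ m * f m)) =
     (\<Sum>m\<in>UNIV. (\<Sum>l\<in>UNIV. E c $ k $ l * G (\<not> c) $ l $ m) * f m)"
    unfolding sum_distrib_left sum_distrib_right by (subst sum.swap) (simp add: mult_ac)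
  then show ?thesis by (simp add: EG if_distrib[of "\<lambda>x. x * _"] cong: if_cong)
qed

lemma GE_vec: "(\<Sum>l\<in>UNIV. G c $ k $ l * (\<Sum>m\<in>UNIV. E (\<not> c) $ l $ m * f m)) = f k"
  by (rule cup_cap.EG_vec[OF dual])

text \<open>The cap of the contraction meets the cup of the correction term in \<open>create\<close>
  and straightens it by \<open>GE_vec\<close>.\<close>

lemma flat_create:
  "flat G c i (create E G (\<not> c) j p) w =
     G c $ i $ j * p w - create E G c i (damp \<delta> (\<not> c) (flat G (\<not> c) j p)) w"
  using GE_vec[of c i "\<lambda>l. create E G c l (damp \<delta> (\<not> c) (flat G (\<not> c) j p)) w"]
  by (simp add: flat_def right_diff_distrib sum_subtractf if_distrib[of "\<lambda>x. _ * x"] cong: if_cong)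

lemma flat_inverse: "(\<Sum>l\<in>UNIV. E c $ m $ l * flat G (\<not> c) l q w) = strip c m q w"
  using EG_vec[of c m "\<lambda>m. q ((c, m) # w)"] by (simp add: flat_def strip_def)

text \<open>The projection fixes traceless tensors: when \<open>p\<close> is taken apart by its
  first letter and created again, the correction terms add up to the contraction of the first two
  letters of \<open>p\<close>, which is zero.\<close>

lemma sum_create_strip:
  assumes "traceless G p"
  shows "(\<Sum>k\<in>UNIV. create E G c k (strip c k p) w) = (if w \<noteq> [] \<and> fst (hd w) = c then p w else 0)"
proof (cases w)
  case (Cons x v)
  have 0: "(\<Sum>k\<in>UNIV. 1 * damp \<delta> c (flat G c k (strip c k p)) u) = 0" for u
    using assms[unfolded traceless_def, rule_format, where p = "[]" and c = c and w = u]
    by (simp add: damp_def flat_def strip_def flip: sum_distrib_left)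
  have "(\<Sum>k\<in>UNIV. \<Sum>l\<in>UNIV. E c $ m $ l * create E G (\<not> c) l (damp \<delta> c (flat G c k (strip c k p))) v) =
    (\<Sum>l\<in>UNIV. E c $ m $ l * create E G (\<not> c) l (\<lambda>w. \<Sum>k\<in>UNIV. 1 * damp \<delta> c (flat G c k (strip c k p)) w) v)" for m
    unfolding create_lincomb by (subst sum.swap) (simp add: sum_distrib_left)
  then show ?thesis
    using Cons 0 by (cases x) (auto simp: sum_subtractf strip_def)
qed simp

text \<open>This identity dictates the recursion for \<open>wenzl\<close>. By
  \<open>flat_create\<close> the loop value is the main term; in the other term the cup undoes the
  contraction, and \<open>sum_create_strip\<close> gives back a rescaled \<open>p\<close> on the
  words that start with colour \<open>c\<close>.\<close>

lemma sum_flat_create: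
  assumes p: "traceless G p"
  shows "(\<Sum>m\<in>UNIV. \<Sum>l\<in>UNIV. E c $ m $ l * flat G c m (create E G (\<not> c) l p) w) =
    wenzl \<delta> c (cols w) * p w"
proof -
  \<comment> \<open>The factor in \<open>damp\<close> is evaluated before \<open>strip\<close> puts
    a letter back; \<open>tl\<close> compensates for that letter, so the factor becomes a weight on
    \<open>p\<close> itself.\<close>
  define r where "r w = inverse (wenzl \<delta> (\<not> c) (tl (cols w))) * p w" for w
  have r: "traceless G r" unfolding r_def[abs_def] by (rule traceless_weight[OF p])
  have *: "(\<lambda>w. \<Sum>l\<in>UNIV. E c $ m $ l * damp \<delta> (\<not> c) (flat G (\<not> c) l p) w) = strip c m r" for m
  proof
    fix w
    have "(\<Sum>l\<in>UNIV. E c $ m $ l * damp \<delta> (\<not> c) (flat G (\<not> c) l p) w) =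
      inverse (wenzl \<delta> (\<not> c) (cols w)) * (\<Sum>l\<in>UNIV. E c $ m $ l * flat G (\<not> c) l p w)"
      by (simp add: damp_def sum_distrib_left mult_ac)
    then show "(\<Sum>l\<in>UNIV. E c $ m $ l * damp \<delta> (\<not> c) (flat G (\<not> c) l p) w) = strip c m r w"
      by (simp add: flat_inverse) (simp add: strip_def r_def)
  qed
  have "(\<Sum>m\<in>UNIV. \<Sum>l\<in>UNIV. E c $ m $ l * flat G c m (create E G (\<not> c) l p) w) =
    \<delta> c * p w - (\<Sum>m\<in>UNIV. create E G c m (\<lambda>w. \<Sum>l\<in>UNIV. E c $ m $ l * damp \<delta> (\<not> c) (flat G (\<not> c) l p) w) w)"
    by (simp add: flat_create create_lincomb right_diff_distrib sum_subtractf loop_value_def sum_distrib_right flip: mult.assoc)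
  also have "\<dots> = wenzl \<delta> c (cols w) * p w"
    unfolding * sum_create_strip[OF r] by (cases w) (auto simp: r_def algebra_simps)
  finally show ?thesis .
qed

lemma damp_wenzl: "damp \<delta> c (\<lambda>w. wenzl \<delta> c (cols w) * p w) = p"
  using wenzl_nonzero by (auto simp: damp_def)

lemma wenzl_damp: "wenzl \<delta> c (cols w) * damp \<delta> c p w = p w"
  using wenzl_nonzero by (auto simp: damp_def)

text \<open>A cup in front of \<open>p\<close> is projected to zero. The correction of the outer
  creation contracts the inner one, which by \<open>sum_flat_create\<close> produces the Wenzl
  coefficient that \<open>damp\<close> divides out; so correction and leading term are
  equal.\<close>

lemma sum_create_create:
  assumes p: "traceless G p"
  shows "(\<Sum>k\<in>UNIV. \<Sum>l\<in>UNIV. E c $ k $ l * create E G c k (create E G (\<not> c) l p) w) = 0"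
proof (cases w)
  case (Cons x v)
  define h where "h w = (\<Sum>k\<in>UNIV. \<Sum>l\<in>UNIV. E c $ k $ l * flat G c k (create E G (\<not> c) l p) w)" for w
  have h: "h = (\<lambda>w. wenzl \<delta> c (cols w) * p w)" unfolding h_def sum_flat_create[OF p] ..
  have "(\<lambda>w. \<Sum>k\<in>UNIV. \<Sum>l\<in>UNIV. E c $ k $ l * damp \<delta> c (flat G c k (create E G (\<not> c) l p)) w) = damp \<delta> c h"
    by (auto simp: damp_def h_def sum_distrib_left mult_ac fun_eq_iff)
  then have h': "(\<lambda>w. \<Sum>k\<in>UNIV. 1 * (\<Sum>l\<in>UNIV. E c $ k $ l * damp \<delta> c (flat G c k (create E G (\<not> c) l p)) w)) = p"
    by (simp add: h damp_wenzl)
  define Q where "Q k w = (\<Sum>l\<in>UNIV. E c $ k $ l * damp \<delta> c (flat G c k (create E G (\<not> c) l p)) w)" for k w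
  have 1: "(\<Sum>l\<in>UNIV. E c $ k $ l * (\<Sum>l'\<in>UNIV. E c $ m $ l' *
      create E G (\<not> c) l' (damp \<delta> c (flat G c k (create E G (\<not> c) l p))) v)) =
    (\<Sum>l'\<in>UNIV. E c $ m $ l' * create E G (\<not> c) l' (Q k) v)" for m k
    unfolding Q_def[abs_def] create_lincomb sum_distrib_left by (subst sum.swap) (simp add: mult_ac)
  have 2: "(\<Sum>k\<in>UNIV. \<Sum>l'\<in>UNIV. E c $ m $ l' * create E G (\<not> c) l' (Q k) v) =
    (\<Sum>l'\<in>UNIV. E c $ m $ l' * create E G (\<not> c) l' (\<lambda>w. \<Sum>k\<in>UNIV. 1 * Q k w) v)" for m
    unfolding create_lincomb sum_distrib_left by (subst sum.swap) simp
  have *: "(\<Sum>k\<in>UNIV. \<Sum>l\<in>UNIV. E c $ k $ l * (\<Sum>l'\<in>UNIV. E c $ m $ l' *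
      create E G (\<not> c) l' (damp \<delta> c (flat G c k (create E G (\<not> c) l p))) v)) =
      (\<Sum>l'\<in>UNIV. E c $ m $ l' * create E G (\<not> c) l' p v)" for m
    unfolding 1 2 unfolding Q_def h' ..
  have 3: "(\<Sum>k\<in>UNIV. \<Sum>l\<in>UNIV. E c $ k $ l * (if m = k then create E G (\<not> c) l p v else 0)) =
    (\<Sum>l\<in>UNIV. E c $ m $ l * create E G (\<not> c) l p v)" for m
  proof -
    have "(\<Sum>l\<in>UNIV. E c $ k $ l * (if m = k then create E G (\<not> c) l p v else 0)) =
      (if m = k then \<Sum>l\<in>UNIV. E c $ m $ l * create E G (\<not> c) l p v else 0)" for k
      by simp
    then show ?thesis by simp
  qed
  show ?thesis
    using Cons *[of "snd x"] 3[of "snd x"]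
    by (cases "fst x = c") (simp_all add: right_diff_distrib sum_subtractf)
qed simp

text \<open>Induction on the position of the contracted pair. At the front,
  \<open>sum_flat_create\<close> shows that the correction contributes exactly the contraction of
  the leading term: this is the reason for dividing by \<open>wenzl\<close> in the recursion.
  Further inside, the leading term is settled by \<open>q\<close> and the correction by a shorter
  creation.\<close>

lemma traceless_create:
  assumes "traceless G q"
  shows "traceless G (create E G c i q)"
proof -
  have "(\<Sum>m\<in>UNIV. \<Sum>l\<in>UNIV. G c' $ m $ l * create E G c i q (p @ (c', m) # (\<not> c', l) # w)) = 0" for p c' w
    using assms
  proof (induction p arbitrary: q c i)
    case Nil
    let ?q = "damp \<delta> c (flat G c i q)"
    have t: "traceless G ?q" by (intro traceless_damp traceless_flat Nil)
    show ?case
    proof (cases "c' = c")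
      case True
      have "(\<Sum>m\<in>UNIV. \<Sum>l\<in>UNIV. G c $ m $ l * (\<Sum>l'\<in>UNIV. E c $ m $ l' * create E G (\<not> c) l' ?q ((\<not> c, l) # w))) =
        (\<Sum>m\<in>UNIV. \<Sum>l'\<in>UNIV. E c $ m $ l' * flat G c m (create E G (\<not> c) l' ?q) w)"
        unfolding flat_def sum_distrib_left by (rule sum.cong[OF refl], subst sum.swap) (simp add: mult_ac)
      also have "\<dots> = flat G c i q w" unfolding sum_flat_create[OF t] wenzl_damp ..
      finally have 1: "(\<Sum>m\<in>UNIV. \<Sum>l\<in>UNIV. G c $ m $ l * (\<Sum>l'\<in>UNIV. E c $ m $ l' * create E G (\<not> c) l' ?q ((\<not> c, l) # w))) =
         flat G c i q w" .
      have "(\<Sum>m\<in>UNIV. \<Sum>l\<in>UNIV. G c $ m $ l * (if m = i then q ((\<not> c, l) # w) else 0)) =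
         (\<Sum>m\<in>UNIV. if m = i then flat G c i q w else 0)"
        by (rule sum.cong[OF refl]) (simp add: flat_def)
      then have 2: "(\<Sum>m\<in>UNIV. \<Sum>l\<in>UNIV. G c $ m $ l * (if m = i then q ((\<not> c, l) # w) else 0)) = flat G c i q w"
        by simp
      have 3: "create E G c i q ((c, m) # u) = (if m = i then q u else 0) -
          (\<Sum>l'\<in>UNIV. E c $ m $ l' * create E G (\<not> c) l' ?q u)" for m u
        by simp
      show ?thesis
        unfolding True append_Nil 3 right_diff_distrib sum_subtractf 1 2 by simp
    qed simp
  next
    case (Cons x p)
    let ?q = "damp \<delta> c (flat G c i q)" and ?w = "\<lambda>m l. p @ (c', m) # (\<not> c', l) # w"
    have t: "traceless G ?q" by (intro traceless_damp traceless_flat Cons)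
    have IH: "(\<Sum>m\<in>UNIV. \<Sum>l\<in>UNIV. G c' $ m $ l * create E G (\<not> c) l' ?q (?w m l)) = 0" for l'
      by (rule Cons.IH[OF t])
    have "(\<Sum>m\<in>UNIV. \<Sum>l\<in>UNIV. G c' $ m $ l * (\<Sum>l'\<in>UNIV. E c $ snd x $ l' * create E G (\<not> c) l' ?q (?w m l))) =
      (\<Sum>l'\<in>UNIV. E c $ snd x $ l' * (\<Sum>m\<in>UNIV. \<Sum>l\<in>UNIV. G c' $ m $ l * create E G (\<not> c) l' ?q (?w m l)))"
      unfolding sum_distrib_left by (subst sum_swap3) (simp add: mult_ac)
    then have 1: "(\<Sum>m\<in>UNIV. \<Sum>l\<in>UNIV. G c' $ m $ l * (\<Sum>l'\<in>UNIV. E c $ snd x $ l' * create E G (\<not> c) l' ?q (?w m l))) = 0"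
      unfolding IH by simp
    have 2: "(\<Sum>m\<in>UNIV. \<Sum>l\<in>UNIV. G c' $ m $ l * q (?w m l)) = 0"
      using Cons.prems by (simp add: traceless_def)
    show ?case
      using 1 2 by (cases "fst x = c"; cases "snd x = i") (simp_all add: right_diff_distrib sum_subtractf sum_negf)
  qed
  then show ?thesis unfolding traceless_def by blast
qed

end

section \<open>The representation on traceless biwords\<close>

type_synonym 'n bifun = "'n cword \<Rightarrow> 'n cword \<Rightarrow> complex"

definition scale_fun :: "complex \<Rightarrow> 'n bifun \<Rightarrow> 'n bifun" (infixr "*\<^sub>f" 75) where
  "a *\<^sub>f f = (\<lambda>xs ys. a * f xs ys)"

lemma scale_fun_apply [simp]: "(a *\<^sub>f f) xs ys = a * f xs ys"
  by (simp add: scale_fun_def)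

lemma sum_fun_apply [simp]: "(\<Sum>k\<in>K. f k) x = (\<Sum>k\<in>K. f k x)" for f :: "_ \<Rightarrow> _ \<Rightarrow> _ :: comm_monoid_add"
  by (induction K rule: infinite_finite_induct) simp_all

interpretation bifun: vector_space scale_fun
  by unfold_locales (auto simp: fun_eq_iff algebra_simps)

definition linop :: "('n bifun \<Rightarrow> 'n bifun) \<Rightarrow> bool" where
  "linop T \<longleftrightarrow> (\<forall>f g. T (f + g) = T f + T g) \<and> (\<forall>a f. T (a *\<^sub>f f) = a *\<^sub>f T f)"

lemma linopD:
  assumes "linop T"
  shows "T (f + g) = T f + T g" "T (a *\<^sub>f f) = a *\<^sub>f T f" "T 0 = 0" "T (- f) = - T f"
    "T (f - g) = T f - T g" "T (\<Sum>k\<in>K. h k) = (\<Sum>k\<in>K. T (h k))"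
proof -
  show add: "T (f + g) = T f + T g" for f g using assms by (simp add: linop_def)
  show sc: "T (a *\<^sub>f f) = a *\<^sub>f T f" for a f using assms by (simp add: linop_def)
  show zero: "T 0 = 0" using sc[of 0 0] by simp
  show neg: "T (- f) = - T f" for f using sc[of "-1" f] by simp
  show "T (f - g) = T f - T g" using add[of f "- g"] neg[of g] by simp
  show "T (\<Sum>k\<in>K. h k) = (\<Sum>k\<in>K. T (h k))"
    by (induction K rule: infinite_finite_induct)
      (simp_all only: sum.infinite sum.empty sum.insert add zero not_False_eq_True)
qed

lemma linopI: "(\<And>f g. T (f + g) = T f + T g) \<Longrightarrow> (\<And>a f. T (a *\<^sub>f f) = a *\<^sub>f T f) \<Longrightarrow> linop T"
  by (simp add: linop_def)

definition flp :: "'n bifun \<Rightarrow> 'n bifun" where "flp f = (\<lambda>xs ys. f ys xs)"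

definition xstrip :: "bool \<Rightarrow> 'n \<Rightarrow> 'n bifun \<Rightarrow> 'n bifun" where
  "xstrip c i f = (\<lambda>xs ys. f ((c, i) # xs) ys)"

definition ystrip :: "bool \<Rightarrow> 'n \<Rightarrow> 'n bifun \<Rightarrow> 'n bifun" where
  "ystrip c i f = (\<lambda>xs ys. f xs ((c, i) # ys))"

definition xweight :: "(bool list \<Rightarrow> complex) \<Rightarrow> 'n bifun \<Rightarrow> 'n bifun" where
  "xweight \<phi> f = (\<lambda>xs ys. \<phi> (cols xs) * f xs ys)"

definition yweight :: "(bool list \<Rightarrow> complex) \<Rightarrow> 'n bifun \<Rightarrow> 'n bifun" where
  "yweight \<phi> f = (\<lambda>xs ys. \<phi> (cols ys) * f xs ys)"

definition xflat :: "(bool \<Rightarrow> complex ^ 'n ^ 'n) \<Rightarrow> bool \<Rightarrow> 'n \<Rightarrow> 'n bifun \<Rightarrow> 'n bifun" where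
  "xflat G c i f = (\<Sum>l\<in>UNIV. G c $ i $ l *\<^sub>f xstrip (\<not> c) l f)"

definition yflat :: "(bool \<Rightarrow> complex ^ 'n ^ 'n) \<Rightarrow> bool \<Rightarrow> 'n \<Rightarrow> 'n bifun \<Rightarrow> 'n bifun" where
  "yflat E c i f = (\<Sum>l\<in>UNIV. E c $ i $ l *\<^sub>f ystrip (\<not> c) l f)"

definition xcreate :: "(bool \<Rightarrow> complex ^ 'n ^ 'n) \<Rightarrow> (bool \<Rightarrow> complex ^ 'n ^ 'n) \<Rightarrow>
    bool \<Rightarrow> 'n \<Rightarrow> 'n bifun \<Rightarrow> 'n bifun" where
  "xcreate E G c i f = (\<lambda>xs ys. create E G c i (\<lambda>xs. f xs ys) xs)"

definition ycreate :: "(bool \<Rightarrow> complex ^ 'n ^ 'n) \<Rightarrow> (bool \<Rightarrow> complex ^ 'n ^ 'n) \<Rightarrow>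
    bool \<Rightarrow> 'n \<Rightarrow> 'n bifun \<Rightarrow> 'n bifun" where
  "ycreate E G c i f = (\<lambda>xs ys. create G E c i (\<lambda>ys. f xs ys) ys)"

definition damping :: "(bool \<Rightarrow> complex ^ 'n ^ 'n) \<Rightarrow> (bool \<Rightarrow> complex ^ 'n ^ 'n) \<Rightarrow> bool \<Rightarrow> bool list \<Rightarrow> complex" where
  "damping E G c cs = inverse (wenzl (loop_value E G) c cs)"

text \<open>Multiplication of a matrix coefficient by the generator with indices \<open>i\<close>
  and \<open>j\<close>: creation in both words is the component in the top summand of the tensor
  product, contraction in both words the component in the other one, and \<open>damping\<close> is
  the normalization under which the relations hold. The roles of \<open>E\<close> and
  \<open>G\<close> are exchanged between the two words.\<close>

definition lact_gen :: "(bool \<Rightarrow> complex ^ 'n ^ 'n) \<Rightarrow> (bool \<Rightarrow> complex ^ 'n ^ 'n) \<Rightarrow>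
    bool \<Rightarrow> 'n \<Rightarrow> 'n \<Rightarrow> 'n bifun \<Rightarrow> 'n bifun" where
  "lact_gen E G c i j f = xcreate E G c i (ycreate E G c j f) +
     xweight (damping E G c) (xflat G c i (yflat E c j f))"

definition xtraceless :: "(bool \<Rightarrow> complex ^ 'n ^ 'n) \<Rightarrow> 'n bifun \<Rightarrow> bool" where
  "xtraceless G f \<longleftrightarrow> (\<forall>ys. traceless G (\<lambda>xs. f xs ys))"

definition ytraceless :: "(bool \<Rightarrow> complex ^ 'n ^ 'n) \<Rightarrow> 'n bifun \<Rightarrow> bool" where
  "ytraceless E f \<longleftrightarrow> (\<forall>xs. traceless E (\<lambda>ys. f xs ys))"

text \<open>The two words index rows and columns of one and the same corepresentation. On such
  functions a weight may be read off either word, see \<open>weight_same_cols\<close>.\<close>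

definition same_cols :: "'n bifun \<Rightarrow> bool" where
  "same_cols f \<longleftrightarrow> (\<forall>xs ys. f xs ys \<noteq> 0 \<longrightarrow> cols xs = cols ys)"

section \<open>Linearity, mirror symmetry and stability of tracelessness for the operators on
  pairs\<close>

lemma linop_strip: "linop (xstrip c i)" "linop (ystrip c i)"
  by (auto intro!: linopI simp: xstrip_def ystrip_def fun_eq_iff)

lemma linop_weight: "linop (xweight \<phi>)" "linop (yweight \<phi>)"
  by (auto intro!: linopI simp: xweight_def yweight_def fun_eq_iff algebra_simps)

lemma linop_flat: "linop (xflat G c i)" "linop (yflat E c i)"
  by (auto intro!: linopI simp: xflat_def yflat_def linopD[OF linop_strip(1)] linopD[OF linop_strip(2)]
      bifun.scale_right_distrib sum.distrib bifun.scale_sum_right mult.commute)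

lemma create_add: "create E G c i (\<lambda>w. p w + q w) w = create E G c i p w + create E G c i q w"
  using create_lincomb[of E G c i "\<lambda>_. 1" "\<lambda>b. if b then p else q" "UNIV :: bool set" w]
  by (simp add: UNIV_bool add.commute)

lemma linop_create: "linop (xcreate E G c i)" "linop (ycreate E G c i)"
  by (auto intro!: linopI simp: xcreate_def ycreate_def fun_eq_iff create_add create_scale)

lemmas strip_lin = linopD[OF linop_strip(1)] linopD[OF linop_strip(2)]
lemmas weight_lin = linopD[OF linop_weight(1)] linopD[OF linop_weight(2)]
lemmas flat_lin = linopD[OF linop_flat(1)] linopD[OF linop_flat(2)]
lemmas create_lin = linopD[OF linop_create(1)] linopD[OF linop_create(2)]

lemma linop_lact_gen: "linop (lact_gen E G c i j)"
  by (rule linopI)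
    (simp_all add: lact_gen_def create_lin weight_lin flat_lin bifun.scale_right_distrib algebra_simps)

lemmas lact_gen_lin = linopD[OF linop_lact_gen]
lemmas op_lin = strip_lin weight_lin flat_lin create_lin lact_gen_lin

lemma xflat_apply: "xflat G c i f xs ys = flat G c i (\<lambda>xs. f xs ys) xs"
  by (simp add: xflat_def flat_def xstrip_def)

lemma yflat_apply: "yflat E c i f xs ys = flat E c i (\<lambda>ys. f xs ys) ys"
  by (simp add: yflat_def flat_def ystrip_def)

text \<open>The two creations act on different variables. Unfolding one of them by its recursion
  leaves linear combinations, through which the other passes.\<close>

lemma create_create_commute:
  "create E G c i (\<lambda>x. create E' G' c' j (\<lambda>y. f x y) ys) xs =
   create E' G' c' j (\<lambda>y. create E G c i (\<lambda>x. f x y) xs) ys"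
proof (induction xs arbitrary: f c i)
  case (Cons x xs)
  let ?q = "\<lambda>y. damp (loop_value E G) c (flat G c i (\<lambda>x. f x y))"
  have "flat G c i (\<lambda>x. create E' G' c' j (f x) ys) w =
      create E' G' c' j (\<lambda>y. flat G c i (\<lambda>x. f x y) w) ys" for w
    by (simp add: flat_def create_lincomb)
  then have q: "damp (loop_value E G) c (flat G c i (\<lambda>x. create E' G' c' j (f x) ys)) =
      (\<lambda>w. create E' G' c' j (\<lambda>y. ?q y w) ys)"
    by (simp add: damp_def create_scale fun_eq_iff)
  have sub: "create E' G' c' j (\<lambda>y. p y - r y) ys = create E' G' c' j p ys - create E' G' c' j r ys" for p r
    using create_add[of E' G' c' j p "\<lambda>y. - 1 * r y" ys] by (simp only: create_scale) simp
  have neg: "create E' G' c' j (\<lambda>y. - p y) ys = - create E' G' c' j p ys" for p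
    using create_scale[of E' G' c' j "- 1" p ys] by simp
  show ?case
    by (cases "fst x = c"; cases "snd x = i") (simp_all add: q Cons create_lincomb sub neg)
qed simp

lemma xy_commute:
  "xcreate E G c i (ycreate E' G' c' j f) = ycreate E' G' c' j (xcreate E G c i f)"
  "xcreate E G c i (ystrip c' j f) = ystrip c' j (xcreate E G c i f)"
  "xcreate E G c i (yflat E' c' j f) = yflat E' c' j (xcreate E G c i f)"
  "xcreate E G c i (yweight \<phi> f) = yweight \<phi> (xcreate E G c i f)"
  "xstrip c i (ycreate E' G' c' j f) = ycreate E' G' c' j (xstrip c i f)"
  "xstrip c i (ystrip c' j f) = ystrip c' j (xstrip c i f)"
  "xstrip c i (yflat E' c' j f) = yflat E' c' j (xstrip c i f)"
  "xstrip c i (yweight \<phi> f) = yweight \<phi> (xstrip c i f)"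
  "xflat G c i (ycreate E' G' c' j f) = ycreate E' G' c' j (xflat G c i f)"
  "xflat G c i (ystrip c' j f) = ystrip c' j (xflat G c i f)"
  "xflat G c i (yflat E' c' j f) = yflat E' c' j (xflat G c i f)"
  "xflat G c i (yweight \<phi> f) = yweight \<phi> (xflat G c i f)"
  "xweight \<psi> (ycreate E' G' c' j f) = ycreate E' G' c' j (xweight \<psi> f)"
  "xweight \<psi> (ystrip c' j f) = ystrip c' j (xweight \<psi> f)"
  "xweight \<psi> (yflat E' c' j f) = yflat E' c' j (xweight \<psi> f)"
  "xweight \<psi> (yweight \<phi> f) = yweight \<phi> (xweight \<psi> f)"
proof -
  show A: "xcreate E G c i (ycreate E' G' c' j f) = ycreate E' G' c' j (xcreate E G c i f)" for f
    unfolding xcreate_def ycreate_def by (intro ext) (rule create_create_commute[where f = f])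
  show B: "xcreate E G c i (ystrip c' j f) = ystrip c' j (xcreate E G c i f)" for c' j f
    by (simp add: xcreate_def ystrip_def fun_eq_iff)
  show "xcreate E G c i (yflat E' c' j f) = yflat E' c' j (xcreate E G c i f)"
    by (simp add: yflat_def B create_lin)
  show "xcreate E G c i (yweight \<phi> f) = yweight \<phi> (xcreate E G c i f)"
    by (simp add: xcreate_def yweight_def create_scale fun_eq_iff)
  show C: "xstrip c i (ycreate E' G' c' j f) = ycreate E' G' c' j (xstrip c i f)" for c i
    by (simp add: ycreate_def xstrip_def fun_eq_iff)
  show D: "xstrip c i (ystrip c' j f) = ystrip c' j (xstrip c i f)" for c i c' j
    by (simp add: ystrip_def xstrip_def fun_eq_iff)
  show D': "xstrip c i (yflat E' c' j f) = yflat E' c' j (xstrip c i f)" for c i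
    by (simp add: yflat_def D strip_lin)
  show F: "xstrip c i (yweight \<phi> f) = yweight \<phi> (xstrip c i f)" for c i
    by (simp add: yweight_def xstrip_def fun_eq_iff)
  show "xflat G c i (ycreate E' G' c' j f) = ycreate E' G' c' j (xflat G c i f)"
    by (simp add: xflat_def C create_lin)
  show H: "xflat G c i (ystrip c' j f) = ystrip c' j (xflat G c i f)" for c' j
    by (simp add: xflat_def D strip_lin)
  show "xflat G c i (yflat E' c' j f) = yflat E' c' j (xflat G c i f)"
    by (simp add: yflat_def H flat_lin)
  show "xflat G c i (yweight \<phi> f) = yweight \<phi> (xflat G c i f)"
    by (simp add: xflat_def F weight_lin)
  show "xweight \<psi> (ycreate E' G' c' j f) = ycreate E' G' c' j (xweight \<psi> f)"
    by (simp add: ycreate_def xweight_def create_scale fun_eq_iff)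
  show K: "xweight \<psi> (ystrip c' j f) = ystrip c' j (xweight \<psi> f)" for c' j
    by (simp add: ystrip_def xweight_def fun_eq_iff)
  show "xweight \<psi> (yflat E' c' j f) = yflat E' c' j (xweight \<psi> f)"
    by (simp add: yflat_def K weight_lin)
  show "xweight \<psi> (yweight \<phi> f) = yweight \<phi> (xweight \<psi> f)"
    by (simp add: yweight_def xweight_def fun_eq_iff)
qed

lemma flp_ops:
  "flp (flp f) = f" "flp (xcreate E G c i f) = ycreate G E c i (flp f)"
  "flp (ycreate E G c i f) = xcreate G E c i (flp f)" "flp (xstrip c i f) = ystrip c i (flp f)"
  "flp (ystrip c i f) = xstrip c i (flp f)" "flp (xflat G c i f) = yflat G c i (flp f)"
  "flp (yflat E c i f) = xflat E c i (flp f)" "flp (xweight \<phi> f) = yweight \<phi> (flp f)"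
  "flp (yweight \<phi> f) = xweight \<phi> (flp f)"
  by (simp_all add: flp_def xcreate_def ycreate_def xstrip_def ystrip_def xweight_def yweight_def
      xflat_def yflat_def fun_eq_iff)

lemma flp_lin: "flp (f + g) = flp f + flp g" "flp (a *\<^sub>f f) = a *\<^sub>f flp f"
  "flp (f - g) = flp f - flp g" "flp (\<Sum>k\<in>K. h k) = (\<Sum>k\<in>K. flp (h k))" "flp 0 = 0"
  by (simp_all add: flp_def fun_eq_iff)

lemma flp_eq_iff: "flp f = flp g \<longleftrightarrow> f = g"
  by (auto simp: flp_def fun_eq_iff)

lemma xtraceless_flp: "xtraceless G (flp f) \<longleftrightarrow> ytraceless G f" "ytraceless G (flp f) \<longleftrightarrow> xtraceless G f"
  by (simp_all add: xtraceless_def ytraceless_def flp_def)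

lemma ytraceless_iff: "ytraceless G f \<longleftrightarrow> xtraceless G (flp f)"
  by (simp add: xtraceless_flp)

lemma same_cols_flp: "same_cols (flp f) \<longleftrightarrow> same_cols f"
  unfolding same_cols_def flp_def by (auto dest: sym)

lemma xtraceless_lincomb:
  assumes "\<And>k. k \<in> K \<Longrightarrow> xtraceless G (h k)"
  shows "xtraceless G (\<Sum>k\<in>K. a k *\<^sub>f h k)"
  using assms unfolding xtraceless_def by (auto intro!: traceless_lincomb)

lemma same_cols_lincomb:
  assumes "\<And>k. k \<in> K \<Longrightarrow> same_cols (h k)"
  shows "same_cols (\<Sum>k\<in>K. a k *\<^sub>f h k)"
  unfolding same_cols_def
proof (intro allI impI)
  fix xs ys assume "(\<Sum>k\<in>K. a k *\<^sub>f h k) xs ys \<noteq> 0"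
  then obtain k where "k \<in> K" "h k xs ys \<noteq> 0" by (auto elim!: sum.not_neutral_contains_not_neutral)
  then show "cols xs = cols ys" using assms by (auto simp: same_cols_def)
qed

lemma create_front: "create E G c i q w \<noteq> 0 \<Longrightarrow> w \<noteq> [] \<and> fst (hd w) = c"
  by (cases w) (auto split: if_splits)

lemma create_support:
  assumes "create E G c i q w \<noteq> 0"
  obtains w' where "cols w = c # cols w'" "q w' \<noteq> 0"
proof -
  have "\<exists>w'. cols w' = tl (cols w) \<and> q w' \<noteq> 0"
  proof (rule ccontr)
    assume "\<not> ?thesis"
    then have "create E G c i q w = create E G c i (\<lambda>_. 0) w" by (intro create_cong) auto
    with assms show False by simp
  qed
  then obtain w' where "cols w' = tl (cols w)" "q w' \<noteq> 0" by blast
  with create_front[OF assms] show thesis by (intro that[of w']) (cases w; simp)+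
qed

lemma flat_support:
  assumes "flat G c i q w \<noteq> 0"
  obtains l where "q ((\<not> c, l) # w) \<noteq> 0"
  using assms by (auto simp: flat_def elim!: sum.not_neutral_contains_not_neutral)

lemma same_cols_create:
  assumes "same_cols f"
  shows "same_cols (xcreate E G c i (ycreate E G c j f))"
  unfolding same_cols_def
proof (intro allI impI)
  fix xs ys assume "xcreate E G c i (ycreate E G c j f) xs ys \<noteq> 0"
  then obtain xs' where xs': "cols xs = c # cols xs'" "ycreate E G c j f xs' ys \<noteq> 0"
    unfolding xcreate_def by (rule create_support)
  from xs'(2) obtain ys' where "cols ys = c # cols ys'" "f xs' ys' \<noteq> 0"
    unfolding ycreate_def by (rule create_support)
  with assms xs'(1) show "cols xs = cols ys" by (auto simp: same_cols_def)
qed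

lemma same_cols_flat:
  assumes "same_cols f"
  shows "same_cols (xflat G c i (yflat E c j f))"
  unfolding same_cols_def
proof (intro allI impI)
  fix xs ys assume "xflat G c i (yflat E c j f) xs ys \<noteq> 0"
  then obtain l where "yflat E c j f ((\<not> c, l) # xs) ys \<noteq> 0"
    unfolding xflat_apply by (rule flat_support)
  then obtain m where "f ((\<not> c, l) # xs) ((\<not> c, m) # ys) \<noteq> 0"
    unfolding yflat_apply by (rule flat_support)
  with assms show "cols xs = cols ys" by (fastforce simp: same_cols_def)
qed

lemma same_cols_strip: "same_cols f \<Longrightarrow> same_cols (xstrip c i (ystrip c j f))"
  by (fastforce simp: same_cols_def xstrip_def ystrip_def)

lemma same_cols_weight: "same_cols f \<Longrightarrow> same_cols (xweight \<phi> f)"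
  by (auto simp: same_cols_def xweight_def)

lemma weight_same_cols: "same_cols f \<Longrightarrow> xweight \<phi> f = yweight \<phi> f"
proof (intro ext)
  fix xs ys assume "same_cols f"
  then show "xweight \<phi> f xs ys = yweight \<phi> f xs ys"
    by (cases "f xs ys = 0") (simp_all add: same_cols_def xweight_def yweight_def)
qed

lemma loop_value_dual: "loop_value G E = loop_value E G"
  by (auto simp: loop_value_def fun_eq_iff mult.commute)

lemma damping_dual: "damping G E = damping E G"
  by (simp add: damping_def[abs_def] loop_value_dual[of G E])

text \<open>The weight in \<open>lact_gen\<close> is the only part that prefers one word; since the
  colours agree it can be moved to the other.\<close>

lemma lact_gen_flp:
  fixes f :: "'n :: finite bifun"
  assumes "same_cols f"
  shows "lact_gen G E c j i (flp f) = flp (lact_gen E G c i j f)"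
proof -
  have "xflat E c j (yflat G c i (flp f)) = flp (xflat G c i (yflat E c j f))"
    by (simp add: flp_ops xy_commute)
  moreover have "xcreate G E c j (ycreate G E c i (flp f)) = flp (xcreate E G c i (ycreate E G c j f))"
    by (simp add: flp_ops xy_commute)
  moreover have "xweight (damping E G c) (flp g) = flp (xweight (damping E G c) g)" if "same_cols g" for g :: "'n bifun"
    using that weight_same_cols[of "flp g"] by (simp add: same_cols_flp flp_ops)
  ultimately show ?thesis
    using same_cols_flat[OF assms] by (simp add: lact_gen_def flp_lin damping_dual[of G E])
qed

lemma xtraceless_strip: "xtraceless G f \<Longrightarrow> xtraceless G (xstrip c i f)"
  using traceless_strip unfolding xtraceless_def xstrip_def strip_def[abs_def] by blast

lemma xtraceless_flat: "xtraceless G f \<Longrightarrow> xtraceless G (xflat G' c i f)"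
  unfolding xflat_def by (intro xtraceless_lincomb xtraceless_strip)

lemma xtraceless_weight: "xtraceless G f \<Longrightarrow> xtraceless G (xweight \<phi> f)"
  using traceless_weight unfolding xtraceless_def xweight_def by blast

lemma traceless_create_param:
  assumes "\<And>y. traceless G (\<lambda>x. f x y)"
  shows "traceless G (\<lambda>x. create E' G' c j (\<lambda>y. f x y) ys)"
proof -
  have "(\<Sum>m\<in>UNIV. \<Sum>l\<in>UNIV. G c' $ m $ l * create E' G' c j (f (p @ (c', m) # (\<not> c', l) # w)) ys) =
    create E' G' c j (\<lambda>y. \<Sum>m\<in>UNIV. 1 * (\<Sum>l\<in>UNIV. G c' $ m $ l * f (p @ (c', m) # (\<not> c', l) # w) y)) ys" for p c' w
    unfolding create_lincomb by simp
  with assms show ?thesis unfolding traceless_def by simp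
qed

lemma xtraceless_y_ops:
  assumes "xtraceless G f"
  shows "xtraceless G (ycreate E' G' c j f)" "xtraceless G (ystrip c j f)"
    "xtraceless G (yflat E' c j f)" "xtraceless G (yweight \<phi> f)"
proof -
  show "xtraceless G (ycreate E' G' c j f)"
    using assms unfolding xtraceless_def ycreate_def by (auto intro: traceless_create_param)
  show s: "xtraceless G (ystrip c j f)" for c j using assms by (simp add: xtraceless_def ystrip_def)
  show "xtraceless G (yflat E' c j f)" unfolding yflat_def by (intro xtraceless_lincomb s)
  show "xtraceless G (yweight \<phi> f)"
    unfolding xtraceless_def yweight_def
  proof
    fix ys
    show "traceless G (\<lambda>xs. \<phi> (cols ys) * f xs ys)"
      using assms by (intro traceless_weight[of G _ "\<lambda>_. \<phi> (cols ys)"]) (simp add: xtraceless_def)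
  qed
qed

lemma ytraceless_lincomb:
  assumes "\<And>k. k \<in> K \<Longrightarrow> ytraceless G (h k)"
  shows "ytraceless G (\<Sum>k\<in>K. a k *\<^sub>f h k)"
  using xtraceless_lincomb[of K G "\<lambda>k. flp (h k)" a] assms
  by (simp add: ytraceless_iff flp_lin)

lemma ytraceless_ops:
  assumes "ytraceless G f"
  shows "ytraceless G (ystrip c i f)" "ytraceless G (yflat G' c i f)" "ytraceless G (yweight \<phi> f)"
    "ytraceless G (xcreate E' G' c j f)" "ytraceless G (xstrip c j f)"
    "ytraceless G (xflat E' c j f)" "ytraceless G (xweight \<phi> f)"
  using assms xtraceless_strip[of G "flp f"] xtraceless_flat[of G "flp f"] xtraceless_weight[of G "flp f"]
    xtraceless_y_ops[of G "flp f"]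
  by (simp_all add: ytraceless_iff flp_ops)

definition bitraceless :: "(bool \<Rightarrow> complex ^ 'n ^ 'n) \<Rightarrow> (bool \<Rightarrow> complex ^ 'n ^ 'n) \<Rightarrow> 'n bifun \<Rightarrow> bool" where
  "bitraceless E G f \<longleftrightarrow> xtraceless G f \<and> ytraceless E f \<and> same_cols f"

lemma bitraceless_flp: "bitraceless G E (flp f) \<longleftrightarrow> bitraceless E G f"
  by (auto simp: bitraceless_def xtraceless_flp same_cols_flp)

context cup_cap
begin

lemma xtraceless_create: "xtraceless G f \<Longrightarrow> xtraceless G (xcreate E G c i f)"
  unfolding xtraceless_def xcreate_def by (auto intro: traceless_create)

lemma ytraceless_create: "ytraceless E f \<Longrightarrow> ytraceless E (ycreate E G c i f)"
  using cup_cap.xtraceless_create[OF dual, of "flp f"] by (simp add: ytraceless_iff flp_ops)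

lemma bitraceless_lact_gen:
  assumes "bitraceless E G f"
  shows "bitraceless E G (lact_gen E G c i j f)"
proof -
  have add: "bitraceless E G (f + g)" if "bitraceless E G f" "bitraceless E G g" for f g
    using that xtraceless_lincomb[of UNIV G "\<lambda>b. if b then f else g" "\<lambda>_. 1"]
      ytraceless_lincomb[of UNIV E "\<lambda>b. if b then f else g" "\<lambda>_. 1"]
      same_cols_lincomb[of UNIV "\<lambda>b. if b then f else g" "\<lambda>_. 1"]
    by (simp add: bitraceless_def UNIV_bool add.commute)
  show ?thesis
    unfolding lact_gen_def using assms
    by (intro add) (simp_all add: bitraceless_def xtraceless_create ytraceless_create xtraceless_y_ops ytraceless_ops
      xtraceless_flat xtraceless_weight same_cols_create same_cols_flat same_cols_weight)
qed

lemma xflat_create: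
  "xflat G c i (xcreate E G (\<not> c) j f) =
    G c $ i $ j *\<^sub>f f - xcreate E G c i (xweight (damping E G (\<not> c)) (xflat G (\<not> c) j f))"
  using flat_create by (simp add: fun_eq_iff xflat_apply xcreate_def xweight_def damping_def damp_def[abs_def])

lemma xflat_inverse: "(\<Sum>l\<in>UNIV. E c $ m $ l *\<^sub>f xflat G (\<not> c) l f) = xstrip c m f"
  using flat_inverse by (simp add: fun_eq_iff xflat_apply xstrip_def strip_def)

lemma sum_xcreate_strip:
  assumes "xtraceless G f"
  shows "(\<Sum>k\<in>UNIV. xcreate E G c k (xstrip c k f)) = xweight (\<lambda>cs. if cs \<noteq> [] \<and> hd cs = c then 1 else 0) f"
proof (intro ext)
  fix xs ys
  have "traceless G (\<lambda>xs. f xs ys)" using assms by (simp add: xtraceless_def)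
  from sum_create_strip[OF this, of c xs]
  show "(\<Sum>k\<in>UNIV. xcreate E G c k (xstrip c k f)) xs ys =
      xweight (\<lambda>cs. if cs \<noteq> [] \<and> hd cs = c then 1 else 0) f xs ys"
    by (cases xs) (simp_all add: xcreate_def xstrip_def strip_def[abs_def] xweight_def)
qed

lemma sum_xflat_create:
  assumes "xtraceless G f"
  shows "(\<Sum>m\<in>UNIV. \<Sum>l\<in>UNIV. E c $ m $ l *\<^sub>f xflat G c m (xcreate E G (\<not> c) l f)) = xweight (wenzl \<delta> c) f"
  using sum_flat_create assms
  by (auto simp: fun_eq_iff xcreate_def xflat_apply xtraceless_def xweight_def)

lemma sum_xcreate_create:
  assumes "xtraceless G f"
  shows "(\<Sum>m\<in>UNIV. \<Sum>l\<in>UNIV. E c $ m $ l *\<^sub>f xcreate E G c m (xcreate E G (\<not> c) l f)) = 0"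
  using sum_create_create assms
  by (auto simp: fun_eq_iff xcreate_def xtraceless_def)

lemma damping_wenzl: "xweight (damping E G c) (xweight (wenzl \<delta> c) f) = f"
  using wenzl_nonzero by (simp add: fun_eq_iff xweight_def damping_def)

lemma sum_xflat_strip:
  assumes "xtraceless G f"
  shows "(\<Sum>k\<in>UNIV. xflat G c k (xweight \<phi> (xstrip c k f))) = 0"
proof -
  have "(\<Sum>k\<in>UNIV. xflat G c k (xweight \<phi> (xstrip c k f))) xs ys = 0" for xs ys
  proof -
    have "(\<Sum>k\<in>UNIV. xflat G c k (xweight \<phi> (xstrip c k f))) xs ys =
      \<phi> ((\<not> c) # cols xs) * (\<Sum>m\<in>UNIV. \<Sum>l\<in>UNIV. G c $ m $ l * f ((c, m) # (\<not> c, l) # xs) ys)"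
      by (simp add: xflat_apply flat_def xweight_def xstrip_def sum_distrib_left mult_ac)
    also have "\<dots> = 0"
      using assms[unfolded xtraceless_def traceless_def, rule_format, where p = "[]" and c = c and w = xs and ys = ys] by simp
    finally show ?thesis .
  qed
  then show ?thesis by (simp add: fun_eq_iff)
qed

end

section \<open>The operators satisfy the defining relations\<close>

context cup_cap
begin

text \<open>Each of the two factors creates or contracts, which gives four sums. Two creations of a
  cup vanish by \<open>sum_xcreate_create\<close>, two contractions vanish by tracelessness. In the
  mixed sums the first word returns to its old state, and what remains in the second word are the
  two terms of the mirror image of \<open>flat_create\<close>, which add up to the scalar.\<close>

lemma x_relation:
  assumes f: "bitraceless E G f"
  shows "(\<Sum>k\<in>UNIV. \<Sum>l\<in>UNIV. E c $ k $ l *\<^sub>f lact_gen E G c k i (lact_gen E G (\<not> c) l j f)) = E c $ i $ j *\<^sub>f f"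
proof -
  interpret dual: cup_cap G E by (rule dual)
  have x: "xtraceless G f" and sc: "same_cols f" using f by (auto simp: bitraceless_def)
  let ?w = "damping E G"
  define h where "h = ycreate E G c i (yflat E (\<not> c) j f)"
  define h' where "h' = yflat E c i (yflat E (\<not> c) j f)"
  have T1: "(\<Sum>k\<in>UNIV. \<Sum>l\<in>UNIV. E c $ k $ l *\<^sub>f
      xcreate E G c k (ycreate E G c i (xcreate E G (\<not> c) l (ycreate E G (\<not> c) j f)))) = 0"
    using sum_xcreate_create[of "ycreate E G c i (ycreate E G (\<not> c) j f)" c] x
    by (simp add: xtraceless_y_ops xy_commute)
  have "(\<Sum>k\<in>UNIV. \<Sum>l\<in>UNIV. E c $ k $ l *\<^sub>f
      xcreate E G c k (ycreate E G c i (xweight (?w (\<not> c)) (xflat G (\<not> c) l (yflat E (\<not> c) j f))))) =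
    (\<Sum>k\<in>UNIV. xcreate E G c k (xweight (?w (\<not> c)) (\<Sum>l\<in>UNIV. E c $ k $ l *\<^sub>f xflat G (\<not> c) l h)))"
    by (simp add: op_lin h_def flip: xy_commute)
  also have "\<dots> = (\<Sum>k\<in>UNIV. xcreate E G c k (xstrip c k (xweight (\<lambda>cs. ?w (\<not> c) (tl cs)) h)))"
    unfolding xflat_inverse by (simp add: xstrip_def xweight_def)
  also have "\<dots> = xweight (\<lambda>cs. if cs \<noteq> [] \<and> hd cs = c then 1 else 0) (xweight (\<lambda>cs. ?w (\<not> c) (tl cs)) h)"
    unfolding h_def by (intro sum_xcreate_strip xtraceless_weight xtraceless_y_ops x)
  also have "\<dots> = ycreate E G c i (yweight (?w (\<not> c)) (yflat E (\<not> c) j f))"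
  proof -
    \<comment> \<open>The contraction has removed a letter of colour \<open>c\<close> from the
      second word only. So nonzero values occur only if the first word starts with \<open>c\<close>
      and its tail has the colours of the second word: the test holds, and the weight of the tail is
      the weight of the second word.\<close>
    have "xweight (\<lambda>cs. if cs \<noteq> [] \<and> hd cs = c then 1 else 0) (xweight (\<lambda>cs. ?w (\<not> c) (tl cs)) (yflat E (\<not> c) j f)) =
      yweight (?w (\<not> c)) (yflat E (\<not> c) j f)"
    proof (intro ext)
      fix xs ys
      have "yflat E (\<not> c) j f xs ys = 0" if "cols xs \<noteq> c # cols ys"
        using that sc by (auto simp: yflat_apply flat_def same_cols_def intro!: sum.neutral)
      then show "xweight (\<lambda>cs. if cs \<noteq> [] \<and> hd cs = c then 1 else 0) (xweight (\<lambda>cs. ?w (\<not> c) (tl cs)) (yflat E (\<not> c) j f)) xs ys =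
        yweight (?w (\<not> c)) (yflat E (\<not> c) j f) xs ys"
        by (cases "cols xs = c # cols ys") (auto simp: xweight_def yweight_def)
    qed
    then show ?thesis by (simp add: h_def xy_commute)
  qed
  finally have T2: "(\<Sum>k\<in>UNIV. \<Sum>l\<in>UNIV. E c $ k $ l *\<^sub>f
      xcreate E G c k (ycreate E G c i (xweight (?w (\<not> c)) (xflat G (\<not> c) l (yflat E (\<not> c) j f))))) =
      ycreate E G c i (yweight (?w (\<not> c)) (yflat E (\<not> c) j f))" .
  have g: "yflat E c i (ycreate E G (\<not> c) j f) =
     E c $ i $ j *\<^sub>f f - ycreate E G c i (yweight (?w (\<not> c)) (yflat E (\<not> c) j f))"
  proof -
    show ?thesis
      using dual.xflat_create[of c i j "flp f"]
      by (subst flp_eq_iff[symmetric]) (simp add: flp_ops flp_lin damping_dual[of G E])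
  qed
  have "(\<Sum>k\<in>UNIV. \<Sum>l\<in>UNIV. E c $ k $ l *\<^sub>f
      xweight (?w c) (xflat G c k (yflat E c i (xcreate E G (\<not> c) l (ycreate E G (\<not> c) j f))))) =
    xweight (?w c) (\<Sum>k\<in>UNIV. \<Sum>l\<in>UNIV. E c $ k $ l *\<^sub>f xflat G c k (xcreate E G (\<not> c) l (yflat E c i (ycreate E G (\<not> c) j f))))"
    by (simp add: op_lin flip: xy_commute)
  also have "\<dots> = yflat E c i (ycreate E G (\<not> c) j f)"
    by (simp add: sum_xflat_create xtraceless_y_ops x damping_wenzl)
  finally have T3: "(\<Sum>k\<in>UNIV. \<Sum>l\<in>UNIV. E c $ k $ l *\<^sub>f
      xweight (?w c) (xflat G c k (yflat E c i (xcreate E G (\<not> c) l (ycreate E G (\<not> c) j f))))) =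
      yflat E c i (ycreate E G (\<not> c) j f)" .
  have "(\<Sum>k\<in>UNIV. \<Sum>l\<in>UNIV. E c $ k $ l *\<^sub>f
      xweight (?w c) (xflat G c k (yflat E c i (xweight (?w (\<not> c)) (xflat G (\<not> c) l (yflat E (\<not> c) j f)))))) =
    xweight (?w c) (\<Sum>k\<in>UNIV. xflat G c k (xweight (?w (\<not> c)) (\<Sum>l\<in>UNIV. E c $ k $ l *\<^sub>f xflat G (\<not> c) l h')))"
    by (simp add: op_lin h'_def flip: xy_commute)
  also have "\<dots> = 0"
    unfolding xflat_inverse h'_def by (subst sum_xflat_strip) (simp_all add: xtraceless_y_ops x op_lin)
  finally have T4: "(\<Sum>k\<in>UNIV. \<Sum>l\<in>UNIV. E c $ k $ l *\<^sub>f
      xweight (?w c) (xflat G c k (yflat E c i (xweight (?w (\<not> c)) (xflat G (\<not> c) l (yflat E (\<not> c) j f)))))) = 0" .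
  show ?thesis
    unfolding lact_gen_def op_lin bifun.scale_right_distrib sum.distrib T1 T2 T3 T4 g by simp
qed

lemma y_relation:
  assumes f: "bitraceless E G f"
  shows "(\<Sum>k\<in>UNIV. \<Sum>l\<in>UNIV. G c $ k $ l *\<^sub>f lact_gen E G c i k (lact_gen E G (\<not> c) j l f)) = G c $ i $ j *\<^sub>f f"
proof -
  have "same_cols f" "same_cols (lact_gen E G (\<not> c) j l f)" for l
    using f bitraceless_lact_gen[OF f] by (auto simp: bitraceless_def)
  then show ?thesis
    using cup_cap.x_relation[OF dual, of "flp f" c i j] f
    by (subst flp_eq_iff[symmetric]) (simp add: lact_gen_flp bitraceless_flp flp_lin)
qed

end

section \<open>Degrees and leading terms\<close>

declare sum_fun_apply [simp del]

text \<open>Only the first word is measured; under \<open>same_cols\<close> both have the same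
  length.\<close>

definition deg_less :: "nat \<Rightarrow> 'n bifun \<Rightarrow> bool" where
  "deg_less k f \<longleftrightarrow> (\<forall>xs ys. f xs ys \<noteq> 0 \<longrightarrow> length xs < k)"

abbreviation part :: "nat \<Rightarrow> 'n bifun \<Rightarrow> 'n bifun" where
  "part k \<equiv> xweight (\<lambda>cs. if length cs = k then 1 else 0)"

lemma contract:
  fixes A :: "'k :: finite \<Rightarrow> complex"
  assumes "\<And>m. (\<Sum>k\<in>UNIV. A k * B k m) = (if m = l then 1 else 0)"
  shows "(\<Sum>k\<in>UNIV. A k *\<^sub>f (\<Sum>m\<in>UNIV. B k m *\<^sub>f h (m :: 'm :: finite))) = h l"
proof -
  have "(\<Sum>k\<in>UNIV. A k *\<^sub>f (\<Sum>m\<in>UNIV. B k m *\<^sub>f h m)) = (\<Sum>m\<in>UNIV. (\<Sum>k\<in>UNIV. A k * B k m) *\<^sub>f h m)"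
    unfolding bifun.scale_sum_right bifun.scale_sum_left by (subst sum.swap) simp
  then show ?thesis by (simp add: assms if_distrib[of "\<lambda>x. x *\<^sub>f _"] cong: if_cong)
qed

lemma xweight_create: "xweight \<phi> (xcreate E G c i f) = xcreate E G c i (xweight (\<lambda>cs. \<phi> (c # cs)) f)"
proof (intro ext)
  fix xs ys
  have "create E G c i (\<lambda>w. \<phi> (c # cols w) * f w ys) xs = \<phi> (c # tl (cols xs)) * create E G c i (\<lambda>w. f w ys) xs"
    by (rule create_weight[of E G c i "\<lambda>cs. \<phi> (c # cs)" "\<lambda>xs. f xs ys"])
  then have *: "create E G c i (\<lambda>w. \<phi> (c # cols w) * f w ys) xs = \<phi> (cols xs) * create E G c i (\<lambda>w. f w ys) xs"
  proof (cases "xs \<noteq> [] \<and> fst (hd xs) = c")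
    case True
    then have "c # tl (cols xs) = cols xs" by (cases xs) auto
    with \<open>create E G c i _ xs = _\<close> show ?thesis by simp
  next
    case False
    then have "create E G c i q xs = 0" for q using create_front by blast
    then show ?thesis by simp
  qed
  show "xweight \<phi> (xcreate E G c i f) xs ys = xcreate E G c i (xweight (\<lambda>cs. \<phi> (c # cs)) f) xs ys"
    unfolding xweight_def xcreate_def * ..
qed

lemma xweight_flat:
  "xweight \<phi> (xflat G c i f) = xflat G c i (xweight (\<lambda>cs. if cs = [] then 0 else \<phi> (tl cs)) f)"
  by (auto simp: fun_eq_iff xweight_def xflat_apply flat_def sum_distrib_left mult_ac)

lemma xweight_commute: "xweight \<phi> (xweight \<psi> f) = xweight \<psi> (xweight \<phi> f)"
  by (simp add: fun_eq_iff xweight_def)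

text \<open>The shifts of the weight record that one summand of a generator raises the degree by one
  and the other lowers it by one. The value 0 on the empty word is immaterial, since a contraction
  never evaluates its argument there.\<close>

lemma xweight_lact_gen:
  "xweight \<phi> (lact_gen E G c i j f) =
     xcreate E G c i (ycreate E G c j (xweight (\<lambda>cs. \<phi> (c # cs)) f)) +
     xweight (damping E G c) (xflat G c i (yflat E c j (xweight (\<lambda>cs. if cs = [] then 0 else \<phi> (tl cs)) f)))"
  by (simp only: lact_gen_def weight_lin xweight_commute[of \<phi> "damping E G c"] xweight_create
      xweight_flat[of \<phi>] xy_commute(13,15))

lemma part_deg_less: "deg_less k f \<Longrightarrow> (\<And>cs. length cs < k \<Longrightarrow> \<phi> cs = 0) \<Longrightarrow> xweight \<phi> f = 0"
  by (auto simp: deg_less_def fun_eq_iff xweight_def)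

lemma shift_weight_0: "length cs \<le> m \<Longrightarrow> (if cs = [] then 0 else if length (tl cs) = m then 1 else 0 :: complex) = 0"
  by (cases cs) auto

lemma deg_less_add: "deg_less k f \<Longrightarrow> deg_less k g \<Longrightarrow> deg_less k (f + g)"
  unfolding deg_less_def
proof (intro allI impI)
  fix xs ys
  assume "\<forall>xs ys. f xs ys \<noteq> 0 \<longrightarrow> length xs < k" "\<forall>xs ys. g xs ys \<noteq> 0 \<longrightarrow> length xs < k" "(f + g) xs ys \<noteq> 0"
  then show "length xs < k" by (cases "f xs ys = 0") auto
qed

lemma deg_less_lincomb: "(\<And>i. i \<in> I \<Longrightarrow> deg_less k (f i)) \<Longrightarrow> deg_less k (\<Sum>i\<in>I. a i *\<^sub>f f i)"
  unfolding deg_less_def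
proof (intro allI impI)
  fix xs ys
  assume *: "\<And>i. i \<in> I \<Longrightarrow> \<forall>xs ys. f i xs ys \<noteq> 0 \<longrightarrow> length xs < k" and "(\<Sum>i\<in>I. a i *\<^sub>f f i) xs ys \<noteq> 0"
  then obtain i where "i \<in> I" "f i xs ys \<noteq> 0" by (auto simp: sum_fun_apply elim!: sum.not_neutral_contains_not_neutral)
  with * show "length xs < k" by blast
qed

lemma deg_less_scale: "deg_less k f \<Longrightarrow> deg_less k (a *\<^sub>f f)"
  by (auto simp: deg_less_def)

lemma deg_less_uminus: "deg_less k f \<Longrightarrow> deg_less k (- f)"
  by (auto simp: deg_less_def)

lemma deg_less_mono: "deg_less k f \<Longrightarrow> k \<le> k' \<Longrightarrow> deg_less k' f"
  by (fastforce simp: deg_less_def)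

lemma deg_less_iff: "deg_less k f \<longleftrightarrow> xweight (\<lambda>cs. if length cs < k then 0 else 1) f = 0"
  by (auto simp: deg_less_def fun_eq_iff xweight_def)

lemma deg_less_Suc: "deg_less (Suc k) f \<Longrightarrow> part k f = 0 \<Longrightarrow> deg_less k f"
  unfolding deg_less_def
proof (intro allI impI)
  fix xs ys assume *: "\<forall>xs ys. f xs ys \<noteq> 0 \<longrightarrow> length xs < Suc k" "part k f = 0" "f xs ys \<noteq> 0"
  have "part k f xs ys = 0" using *(2) by simp
  with *(3) have "length xs \<noteq> k" by (auto simp: xweight_def)
  moreover have "length xs < Suc k" using * by blast
  ultimately show "length xs < k" by simp
qed

lemma deg_less_lact_gen:
  assumes "deg_less k f" shows "deg_less (Suc k) (lact_gen E G c i j f)"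
proof -
  have "xweight (\<lambda>cs. if length (c # cs) < Suc k then 0 else 1) f = 0"
    "xweight (\<lambda>cs. if cs = [] then 0 else if length (tl cs) < Suc k then 0 else 1) f = 0"
    by (rule part_deg_less[OF assms], force)+
  then show ?thesis unfolding deg_less_iff[of "Suc k"] xweight_lact_gen by (simp add: op_lin)
qed

lemma bitraceless_lincomb:
  assumes "\<And>k. k \<in> K \<Longrightarrow> bitraceless E G (h k)"
  shows "bitraceless E G (\<Sum>k\<in>K. a k *\<^sub>f h k)"
  using assms by (auto simp: bitraceless_def intro!: xtraceless_lincomb ytraceless_lincomb same_cols_lincomb)

lemma bitraceless_scale: "bitraceless E G f \<Longrightarrow> bitraceless E G (a *\<^sub>f f)"
  using bitraceless_lincomb[of "{()}" E G "\<lambda>_. f" "\<lambda>_. a"] by simp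

lemma bitraceless_sum: "(\<And>k. k \<in> K \<Longrightarrow> bitraceless E G (h k)) \<Longrightarrow> bitraceless E G (\<Sum>k\<in>K. h k)"
  using bitraceless_lincomb[of K E G h "\<lambda>_. 1"] by simp

lemma xtraceless_sum: "(\<And>k. k \<in> K \<Longrightarrow> xtraceless G (h k)) \<Longrightarrow> xtraceless G (\<Sum>k\<in>K. h k)"
  using xtraceless_lincomb[of K G h "\<lambda>_. 1"] by simp

lemma ytraceless_sum: "(\<And>k. k \<in> K \<Longrightarrow> ytraceless E (h k)) \<Longrightarrow> ytraceless E (\<Sum>k\<in>K. h k)"
  using ytraceless_lincomb[of K E h "\<lambda>_. 1"] by simp

lemma same_cols_sum: "(\<And>k. k \<in> K \<Longrightarrow> same_cols (h k)) \<Longrightarrow> same_cols (\<Sum>k\<in>K. h k)"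
  using same_cols_lincomb[of K h "\<lambda>_. 1"] by simp

lemma bitraceless_add: "bitraceless E G f \<Longrightarrow> bitraceless E G g \<Longrightarrow> bitraceless E G (f + g)"
  using bitraceless_lincomb[of UNIV E G "\<lambda>b. if b then f else g" "\<lambda>_. 1"] by (simp add: UNIV_bool add.commute)

lemma bitraceless_uminus: "bitraceless E G f \<Longrightarrow> bitraceless E G (- f)"
  using bitraceless_scale[of E G f "- 1"] by simp

lemma bitraceless_diff: "bitraceless E G f \<Longrightarrow> bitraceless E G g \<Longrightarrow> bitraceless E G (f - g)"
  using bitraceless_add[of E G f "- g"] by (simp add: bitraceless_uminus)

lemma bitraceless_weight: "bitraceless E G f \<Longrightarrow> bitraceless E G (xweight \<phi> f)"
  by (simp add: bitraceless_def xtraceless_weight ytraceless_ops same_cols_weight)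

lemma same_cols_yflat_create:
  assumes "same_cols f"
  shows "same_cols (yflat E' c m (ycreate E G (\<not> c) j f))"
  unfolding same_cols_def
proof (intro allI impI)
  fix xs ys assume "yflat E' c m (ycreate E G (\<not> c) j f) xs ys \<noteq> 0"
  then obtain l where "ycreate E G (\<not> c) j f xs ((\<not> c, l) # ys) \<noteq> 0"
    unfolding yflat_apply by (rule flat_support)
  then obtain ys' where "cols ((\<not> c, l) # ys) = (\<not> c) # cols ys'" "f xs ys' \<noteq> 0"
    unfolding ycreate_def by (rule create_support)
  with assms show "cols xs = cols ys" by (auto simp: same_cols_def)
qed

text \<open>This matrix appears when the boundary \<open>bd2\<close> is multiplied by
  \<open>G (\<not> c)\<close>, the inverse of \<open>E c\<close>; see \<open>bd2_exact\<close>. For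
  \<open>cup F\<close> and \<open>cap F\<close> it is \<open>F\<close> in the colour
  \<open>True\<close> and the transpose of the inverse of \<open>F\<close> in the colour
  \<open>False\<close>.\<close>

definition syz :: "(bool \<Rightarrow> complex ^ 'n ^ 'n) \<Rightarrow> (bool \<Rightarrow> complex ^ 'n ^ 'n) \<Rightarrow> bool \<Rightarrow> 'n \<Rightarrow> 'n \<Rightarrow> complex" where
  "syz E G c l m = (\<Sum>k\<in>UNIV. G (\<not> c) $ l $ k * E (\<not> c) $ m $ k)"

definition syz_inv :: "(bool \<Rightarrow> complex ^ 'n ^ 'n) \<Rightarrow> (bool \<Rightarrow> complex ^ 'n ^ 'n) \<Rightarrow> bool \<Rightarrow> 'n \<Rightarrow> 'n \<Rightarrow> complex" where
  "syz_inv E G c m l = (\<Sum>s\<in>UNIV. G c $ s $ m * E c $ s $ l)"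

section \<open>Exactness at the left end of the resolution, in the model\<close>

context cup_cap
begin

abbreviation X where "X \<equiv> xcreate E G"
abbreviation Y where "Y \<equiv> ycreate E G"
abbreviation L where "L \<equiv> lact_gen E G"
abbreviation trl where "trl \<equiv> bitraceless E G"

lemma xstrip_create:
  "xstrip c m (X c i f) = (if m = i then f else 0) -
     (\<Sum>l\<in>UNIV. E c $ m $ l *\<^sub>f X (\<not> c) l (xweight (damping E G c) (xflat G c i f)))"
  by (auto simp: fun_eq_iff sum_fun_apply xstrip_def xcreate_def xweight_def xflat_apply damping_def damp_def[abs_def])

lemma ystrip_create:
  "ystrip c m (Y c i f) = (if m = i then f else 0) -
     (\<Sum>l\<in>UNIV. G c $ m $ l *\<^sub>f Y (\<not> c) l (yweight (damping E G c) (yflat E c i f)))"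
  using cup_cap.xstrip_create[OF dual, of c m i "flp f"]
  by (subst flp_eq_iff[symmetric]) (simp add: flp_ops flp_lin damping_dual[of G E] if_distrib[of flp] cong: if_cong)

lemma sum_yflat_create:
  assumes "ytraceless E f"
  shows "(\<Sum>m\<in>UNIV. \<Sum>l\<in>UNIV. G c $ m $ l *\<^sub>f yflat E c m (Y (\<not> c) l f)) = yweight (wenzl \<delta> c) f"
  using cup_cap.sum_xflat_create[OF dual, of "flp f" c] assms
  by (subst flp_eq_iff[symmetric]) (simp add: flp_ops flp_lin xtraceless_flp loop_value_dual[of G E])

lemma ydamping_wenzl: "yweight (damping E G c) (yweight (wenzl \<delta> c) f) = f"
  using wenzl_nonzero by (simp add: fun_eq_iff yweight_def damping_def)

text \<open>The creations of all letters of one colour are jointly injective: closing them with a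
  cup gives back \<open>f\<close> up to nonzero Wenzl coefficients.\<close>

lemma xcreate_inj:
  assumes "xtraceless G f" "\<And>l. X c l f = 0"
  shows "f = 0"
proof -
  have "xweight (wenzl \<delta> (\<not> c)) f = 0"
    using sum_xflat_create[OF assms(1), of "\<not> c"] assms(2) by (simp add: op_lin)
  then show ?thesis using damping_wenzl[of "\<not> c" f] by (simp add: op_lin)
qed

lemma ycreate_inj:
  assumes "ytraceless E f" "\<And>l. Y c l f = 0"
  shows "f = 0"
proof -
  have "yweight (wenzl \<delta> (\<not> c)) f = 0"
    using sum_yflat_create[OF assms(1), of "\<not> c"] assms(2) by (simp add: op_lin)
  then show ?thesis using ydamping_wenzl[of "\<not> c" f] by (simp add: op_lin)
qed

lemma EG': "(\<Sum>l\<in>UNIV. E (\<not> c) $ k $ l * G c $ l $ m) = (if k = m then 1 else 0)"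
  using EG[of "\<not> c"] by simp

lemma GE': "(\<Sum>l\<in>UNIV. G (\<not> c) $ k $ l * E c $ l $ m) = (if k = m then 1 else 0)"
  using GE[of "\<not> c"] by simp

lemma syz_syz_inv: "(\<Sum>m\<in>UNIV. syz E G c l m * syz_inv E G c m l') = (if l = l' then 1 else 0)"
proof -
  have "(\<Sum>m\<in>UNIV. syz E G c l m * syz_inv E G c m l') =
    (\<Sum>k\<in>UNIV. \<Sum>s\<in>UNIV. G (\<not> c) $ l $ k * E c $ s $ l' * (\<Sum>m\<in>UNIV. G c $ s $ m * E (\<not> c) $ m $ k))"
    unfolding syz_def syz_inv_def sum_product
    by (subst sum.swap, rule sum.cong[OF refl], subst sum.swap) (simp add: sum_distrib_left mult_ac)
  also have "\<dots> = (if l = l' then 1 else 0)"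
    by (simp add: GE GE' if_distrib[of "\<lambda>x. _ * x"] cong: if_cong)
  finally show ?thesis .
qed

lemma syz_inv_syz: "(\<Sum>l\<in>UNIV. syz_inv E G c m l * syz E G c l m') = (if m = m' then 1 else 0)"
proof -
  have "(\<Sum>l\<in>UNIV. syz_inv E G c m l * syz E G c l m') =
    (\<Sum>s\<in>UNIV. \<Sum>k\<in>UNIV. G c $ s $ m * E (\<not> c) $ m' $ k * (\<Sum>l\<in>UNIV. E c $ s $ l * G (\<not> c) $ l $ k))"
    unfolding syz_def syz_inv_def sum_product
    by (subst sum.swap, rule sum.cong[OF refl], subst sum.swap) (simp add: sum_distrib_left mult_ac)
  also have "\<dots> = (if m = m' then 1 else 0)"
    using EG'[of c m' m] by (simp add: EG if_distrib[of "\<lambda>x. _ * x"] mult.commute[of "G c $ _ $ _"] cong: if_cong)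
  finally show ?thesis .
qed

lemma syz_G: "(\<Sum>l\<in>UNIV. syz_inv E G c i l * G c $ k $ l) = (\<Sum>m\<in>UNIV. syz E G (\<not> c) k m * G c $ m $ i)"
  unfolding syz_def syz_inv_def sum_distrib_left sum_distrib_right
  by (subst sum.swap) (simp add: mult_ac)

text \<open>The last map of the resolution. In colour \<open>c\<close> the entry
  \<open>\<gamma> (\<not> c)\<close> is multiplied by a generator and \<open>\<gamma> c\<close> only
  by a scalar; for entries of bounded degree the part one above the bound therefore depends on
  \<open>\<gamma> (\<not> c)\<close> alone.\<close>

definition syzygy :: "(bool \<Rightarrow> 'n bifun) \<Rightarrow> bool \<Rightarrow> 'n \<Rightarrow> 'n \<Rightarrow> 'n bifun" where
  "syzygy \<gamma> c m i = (\<Sum>l\<in>UNIV. syz_inv E G (\<not> c) m l *\<^sub>f (\<Sum>r\<in>UNIV. G (\<not> c) $ i $ r *\<^sub>f L c l r (\<gamma> (\<not> c)))) -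
     G c $ m $ i *\<^sub>f \<gamma> c"

lemma trl_syzygy: "(\<And>c. trl (\<gamma> c)) \<Longrightarrow> trl (syzygy \<gamma> c m i)"
  unfolding syzygy_def
  by (intro bitraceless_diff bitraceless_scale bitraceless_lincomb bitraceless_lact_gen)

text \<open>The composite of the last two maps is zero. In one sum two generators meet and
  \<open>y_relation\<close> reduces them to a scalar; in the other \<open>syz\<close> cancels
  \<open>syz_inv\<close> and leaves a single generator. The terms with one generator cancel at once,
  the scalar terms by \<open>syz_G\<close>.\<close>

lemma syzygy_equation:
  assumes \<gamma>: "\<And>c. trl (\<gamma> c)"
  shows "(\<Sum>j\<in>UNIV. L (\<not> c) l j (syzygy \<gamma> c i j)) + (\<Sum>m\<in>UNIV. syz E G c l m *\<^sub>f syzygy \<gamma> (\<not> c) m i) = 0"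
proof -
  have 1: "(\<Sum>j\<in>UNIV. L (\<not> c) l j (\<Sum>l'\<in>UNIV. syz_inv E G (\<not> c) i l' *\<^sub>f (\<Sum>r\<in>UNIV. G (\<not> c) $ j $ r *\<^sub>f L c l' r (\<gamma> (\<not> c))))) =
    (\<Sum>l'\<in>UNIV. syz_inv E G (\<not> c) i l' *\<^sub>f (G (\<not> c) $ l $ l' *\<^sub>f \<gamma> (\<not> c)))"
    using y_relation[OF \<gamma>, of "\<not> c" l _ "\<not> c"]
    unfolding op_lin by (subst sum.swap) (simp add: bifun.scale_sum_right[symmetric])
  have 2: "(\<Sum>m\<in>UNIV. syz E G c l m *\<^sub>f (\<Sum>l'\<in>UNIV. syz_inv E G c m l' *\<^sub>f (\<Sum>r\<in>UNIV. G c $ i $ r *\<^sub>f L (\<not> c) l' r (\<gamma> c)))) =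
    (\<Sum>r\<in>UNIV. G c $ i $ r *\<^sub>f L (\<not> c) l r (\<gamma> c))"
    by (rule contract) (auto simp: syz_syz_inv)
  have "(\<Sum>l'\<in>UNIV. syz_inv E G (\<not> c) i l' *\<^sub>f (G (\<not> c) $ l $ l' *\<^sub>f \<gamma> (\<not> c))) =
    (\<Sum>l'\<in>UNIV. syz_inv E G (\<not> c) i l' * G (\<not> c) $ l $ l') *\<^sub>f \<gamma> (\<not> c)"
    by (simp add: bifun.scale_sum_left)
  also have "\<dots> = (\<Sum>m\<in>UNIV. syz E G c l m *\<^sub>f (G (\<not> c) $ m $ i *\<^sub>f \<gamma> (\<not> c)))"
    unfolding syz_G by (simp add: bifun.scale_sum_left)
  finally have 3: "(\<Sum>l'\<in>UNIV. syz_inv E G (\<not> c) i l' *\<^sub>f (G (\<not> c) $ l $ l' *\<^sub>f \<gamma> (\<not> c))) =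
    (\<Sum>m\<in>UNIV. syz E G c l m *\<^sub>f (G (\<not> c) $ m $ i *\<^sub>f \<gamma> (\<not> c)))" .
  have 4: "(\<Sum>j\<in>UNIV. L (\<not> c) l j (syzygy \<gamma> c i j)) =
    (\<Sum>m\<in>UNIV. syz E G c l m *\<^sub>f (G (\<not> c) $ m $ i *\<^sub>f \<gamma> (\<not> c))) - (\<Sum>r\<in>UNIV. G c $ i $ r *\<^sub>f L (\<not> c) l r (\<gamma> c))"
    unfolding syzygy_def linopD(5)[OF linop_lact_gen] sum_subtractf 1 3 by (simp add: op_lin)
  have 5: "(\<Sum>m\<in>UNIV. syz E G c l m *\<^sub>f syzygy \<gamma> (\<not> c) m i) =
    (\<Sum>r\<in>UNIV. G c $ i $ r *\<^sub>f L (\<not> c) l r (\<gamma> c)) - (\<Sum>m\<in>UNIV. syz E G c l m *\<^sub>f (G (\<not> c) $ m $ i *\<^sub>f \<gamma> (\<not> c)))"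
    using 2 unfolding syzygy_def by (simp add: bifun.scale_right_diff_distrib sum_subtractf)
  show ?thesis unfolding 4 5 by simp
qed

lemma trl_D:
  assumes "trl f" shows "xtraceless G f" "ytraceless E f" "same_cols f"
  using assms by (simp_all add: bitraceless_def)

text \<open>The top degree part of a cycle is a creation from both sides, hence the top degree part of
  a syzygy: this is read off by contracting with the trace identity \<open>sum_yflat_create\<close>.\<close>

lemma exact_step:
  assumes trl: "\<And>c i j. trl (a c i j)"
    and deg: "\<And>c i j. deg_less (Suc k) (a c i j)"
    and eq: "\<And>c i l. (\<Sum>j\<in>UNIV. L (\<not> c) l j (a c i j)) + (\<Sum>m\<in>UNIV. syz E G c l m *\<^sub>f a (\<not> c) m i) = 0"
  obtains \<gamma> where "\<And>c. trl (\<gamma> c)" "\<And>c. deg_less k (\<gamma> c)"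
    "\<And>c m i. deg_less k (a c m i - syzygy \<gamma> c m i)"
proof -
  define top where "top c i j = part k (a c i j)" for c i j
  \<comment> \<open>The part of degree \<open>k - 1\<close>; the form with \<open>Suc\<close> makes
    it zero for \<open>k = 0\<close>, where truncated subtraction would select degree 0.\<close>
  define prev where "prev c i j = xweight (\<lambda>cs. if Suc (length cs) = k then 1 else 0) (a c i j)" for c i j
  have trl_top: "trl (top c i j)" for c i j unfolding top_def by (rule bitraceless_weight[OF trl])
  have trl_prev: "trl (prev c i j)" for c i j unfolding prev_def by (rule bitraceless_weight[OF trl])
  have deg_prev: "xweight (\<lambda>cs. if Suc (length cs) = k then 1 else 0) (prev c i j) = prev c i j" for c i j
    unfolding prev_def by (auto simp: fun_eq_iff xweight_def)
  have LSuc: "part (Suc k) (L c l r (a c' i j)) = X c l (Y c r (top c' i j))" for c l r c' i j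
  proof -
    have "xweight (\<lambda>cs. if cs = [] then 0 else if length (tl cs) = Suc k then 1 else 0) (a c' i j) = 0"
      by (rule part_deg_less[OF deg], rule shift_weight_0) simp
    then show ?thesis unfolding xweight_lact_gen top_def by (simp add: op_lin)
  qed
  have Lk: "part k (L c l r (a c' i j)) = X c l (Y c r (prev c' i j))" for c l r c' i j
  proof -
    have "xweight (\<lambda>cs. if cs = [] then 0 else if length (tl cs) = k then 1 else 0) (a c' i j) = 0"
      by (rule part_deg_less[OF deg], rule shift_weight_0) simp
    then show ?thesis unfolding xweight_lact_gen prev_def by (simp add: op_lin)
  qed
  \<comment> \<open>The part of degree \<open>Suc k\<close> of the equation is a creation of
    \<open>P\<close> in the first word, as the second sum does not reach this degree.\<close>
  define P where "P c i = (\<Sum>j\<in>UNIV. Y (\<not> c) j (top c i j))" for c i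
  have P: "P c i = 0" for c i
  proof (rule xcreate_inj)
    have "part (Suc k) (a c' i j) = 0" for c' i j by (rule part_deg_less[OF deg]) auto
    then show "X (\<not> c) l (P c i) = 0" for l
      using arg_cong[OF eq[where c = c and i = i and l = l], of "part (Suc k)"] by (simp add: op_lin LSuc P_def)
    show "xtraceless G (P c i)"
      using xtraceless_lincomb[of UNIV G "\<lambda>j. Y (\<not> c) j (top c i j)" "\<lambda>_. 1"]
      by (simp add: P_def xtraceless_y_ops trl_D[OF trl_top])
  qed
  \<comment> \<open>Stripping the first letter off \<open>P c i = 0\<close> expresses the top part
    by creations in the second word; \<open>\<omega>\<close> is what they are applied to.\<close>
  define \<omega> where "\<omega> c i = yweight (damping E G (\<not> c)) (\<Sum>j\<in>UNIV. yflat E (\<not> c) j (top c i j))" for c i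
  have top: "top c i m = (\<Sum>r\<in>UNIV. G (\<not> c) $ m $ r *\<^sub>f Y c r (\<omega> c i))" for c i m
  proof -
    have "0 = ystrip (\<not> c) m (P c i)" by (simp add: P op_lin)
    also have "\<dots> = top c i m - (\<Sum>j\<in>UNIV. \<Sum>r\<in>UNIV. G (\<not> c) $ m $ r *\<^sub>f Y c r (yweight (damping E G (\<not> c)) (yflat E (\<not> c) j (top c i j))))"
      unfolding P_def op_lin ystrip_create by (simp add: sum_subtractf)
    also have "(\<Sum>j\<in>UNIV. \<Sum>r\<in>UNIV. G (\<not> c) $ m $ r *\<^sub>f Y c r (yweight (damping E G (\<not> c)) (yflat E (\<not> c) j (top c i j)))) =
        (\<Sum>r\<in>UNIV. G (\<not> c) $ m $ r *\<^sub>f Y c r (\<omega> c i))"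
      unfolding \<omega>_def op_lin bifun.scale_sum_right by (rule sum.swap)
    finally show ?thesis unfolding eq_iff_diff_eq_0[of "top c i m"] by (rule sym)
  qed
  define \<zeta> where "\<zeta> c l = (\<Sum>m\<in>UNIV. syz E G c l m *\<^sub>f \<omega> (\<not> c) m)" for c l
  define \<eta> where "\<eta> c r = (\<Sum>i\<in>UNIV. E (\<not> c) $ r $ i *\<^sub>f (\<Sum>j\<in>UNIV. Y (\<not> c) j (prev c i j)))" for c r
  have \<eta>\<zeta>: "X (\<not> c) l (\<eta> c r) + Y (\<not> c) r (\<zeta> c l) = 0" for c l r
  proof -
    have "(\<Sum>j\<in>UNIV. X (\<not> c) l (Y (\<not> c) j (prev c i j))) + (\<Sum>m\<in>UNIV. syz E G c l m *\<^sub>f top (\<not> c) m i) = 0" for i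
      using arg_cong[OF eq[where c = c and i = i and l = l], of "part k"] by (simp add: op_lin Lk top_def)
    moreover have "(\<Sum>m\<in>UNIV. syz E G c l m *\<^sub>f top (\<not> c) m i) = (\<Sum>r\<in>UNIV. G c $ i $ r *\<^sub>f Y (\<not> c) r (\<zeta> c l))" for i
      unfolding top \<zeta>_def op_lin bifun.scale_sum_right by (subst sum.swap) (simp add: mult.commute)
    ultimately have *: "(\<Sum>j\<in>UNIV. X (\<not> c) l (Y (\<not> c) j (prev c i j))) + (\<Sum>r\<in>UNIV. G c $ i $ r *\<^sub>f Y (\<not> c) r (\<zeta> c l)) = 0" for i
      by simp
    have "(\<Sum>i\<in>UNIV. E (\<not> c) $ r $ i *\<^sub>f ((\<Sum>j\<in>UNIV. X (\<not> c) l (Y (\<not> c) j (prev c i j))) + (\<Sum>r\<in>UNIV. G c $ i $ r *\<^sub>f Y (\<not> c) r (\<zeta> c l)))) =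
      X (\<not> c) l (\<eta> c r) + (\<Sum>i\<in>UNIV. E (\<not> c) $ r $ i *\<^sub>f (\<Sum>r\<in>UNIV. G c $ i $ r *\<^sub>f Y (\<not> c) r (\<zeta> c l)))"
      by (simp add: \<eta>_def op_lin bifun.scale_right_distrib sum.distrib)
    also have "(\<Sum>i\<in>UNIV. E (\<not> c) $ r $ i *\<^sub>f (\<Sum>r\<in>UNIV. G c $ i $ r *\<^sub>f Y (\<not> c) r (\<zeta> c l))) = Y (\<not> c) r (\<zeta> c l)"
      by (rule contract) (auto simp: EG')
    finally show ?thesis unfolding * bifun.scale_zero_right sum.neutral_const by (rule sym)
  qed
  \<comment> \<open>Contraction of \<open>\<eta>\<zeta>\<close> in the second word turns its second
    term into a Wenzl multiple of \<open>\<zeta> c l\<close> and keeps the creation in the first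
    word. Division by the coefficient exhibits \<open>\<zeta> c l\<close> as a creation of this
    function.\<close>
  define \<gamma> where "\<gamma> c = - yweight (damping E G c) (\<Sum>m\<in>UNIV. \<Sum>r\<in>UNIV. G c $ m $ r *\<^sub>f yflat E c m (\<eta> c r))" for c
  have \<zeta>: "\<zeta> c l = X (\<not> c) l (\<gamma> c)" for c l
  proof -
    have y: "ytraceless E (\<zeta> c l)"
    proof -
      have "ytraceless E (\<omega> c i)" for c i
        unfolding \<omega>_def using ytraceless_lincomb[of UNIV E "\<lambda>j. yflat E (\<not> c) j (top c i j)" "\<lambda>_. 1"]
        by (auto intro!: ytraceless_ops simp: ytraceless_ops trl_D[OF trl_top])
      then show ?thesis unfolding \<zeta>_def by (intro ytraceless_lincomb)
    qed
    have "Y (\<not> c) r (\<zeta> c l) = - X (\<not> c) l (\<eta> c r)" for r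
      using \<eta>\<zeta>[of c l r] by (metis minus_unique)
    then have "yweight (wenzl \<delta> c) (\<zeta> c l) = - X (\<not> c) l (\<Sum>m\<in>UNIV. \<Sum>r\<in>UNIV. G c $ m $ r *\<^sub>f yflat E c m (\<eta> c r))"
      using sum_yflat_create[OF y, of c] by (simp add: op_lin xy_commute sum_negf)
    then have "yweight (damping E G c) (yweight (wenzl \<delta> c) (\<zeta> c l)) = X (\<not> c) l (\<gamma> c)"
      by (simp add: \<gamma>_def weight_lin(10) linopD(4)[OF linop_create(1)] xy_commute(4))
    then show ?thesis by (simp add: ydamping_wenzl)
  qed
  have top_eq: "top c m i = (\<Sum>l\<in>UNIV. syz_inv E G (\<not> c) m l *\<^sub>f (\<Sum>r\<in>UNIV. G (\<not> c) $ i $ r *\<^sub>f X c l (Y c r (\<gamma> (\<not> c)))))" for c m i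
  proof -
    have "(\<Sum>l\<in>UNIV. syz_inv E G (\<not> c) m l *\<^sub>f \<zeta> (\<not> c) l) = \<omega> c m"
      unfolding \<zeta>_def not_not by (rule contract) (auto simp: syz_inv_syz)
    note \<omega> = this[symmetric]
    show ?thesis
      unfolding top \<omega> \<zeta> not_not op_lin xy_commute bifun.scale_sum_right
      by (subst sum.swap) (simp add: mult.commute)
  qed
  have trl_\<gamma>: "trl (\<gamma> c)" for c
  proof -
    have x: "xtraceless G (\<eta> c r)" for r
      unfolding \<eta>_def by (intro xtraceless_lincomb xtraceless_sum xtraceless_y_ops trl_D[OF trl_prev])
    have y: "ytraceless E (\<eta> c r)" for r
      unfolding \<eta>_def by (intro ytraceless_lincomb ytraceless_sum ytraceless_create trl_D[OF trl_prev])
    have sc: "same_cols (yflat E c m (\<eta> c r))" for m r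
      unfolding \<eta>_def op_lin by (intro same_cols_lincomb same_cols_sum same_cols_yflat_create trl_D[OF trl_prev])
    have "trl (yweight (damping E G c) (yflat E c m (\<eta> c r)))" for m r
    proof -
      have "same_cols (yweight (damping E G c) (yflat E c m (\<eta> c r)))"
        using same_cols_weight[OF sc] weight_same_cols[OF sc] by metis
      then show ?thesis by (simp add: bitraceless_def xtraceless_y_ops ytraceless_ops x y)
    qed
    then have "trl (- (\<Sum>m\<in>UNIV. \<Sum>r\<in>UNIV. G c $ m $ r *\<^sub>f yweight (damping E G c) (yflat E c m (\<eta> c r))))"
      by (intro bitraceless_uminus bitraceless_sum bitraceless_scale)
    then show ?thesis by (simp add: \<gamma>_def op_lin)
  qed
  \<comment> \<open>One creation and one contraction, both in the second word, do not change the
    length of the first word, so the degree is that of \<open>prev\<close>.\<close>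
  have \<gamma>_weight: "xweight (\<lambda>cs. if Suc (length cs) = k then 1 else 0) (\<gamma> c) = \<gamma> c" for c
    unfolding \<gamma>_def \<eta>_def
    by (simp only: weight_lin create_lin flat_lin xy_commute(13,15,16) deg_prev)
  have deg_\<gamma>: "deg_less k (\<gamma> c)" for c
    unfolding deg_less_def
  proof (intro allI impI)
    fix xs ys assume "\<gamma> c xs ys \<noteq> 0"
    then have "xweight (\<lambda>cs. if Suc (length cs) = k then 1 else 0) (\<gamma> c) xs ys \<noteq> 0" by (simp add: \<gamma>_weight)
    then show "length xs < k" by (auto simp: xweight_def split: if_splits)
  qed
  have "deg_less k (a c m i - syzygy \<gamma> c m i)" for c m i
  proof (rule deg_less_Suc)
    have "deg_less (Suc k) (syzygy \<gamma> c m i)"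
      using deg_less_mono[OF deg_\<gamma>, of "Suc k"]
      unfolding syzygy_def diff_conv_add_uminus
      by (intro deg_less_add deg_less_uminus deg_less_scale deg_less_lincomb deg_less_lact_gen deg_\<gamma>) auto
    then show "deg_less (Suc k) (a c m i - syzygy \<gamma> c m i)"
      unfolding diff_conv_add_uminus by (intro deg_less_add deg deg_less_uminus)
    have p: "part k (L c l r (\<gamma> c')) = X c l (Y c r (\<gamma> c'))" for c l r c'
    proof -
      have 1: "xweight (\<lambda>cs. if length (c # cs) = k then 1 else 0) (\<gamma> c') = \<gamma> c'"
        using \<gamma>_weight[of c'] by simp
      have 2: "xweight (\<lambda>cs. if cs = [] then 0 else if length (tl cs) = k then 1 else 0) (\<gamma> c') = 0"
        by (rule part_deg_less[OF deg_\<gamma>], rule shift_weight_0) simp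
      show ?thesis unfolding xweight_lact_gen 1 2 by (simp add: op_lin)
    qed
    have "part k (\<gamma> c) = 0" by (rule part_deg_less[OF deg_\<gamma>]) auto
    then have "part k (syzygy \<gamma> c m i) = top c m i"
      unfolding syzygy_def top_eq by (simp add: weight_lin p)
    then show "part k (a c m i - syzygy \<gamma> c m i) = 0" by (simp add: weight_lin top_def)
  qed
  then show thesis by (rule that[OF trl_\<gamma> deg_\<gamma>])
qed

lemma syzygy_add: "syzygy (\<lambda>c. \<gamma> c + \<gamma>' c) c m i = syzygy \<gamma> c m i + syzygy \<gamma>' c m i"
  by (simp add: syzygy_def lact_gen_lin bifun.scale_right_distrib sum.distrib algebra_simps)

text \<open>Induction on a bound for the degree: subtracting the syzygy from
  \<open>exact_step\<close> preserves the equation by \<open>syzygy_equation\<close> and lowers the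
  bound. The bound on the preimage is kept because it is needed to find an element of the algebra
  that represents it.\<close>

lemma exact:
  assumes "\<And>c i j. trl (a c i j)" and "\<And>c i j. deg_less k (a c i j)"
    and "\<And>c i l. (\<Sum>j\<in>UNIV. L (\<not> c) l j (a c i j)) + (\<Sum>m\<in>UNIV. syz E G c l m *\<^sub>f a (\<not> c) m i) = 0"
  shows "\<exists>\<gamma>. (\<forall>c. trl (\<gamma> c) \<and> deg_less k (\<gamma> c)) \<and> (\<forall>c m i. a c m i = syzygy \<gamma> c m i)"
  using assms
proof (induction k arbitrary: a)
  case 0
  have "a c i j = 0" for c i j using 0(2) by (auto simp: deg_less_def fun_eq_iff)
  moreover have "trl 0" using bitraceless_scale[of E G "a True undefined undefined" 0] 0(1) by simp
  moreover have "syzygy (\<lambda>_. 0) c m i = 0" for c m i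
    unfolding syzygy_def linopD(3)[OF linop_lact_gen] bifun.scale_zero_right sum.neutral_const diff_self ..
  moreover have "deg_less 0 0" by (simp only: deg_less_def zero_fun_apply) simp
  ultimately show ?case by (intro exI[of _ "\<lambda>_. 0"] conjI allI) (simp_all only:)
next
  case (Suc k)
  obtain \<gamma> where \<gamma>: "\<And>c. trl (\<gamma> c)" "\<And>c. deg_less k (\<gamma> c)" "\<And>c m i. deg_less k (a c m i - syzygy \<gamma> c m i)"
    using exact_step[OF Suc.prems] by metis
  have "(\<Sum>j\<in>UNIV. L (\<not> c) l j (a c i j - syzygy \<gamma> c i j)) +
      (\<Sum>m\<in>UNIV. syz E G c l m *\<^sub>f (a (\<not> c) m i - syzygy \<gamma> (\<not> c) m i)) = 0" for c i l
  proof -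
    have "(\<Sum>j\<in>UNIV. L (\<not> c) l j (a c i j - syzygy \<gamma> c i j)) +
        (\<Sum>m\<in>UNIV. syz E G c l m *\<^sub>f (a (\<not> c) m i - syzygy \<gamma> (\<not> c) m i)) =
      ((\<Sum>j\<in>UNIV. L (\<not> c) l j (a c i j)) + (\<Sum>m\<in>UNIV. syz E G c l m *\<^sub>f a (\<not> c) m i)) -
      ((\<Sum>j\<in>UNIV. L (\<not> c) l j (syzygy \<gamma> c i j)) + (\<Sum>m\<in>UNIV. syz E G c l m *\<^sub>f syzygy \<gamma> (\<not> c) m i))"
      by (simp add: lact_gen_lin bifun.scale_right_diff_distrib sum_subtractf)
    then show ?thesis unfolding Suc.prems(3) syzygy_equation[OF \<gamma>(1)] by simp
  qed
  from Suc.IH[OF bitraceless_diff[OF Suc.prems(1) trl_syzygy[OF \<gamma>(1)]] \<gamma>(3) this]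
  obtain \<gamma>' where \<gamma>': "\<And>c. trl (\<gamma>' c)" "\<And>c. deg_less k (\<gamma>' c)" "\<And>c m i. a c m i - syzygy \<gamma> c m i = syzygy \<gamma>' c m i"
    by blast
  show ?case
  proof (intro exI[of _ "\<lambda>c. \<gamma> c + \<gamma>' c"] conjI allI)
    show "trl (\<gamma> c + \<gamma>' c)" for c by (intro bitraceless_add \<gamma>(1) \<gamma>'(1))
    show "deg_less (Suc k) (\<gamma> c + \<gamma>' c)" for c
      by (rule deg_less_mono[OF deg_less_add[OF \<gamma>(2) \<gamma>'(2)]]) simp
    show "a c m i = syzygy (\<lambda>c. \<gamma> c + \<gamma>' c) c m i" for c m i
      unfolding syzygy_add \<gamma>'(3)[symmetric] by (simp only: add_diff_eq add_diff_cancel_left')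
  qed
qed

text \<open>Only the term with a generator contributes to the degree above the top. The matrices
  \<open>syz_inv\<close> and \<open>G\<close> are invertible and creation is injective in either
  word, so the leading part of \<open>\<gamma> (\<not> c)\<close> is zero.\<close>

lemma syzygy_inj:
  assumes "\<And>c. trl (\<gamma> c)" and "\<And>c. deg_less k (\<gamma> c)" and "\<And>c m i. syzygy \<gamma> c m i = 0"
  shows "\<gamma> c = 0"
  using assms(2)
proof (induction k)
  case 0
  then show ?case by (auto simp: deg_less_def fun_eq_iff)
next
  case (Suc k)
  have "part k (\<gamma> (\<not> c)) = 0" for c
  proof -
    have p: "part (Suc k) (L c l r (\<gamma> c')) = X c l (Y c r (part k (\<gamma> c')))" for l r c'
    proof -
      have 2: "xweight (\<lambda>cs. if cs = [] then 0 else if length (tl cs) = Suc k then 1 else 0) (\<gamma> c') = 0"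
        by (rule part_deg_less[OF Suc.prems], rule shift_weight_0) simp
      show ?thesis unfolding xweight_lact_gen 2 by (simp add: op_lin)
    qed
    have "part (Suc k) (\<gamma> c) = 0" by (rule part_deg_less[OF Suc.prems]) auto
    then have *: "(\<Sum>l\<in>UNIV. syz_inv E G (\<not> c) m l *\<^sub>f (\<Sum>r\<in>UNIV. G (\<not> c) $ i $ r *\<^sub>f X c l (Y c r (part k (\<gamma> (\<not> c)))))) = 0" for m i
      using arg_cong[OF assms(3)[of c m i], of "part (Suc k)"] by (simp add: syzygy_def weight_lin p)
    have "(\<Sum>r\<in>UNIV. G (\<not> c) $ i $ r *\<^sub>f X c l (Y c r (part k (\<gamma> (\<not> c))))) = 0" for l i
    proof -
      have "(\<Sum>m\<in>UNIV. syz E G (\<not> c) l m *\<^sub>f (\<Sum>l\<in>UNIV. syz_inv E G (\<not> c) m l *\<^sub>f (\<Sum>r\<in>UNIV. G (\<not> c) $ i $ r *\<^sub>f X c l (Y c r (part k (\<gamma> (\<not> c))))))) =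
        (\<Sum>r\<in>UNIV. G (\<not> c) $ i $ r *\<^sub>f X c l (Y c r (part k (\<gamma> (\<not> c)))))"
        by (rule contract) (auto simp: syz_syz_inv)
      then show ?thesis unfolding * bifun.scale_zero_right sum.neutral_const by (rule sym)
    qed
    note ** = this
    have "X c l (Y c r (part k (\<gamma> (\<not> c)))) = 0" for l r
    proof -
      have "(\<Sum>i\<in>UNIV. E c $ r $ i *\<^sub>f (\<Sum>r\<in>UNIV. G (\<not> c) $ i $ r *\<^sub>f X c l (Y c r (part k (\<gamma> (\<not> c)))))) =
        X c l (Y c r (part k (\<gamma> (\<not> c))))"
        by (rule contract) (auto simp: EG)
      then show ?thesis unfolding ** bifun.scale_zero_right sum.neutral_const by (rule sym)
    qed
    note *** = this
    have t: "trl (part k (\<gamma> (\<not> c)))" by (rule bitraceless_weight[OF assms(1)])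
    show ?thesis
    proof (rule ycreate_inj[of _ c])
      show "Y c r (part k (\<gamma> (\<not> c))) = 0" for r
        by (rule xcreate_inj[OF xtraceless_y_ops(1)[OF trl_D(1)[OF t]] ***])
    qed (rule trl_D(2)[OF t])
  qed
  note * = this
  have "part k (\<gamma> c) = 0" for c using *[of "\<not> c"] unfolding not_not .
  then have "deg_less k (\<gamma> c)" for c by (rule deg_less_Suc[OF Suc.prems])
  then show ?case by (rule Suc.IH)
qed

end

declare scale_fun_apply [simp del] plus_fun_apply [simp del] zero_fun_apply [simp del]

section \<open>The algebra acts on traceless biwords\<close>

text \<open>If some positive power of \<open>q\<close> is 1, then the least such exponent is its
  order, and genericity leaves only the orders 1 and 2.\<close>

lemma generic_power:
  assumes "generic F" and q: "q\<^sup>2 - csqrt (trace F * trace (matrix_inv F)) * q + 1 = 0"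
    and "q ^ N = 1" "N > 0"
  shows "q\<^sup>2 = 1"
proof (rule ccontr)
  assume ne: "q\<^sup>2 \<noteq> 1"
  define m where "m = (LEAST m. m > 0 \<and> q ^ m = 1)"
  have m: "m > 0" "q ^ m = 1" "\<And>k. 0 < k \<Longrightarrow> k < m \<Longrightarrow> q ^ k \<noteq> 1"
    using LeastI[of "\<lambda>m. m > 0 \<and> q ^ m = 1" N] assms(3,4) not_less_Least[of _ "\<lambda>m. m > 0 \<and> q ^ m = 1"]
    by (auto simp: m_def)
  have "m \<noteq> 1" "m \<noteq> 2" using m(2) ne by (auto simp: power2_eq_square)
  then have "m \<ge> 3" using m(1) by linarith
  then show False using assms(1) q m unfolding generic_def root_of_unity_of_order_def by blast
qed

text \<open>Up to the factor \<open>\<delta> c / s\<close> the coefficients are the quotients \<open>[k + 1] / [k]\<close> of \<open>q\<close>-integers; in the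
  proof, \<open>h k\<close> is \<open>[k]\<close> up to a power of \<open>q\<close>.\<close>

lemma wenzl_nonzero:
  assumes "generic F" and \<delta>: "\<delta> True * \<delta> False = trace F * trace (matrix_inv F)"
  shows "wenzl \<delta> c cs \<noteq> 0"
proof -
  define s where "s = csqrt (trace F * trace (matrix_inv F))"
  define q where "q = (s + csqrt (s\<^sup>2 - 4)) / 2"
  have s2: "s\<^sup>2 = \<delta> True * \<delta> False" by (simp add: s_def \<delta>)
  have q: "q\<^sup>2 - s * q + 1 = 0"
  proof -
    define r where "r = csqrt (s\<^sup>2 - 4)"
    have r: "r\<^sup>2 = s\<^sup>2 - 4" by (simp add: r_def)
    have "4 * (q\<^sup>2 - s * q + 1) = r\<^sup>2 - (s\<^sup>2 - 4)"
      unfolding q_def r_def[symmetric] by (simp add: field_simps power2_eq_square)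
    then have "4 * (q\<^sup>2 - s * q + 1) = 0" unfolding r by (simp only: diff_self)
    then show ?thesis by (simp only: mult_eq_0_iff) simp
  qed
  have q0: "q \<noteq> 0" using q by auto
  have root: "q\<^sup>2 = 1" if "q ^ N = 1" "N > 0" for N
    using generic_power[OF assms(1) q[unfolded s_def] that] .
  \<comment> \<open>For \<open>s = 0\<close> the solutions would be primitive fourth roots of
    unity.\<close>
  have s0: "s \<noteq> 0"
  proof
    assume "s = 0"
    with q have "q\<^sup>2 = - 1" by (simp add: eq_neg_iff_add_eq_0)
    moreover then have "q ^ 4 = 1" using power_mult[of q 2 2] by simp
    ultimately show False using root[of 4] by simp
  qed
  define h where "h k = (\<Sum>i<k. (q\<^sup>2) ^ i)" for k
  have h0: "h k \<noteq> 0" if "k > 0" for k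
  proof (cases "q\<^sup>2 = 1")
    case True
    then show ?thesis using that by (simp add: h_def)
  next
    case False
    have "(q\<^sup>2) ^ k \<noteq> 1" using root[of "2 * k"] False that by (auto simp: power_mult)
    then show ?thesis using geometric_sum[OF False, of k] False by (simp add: h_def)
  qed
  have h2: "h (Suc (Suc k)) = (1 + q\<^sup>2) * h (Suc k) - q\<^sup>2 * h k" for k
    by (simp add: h_def algebra_simps)
  have sq: "1 + q\<^sup>2 = s * q" using q by (simp add: algebra_simps)
  have \<delta>0: "\<delta> c \<noteq> 0" for c using s0 s2 by (cases c) auto
  have base: "\<delta> c = \<delta> c / s * (h (Suc 1) / (q * h 1))" for c
  proof -
    have "h (Suc 1) = s * q" "h 1 = 1" using sq by (simp_all add: h_def)
    then show ?thesis using s0 q0 by simp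
  qed
  \<comment> \<open>Here \<open>k - 1\<close> is the length of the longest initial segment of
    \<open>cs\<close> that alternates as \<open>c\<close>, \<open>\<not> c\<close>, \<open>c\<close>
    and so on.\<close>
  have "\<exists>k>0. wenzl \<delta> c cs = \<delta> c / s * (h (Suc k) / (q * h k))"
  proof (induction cs arbitrary: c)
    case Nil
    show ?case using base[of c] by (intro exI[of _ 1]) simp
  next
    case (Cons c' cs)
    show ?case
    proof (cases "c' = c")
      case True
      obtain k where k: "k > 0" "wenzl \<delta> (\<not> c) cs = \<delta> (\<not> c) / s * (h (Suc k) / (q * h k))"
        using Cons.IH by blast
      have \<delta>\<delta>: "\<delta> c * \<delta> (\<not> c) = s\<^sup>2" using s2 by (cases c) auto
      have n: "h k \<noteq> 0" "h (Suc k) \<noteq> 0" "\<delta> (\<not> c) \<noteq> 0" using h0 k(1) \<delta>0 by auto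
      have "wenzl \<delta> c (c' # cs) = \<delta> c - s * (q * h k) / (\<delta> (\<not> c) * h (Suc k))"
        using True k(2) n by (simp add: field_simps)
      also have "s * (q * h k) / (\<delta> (\<not> c) * h (Suc k)) = \<delta> c / s * (q * h k / h (Suc k))"
        using \<delta>\<delta> n s0 by (simp add: field_simps power2_eq_square)
      also have "\<delta> c - \<delta> c / s * (q * h k / h (Suc k)) = \<delta> c / s * ((s * q * h (Suc k) - q\<^sup>2 * h k) / (q * h (Suc k)))"
        using n s0 q0 by (simp add: field_simps power2_eq_square)
      also have "\<dots> = \<delta> c / s * (h (Suc (Suc k)) / (q * h (Suc k)))"
        unfolding h2 sq ..
      finally show ?thesis by blast
    next
      case False
      then show ?thesis using base[of c] by (intro exI[of _ 1]) simp
    qed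
  qed
  then show ?thesis using h0 \<delta>0 s0 q0 by auto
qed

text \<open>With these forms the relations \<open>v^t u = 1\<close> and
  \<open>u^t F^{-1} v = F^{-1}\<close> are \<open>xrel\<close> for the colours \<open>False\<close>
  and \<open>True\<close>, and \<open>u v^t = 1\<close> and \<open>v F u^t = F\<close> are
  \<open>yrel\<close> for \<open>True\<close> and \<open>False\<close>.\<close>

definition cup :: "complex ^ 'n ^ 'n \<Rightarrow> bool \<Rightarrow> complex ^ 'n ^ 'n" where
  "cup F c = (if c then matrix_inv F else mat 1)"

definition cap :: "complex ^ 'n ^ 'n \<Rightarrow> bool \<Rightarrow> complex ^ 'n ^ 'n" where
  "cap F c = (if c then mat 1 else F)"

lemma matrix_inv_mult:
  fixes F :: "complex ^ 'n ^ 'n"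
  assumes "invertible F"
  shows "F ** matrix_inv F = mat 1" "matrix_inv F ** F = mat 1"
  using someI_ex[OF assms[unfolded invertible_def]] by (auto simp: matrix_inv_def)

lemma cup_cap:
  fixes F :: "complex ^ 'n ^ 'n"
  assumes "invertible F" "generic F"
  shows "cup_cap (cup F) (cap F)"
proof
  have *: "(\<Sum>l\<in>UNIV. A $ k $ l * B $ l $ m) = (if k = m then 1 else 0)" if "A ** B = mat 1" for A B :: "complex ^ 'n ^ 'n" and k m
    using arg_cong[OF that, of "\<lambda>X. X $ k $ m"] by (simp add: matrix_matrix_mult_def mat_def)
  have "cup F c ** cap F (\<not> c) = mat 1" "cap F c ** cup F (\<not> c) = mat 1" for c
    using matrix_inv_mult[OF assms(1)] by (cases c; simp add: cup_def cap_def)+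
  then show "(\<Sum>l\<in>UNIV. cup F c $ k $ l * cap F (\<not> c) $ l $ m) = (if k = m then 1 else 0)"
    "(\<Sum>l\<in>UNIV. cap F c $ k $ l * cup F (\<not> c) $ l $ m) = (if k = m then 1 else 0)" for c k m
    by (simp_all add: *)
  have "loop_value (cup F) (cap F) True = trace (matrix_inv F)" "loop_value (cup F) (cap F) False = trace F"
    by (simp_all add: loop_value_def cup_def cap_def trace_def mat_def if_distrib[of "\<lambda>x. _ * x"] if_distrib[of "\<lambda>x. x * _"] cong: if_cong)
  then show "wenzl (loop_value (cup F) (cap F)) c cs \<noteq> 0" for c cs
    by (intro wenzl_nonzero[OF assms(2)]) simp
qed

section \<open>Words, scalars and the action of the free algebra\<close>

definition letter :: "bool \<Rightarrow> 'n \<Rightarrow> 'n \<Rightarrow> 'n generator" where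
  "letter c i j = (if c then U i j else V i j)"

lemma generator_exhaust: obtains c i j where "g = letter c i j"
  by (cases g) (auto simp: letter_def intro: that[of True] that[of False])

lemma letter_eq_iff [simp]: "letter c i j = letter c' i' j' \<longleftrightarrow> c = c' \<and> i = i' \<and> j = j'"
  by (auto simp: letter_def)

abbreviation lt :: "bool \<Rightarrow> 'n \<Rightarrow> 'n \<Rightarrow> 'n generator free_algebra" where
  "lt c i j \<equiv> gen (letter c i j)"

lemma scalar_0 [simp]: "scalar 0 = 0" and scalar_1 [simp]: "scalar 1 = 1"
  by (simp_all add: scalar_def single_zero single_one)

lemma scalar_add: "scalar (a + b) = scalar a + scalar b"
  by (simp add: scalar_def single_add)

lemma scalar_mult: "scalar (a * b) = scalar a * scalar b"
  by (simp add: scalar_def mult_single)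

lemma scalar_uminus: "scalar (- a) = - scalar a"
  using scalar_add[of a "- a"] by (simp add: eq_neg_iff_add_eq_0 add.commute)

lemma scalar_sum: "scalar (sum f A) = (\<Sum>x\<in>A. scalar (f x))"
  by (induction A rule: infinite_finite_induct) (simp_all add: scalar_add)

lemma scalar_commute: "x * scalar a = scalar a * x"
proof -
  have "x * scalar a = (\<Sum>w\<in>Poly_Mapping.keys x. Poly_Mapping.single w (Poly_Mapping.lookup x w)) * scalar a"
    using free_algebra_eq_sum[of x] by simp
  also have "\<dots> = scalar a * (\<Sum>w\<in>Poly_Mapping.keys x. Poly_Mapping.single w (Poly_Mapping.lookup x w))"
    by (simp add: sum_distrib_left sum_distrib_right scalar_def mult_single mult.commute)
  finally show ?thesis using free_algebra_eq_sum[of x] by simp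
qed

lemma scalar_left_commute: "x * (scalar a * y) = scalar a * (x * y)"
  by (metis mult.assoc scalar_commute)

lemma single_Word: "Poly_Mapping.single (Word gs) c = scalar c * prod_list (map gen gs)"
proof (induction gs)
  case (Cons g gs)
  have "Poly_Mapping.single (Word (g # gs)) c = gen g * Poly_Mapping.single (Word gs) c"
    by (simp add: gen_def mult_single plus_free_monoid_def)
  then show ?case by (simp add: Cons scalar_left_commute)
qed (simp add: scalar_def zero_free_monoid_def)

lemma free_algebra_induct [case_names zero add mult]:
  assumes "P 0" "\<And>x y. P x \<Longrightarrow> P y \<Longrightarrow> P (x + y)"
    "\<And>a gs. P (scalar a * prod_list (map gen gs))"
  shows "P x"
proof -
  have "P (\<Sum>w\<in>A. Poly_Mapping.single w (Poly_Mapping.lookup x w))" for A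
  proof (induction A rule: infinite_finite_induct)
    case (insert w A)
    then show ?case using assms(2,3) single_Word[of "letters w"] by simp
  qed (simp_all add: assms(1))
  then show ?thesis by (subst free_algebra_eq_sum)
qed

definition act_gen :: "complex ^ 'n ^ 'n \<Rightarrow> 'n generator \<Rightarrow> 'n bifun \<Rightarrow> 'n bifun" where
  "act_gen F g = (case g of U i j \<Rightarrow> lact_gen (cup F) (cap F) True i j | V i j \<Rightarrow> lact_gen (cup F) (cap F) False i j)"

lemma act_gen_letter: "act_gen F (letter c i j) = lact_gen (cup F) (cap F) c i j"
  by (simp add: act_gen_def letter_def)

definition act :: "complex ^ 'n ^ 'n \<Rightarrow> 'n generator free_algebra \<Rightarrow> 'n bifun \<Rightarrow> 'n bifun" where
  "act F x f = (\<Sum>w\<in>Poly_Mapping.keys x. Poly_Mapping.lookup x w *\<^sub>f foldr (act_gen F) (letters w) f)"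

lemma linop_foldr_act_gen: "linop (foldr (act_gen F) gs)"
proof (induction gs)
  case (Cons g gs)
  obtain c i j where "g = letter c i j" by (rule generator_exhaust)
  then show ?case using Cons by (auto intro!: linopI simp: linopD[OF Cons] act_gen_letter lact_gen_lin)
qed (auto intro!: linopI)

lemma act_add: "act F (x + y) f = act F x f + act F y f"
  unfolding act_def by (rule setsum_keys_plus_distrib) (auto simp: bifun.scale_left_distrib)

lemma act_0 [simp]: "act F 0 f = 0"
  by (simp add: act_def)

lemma act_single: "act F (Poly_Mapping.single w c) f = c *\<^sub>f foldr (act_gen F) (letters w) f"
  by (cases "c = 0") (simp_all add: act_def)

lemma act_sum: "act F (sum h A) f = (\<Sum>x\<in>A. act F (h x) f)"
  by (induction A rule: infinite_finite_induct) (simp_all only: act_add act_0 sum.infinite sum.empty sum.insert not_False_eq_True)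

lemma act_uminus: "act F (- x) f = - act F x f"
  using act_add[of F x "- x" f] by (metis act_0 add.right_inverse minus_unique)

lemma act_diff: "act F (x - y) f = act F x f - act F y f"
  using act_add[of F x "- y" f] by (simp only: act_uminus diff_conv_add_uminus)

lemma linop_act: "linop (act F x)"
  by (rule linopI)
    (simp_all add: act_def linopD[OF linop_foldr_act_gen] bifun.scale_right_distrib sum.distrib
      bifun.scale_sum_right mult.commute)

lemmas act_lin = linopD[OF linop_act]

lemma act_mult: "act F (x * y) f = act F x (act F y f)"
proof -
  have "act F (x * y) f =
      act F ((\<Sum>v \<in> Poly_Mapping.keys x. Poly_Mapping.single v (Poly_Mapping.lookup x v)) *
        (\<Sum>w \<in> Poly_Mapping.keys y. Poly_Mapping.single w (Poly_Mapping.lookup y w))) f"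
    by (rule arg_cong2[where f = "\<lambda>x y. act F (x * y) f", OF free_algebra_eq_sum free_algebra_eq_sum])
  also have "\<dots> = (\<Sum>v \<in> Poly_Mapping.keys x. \<Sum>w \<in> Poly_Mapping.keys y.
      (Poly_Mapping.lookup x v * Poly_Mapping.lookup y w) *\<^sub>f foldr (act_gen F) (letters v) (foldr (act_gen F) (letters w) f))"
    unfolding sum_product act_sum
    by (simp only: mult_single act_single plus_free_monoid_def free_monoid.sel foldr_append comp_apply)
  also have "\<dots> = act F x (act F y f)"
    unfolding act_def[of F x] act_def[of F y]
    by (simp add: linopD[OF linop_foldr_act_gen] bifun.scale_sum_right)
  finally show ?thesis .
qed

lemma act_scalar: "act F (scalar c) f = c *\<^sub>f f"
  by (simp add: scalar_def act_single zero_free_monoid_def)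

lemma act_1 [simp]: "act F 1 f = f"
  using act_scalar[of F 1 f] by simp

lemma act_lt: "act F (lt c i j) f = lact_gen (cup F) (cap F) c i j f"
  by (simp add: gen_def act_single act_gen_letter)

section \<open>The ideal of relations\<close>

lemma rel_ideal_0 [simp]: "0 \<in> rel_ideal F"
  using additive_subgroup.zero_closed[OF ideal.axioms(1)[OF ideal_rel_ideal], of F]
  unfolding free_algebra_simps .

lemma rel_ideal_add: "x \<in> rel_ideal F \<Longrightarrow> y \<in> rel_ideal F \<Longrightarrow> x + y \<in> rel_ideal F"
  using additive_subgroup.a_closed[OF ideal.axioms(1)[OF ideal_rel_ideal], of x F y]
  unfolding free_algebra_simps .

lemma rel_ideal_mult_left: "x \<in> rel_ideal F \<Longrightarrow> a * x \<in> rel_ideal F"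
  using ideal.I_l_closed[OF ideal_rel_ideal, of x F a] by simp

lemma rel_ideal_mult_right: "x \<in> rel_ideal F \<Longrightarrow> x * a \<in> rel_ideal F"
  using ideal.I_r_closed[OF ideal_rel_ideal, of x F a] by simp

lemma rel_ideal_uminus: "x \<in> rel_ideal F \<Longrightarrow> - x \<in> rel_ideal F"
  using rel_ideal_mult_left[of x F "- 1"] by simp

lemma rel_ideal_diff: "x \<in> rel_ideal F \<Longrightarrow> y \<in> rel_ideal F \<Longrightarrow> x - y \<in> rel_ideal F"
  using rel_ideal_add[OF _ rel_ideal_uminus, of x F y] by simp

lemma rel_ideal_sum: "(\<And>k. k \<in> A \<Longrightarrow> h k \<in> rel_ideal F) \<Longrightarrow> sum h A \<in> rel_ideal F"
  by (induction A rule: infinite_finite_induct) (auto intro: rel_ideal_add)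

lemmas rel_ideal_intros = rel_ideal_0 rel_ideal_add rel_ideal_mult_left rel_ideal_mult_right
  rel_ideal_uminus rel_ideal_diff rel_ideal_sum

lemma rel_ideal_minimal:
  assumes "relations F \<subseteq> J" "0 \<in> J" "\<And>x y. x \<in> J \<Longrightarrow> y \<in> J \<Longrightarrow> x + y \<in> J"
    and "\<And>a x. x \<in> J \<Longrightarrow> a * x \<in> J" "\<And>a x. x \<in> J \<Longrightarrow> x * a \<in> J"
  shows "rel_ideal F \<subseteq> J"
proof -
  have G: "group (add_monoid (free_algebra :: (complex, 'a generator free_algebra) module))"
    by (rule abelian_group.a_group[OF ring.is_abelian_group[OF ring_free_algebra]])
  have neg: "inv\<^bsub>add_monoid free_algebra\<^esub> y = - y" for y :: "'a generator free_algebra"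
    by (rule group.inv_equality[OF G]) simp_all
  have "ideal J free_algebra"
  proof (rule idealI)
    show "subgroup J (add_monoid free_algebra)"
    proof (rule group.subgroupI[OF G])
      show "J \<noteq> {}" using assms(2) by blast
      show "inv\<^bsub>add_monoid free_algebra\<^esub> y \<in> J" if "y \<in> J" for y
        unfolding neg using assms(4)[OF that, of "- 1"] by simp
    qed (use assms in auto)
  qed (use assms in \<open>simp_all add: ring_free_algebra\<close>)
  from ring.genideal_minimal[OF ring_free_algebra this assms(1)]
  show ?thesis unfolding rel_ideal_def .
qed

definition xrel :: "complex ^ 'n ^ 'n \<Rightarrow> bool \<Rightarrow> 'n \<Rightarrow> 'n \<Rightarrow> 'n generator free_algebra" where
  "xrel F c i j = (\<Sum>k\<in>UNIV. \<Sum>l\<in>UNIV. scalar (cup F c $ k $ l) * (lt c k i * lt (\<not> c) l j)) - scalar (cup F c $ i $ j)"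

definition yrel :: "complex ^ 'n ^ 'n \<Rightarrow> bool \<Rightarrow> 'n \<Rightarrow> 'n \<Rightarrow> 'n generator free_algebra" where
  "yrel F c i j = (\<Sum>k\<in>UNIV. \<Sum>l\<in>UNIV. scalar (cap F c $ k $ l) * (lt c i k * lt (\<not> c) j l)) - scalar (cap F c $ i $ j)"

lemma lt_True: "u_mat $ i $ j = lt True i j" and lt_False: "v_mat $ i $ j = lt False i j"
  by (simp_all add: u_mat_def v_mat_def letter_def)

lemma mult_entry: "(A ** B) $ i $ j = (\<Sum>k\<in>UNIV. A $ i $ k * B $ k $ j)"
  by (simp add: matrix_matrix_mult_def)

lemma mat_1_entry: "(mat 1 :: 'a :: {zero, one} ^ 'n ^ 'n) $ i $ j = (if i = j then 1 else 0)"
  by (simp add: mat_def)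

lemma scalar_mat_1:
  "scalar ((mat 1 :: complex ^ 'n ^ 'n) $ i $ j) = (mat 1 :: 'g free_algebra ^ 'n ^ 'n) $ i $ j"
  "(\<Sum>k\<in>UNIV. (mat 1 :: 'g free_algebra ^ 'n ^ 'n) $ (i :: 'n :: finite) $ k * h k) = h i"
  by (simp_all add: mat_def if_distrib[of "\<lambda>x. x * _"] cong: if_cong)

text \<open>The first two families agree literally. The others carry an invertible scalar factor:
  \<open>v F u^t F^{-1} - 1 = (v F u^t - F) F^{-1}\<close> and
  \<open>F u^t F^{-1} v - 1 = F (u^t F^{-1} v - F^{-1})\<close>.\<close>

lemma relation_entries:
  fixes F :: "complex ^ 'n ^ 'n"
  assumes "invertible F"
  defines "G \<equiv> map_matrix scalar F :: 'n generator free_algebra ^ 'n ^ 'n"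
    and "G' \<equiv> map_matrix scalar (matrix_inv F) :: 'n generator free_algebra ^ 'n ^ 'n"
  shows "(u_mat ** transpose v_mat - mat 1) $ i $ j = yrel F True i j"
    "(transpose v_mat ** u_mat - mat 1) $ i $ j = xrel F False i j"
    "(v_mat ** G ** transpose u_mat ** G' - mat 1) $ i $ j =
       (\<Sum>m\<in>UNIV. yrel F False i m * scalar (matrix_inv F $ m $ j))"
    "(G ** transpose u_mat ** G' ** v_mat - mat 1) $ i $ j =
       (\<Sum>m\<in>UNIV. scalar (F $ i $ m) * xrel F True m j)"
proof -
  show "(u_mat ** transpose v_mat - mat 1) $ i $ j = yrel F True i j"
    "(transpose v_mat ** u_mat - mat 1) $ i $ j = xrel F False i j"
    by (simp_all add: yrel_def xrel_def mult_entry transpose_def lt_True lt_False cap_def cup_def scalar_mat_1)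
  have inv: "(\<Sum>m\<in>UNIV. scalar (F $ i $ m) * scalar (matrix_inv F $ m $ j)) = (mat 1 :: 'n generator free_algebra ^ 'n ^ 'n) $ i $ j"
    using arg_cong[OF matrix_inv_mult(1)[OF assms(1)], of "\<lambda>X. scalar (X $ i $ j) :: 'n generator free_algebra"]
    by (cases "i = j") (simp_all add: mult_entry mat_1_entry scalar_sum scalar_mult)
  have "(v_mat ** G ** transpose u_mat ** G') $ i $ j =
    (\<Sum>m\<in>UNIV. (\<Sum>l\<in>UNIV. (\<Sum>k\<in>UNIV. lt False i k * scalar (F $ k $ l)) * lt True m l) * scalar (matrix_inv F $ m $ j))"
    by (simp add: mult_entry transpose_def lt_True lt_False G_def G'_def)
  moreover have "(\<Sum>l\<in>UNIV. (\<Sum>k\<in>UNIV. lt False i k * scalar (F $ k $ l)) * lt True m l) = yrel F False i m + scalar (F $ i $ m)" for m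
    unfolding yrel_def sum_distrib_right by (subst sum.swap) (simp add: cap_def scalar_commute mult.assoc)
  ultimately show "(v_mat ** G ** transpose u_mat ** G' - mat 1) $ i $ j =
       (\<Sum>m\<in>UNIV. yrel F False i m * scalar (matrix_inv F $ m $ j))"
    using inv by (simp add: distrib_right sum.distrib)
  have "(G ** transpose u_mat ** G' ** v_mat) $ i $ j =
    (\<Sum>l\<in>UNIV. (\<Sum>k\<in>UNIV. (\<Sum>m\<in>UNIV. scalar (F $ i $ m) * lt True k m) * scalar (matrix_inv F $ k $ l)) * lt False l j)"
    by (simp add: mult_entry transpose_def lt_True lt_False G_def G'_def)
  also have "\<dots> = (\<Sum>m\<in>UNIV. scalar (F $ i $ m) * (xrel F True m j + scalar (matrix_inv F $ m $ j)))"
  proof -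
    have 1: "scalar (F $ i $ m) * (xrel F True m j + scalar (matrix_inv F $ m $ j)) =
      (\<Sum>k\<in>UNIV. \<Sum>l\<in>UNIV. scalar (F $ i $ m) * lt True k m * scalar (matrix_inv F $ k $ l) * lt False l j)" for m
      by (simp add: xrel_def cup_def sum_distrib_left mult.assoc scalar_left_commute[of "lt _ _ _"])
    show ?thesis
      unfolding 1 sum_distrib_right by (subst sum.swap, subst sum_swap3) simp
  qed
  finally show "(G ** transpose u_mat ** G' ** v_mat - mat 1) $ i $ j =
       (\<Sum>m\<in>UNIV. scalar (F $ i $ m) * xrel F True m j)"
    using inv by (simp add: distrib_left sum.distrib)
qed

lemma relations_cases:
  assumes "invertible F" "r \<in> relations F"
  obtains i j where "r = yrel F True i j" | i j where "r = xrel F False i j"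
  | i j where "r = (\<Sum>m\<in>UNIV. yrel F False i m * scalar (matrix_inv F $ m $ j))"
  | i j where "r = (\<Sum>m\<in>UNIV. scalar (F $ i $ m) * xrel F True m j)"
  using assms(2) relation_entries[OF assms(1)] unfolding relations_def Let_def entries_def by auto

lemma rel_in_rel_ideal: "relations F \<subseteq> rel_ideal F"
  using ring.genideal_self[OF ring_free_algebra, of "relations F"] unfolding rel_ideal_def by auto

lemma xrel_yrel_in_rel_ideal:
  assumes "invertible F"
  shows "xrel F c i j \<in> rel_ideal F" "yrel F c i j \<in> rel_ideal F"
proof -
  note ent = relation_entries[OF assms, symmetric]
  have in_rel: "X $ i $ j \<in> rel_ideal F" if "entries X \<subseteq> relations F" for X i j
    using that rel_in_rel_ideal[of F] by (auto simp: entries_def)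
  have sub: "entries (u_mat ** transpose v_mat - mat 1) \<subseteq> relations F"
    "entries (transpose v_mat ** u_mat - mat 1) \<subseteq> relations F"
    "entries (v_mat ** map_matrix scalar F ** transpose u_mat ** map_matrix scalar (matrix_inv F) - mat 1) \<subseteq> relations F"
    "entries (map_matrix scalar F ** transpose u_mat ** map_matrix scalar (matrix_inv F) ** v_mat - mat 1) \<subseteq> relations F"
    by (auto simp: relations_def Let_def)
  have yT: "yrel F True i j \<in> rel_ideal F" for i j unfolding ent(1) by (rule in_rel[OF sub(1)])
  have xF: "xrel F False i j \<in> rel_ideal F" for i j unfolding ent(2) by (rule in_rel[OF sub(2)])
  have 3: "(\<Sum>m\<in>UNIV. yrel F False i m * scalar (matrix_inv F $ m $ j)) \<in> rel_ideal F" for i j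
    unfolding ent(3) by (rule in_rel[OF sub(3)])
  have 4: "(\<Sum>m\<in>UNIV. scalar (F $ i $ m) * xrel F True m j) \<in> rel_ideal F" for i j
    unfolding ent(4) by (rule in_rel[OF sub(4)])
  have FF: "(\<Sum>j\<in>UNIV. matrix_inv F $ m $ j * F $ j $ l) = (if m = l then 1 else 0)" for m l
    using arg_cong[OF matrix_inv_mult(2)[OF assms], of "\<lambda>X. X $ m $ l"] by (simp add: mult_entry mat_1_entry)
  have yF: "yrel F False i l \<in> rel_ideal F" for i l
  proof -
    have "(\<Sum>j\<in>UNIV. (\<Sum>m\<in>UNIV. yrel F False i m * scalar (matrix_inv F $ m $ j)) * scalar (F $ j $ l)) =
      (\<Sum>m\<in>UNIV. yrel F False i m * scalar (\<Sum>j\<in>UNIV. matrix_inv F $ m $ j * F $ j $ l))"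
      unfolding scalar_sum sum_distrib_left sum_distrib_right
      by (subst sum.swap) (simp add: scalar_mult mult.assoc)
    also have "\<dots> = yrel F False i l" unfolding FF by (simp add: if_distrib[of scalar] if_distrib[of "\<lambda>x. _ * x"] cong: if_cong)
    finally show ?thesis by (rule subst) (intro rel_ideal_sum rel_ideal_mult_right 3)
  qed
  have xT: "xrel F True l j \<in> rel_ideal F" for l j
  proof -
    have "(\<Sum>i\<in>UNIV. scalar (matrix_inv F $ l $ i) * (\<Sum>m\<in>UNIV. scalar (F $ i $ m) * xrel F True m j)) =
      (\<Sum>m\<in>UNIV. scalar (\<Sum>i\<in>UNIV. matrix_inv F $ l $ i * F $ i $ m) * xrel F True m j)"
      unfolding scalar_sum sum_distrib_left sum_distrib_right
      by (subst sum.swap) (simp add: scalar_mult mult.assoc)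
    also have "\<dots> = xrel F True l j" unfolding FF by (simp add: if_distrib[of scalar] if_distrib[of "\<lambda>x. x * _"] cong: if_cong)
    finally show ?thesis by (rule subst) (intro rel_ideal_sum rel_ideal_mult_left 4)
  qed
  show "xrel F c i j \<in> rel_ideal F" "yrel F c i j \<in> rel_ideal F"
    using yT xF yF xT by (cases c; simp)+
qed

section \<open>Normal form: from the model back to the algebra\<close>

definition vac :: "'n bifun" where
  "vac = (\<lambda>xs ys. if xs = [] \<and> ys = [] then 1 else 0)"

text \<open>The sum over all pairs of words of length \<open>k\<close> with equal colours of the
  value of \<open>f\<close> times the product of the generators that they index. On traceless
  functions it inverts, modulo the ideal, the action on the vacuum, see \<open>act_theta\<close> and
  \<open>Theta_act\<close>.\<close>

primrec theta :: "nat \<Rightarrow> 'n :: finite bifun \<Rightarrow> 'n generator free_algebra" where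
  "theta 0 f = scalar (f [] [])"
| "theta (Suc k) f = (\<Sum>c\<in>UNIV. \<Sum>i\<in>UNIV. \<Sum>j\<in>UNIV. lt c i j * theta k (xstrip c i (ystrip c j f)))"

lemma theta_add: "theta k (f + g) = theta k f + theta k g"
  by (induction k arbitrary: f g)
    (simp_all add: plus_fun_apply scalar_add strip_lin distrib_left sum.distrib)

lemma theta_scale: "theta k (a *\<^sub>f f) = scalar a * theta k f"
  by (induction k arbitrary: f)
    (simp_all add: scale_fun_apply scalar_mult strip_lin sum_distrib_left scalar_left_commute)

lemma theta_0 [simp]: "theta k 0 = 0"
  using theta_scale[of k 0 0] by simp

lemma theta_uminus: "theta k (- f) = - theta k f"
  using theta_scale[of k "- 1" f] by (simp add: scalar_uminus)

lemma theta_diff: "theta k (f - g) = theta k f - theta k g"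
  using theta_add[of k f "- g"] by (simp add: theta_uminus)

lemma theta_sum: "theta k (sum h A) = (\<Sum>x\<in>A. theta k (h x))"
  by (induction A rule: infinite_finite_induct) (simp_all add: theta_add)

lemmas theta_lin = theta_add theta_scale theta_0 theta_uminus theta_diff theta_sum

lemma xstrip_weight: "xstrip c i (xweight \<phi> f) = xweight (\<lambda>cs. \<phi> (c # cs)) (xstrip c i f)"
  by (simp add: fun_eq_iff xstrip_def xweight_def)

lemma theta_part: "theta k (part m f) = (if m = k then theta k f else 0)"
proof (induction k arbitrary: m f)
  case 0
  then show ?case by (simp add: xweight_def)
next
  case (Suc k)
  have "theta k (xstrip c i (ystrip c j (part m f))) = (if m = Suc k then theta k (xstrip c i (ystrip c j f)) else 0)" for c i j
  proof (cases m)
    case 0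
    have "xstrip c i (ystrip c j (part m f)) = 0"
      by (auto simp: 0 fun_eq_iff xstrip_def ystrip_def xweight_def zero_fun_apply)
    then show ?thesis by (simp add: 0)
  next
    case (Suc m')
    have "xstrip c i (ystrip c j (part m f)) = part m' (xstrip c i (ystrip c j f))"
      by (auto simp: Suc fun_eq_iff xstrip_def ystrip_def xweight_def)
    then show ?thesis by (simp add: Suc Suc.IH)
  qed
  then show ?case by simp
qed

lemma theta_hom: "part m f = f \<Longrightarrow> m \<noteq> k \<Longrightarrow> theta k f = 0"
  using theta_part[of k m f] by simp

locale generic_matrix =
  fixes F :: "complex ^ 'n :: finite ^ 'n"
  assumes inv: "invertible F" and gen: "generic F"
begin

sublocale cup_cap "cup F" "cap F"
  by (rule cup_cap[OF inv gen])

abbreviation E where "E \<equiv> cup F"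
abbreviation G where "G \<equiv> cap F"

definition eqv :: "'n generator free_algebra \<Rightarrow> 'n generator free_algebra \<Rightarrow> bool" (infix "\<doteq>" 50) where
  "x \<doteq> y \<longleftrightarrow> x - y \<in> rel_ideal F"

lemma eqv_refl [simp]: "x \<doteq> x" by (simp add: eqv_def)
lemma eqv_sym: "x \<doteq> y \<Longrightarrow> y \<doteq> x" using rel_ideal_uminus[of "x - y" F] by (simp add: eqv_def)
lemma eqv_trans [trans]: "x \<doteq> y \<Longrightarrow> y \<doteq> z \<Longrightarrow> x \<doteq> z" using rel_ideal_add[of "x - y" F "y - z"] by (simp add: eqv_def)
lemma eqv_add: "x \<doteq> y \<Longrightarrow> x' \<doteq> y' \<Longrightarrow> x + x' \<doteq> y + y'"
  using rel_ideal_add[of "x - y" F "x' - y'"] by (simp add: eqv_def algebra_simps)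
lemma eqv_diff: "x \<doteq> y \<Longrightarrow> x' \<doteq> y' \<Longrightarrow> x - x' \<doteq> y - y'"
  using rel_ideal_diff[of "x - y" F "x' - y'"] by (simp add: eqv_def algebra_simps)
lemma eqv_sum: "(\<And>k. k \<in> A \<Longrightarrow> f k \<doteq> g k) \<Longrightarrow> sum f A \<doteq> sum g A"
  using rel_ideal_sum[of A "\<lambda>k. f k - g k" F] by (simp add: eqv_def sum_subtractf)
lemma eqv_mult_left: "x \<doteq> y \<Longrightarrow> a * x \<doteq> a * y"
  using rel_ideal_mult_left[of "x - y" F a] by (simp add: eqv_def algebra_simps)
lemma eqv_mult_right: "x \<doteq> y \<Longrightarrow> x * a \<doteq> y * a"
  using rel_ideal_mult_right[of "x - y" F a] by (simp add: eqv_def algebra_simps)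

lemma xrel_eqv: "(\<Sum>k\<in>UNIV. \<Sum>l\<in>UNIV. scalar (E c $ k $ l) * (lt c k i * lt (\<not> c) l j)) \<doteq> scalar (E c $ i $ j)"
  using xrel_yrel_in_rel_ideal(1)[OF inv] by (simp add: eqv_def xrel_def)

lemma yrel_eqv: "(\<Sum>k\<in>UNIV. \<Sum>l\<in>UNIV. scalar (G c $ k $ l) * (lt c i k * lt (\<not> c) j l)) \<doteq> scalar (G c $ i $ j)"
  using xrel_yrel_in_rel_ideal(2)[OF inv] by (simp add: eqv_def yrel_def)

definition lower :: "bool \<Rightarrow> 'n \<Rightarrow> 'n \<Rightarrow> 'n bifun \<Rightarrow> 'n bifun" where
  "lower c i j f = xweight (damping E G c) (xflat G c i (yflat E c j f))"

lemma lact_eq: "L c i j f = X c i (Y c j f) + lower c i j f"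
  by (simp add: lact_gen_def lower_def)

lemma trl_lower: "trl f \<Longrightarrow> trl (lower c i j f)"
  by (auto simp: lower_def bitraceless_def xtraceless_y_ops ytraceless_ops
      xtraceless_flat xtraceless_weight same_cols_flat same_cols_weight)

lemma part_lower: "part (Suc k) f = f \<Longrightarrow> part k (lower c i j f) = lower c i j f"
proof -
  assume f: "part (Suc k) f = f"
  have "part k (lower c i j f) = lower c i j (xweight (\<lambda>cs. if cs = [] then 0 else if length (tl cs) = k then 1 else 0) f)"
    unfolding lower_def xweight_commute[of _ "damping E G c"] xweight_flat[of "\<lambda>cs. if length cs = k then 1 else 0"] xy_commute(15) ..
  also have "(\<lambda>cs :: bool list. if cs = [] then 0 else if length (tl cs) = k then 1 else 0 :: complex) = (\<lambda>cs. if length cs = Suc k then 1 else 0)"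
    by (auto simp: fun_eq_iff)
  finally show ?thesis by (simp add: f)
qed

lemma part_create: "part k f = f \<Longrightarrow> part (Suc k) (X c i (Y c j f)) = X c i (Y c j f)"
  by (simp add: xweight_create xy_commute(13))

lemma lower_part_0:
  assumes "trl f" "part 0 f = f"
  shows "xflat G c i f = 0" "yflat E c j f = 0"
proof -
  have f: "f xs ys = 0" if "xs \<noteq> [] \<or> ys \<noteq> []" for xs ys
  proof (rule ccontr)
    assume *: "f xs ys \<noteq> 0"
    then have "part 0 f xs ys \<noteq> 0" unfolding assms(2) .
    then have "xs = []" by (auto simp: xweight_def split: if_splits)
    moreover have "cols xs = cols ys" using * trl_D(3)[OF assms(1)] by (simp add: same_cols_def)
    ultimately show False using that by simp
  qed
  show "xflat G c i f = 0" "yflat E c j f = 0"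
    by (simp_all add: fun_eq_iff zero_fun_apply xflat_apply yflat_apply flat_def f)
qed

lemma sum_ycreate_strip:
  assumes "ytraceless E f"
  shows "(\<Sum>k\<in>UNIV. Y c k (ystrip c k f)) = yweight (\<lambda>cs. if cs \<noteq> [] \<and> hd cs = c then 1 else 0) f"
  using cup_cap.sum_xcreate_strip[OF dual, of "flp f" c] assms
  by (subst flp_eq_iff[symmetric]) (simp add: flp_ops flp_lin xtraceless_flp)

lemma sum_yflat_strip:
  assumes "ytraceless E f"
  shows "(\<Sum>k\<in>UNIV. yflat E c k (ystrip c k f)) = 0"
proof -
  have "yweight (\<lambda>_. 1) g = g" "xweight (\<lambda>_. 1) g = g" for g :: "'n bifun" by (simp_all add: fun_eq_iff yweight_def xweight_def)
  then show ?thesis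
    using cup_cap.sum_xflat_strip[OF dual, of "flp f" c "\<lambda>_. 1"] assms
    by (subst flp_eq_iff[symmetric]) (simp add: flp_ops flp_lin xtraceless_flp)
qed

lemma yflat_inverse: "(\<Sum>l\<in>UNIV. G c $ m $ l *\<^sub>f yflat E (\<not> c) l f) = ystrip c m f"
  using cup_cap.xflat_inverse[OF dual, of c m "flp f"]
  by (subst flp_eq_iff[symmetric]) (simp add: flp_ops flp_lin)

lemma xstrip_create_other: "c' \<noteq> c \<Longrightarrow> xstrip c' m (X c i f) = 0"
  by (simp add: fun_eq_iff zero_fun_apply xstrip_def xcreate_def)

text \<open>Each of the two creations has a leading term and a correction; the four terms are the
  products.\<close>

lemma strip_create:
  fixes f :: "'n bifun"
  defines "h1 c i \<equiv> xweight (damping E G c) (xflat G c i f)"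
    and "h2 c j \<equiv> yweight (damping E G c) (yflat E c j f)"
    and "h c i j \<equiv> yweight (damping E G c) (lower c i j f)"
  shows "xstrip c m (ystrip c r (X c i (Y c j f))) =
    (if m = i then if r = j then f else 0 else 0) - (if m = i then (\<Sum>l\<in>UNIV. G c $ r $ l *\<^sub>f Y (\<not> c) l (h2 c j)) else 0) -
    (if r = j then (\<Sum>l\<in>UNIV. E c $ m $ l *\<^sub>f X (\<not> c) l (h1 c i)) else 0) +
    (\<Sum>l\<in>UNIV. \<Sum>l'\<in>UNIV. (E c $ m $ l * G c $ r $ l') *\<^sub>f X (\<not> c) l (Y (\<not> c) l' (h c i j)))"
proof -
  have 1: "xstrip c m (ystrip c r (X c i (Y c j f))) = xstrip c m (X c i (ystrip c r (Y c j f)))"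
    by (simp add: xy_commute)
  have 2: "xweight (damping E G c) (xflat G c i (Y (\<not> c) l' (h2 c j))) = Y (\<not> c) l' (h c i j)" for l'
    unfolding h2_def h_def lower_def by (simp add: xy_commute)
  have 3: "xweight (damping E G c) (xflat G c i (if r = j then f else 0)) = (if r = j then h1 c i else 0)"
    by (simp add: h1_def op_lin)
  have 4: "(\<Sum>l\<in>UNIV. E c $ m $ l *\<^sub>f X (\<not> c) l ((if r = j then h1 c i else 0) - (\<Sum>l'\<in>UNIV. G c $ r $ l' *\<^sub>f Y (\<not> c) l' (h c i j)))) =
    (if r = j then (\<Sum>l\<in>UNIV. E c $ m $ l *\<^sub>f X (\<not> c) l (h1 c i)) else 0) -
    (\<Sum>l\<in>UNIV. \<Sum>l'\<in>UNIV. (E c $ m $ l * G c $ r $ l') *\<^sub>f X (\<not> c) l (Y (\<not> c) l' (h c i j)))"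
    by (simp add: create_lin bifun.scale_right_diff_distrib sum_subtractf bifun.scale_sum_right)
  show ?thesis
    unfolding 1 ystrip_create h2_def[symmetric] xstrip_create weight_lin flat_lin 2 3 4
    by (simp add: algebra_simps)
qed

text \<open>The crucial fact: up to relations \<open>theta\<close> turns the operator of a generator
  into multiplication by it. Of the four terms in \<open>strip_create\<close> one is the product on
  the right. By induction and the relations, each of the other three equals
  \<open>theta (k - 1) (lower c i j f)\<close>, with signs -, - and +. At \<open>k = 0\<close> the
  truncated subtraction is harmless because \<open>lower c i j f\<close> is zero.\<close>

lemma theta_create:
  assumes "trl f" "part k f = f"
  shows "theta (Suc k) (X c i (Y c j f)) \<doteq> lt c i j * theta k f - theta (k - 1) (lower c i j f)"
  using assms
proof (induction k arbitrary: c i j f rule: less_induct)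
  case (less k)
  define D where "D = damping E G"
  define h1 where "h1 = xweight (D c) (xflat G c i f)"
  define h2 where "h2 = yweight (D c) (yflat E c j f)"
  define h where "h = yweight (D c) (lower c i j f)"
  define A1 where "A1 = (\<Sum>m\<in>UNIV. \<Sum>l\<in>UNIV. scalar (E c $ m $ l) * (lt c m j * theta k (X (\<not> c) l h1)))"
  define A2 where "A2 = (\<Sum>r\<in>UNIV. \<Sum>l\<in>UNIV. scalar (G c $ r $ l) * (lt c i r * theta k (Y (\<not> c) l h2)))"
  define A3 where "A3 = (\<Sum>m\<in>UNIV. \<Sum>r\<in>UNIV. \<Sum>l\<in>UNIV. \<Sum>l'\<in>UNIV.
    scalar (E c $ m $ l * G c $ r $ l') * (lt c m r * theta k (X (\<not> c) l (Y (\<not> c) l' h))))"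
  have split: "(\<Sum>c'\<in>UNIV. S c') = S c + S (\<not> c)" for S :: "bool \<Rightarrow> 'n generator free_algebra"
    by (cases c) (simp_all add: UNIV_bool add.commute)
  have expand: "theta (Suc k) (X c i (Y c j f)) = lt c i j * theta k f - A2 - A1 + A3"
  proof -
    have other: "xstrip (\<not> c) m (ystrip (\<not> c) r (X c i (Y c j f))) = 0" for m r
      using xstrip_create_other[of "\<not> c" c m i "ystrip (\<not> c) r (Y c j f)"] by (simp add: xy_commute)
    have d1: "(\<Sum>m\<in>UNIV. \<Sum>r\<in>UNIV. lt c m r * theta k (if m = i then if r = j then f else 0 else 0)) = lt c i j * theta k f"
    proof -
      have "(\<Sum>r\<in>UNIV. lt c m r * theta k (if m = i then if r = j then f else 0 else 0)) =
        (if m = i then lt c i j * theta k f else 0)" for m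
        by (simp add: if_distrib[of "theta k"] if_distrib[of "\<lambda>x. _ * x"] cong: if_cong)
      then show ?thesis by simp
    qed
    have d2: "(\<Sum>m\<in>UNIV. \<Sum>r\<in>UNIV. lt c m r * theta k (if m = i then (\<Sum>l\<in>UNIV. G c $ r $ l *\<^sub>f Y (\<not> c) l h2) else 0)) = A2"
    proof -
      have "(\<Sum>r\<in>UNIV. lt c m r * theta k (if m = i then (\<Sum>l\<in>UNIV. G c $ r $ l *\<^sub>f Y (\<not> c) l h2) else 0)) =
        (if m = i then A2 else 0)" for m
        by (auto simp: A2_def theta_lin sum_distrib_left scalar_left_commute)
      then show ?thesis by simp
    qed
    have d3: "(\<Sum>m\<in>UNIV. \<Sum>r\<in>UNIV. lt c m r * theta k (if r = j then (\<Sum>l\<in>UNIV. E c $ m $ l *\<^sub>f X (\<not> c) l h1) else 0)) = A1"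
    proof -
      have "(\<Sum>r\<in>UNIV. lt c m r * theta k (if r = j then (\<Sum>l\<in>UNIV. E c $ m $ l *\<^sub>f X (\<not> c) l h1) else 0)) =
        (\<Sum>l\<in>UNIV. scalar (E c $ m $ l) * (lt c m j * theta k (X (\<not> c) l h1)))" for m
        by (simp add: if_distrib[of "theta k"] if_distrib[of "\<lambda>x. _ * x"] theta_lin sum_distrib_left scalar_left_commute cong: if_cong)
      then show ?thesis by (simp add: A1_def)
    qed
    have d4: "(\<Sum>m\<in>UNIV. \<Sum>r\<in>UNIV. lt c m r * theta k (\<Sum>l\<in>UNIV. \<Sum>l'\<in>UNIV. (E c $ m $ l * G c $ r $ l') *\<^sub>f X (\<not> c) l (Y (\<not> c) l' h))) = A3"
      by (simp add: A3_def theta_lin sum_distrib_left scalar_left_commute)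
    have "theta (Suc k) (X c i (Y c j f)) = (\<Sum>m\<in>UNIV. \<Sum>r\<in>UNIV. lt c m r * theta k (xstrip c m (ystrip c r (X c i (Y c j f)))))"
      unfolding theta.simps split other by simp
    also have "\<dots> = lt c i j * theta k f - A2 - A1 + A3"
      unfolding strip_create D_def[symmetric] h1_def[symmetric] h2_def[symmetric] h_def[symmetric]
        theta_add theta_diff distrib_left right_diff_distrib sum.distrib sum_subtractf d1 d2 d3 d4 ..
    finally show ?thesis .
  qed
  note t = trl_D[OF less.prems(1)]
  show ?case
  proof (cases k)
    case 0
    have "h1 = 0" "h2 = 0" "lower c i j f = 0"
      using lower_part_0[OF less.prems(1)] less.prems(2) by (simp_all add: 0 h1_def h2_def lower_def op_lin)
    then show ?thesis unfolding expand by (simp add: A1_def A2_def A3_def h_def 0 op_lin)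
  next
    case (Suc k')
    have f: "part (Suc k') f = f" using less.prems(2) by (simp add: Suc)
    have part_xflat: "part k' (xflat G c i g) = xflat G c i g" if "part (Suc k') g = g" for g
    proof -
      have "(\<lambda>cs :: bool list. if cs = [] then 0 else if length (tl cs) = k' then 1 else 0 :: complex) = (\<lambda>cs. if length cs = Suc k' then 1 else 0)"
        by (auto simp: fun_eq_iff)
      then show ?thesis unfolding xweight_flat by (simp add: that)
    qed
    have IH: "theta k (X c i (Y c j g)) \<doteq> lt c i j * theta k' g - theta (k' - 1) (lower c i j g)"
      if "trl g" "part k' g = g" for c i j g
      using less.IH[of k', OF _ that] by (simp add: Suc)
    \<comment> \<open>Only the first word has a creation here. But \<open>h1\<close> vanishes unless
      its second word starts with colour \<open>\<not> c\<close>, so it is also a sum of creations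
      in the second word, and the induction hypothesis applies. The products of two generators are
      then contracted by \<open>xrel_eqv\<close>.\<close>
    have A1: "A1 \<doteq> theta k' (lower c i j f)"
    proof -
      define g where "g s = ystrip (\<not> c) s h1" for s
      have yh1: "ytraceless E h1" unfolding h1_def by (intro ytraceless_ops t)
      have h1_front: "h1 xs ys = 0" if "\<not> (cols ys \<noteq> [] \<and> hd (cols ys) = (\<not> c))" for xs ys
      proof -
        have "f ((\<not> c, l) # xs) ys = 0" for l
        proof (rule ccontr)
          assume "f ((\<not> c, l) # xs) ys \<noteq> 0"
          then have "cols ((\<not> c, l) # xs) = cols ys" using t(3) unfolding same_cols_def by blast
          from this[symmetric] show False using that by simp
        qed
        then show ?thesis by (simp add: h1_def xweight_def xflat_apply flat_def)
      qed
      have h1: "h1 = (\<Sum>s\<in>UNIV. Y (\<not> c) s (g s))"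
        unfolding g_def sum_ycreate_strip[OF yh1] using h1_front by (auto simp: fun_eq_iff yweight_def)
      have g_eq: "g s = xweight (D c) (\<Sum>l\<in>UNIV. G c $ i $ l *\<^sub>f xstrip (\<not> c) l (ystrip (\<not> c) s f))" for s
        unfolding g_def h1_def xflat_def by (simp add: op_lin xy_commute)
      have "trl (xstrip (\<not> c) l (ystrip (\<not> c) s f))" for l s
        by (simp add: bitraceless_def xtraceless_strip xtraceless_y_ops ytraceless_ops t same_cols_strip)
      then have trl_g: "trl (g s)" for s
        unfolding g_eq by (intro bitraceless_weight bitraceless_lincomb)
      have part_g: "part k' (g s) = g s" for s
        unfolding g_def h1_def xy_commute(14) xweight_commute[of _ "D c"] part_xflat[OF f] ..
      have "X (\<not> c) l h1 = (\<Sum>s\<in>UNIV. X (\<not> c) l (Y (\<not> c) s (g s)))" for l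
        by (subst h1) (simp add: create_lin)
      then have "A1 = (\<Sum>m\<in>UNIV. \<Sum>l\<in>UNIV. scalar (E c $ m $ l) * (lt c m j * (\<Sum>s\<in>UNIV. theta k (X (\<not> c) l (Y (\<not> c) s (g s))))))"
        by (simp add: A1_def theta_sum)
      also have "\<dots> \<doteq> (\<Sum>m\<in>UNIV. \<Sum>l\<in>UNIV. scalar (E c $ m $ l) * (lt c m j * (\<Sum>s\<in>UNIV. lt (\<not> c) l s * theta k' (g s) - theta (k' - 1) (lower (\<not> c) l s (g s)))))"
        by (intro eqv_sum eqv_mult_left IH trl_g part_g)
      also have "\<dots> = (\<Sum>s\<in>UNIV. (\<Sum>m\<in>UNIV. \<Sum>l\<in>UNIV. scalar (E c $ m $ l) * (lt c m j * lt (\<not> c) l s)) * theta k' (g s))"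
      proof -
        \<comment> \<open>The lower terms of the induction hypothesis cancel: together they contain
          a contraction of \<open>h1\<close> within its second word.\<close>
        have z: "(\<Sum>s\<in>UNIV. lower (\<not> c) l s (g s)) = 0" for l
        proof -
          have "(\<Sum>s\<in>UNIV. lower (\<not> c) l s (g s)) =
            xweight (D (\<not> c)) (xflat G (\<not> c) l (\<Sum>s\<in>UNIV. yflat E (\<not> c) s (ystrip (\<not> c) s h1)))"
            by (simp add: lower_def g_def op_lin D_def)
          then show ?thesis unfolding sum_yflat_strip[OF yh1] by (simp add: op_lin)
        qed
        have 0: "(\<Sum>s\<in>UNIV. theta (k' - 1) (lower (\<not> c) l s (g s))) = 0" for l
          using arg_cong[OF z[of l], of "theta (k' - 1)"] by (simp only: theta_sum theta_0)
        show ?thesis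
          unfolding sum_subtractf 0 sum_distrib_right
          by (subst sum_swap3[symmetric]) (simp add: sum_distrib_left mult.assoc)
      qed
      also have "\<dots> \<doteq> (\<Sum>s\<in>UNIV. scalar (E c $ j $ s) * theta k' (g s))"
        by (intro eqv_sum eqv_mult_right xrel_eqv)
      also have "\<dots> = theta k' (\<Sum>s\<in>UNIV. E c $ j $ s *\<^sub>f g s)" by (simp add: theta_lin)
      also have "(\<Sum>s\<in>UNIV. E c $ j $ s *\<^sub>f g s) = yflat E c j h1" by (simp add: g_def yflat_def)
      also have "\<dots> = lower c i j f" by (simp add: h1_def lower_def xy_commute D_def)
      finally show ?thesis .
    qed
    \<comment> \<open>The mirror image of \<open>A1\<close>, with \<open>yrel_eqv\<close>.\<close>
    have A2: "A2 \<doteq> theta k' (lower c i j f)"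
    proof -
      define g where "g s = xstrip (\<not> c) s h2" for s
      have xh2: "xtraceless G h2" unfolding h2_def by (intro xtraceless_y_ops t)
      have h2_front: "h2 xs ys = 0" if "\<not> (cols xs \<noteq> [] \<and> hd (cols xs) = (\<not> c))" for xs ys
      proof -
        have "f xs ((\<not> c, l) # ys) = 0" for l
        proof (rule ccontr)
          assume "f xs ((\<not> c, l) # ys) \<noteq> 0"
          then have "cols xs = cols ((\<not> c, l) # ys)" using t(3) unfolding same_cols_def by blast
          then show False using that by simp
        qed
        then show ?thesis by (simp add: h2_def yweight_def yflat_apply flat_def)
      qed
      have h2: "h2 = (\<Sum>s\<in>UNIV. X (\<not> c) s (g s))"
        unfolding g_def sum_xcreate_strip[OF xh2] using h2_front by (auto simp: fun_eq_iff xweight_def)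
      have g_eq: "g s = yweight (D c) (\<Sum>l\<in>UNIV. E c $ j $ l *\<^sub>f xstrip (\<not> c) s (ystrip (\<not> c) l f))" for s
        unfolding g_def h2_def yflat_def by (simp add: op_lin xy_commute)
      have t0: "trl (xstrip (\<not> c) s (ystrip (\<not> c) l f))" for l s
        by (simp add: bitraceless_def xtraceless_strip xtraceless_y_ops ytraceless_ops t same_cols_strip)
      have t1: "trl (\<Sum>l\<in>UNIV. E c $ j $ l *\<^sub>f xstrip (\<not> c) s (ystrip (\<not> c) l f))" for s
        by (intro bitraceless_lincomb t0)
      then have trl_g: "trl (g s)" for s
        unfolding g_eq weight_same_cols[OF trl_D(3)[OF t1], symmetric] by (rule bitraceless_weight)
      have strip_f: "part k' (xstrip (\<not> c) s g) = xstrip (\<not> c) s g" if "part (Suc k') g = g" for s g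
        using arg_cong[OF that, of "xstrip (\<not> c) s"] by (simp add: xstrip_weight)
      have part_g: "part k' (g s) = g s" for s
      proof -
        have "part (Suc k') h2 = h2" unfolding h2_def xy_commute(15,16) f ..
        then show ?thesis unfolding g_def by (rule strip_f)
      qed
      have "Y (\<not> c) l h2 = (\<Sum>s\<in>UNIV. X (\<not> c) s (Y (\<not> c) l (g s)))" for l
        by (subst h2) (simp add: create_lin xy_commute)
      then have "A2 = (\<Sum>r\<in>UNIV. \<Sum>l\<in>UNIV. scalar (G c $ r $ l) * (lt c i r * (\<Sum>s\<in>UNIV. theta k (X (\<not> c) s (Y (\<not> c) l (g s))))))"
        by (simp add: A2_def theta_sum)
      also have "\<dots> \<doteq> (\<Sum>r\<in>UNIV. \<Sum>l\<in>UNIV. scalar (G c $ r $ l) * (lt c i r * (\<Sum>s\<in>UNIV. lt (\<not> c) s l * theta k' (g s) - theta (k' - 1) (lower (\<not> c) s l (g s)))))"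
        by (intro eqv_sum eqv_mult_left IH trl_g part_g)
      also have "\<dots> = (\<Sum>s\<in>UNIV. (\<Sum>r\<in>UNIV. \<Sum>l\<in>UNIV. scalar (G c $ r $ l) * (lt c i r * lt (\<not> c) s l)) * theta k' (g s))"
      proof -
        have z: "(\<Sum>s\<in>UNIV. lower (\<not> c) s l (g s)) = 0" for l
        proof -
          have w1: "xweight (\<lambda>_. 1) g = g" for g :: "'n bifun" by (simp add: fun_eq_iff xweight_def)
          have "(\<Sum>s\<in>UNIV. lower (\<not> c) s l (g s)) =
            xweight (D (\<not> c)) (yflat E (\<not> c) l (\<Sum>s\<in>UNIV. xflat G (\<not> c) s (xweight (\<lambda>_. 1) (xstrip (\<not> c) s h2))))"
            by (simp add: lower_def g_def op_lin D_def xy_commute w1)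
          then show ?thesis unfolding sum_xflat_strip[OF xh2] by (simp add: op_lin)
        qed
        have 0: "(\<Sum>s\<in>UNIV. theta (k' - 1) (lower (\<not> c) s l (g s))) = 0" for l
          using arg_cong[OF z[of l], of "theta (k' - 1)"] by (simp only: theta_sum theta_0)
        show ?thesis
          unfolding sum_subtractf 0 sum_distrib_right
          by (subst sum_swap3[symmetric]) (simp add: sum_distrib_left mult.assoc)
      qed
      also have "\<dots> \<doteq> (\<Sum>s\<in>UNIV. scalar (G c $ i $ s) * theta k' (g s))"
        by (intro eqv_sum eqv_mult_right yrel_eqv)
      also have "\<dots> = theta k' (\<Sum>s\<in>UNIV. G c $ i $ s *\<^sub>f g s)" by (simp add: theta_lin)
      also have "(\<Sum>s\<in>UNIV. G c $ i $ s *\<^sub>f g s) = xflat G c i h2" by (simp add: g_def xflat_def)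
      also have "\<dots> = yweight (D c) (xflat G c i (yflat E c j f))" by (simp add: h2_def xy_commute)
      also have "\<dots> = lower c i j f"
        unfolding lower_def D_def using weight_same_cols[OF same_cols_flat[OF t(3)]] by simp
      finally show ?thesis .
    qed
    \<comment> \<open>Both corrections at once. The relations contract the two generators to the
      loop value, and the lower terms of the induction hypothesis reassemble to \<open>h\<close>
      with the weight \<open>w\<close>. The difference is the Wenzl coefficient, which cancels the
      second damping in \<open>h\<close>.\<close>
    have A3: "A3 \<doteq> theta k' (lower c i j f)"
    proof -
      have sl: "same_cols (lower c i j f)" using trl_D(3)[OF trl_lower[OF less.prems(1)]] .
      have h_eq: "h = xweight (D c) (lower c i j f)"
        unfolding h_def by (rule weight_same_cols[OF sl, symmetric])
      have trl_h: "trl h" unfolding h_eq by (intro bitraceless_weight trl_lower less.prems)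
      have part_h: "part k' h = h"
        unfolding h_eq xweight_commute[of _ "D c"] part_lower[OF f] ..
      \<comment> \<open>The subtracted term in the recursion of \<open>wenzl\<close>.\<close>
      define w where "w cs = (if cs \<noteq> [] \<and> hd cs = c then D (\<not> c) (tl cs) else 0)" for cs
      have "A3 \<doteq> (\<Sum>m\<in>UNIV. \<Sum>r\<in>UNIV. \<Sum>l\<in>UNIV. \<Sum>l'\<in>UNIV. scalar (E c $ m $ l * G c $ r $ l') *
          (lt c m r * (lt (\<not> c) l l' * theta k' h - theta (k' - 1) (lower (\<not> c) l l' h))))"
        unfolding A3_def by (intro eqv_sum eqv_mult_left IH trl_h part_h)
      also have "\<dots> = (\<Sum>m\<in>UNIV. \<Sum>r\<in>UNIV. \<Sum>l\<in>UNIV. \<Sum>l'\<in>UNIV. scalar (E c $ m $ l * G c $ r $ l') * (lt c m r * lt (\<not> c) l l')) * theta k' h -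
          (\<Sum>m\<in>UNIV. \<Sum>r\<in>UNIV. lt c m r * (\<Sum>l\<in>UNIV. \<Sum>l'\<in>UNIV. scalar (E c $ m $ l * G c $ r $ l') * theta (k' - 1) (lower (\<not> c) l l' h)))"
        by (simp add: right_diff_distrib sum_subtractf sum_distrib_left sum_distrib_right mult.assoc scalar_left_commute)
      also have "(\<Sum>m\<in>UNIV. \<Sum>r\<in>UNIV. lt c m r * (\<Sum>l\<in>UNIV. \<Sum>l'\<in>UNIV. scalar (E c $ m $ l * G c $ r $ l') * theta (k' - 1) (lower (\<not> c) l l' h))) =
        theta k' (xweight w h)"
      proof -
        have 1: "(\<Sum>l\<in>UNIV. \<Sum>l'\<in>UNIV. scalar (E c $ m $ l * G c $ r $ l') * theta (k' - 1) (lower (\<not> c) l l' h)) =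
          theta (k' - 1) (xweight (D (\<not> c)) (xstrip c m (ystrip c r h)))" for m r
        proof -
          have "xweight (D (\<not> c)) (xstrip c m (ystrip c r h)) =
            (\<Sum>l\<in>UNIV. \<Sum>l'\<in>UNIV. (E c $ m $ l * G c $ r $ l') *\<^sub>f lower (\<not> c) l l' h)"
            unfolding xflat_inverse[of c m, symmetric] yflat_inverse[of c r, symmetric]
            by (simp add: op_lin lower_def D_def bifun.scale_sum_right)
          then show ?thesis by (simp add: theta_lin)
        qed
        show ?thesis
        proof (cases k')
          case 0
          have "h xs ys = 0" if "xs \<noteq> []" for xs ys
            using arg_cong[OF part_h, of "\<lambda>h. h xs ys"] that by (simp add: 0 xweight_def)
          then have "xstrip c m (ystrip c r h) = 0" for m r
            by (simp add: fun_eq_iff xstrip_def ystrip_def zero_fun_apply)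
          then show ?thesis unfolding 1 by (simp add: 0 op_lin xweight_def w_def zero_fun_apply)
        next
          case (Suc k'')
          have "xstrip (\<not> c) m (ystrip (\<not> c) r (xweight w h)) = 0" for m r
            by (auto simp: fun_eq_iff xstrip_def ystrip_def zero_fun_apply xweight_def w_def)
          moreover have "xstrip c m (ystrip c r (xweight w h)) = xweight (D (\<not> c)) (xstrip c m (ystrip c r h))" for m r
            by (auto simp: fun_eq_iff xstrip_def ystrip_def xweight_def w_def)
          ultimately have "theta k' (xweight w h) = (\<Sum>m\<in>UNIV. \<Sum>r\<in>UNIV. lt c m r * theta k'' (xweight (D (\<not> c)) (xstrip c m (ystrip c r h))))"
            unfolding Suc theta.simps split by simp
          then show ?thesis unfolding 1 by (simp add: Suc)
        qed
      qed
      also have "(\<Sum>m\<in>UNIV. \<Sum>r\<in>UNIV. \<Sum>l\<in>UNIV. \<Sum>l'\<in>UNIV. scalar (E c $ m $ l * G c $ r $ l') * (lt c m r * lt (\<not> c) l l')) * theta k' h - theta k' (xweight w h) \<doteq>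
        scalar (\<delta> c) * theta k' h - theta k' (xweight w h)"
      proof (intro eqv_diff eqv_mult_right)
        have "(\<Sum>m\<in>UNIV. \<Sum>r\<in>UNIV. \<Sum>l\<in>UNIV. \<Sum>l'\<in>UNIV. scalar (E c $ m $ l * G c $ r $ l') * (lt c m r * lt (\<not> c) l l')) =
          (\<Sum>r\<in>UNIV. \<Sum>l'\<in>UNIV. scalar (G c $ r $ l') * (\<Sum>m\<in>UNIV. \<Sum>l\<in>UNIV. scalar (E c $ m $ l) * (lt c m r * lt (\<not> c) l l')))"
        proof -
          define B where "B m r l' = (\<Sum>l\<in>UNIV. scalar (E c $ m $ l) * (lt c m r * lt (\<not> c) l l'))" for m r l'
          have B: "(\<Sum>l\<in>UNIV. \<Sum>l'\<in>UNIV. scalar (E c $ m $ l * G c $ r $ l') * (lt c m r * lt (\<not> c) l l')) =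
            (\<Sum>l'\<in>UNIV. scalar (G c $ r $ l') * B m r l')" for m r
            unfolding sum_distrib_left B_def
            by (subst sum.swap) (simp add: scalar_mult mult.assoc scalar_left_commute[of "scalar (E _ $ _ $ _)"])
          show ?thesis
            unfolding B unfolding B_def[symmetric] unfolding sum_distrib_left by (rule sum_swap3[symmetric])
        qed
        also have "\<dots> \<doteq> (\<Sum>r\<in>UNIV. \<Sum>l'\<in>UNIV. scalar (G c $ r $ l') * scalar (E c $ r $ l'))"
          by (intro eqv_sum eqv_mult_left xrel_eqv)
        also have "\<dots> = scalar (\<delta> c)" by (simp add: loop_value_def scalar_sum mult.commute flip: scalar_mult)
        finally show "(\<Sum>m\<in>UNIV. \<Sum>r\<in>UNIV. \<Sum>l\<in>UNIV. \<Sum>l'\<in>UNIV. scalar (E c $ m $ l * G c $ r $ l') * (lt c m r * lt (\<not> c) l l')) \<doteq> scalar (\<delta> c)" .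
      qed simp
      also have "scalar (\<delta> c) * theta k' h - theta k' (xweight w h) = theta k' (\<delta> c *\<^sub>f h - xweight w h)"
        by (simp add: theta_lin)
      also have "\<delta> c *\<^sub>f h - xweight w h = xweight (wenzl \<delta> c) h"
      proof (intro ext)
        fix xs ys
        have wz: "wenzl \<delta> c cs = \<delta> c - w cs" for cs by (cases cs) (auto simp: w_def D_def damping_def)
        show "(\<delta> c *\<^sub>f h - xweight w h) xs ys = xweight (wenzl \<delta> c) h xs ys"
          by (simp add: scale_fun_apply xweight_def wz left_diff_distrib)
      qed
      also have "xweight (wenzl \<delta> c) h = lower c i j f"
        unfolding h_eq D_def xweight_commute[of "wenzl \<delta> c"] by (rule damping_wenzl)
      finally show ?thesis .
    qed
    have "theta (Suc k) (X c i (Y c j f)) \<doteq> lt c i j * theta k f - theta k' (lower c i j f) - theta k' (lower c i j f) + theta k' (lower c i j f)"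
      unfolding expand by (intro eqv_add eqv_diff A1 A2 A3) simp
    then show ?thesis by (simp add: Suc)
  qed
qed

lemma theta_letter:
  assumes "trl f" "part k f = f"
  shows "theta (Suc k) (X c i (Y c j f)) + theta (k - 1) (lower c i j f) \<doteq> lt c i j * theta k f"
  using eqv_add[OF theta_create[OF assms] eqv_refl, of c i j "theta (k - 1) (lower c i j f)"] by simp

text \<open>All degrees below \<open>K\<close>, as a substitute for a sum over all degrees; by
  \<open>Theta_eq\<close> every bound on the degree of \<open>f\<close> gives the same
  value.\<close>

definition Theta :: "nat \<Rightarrow> 'n bifun \<Rightarrow> 'n generator free_algebra" where
  "Theta K f = (\<Sum>k<K. theta k f)"

lemma Theta_hom:
  assumes "part k f = f"
  shows "Theta K f = (if k < K then theta k f else 0)"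
proof -
  have "Theta K f = (\<Sum>m<K. if m = k then theta k f else 0)"
    unfolding Theta_def by (rule sum.cong) (auto simp: theta_hom[OF assms])
  then show ?thesis by simp
qed

lemma Theta_sum: "Theta K (sum h A) = (\<Sum>x\<in>A. Theta K (h x))"
  unfolding Theta_def theta_sum by (rule sum.swap)

lemma Theta_add: "Theta K (f + g) = Theta K f + Theta K g"
  by (simp add: Theta_def theta_add sum.distrib)

lemma part_part: "part k (part k f) = part k f"
  by (auto simp: fun_eq_iff xweight_def)

lemma sum_parts:
  assumes "deg_less K f"
  shows "f = (\<Sum>k<K. part k f)"
proof (intro ext)
  fix xs ys
  have "(\<Sum>k<K. part k f xs ys) = (\<Sum>k<K. if k = length xs then f xs ys else 0)"
    by (rule sum.cong) (auto simp: xweight_def)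
  also have "\<dots> = f xs ys" using assms by (auto simp: deg_less_def)
  finally show "f xs ys = (\<Sum>k<K. part k f) xs ys" by (simp add: sum_fun_apply)
qed

lemma Theta_letter:
  assumes "trl f" "deg_less K f"
  shows "Theta (Suc K) (L c i j f) \<doteq> lt c i j * Theta K f"
proof -
  have *: "Theta (Suc K) (L c i j (part k f)) \<doteq> lt c i j * theta k f" if "k < K" for k
  proof -
    let ?f = "part k f"
    have t: "trl ?f" by (rule bitraceless_weight[OF assms(1)])
    have "Theta (Suc K) (X c i (Y c j ?f)) = theta (Suc k) (X c i (Y c j ?f))"
      using Theta_hom[OF part_create[of k ?f c i j, OF part_part], of "Suc K"] that by simp
    moreover have "Theta (Suc K) (lower c i j ?f) = theta (k - 1) (lower c i j ?f)"
    proof (cases k)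
      case 0
      have "lower c i j ?f = 0"
        unfolding lower_def lower_part_0(2)[OF t, unfolded 0, OF part_part] 0 by (simp only: op_lin)
      then show ?thesis by (simp add: Theta_def)
    next
      case (Suc k')
      then show ?thesis using Theta_hom[OF part_lower[of k' "part (Suc k') f" c i j, OF part_part], of "Suc K"] that by simp
    qed
    ultimately have "Theta (Suc K) (L c i j ?f) = theta (Suc k) (X c i (Y c j ?f)) + theta (k - 1) (lower c i j ?f)"
      by (simp add: lact_eq Theta_add)
    also have "\<dots> \<doteq> lt c i j * theta k ?f" by (rule theta_letter[OF t part_part])
    finally show ?thesis by (simp add: theta_part)
  qed
  have "Theta (Suc K) (L c i j f) = (\<Sum>k<K. Theta (Suc K) (L c i j (part k f)))"
    by (subst sum_parts[OF assms(2)]) (simp only: lact_gen_lin Theta_sum)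
  also have "\<dots> \<doteq> (\<Sum>k<K. lt c i j * theta k f)" by (intro eqv_sum *) simp
  finally show ?thesis by (simp add: Theta_def sum_distrib_left)
qed

lemma traceless_vac: "traceless M (\<lambda>xs. if xs = [] then a else 0)"
  unfolding traceless_def by simp

lemma trl_vac: "trl vac"
proof -
  have "vac = (\<lambda>xs ys. if xs = [] then if ys = [] then 1 else 0 else 0)"
    "vac = (\<lambda>xs ys. if ys = [] then if xs = [] then 1 else 0 else 0)"
    by (auto simp: vac_def fun_eq_iff)
  note v = this
  have "xtraceless G vac" unfolding xtraceless_def v(1) by (intro allI traceless_vac)
  moreover have "ytraceless E vac" unfolding ytraceless_def v(2) by (intro allI traceless_vac)
  ultimately show ?thesis by (auto simp: bitraceless_def same_cols_def vac_def)
qed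

text \<open>A word is recovered, modulo the ideal, from its action on the vacuum. Tracelessness and
  the bound on the degree are carried along because \<open>Theta_letter\<close> asks for
  them.\<close>

lemma act_word:
  "trl (act F (prod_list (map Defs.gen gs)) vac) \<and> deg_less (Suc (length gs)) (act F (prod_list (map Defs.gen gs)) vac) \<and>
   Theta (Suc (length gs)) (act F (prod_list (map Defs.gen gs)) vac) \<doteq> prod_list (map Defs.gen gs)"
proof (induction gs)
  case Nil
  have "deg_less (Suc 0) vac" by (simp add: deg_less_def vac_def)
  moreover have "Theta (Suc 0) vac = 1" by (simp add: Theta_def vac_def)
  ultimately show ?case using trl_vac by simp
next
  case (Cons g gs)
  obtain c i j where g: "g = letter c i j" by (rule generator_exhaust)
  let ?f = "act F (prod_list (map Defs.gen gs)) vac"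
  have IH: "trl ?f" "deg_less (Suc (length gs)) ?f" "Theta (Suc (length gs)) ?f \<doteq> prod_list (map Defs.gen gs)"
    using Cons by auto
  have e: "act F (prod_list (map Defs.gen (g # gs))) vac = L c i j ?f"
    by (simp add: g act_mult act_lt)
  have "Theta (Suc (Suc (length gs))) (L c i j ?f) \<doteq> lt c i j * Theta (Suc (length gs)) ?f"
    by (rule Theta_letter[OF IH(1,2)])
  also have "\<dots> \<doteq> lt c i j * prod_list (map Defs.gen gs)" by (rule eqv_mult_left[OF IH(3)])
  finally show ?case
    unfolding e using bitraceless_lact_gen[OF IH(1)] deg_less_lact_gen[OF IH(2)] by (simp add: g)
qed

lemma trl_act_vac: "trl (act F x vac)"
proof (induction x rule: free_algebra_induct)
  case zero
  then show ?case using bitraceless_scale[OF trl_vac, of 0] by simp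
next
  case (add x y)
  then show ?case by (simp add: act_add bitraceless_add)
next
  case (mult a gs)
  then show ?case using act_word by (simp add: act_mult act_scalar bitraceless_scale)
qed

lemma Theta_eq: "deg_less K f \<Longrightarrow> K \<le> K' \<Longrightarrow> Theta K' f = Theta K f"
proof -
  assume *: "deg_less K f" "K \<le> K'"
  have "Theta K' f = (\<Sum>k<K. Theta K' (part k f))"
    using arg_cong[OF sum_parts[OF *(1)], of "Theta K'"] by (simp add: Theta_sum)
  also have "\<dots> = (\<Sum>k<K. Theta K (part k f))"
    using *(2) by (intro sum.cong) (simp_all add: Theta_hom[OF part_part])
  also have "\<dots> = Theta K f"
    using arg_cong[OF sum_parts[OF *(1)], of "Theta K"] by (simp add: Theta_sum)
  finally show ?thesis .
qed

lemma Theta_act: "\<exists>K. deg_less K (act F x vac) \<and> Theta K (act F x vac) \<doteq> x"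
proof (induction x rule: free_algebra_induct)
  case zero
  have "deg_less 0 (0 :: 'n bifun)" by (simp add: deg_less_def zero_fun_apply)
  moreover have "Theta 0 0 \<doteq> 0" by (simp add: Theta_def)
  ultimately show ?case unfolding act_0 by blast
next
  case (add x y)
  then obtain K K' where *: "deg_less K (act F x vac)" "Theta K (act F x vac) \<doteq> x"
    "deg_less K' (act F y vac)" "Theta K' (act F y vac) \<doteq> y" by blast
  let ?K = "max K K'"
  have "deg_less ?K (act F (x + y) vac)"
    unfolding act_add
    by (rule deg_less_add[OF deg_less_mono[OF *(1)] deg_less_mono[OF *(3)]]) simp_all
  moreover have "Theta ?K (act F (x + y) vac) \<doteq> x + y"
    unfolding act_add Theta_add Theta_eq[OF *(1) max.cobounded1] Theta_eq[OF *(3) max.cobounded2]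
    by (rule eqv_add[OF *(2,4)])
  ultimately show ?case by blast
next
  case (mult a gs)
  let ?x = "prod_list (map Defs.gen gs)"
  have "Theta K (a *\<^sub>f f) = scalar a * Theta K f" for K f
    by (simp add: Theta_def theta_scale sum_distrib_left)
  then have "Theta (Suc (length gs)) (act F (scalar a * ?x) vac) \<doteq> scalar a * ?x"
    using act_word[of gs] eqv_mult_left by (simp add: act_mult act_scalar)
  moreover have "deg_less (Suc (length gs)) (act F (scalar a * ?x) vac)"
    using act_word[of gs] by (simp add: act_mult act_scalar deg_less_scale)
  ultimately show ?case by blast
qed

lemma trl_act: "trl f \<Longrightarrow> trl (act F x f)"
proof (induction x rule: free_algebra_induct)
  case zero
  then show ?case using bitraceless_scale[of E G f 0] by simp
next
  case (add x y)
  then show ?case by (simp add: act_add bitraceless_add)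
next
  case (mult a gs)
  have "trl (act F (prod_list (map Defs.gen gs)) f)"
  proof (induction gs)
    case (Cons g gs)
    obtain c i j where g: "g = letter c i j" by (rule generator_exhaust)
    show ?case using Cons by (simp add: g act_mult act_lt bitraceless_lact_gen)
  qed (simp add: mult)
  then show ?case by (simp add: act_mult act_scalar bitraceless_scale)
qed

lemma act_xrel: "trl f \<Longrightarrow> act F (xrel F c i j) f = 0"
  using x_relation[of f c i j] by (simp add: xrel_def act_diff act_sum act_mult act_scalar act_lt)

lemma act_yrel: "trl f \<Longrightarrow> act F (yrel F c i j) f = 0"
  using y_relation[of f c i j] by (simp add: yrel_def act_diff act_sum act_mult act_scalar act_lt)

text \<open>The elements that annihilate all traceless functions form a two-sided ideal, whereas
  annihilating the vacuum is closed only under left multiplication; hence the quantification over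
  \<open>f\<close> in the proof.\<close>

lemma act_rel_ideal:
  assumes "x \<in> rel_ideal F" "trl f"
  shows "act F x f = 0"
proof -
  have "rel_ideal F \<subseteq> {x. \<forall>f. trl f \<longrightarrow> act F x f = 0}"
  proof (rule rel_ideal_minimal)
    show "relations F \<subseteq> {x. \<forall>f. trl f \<longrightarrow> act F x f = 0}"
    proof
      fix r assume "r \<in> relations F"
      from inv this have "act F r f = 0" if "trl f" for f
        using that by (cases rule: relations_cases)
          (simp_all add: act_xrel act_yrel act_sum act_mult act_scalar bitraceless_scale act_lin)
      then show "r \<in> {x. \<forall>f. trl f \<longrightarrow> act F x f = 0}" by blast
    qed
  qed (auto simp: act_add act_mult act_lin trl_act)
  with assms show ?thesis by auto
qed

text \<open>This solves the word problem. If \<open>x\<close> annihilates the vacuum, then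
  \<open>Theta_act\<close> says that \<open>x\<close> is congruent to \<open>Theta\<close> of the
  zero function.\<close>

lemma rel_ideal_iff: "x \<in> rel_ideal F \<longleftrightarrow> act F x vac = 0"
proof
  assume "act F x vac = 0"
  then obtain K where "Theta K 0 \<doteq> x" using Theta_act[of x] by auto
  then have "- x \<in> rel_ideal F" by (simp add: eqv_def Theta_def)
  then show "x \<in> rel_ideal F" using rel_ideal_uminus[of "- x" F] by simp
qed (rule act_rel_ideal[OF _ trl_vac])

text \<open>Every homogeneous traceless function comes from the algebra. Stripping and creating the
  first letters of both words is the identity on the words that start with the given colour, and the
  degree-lowering parts of the generators add up to contractions of a traceless function.\<close>

lemma act_theta:
  assumes "trl f"
  shows "act F (theta k f) vac = part k f"
  using assms
proof (induction k arbitrary: f)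
  case 0
  show ?case
  proof (intro ext)
    fix xs ys
    have "f [] ys = 0" if "ys \<noteq> []"
      using that trl_D(3)[OF 0] unfolding same_cols_def by (metis map_is_Nil_conv)
    then show "act F (theta 0 f) vac xs ys = part 0 f xs ys"
      by (auto simp: act_scalar scale_fun_apply vac_def xweight_def)
  qed
next
  case (Suc k)
  note t = trl_D[OF Suc.prems]
  define g where "g = part (Suc k) f"
  have tg: "trl g" unfolding g_def by (rule bitraceless_weight[OF Suc.prems])
  have strip: "part k (xstrip c i (ystrip c j f)) = xstrip c i (ystrip c j g)" for c i j
    by (auto simp: g_def fun_eq_iff xweight_def xstrip_def ystrip_def)
  have "trl (xstrip c i (ystrip c j f))" for c i j
    by (simp add: bitraceless_def xtraceless_strip xtraceless_y_ops ytraceless_ops t same_cols_strip)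
  then have "act F (theta (Suc k) f) vac = (\<Sum>c\<in>UNIV. \<Sum>i\<in>UNIV. \<Sum>j\<in>UNIV. L c i j (xstrip c i (ystrip c j g)))"
    by (simp add: act_sum act_mult act_lt Suc.IH strip)
  also have "\<dots> = (\<Sum>c\<in>UNIV. (\<Sum>i\<in>UNIV. \<Sum>j\<in>UNIV. X c i (Y c j (xstrip c i (ystrip c j g)))) +
      (\<Sum>i\<in>UNIV. \<Sum>j\<in>UNIV. lower c i j (xstrip c i (ystrip c j g))))"
    by (simp add: lact_eq sum.distrib)
  also have "\<dots> = (\<Sum>c\<in>UNIV. yweight (\<lambda>cs. if cs \<noteq> [] \<and> hd cs = c then 1 else 0) g)"
  proof (rule sum.cong[OF refl])
    fix c
    have "lower c i j (xstrip c i (ystrip c j g)) =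
        xweight (damping E G c) (yflat E c j (ystrip c j (xflat G c i (xweight (\<lambda>_. 1) (xstrip c i g)))))" for i j
    proof -
      have "xweight (\<lambda>_. 1) h = h" for h :: "'n bifun" by (simp add: fun_eq_iff xweight_def)
      then show ?thesis by (simp add: lower_def xy_commute)
    qed
    then have "(\<Sum>i\<in>UNIV. \<Sum>j\<in>UNIV. lower c i j (xstrip c i (ystrip c j g))) =
      (\<Sum>j\<in>UNIV. xweight (damping E G c) (yflat E c j (ystrip c j (\<Sum>i\<in>UNIV. xflat G c i (xweight (\<lambda>_. 1) (xstrip c i g))))))"
      by (simp only: op_lin) (rule sum.swap)
    then have 1: "(\<Sum>i\<in>UNIV. \<Sum>j\<in>UNIV. lower c i j (xstrip c i (ystrip c j g))) = 0"
      unfolding sum_xflat_strip[OF trl_D(1)[OF tg]] by (simp add: op_lin)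
    have "(\<Sum>i\<in>UNIV. \<Sum>j\<in>UNIV. X c i (Y c j (xstrip c i (ystrip c j g)))) =
      (\<Sum>j\<in>UNIV. Y c j (ystrip c j (\<Sum>i\<in>UNIV. X c i (xstrip c i g))))"
      by (subst sum.swap) (simp add: op_lin xy_commute)
    also have "\<dots> = (\<Sum>j\<in>UNIV. Y c j (ystrip c j (xweight (\<lambda>cs. if cs \<noteq> [] \<and> hd cs = c then 1 else 0) g)))"
      unfolding sum_xcreate_strip[OF trl_D(1)[OF tg]] ..
    also have "\<dots> = yweight (\<lambda>cs. if cs \<noteq> [] \<and> hd cs = c then 1 else 0) (xweight (\<lambda>cs. if cs \<noteq> [] \<and> hd cs = c then 1 else 0) g)"
      by (rule sum_ycreate_strip) (intro ytraceless_ops trl_D[OF tg])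
    also have "\<dots> = yweight (\<lambda>cs. if cs \<noteq> [] \<and> hd cs = c then 1 else 0) g"
      unfolding weight_same_cols[OF trl_D(3)[OF tg]] by (auto simp: fun_eq_iff yweight_def)
    finally show "(\<Sum>i\<in>UNIV. \<Sum>j\<in>UNIV. X c i (Y c j (xstrip c i (ystrip c j g)))) +
      (\<Sum>i\<in>UNIV. \<Sum>j\<in>UNIV. lower c i j (xstrip c i (ystrip c j g))) = yweight (\<lambda>cs. if cs \<noteq> [] \<and> hd cs = c then 1 else 0) g"
      unfolding 1 by simp
  qed
  also have "\<dots> = g"
  proof (intro ext)
    fix xs ys
    have "g xs [] = 0"
    proof (cases xs)
      case Nil
      then show ?thesis by (simp add: g_def xweight_def)
    next
      case (Cons x xs')
      then show ?thesis using trl_D(3)[OF tg] unfolding same_cols_def by (metis map_is_Nil_conv neq_Nil_conv)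
    qed
    then show "(\<Sum>c\<in>UNIV. yweight (\<lambda>cs. if cs \<noteq> [] \<and> hd cs = c then 1 else 0) g) xs ys = g xs ys"
      by (cases ys) (auto simp: sum_fun_apply plus_fun_apply yweight_def UNIV_bool)
  qed
  finally show ?case by (simp add: g_def)
qed

section \<open>Transport of exactness from the model to the algebra\<close>

lemma act_Theta:
  assumes "trl f" "deg_less K f"
  shows "act F (Theta K f) vac = f"
  unfolding Theta_def act_sum act_theta[OF assms(1)] by (rule sum_parts[OF assms(2), symmetric])

definition syzygy_elt :: "(bool \<Rightarrow> 'n generator free_algebra) \<Rightarrow> bool \<Rightarrow> 'n \<Rightarrow> 'n \<Rightarrow> 'n generator free_algebra" where
  "syzygy_elt g c m i = (\<Sum>l\<in>UNIV. scalar (syz_inv E G (\<not> c) m l) *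
     (\<Sum>r\<in>UNIV. scalar (G (\<not> c) $ i $ r) * (lt c l r * g (\<not> c)))) - scalar (G c $ m $ i) * g c"

lemma act_syzygy_elt: "act F (syzygy_elt g c m i) vac = syzygy (\<lambda>c. act F (g c) vac) c m i"
  by (simp add: syzygy_elt_def syzygy_def act_diff act_sum act_mult act_scalar act_lt)

text \<open>By \<open>rel_ideal_iff\<close> the equation modulo the ideal is an equation in the
  model. The finitely many entries have a common degree bound, so \<open>exact\<close> applies, and
  \<open>Theta\<close> brings its solution back.\<close>

lemma exact_elt:
  assumes "\<And>c i l. (\<Sum>j\<in>UNIV. lt (\<not> c) l j * a c i j) + (\<Sum>m\<in>UNIV. scalar (syz E G c l m) * a (\<not> c) m i) \<in> rel_ideal F"
  shows "\<exists>g. \<forall>c m i. a c m i \<doteq> syzygy_elt g c m i"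
proof -
  define b where "b c i j = act F (a c i j) vac" for c i j
  have "\<exists>K. \<forall>c i j. deg_less K (b c i j)"
  proof -
    define K where "K x = (SOME k. deg_less k (b (fst x) (fst (snd x)) (snd (snd x))))" for x
    have K: "deg_less (K (c, i, j)) (b c i j)" for c i j
      unfolding K_def fst_conv snd_conv b_def by (rule someI_ex) (use Theta_act in blast)
    have "deg_less (Max (range K)) (b c i j)" for c i j
      by (rule deg_less_mono[OF K]) simp
    then show ?thesis by blast
  qed
  then obtain K where K: "\<And>c i j. deg_less K (b c i j)" by blast
  have eq: "(\<Sum>j\<in>UNIV. L (\<not> c) l j (b c i j)) + (\<Sum>m\<in>UNIV. syz E G c l m *\<^sub>f b (\<not> c) m i) = 0" for c i l
    using assms[of c l i] unfolding rel_ideal_iff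
    by (simp add: act_add act_sum act_mult act_scalar act_lt b_def)
  obtain \<gamma> where \<gamma>: "\<And>c. trl (\<gamma> c)" "\<And>c. deg_less K (\<gamma> c)" "\<And>c m i. b c m i = syzygy \<gamma> c m i"
    using exact[of b K, OF _ K eq] trl_act_vac unfolding b_def by blast
  have "act F (Theta K (\<gamma> c)) vac = \<gamma> c" for c by (rule act_Theta[OF \<gamma>(1,2)])
  then have "act F (a c m i - syzygy_elt (\<lambda>c. Theta K (\<gamma> c)) c m i) vac = 0" for c m i
    using \<gamma>(3)[of c m i] by (simp add: act_diff act_syzygy_elt b_def)
  then have "a c m i \<doteq> syzygy_elt (\<lambda>c. Theta K (\<gamma> c)) c m i" for c m i
    unfolding eqv_def rel_ideal_iff .
  then show ?thesis by blast
qed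

lemma syzygy_elt_equation:
  "(\<Sum>j\<in>UNIV. lt (\<not> c) l j * syzygy_elt g c i j) + (\<Sum>m\<in>UNIV. scalar (syz E G c l m) * syzygy_elt g (\<not> c) m i) \<in> rel_ideal F"
  unfolding rel_ideal_iff
  using syzygy_equation[of "\<lambda>c. act F (g c) vac" c l i] trl_act_vac
  by (simp add: act_add act_sum act_mult act_scalar act_lt act_syzygy_elt)

lemma syzygy_elt_inj:
  assumes "\<And>c m i. syzygy_elt g c m i \<in> rel_ideal F"
  shows "g c \<in> rel_ideal F"
proof -
  obtain K K' where *: "deg_less K (act F (g True) vac)" "deg_less K' (act F (g False) vac)"
    using Theta_act by blast
  have "deg_less (max K K') (act F (g c) vac)" for c
    using deg_less_mono[OF *(1), of "max K K'"] deg_less_mono[OF *(2), of "max K K'"] by (cases c) simp_all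
  then show ?thesis
    using assms syzygy_inj[of "\<lambda>c. act F (g c) vac" "max K K'" c] trl_act_vac
    unfolding rel_ideal_iff act_syzygy_elt by blast
qed

end

section \<open>Hochschild cohomology from a free resolution\<close>

text \<open>The part of the Hochschild differential that does not involve the left action.\<close>

fun rdiff :: "('a :: semigroup_mult \<Rightarrow> complex) \<Rightarrow> ('a list \<Rightarrow> complex) \<Rightarrow> 'a list \<Rightarrow> complex" where
  "rdiff \<tau> f [] = 0"
| "rdiff \<tau> f [a] = f [] * \<tau> a"
| "rdiff \<tau> f (a # b # cs) = f ((a * b) # cs) - rdiff \<tau> (\<lambda>ys. f (a # ys)) (b # cs)"

lemma rdiff_add: "rdiff \<tau> (\<lambda>ys. f ys + g ys) as = rdiff \<tau> f as + rdiff \<tau> g as"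
proof (induction \<tau> f as arbitrary: g rule: rdiff.induct)
  case (3 \<tau> f a b cs)
  from 3[of "\<lambda>ys. g (a # ys)"] show ?case by simp
qed (simp_all add: distrib_right)

lemma rdiff_scale: "rdiff \<tau> (\<lambda>ys. c * f ys) as = c * rdiff \<tau> f as"
  by (induction \<tau> f as rule: rdiff.induct) (simp_all add: algebra_simps)

lemma rdiff_0 [simp]: "rdiff \<tau> (\<lambda>ys. 0) as = 0"
  using rdiff_scale[of \<tau> 0 "\<lambda>_. 0" as] by simp

lemma rdiff_diff: "rdiff \<tau> (\<lambda>ys. f ys - g ys) as = rdiff \<tau> f as - rdiff \<tau> g as"
  using rdiff_add[of \<tau> f "\<lambda>ys. - 1 * g ys" as] by (simp only: rdiff_scale) simp

lemma rdiff_sum: "rdiff \<tau> (\<lambda>ys. \<Sum>s\<in>S. f s ys) as = (\<Sum>s\<in>S. rdiff \<tau> (f s) as)"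
  by (induction S rule: infinite_finite_induct) (simp_all add: rdiff_add)

text \<open>The part of the square of the differential that does not see the left action: of all
  terms only the product of the leading two arguments survives. Associativity and, for the last
  argument, multiplicativity of \<open>\<tau>\<close> are what is used.\<close>

lemma rdiff_rdiff:
  assumes "\<And>a b. \<tau> (a * b) = \<tau> a * \<tau> b"
  shows "rdiff \<tau> (\<lambda>ys. rdiff \<tau> f (a # ys)) (b # cs) = rdiff \<tau> f ((a * b) # cs)"
proof (induction cs arbitrary: f a b)
  case (Cons c cs)
  show ?case by (simp add: Cons rdiff_diff mult.assoc)
qed (simp add: assms mult.assoc)

text \<open>Multilinear functions on the quotient by \<open>I\<close>, read on representatives.
  Lists of a wrong length get the value 0, so that sums and differentials need no restriction of
  domains. The recursion over the first argument matches that of \<open>rdiff\<close>.\<close>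

primrec multilin :: "'g free_algebra set \<Rightarrow> nat \<Rightarrow> ('g free_algebra list \<Rightarrow> complex) \<Rightarrow> bool" where
  "multilin I 0 f \<longleftrightarrow> (\<forall>as. as \<noteq> [] \<longrightarrow> f as = 0)"
| "multilin I (Suc k) f \<longleftrightarrow> f [] = 0 \<and> (\<forall>a. multilin I k (\<lambda>as. f (a # as))) \<and>
     (\<forall>a b as. f ((a + b) # as) = f (a # as) + f (b # as)) \<and>
     (\<forall>c a as. f ((scalar c * a) # as) = c * f (a # as)) \<and> (\<forall>a\<in>I. \<forall>as. f (a # as) = 0)"

lemma multilin_length: "multilin I k f \<Longrightarrow> length as \<noteq> k \<Longrightarrow> f as = 0"
proof (induction k arbitrary: f as)
  case (Suc k)
  then show ?case
  proof (cases as)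
    case (Cons a as')
    have "multilin I k (\<lambda>as. f (a # as))" using Suc.prems by simp
    from Suc.IH[OF this] show ?thesis using Suc.prems(2) Cons by simp
  qed simp
qed auto

lemma multilin_add: "multilin I k f \<Longrightarrow> multilin I k g \<Longrightarrow> multilin I k (\<lambda>as. f as + g as)"
  by (induction k arbitrary: f g) (simp_all add: algebra_simps)

lemma multilin_scale: "multilin I k f \<Longrightarrow> multilin I k (\<lambda>as. c * f as)"
  by (induction k arbitrary: f) (simp_all add: algebra_simps)

lemma multilin_0: "multilin I k (\<lambda>as. 0)"
  by (induction k) simp_all

lemma multilin_diff: "multilin I k f \<Longrightarrow> multilin I k g \<Longrightarrow> multilin I k (\<lambda>as. f as - g as)"
  using multilin_add[OF _ multilin_scale[of I k g "- 1"], of f] by simp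

lemma multilin_sum: "(\<And>s. s \<in> S \<Longrightarrow> multilin I k (f s)) \<Longrightarrow> multilin I k (\<lambda>as. \<Sum>s\<in>S. f s as)"
  by (induction S rule: infinite_finite_induct) (simp_all add: multilin_0 multilin_add)

locale free_algebra_character =
  fixes I :: "'g free_algebra set" and \<tau> :: "'g free_algebra \<Rightarrow> complex"
  assumes \<tau>_mult: "\<tau> (x * y) = \<tau> x * \<tau> y" and \<tau>_add: "\<tau> (x + y) = \<tau> x + \<tau> y"
    and \<tau>_scalar: "\<tau> (scalar c) = c" and \<tau>_I: "x \<in> I \<Longrightarrow> \<tau> x = 0"
begin

lemma \<tau>_0: "\<tau> 0 = 0" using \<tau>_scalar[of 0] by simp
lemma \<tau>_1: "\<tau> 1 = 1" using \<tau>_scalar[of 1] by simp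
lemma \<tau>_sum: "\<tau> (sum f A) = (\<Sum>x\<in>A. \<tau> (f x))"
  by (induction A rule: infinite_finite_induct) (simp_all add: \<tau>_add \<tau>_0)
lemma \<tau>_uminus: "\<tau> (- x) = - \<tau> x" using \<tau>_add[of x "- x"] by (simp add: \<tau>_0 eq_neg_iff_add_eq_0 add.commute)
lemma \<tau>_diff: "\<tau> (x - y) = \<tau> x - \<tau> y" using \<tau>_add[of x "- y"] by (simp add: \<tau>_uminus)

lemma multilin_rdiff:
  assumes I: "\<And>a b. a \<in> I \<Longrightarrow> a * b \<in> I" "\<And>a b. b \<in> I \<Longrightarrow> a * b \<in> I"
  shows "multilin I k f \<Longrightarrow> multilin I (Suc k) (rdiff \<tau> f)"
proof (induction k arbitrary: f)
  case 0
  have "rdiff \<tau> f (a # b # cs) = 0" for a b cs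
  proof -
    have "(\<lambda>ys. f (a # ys)) = (\<lambda>ys. 0)" using 0 by auto
    then show ?thesis using 0 by simp
  qed
  then have z: "rdiff \<tau> f (a # as) = (if as = [] then f [] * \<tau> a else 0)" for a as
    by (cases as) auto
  show ?case by (simp add: z \<tau>_add \<tau>_mult \<tau>_scalar \<tau>_I algebra_simps)
next
  case (Suc k)
  have f0: "f [] = 0" and fm: "\<And>a. multilin I k (\<lambda>as. f (a # as))"
    and fa: "\<And>a b as. f ((a + b) # as) = f (a # as) + f (b # as)"
    and fs: "\<And>c a as. f ((scalar c * a) # as) = c * f (a # as)"
    and fI: "\<And>a as. a \<in> I \<Longrightarrow> f (a # as) = 0"
    using Suc.prems by simp_all
  have IH: "multilin I (Suc k) (rdiff \<tau> (\<lambda>as. f (a # as)))" for a by (rule Suc.IH[OF fm])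
  define g where "g a as = (case as of [] \<Rightarrow> 0 | b # bs \<Rightarrow> f ((a * b) # bs) - rdiff \<tau> (\<lambda>ys. f (a # ys)) (b # bs))" for a as
  have g: "rdiff \<tau> f (a # as) = g a as" for a as by (cases as) (simp_all add: f0 g_def)
  have "multilin I (Suc k) (g a)" for a
    using IH[of a] fm fa fs fI I(2)
    by (auto simp: g_def distrib_left scalar_left_commute algebra_simps intro!: multilin_diff)
  moreover have "g (a + b) as = g a as + g b as" for a b as
    by (cases as) (simp_all add: g_def fa distrib_right rdiff_add)
  moreover have "g (scalar c * a) as = c * g a as" for c a as
    by (cases as) (simp_all add: g_def fs mult.assoc rdiff_scale right_diff_distrib)
  moreover have "g a as = 0" if "a \<in> I" for a as
    using that by (cases as) (simp_all add: g_def fI I(1))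
  ultimately show ?case by (subst multilin.simps) (simp add: g del: multilin.simps)
qed

end

definition unit_vec_at :: "'s \<Rightarrow> 's \<Rightarrow> 'a :: zero_neq_one" where
  "unit_vec_at s r = (if r = s then 1 else 0)"

definition fscale :: "complex \<Rightarrow> ('s \<Rightarrow> complex) \<Rightarrow> 's \<Rightarrow> complex" where
  "fscale c g = (\<lambda>s. c * g s)"

interpretation fvec: vector_space fscale
  by unfold_locales (auto simp: fscale_def fun_eq_iff algebra_simps plus_fun_apply)

definition tscale :: "complex \<Rightarrow> ('s \<Rightarrow> 'g free_algebra) \<Rightarrow> 's \<Rightarrow> 'g free_algebra" where
  "tscale c x = (\<lambda>s. scalar c * x s)"

interpretation tvec: vector_space tscale
  by unfold_locales (auto simp: tscale_def fun_eq_iff algebra_simps scalar_add scalar_mult plus_fun_apply)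

type_synonym ('s, 'g) cofun = "('s \<Rightarrow> 'g free_algebra) \<Rightarrow> 'g free_algebra list \<Rightarrow> complex"

text \<open>The matrices \<open>M p\<close>, acting from the left on columns, form a complex of free right modules over the
  quotient by \<open>I\<close> that resolves the right module \<open>\<complex>\<close> given by \<open>\<epsilon>\<close>; everything is stated in the free algebra,
  modulo \<open>I\<close>. A \<open>cochain p k\<close> is an element of the double complex of \<open>k\<close>-linear maps from
  the \<open>p\<close>-th module to \<open>\<complex>\<close>.\<close>

locale resolution = \<tau>: free_algebra_character I \<tau> + \<epsilon>: free_algebra_character I \<epsilon>
  for I :: "'g free_algebra set" and \<tau> \<epsilon> :: "'g free_algebra \<Rightarrow> complex" +
  fixes J :: "nat \<Rightarrow> 's set" and M :: "nat \<Rightarrow> 's \<Rightarrow> 's \<Rightarrow> 'g free_algebra" and s0 :: 's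
  assumes I_0: "0 \<in> I" and I_add: "x \<in> I \<Longrightarrow> y \<in> I \<Longrightarrow> x + y \<in> I"
    and I_left: "x \<in> I \<Longrightarrow> a * x \<in> I" and I_right: "x \<in> I \<Longrightarrow> x * a \<in> I"
    and finite_J: "finite (J p)" and J_0: "J 0 = {s0}"
    and exact_0: "\<epsilon> z = 0 \<longleftrightarrow> (\<exists>y. z - (\<Sum>s\<in>J 1. M 1 s0 s * y s) \<in> I)"
    and exact_Suc: "(\<forall>r\<in>J p. (\<Sum>s\<in>J (Suc p). M (Suc p) r s * v s) \<in> I) \<longleftrightarrow>
       (\<exists>y. \<forall>s\<in>J (Suc p). v s - (\<Sum>s'\<in>J (Suc (Suc p)). M (Suc (Suc p)) s s' * y s') \<in> I)"
begin

section \<open>The columns of the double complex\<close>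

definition D :: "nat \<Rightarrow> ('s \<Rightarrow> 'g free_algebra) \<Rightarrow> 's \<Rightarrow> 'g free_algebra" where
  "D p x r = (\<Sum>s\<in>J p. M p r s * x s)"

lemma D_add: "D p (\<lambda>s. x s + y s) = (\<lambda>r. D p x r + D p y r)"
  by (simp add: D_def fun_eq_iff distrib_left sum.distrib)

lemma D_scale: "D p (\<lambda>s. scalar c * x s) = (\<lambda>r. scalar c * D p x r)"
  by (simp add: D_def fun_eq_iff sum_distrib_left scalar_left_commute)

lemma D_right: "D p (\<lambda>s. x s * a) = (\<lambda>r. D p x r * a)"
  by (simp add: D_def fun_eq_iff sum_distrib_right mult.assoc)

lemma D_I: "(\<And>s. s \<in> J p \<Longrightarrow> x s \<in> I) \<Longrightarrow> D p x r \<in> I"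
  unfolding D_def using finite_J[of p]
  by (induction rule: finite_induct) (auto simp: I_0 intro: I_add I_left)

lemma I_diff: "x \<in> I \<Longrightarrow> y \<in> I \<Longrightarrow> x - y \<in> I"
  using I_add[of x "- 1 * y"] I_left[of y "- 1"] by simp

definition cochain :: "nat \<Rightarrow> nat \<Rightarrow> ('s, 'g) cofun \<Rightarrow> bool" where
  "cochain p k F \<longleftrightarrow> (\<forall>x. multilin I k (F x)) \<and>
     (\<forall>x y as. F (\<lambda>s. x s + y s) as = F x as + F y as) \<and>
     (\<forall>c x as. F (\<lambda>s. scalar c * x s) as = c * F x as) \<and>
     (\<forall>x. (\<forall>s\<in>J p. x s \<in> I) \<longrightarrow> (\<forall>as. F x as = 0))"

lemma cochainD:
  assumes "cochain p k F"
  shows "multilin I k (F x)" "F (\<lambda>s. x s + y s) as = F x as + F y as"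
    "F (\<lambda>s. scalar c * x s) as = c * F x as" "(\<And>s. s \<in> J p \<Longrightarrow> x s \<in> I) \<Longrightarrow> F x as = 0"
  using assms by (auto simp: cochain_def)

lemma cochain_diff_arg:
  assumes "cochain p k F"
  shows "F (\<lambda>s. x s - y s) as = F x as - F y as"
  using cochainD(2)[OF assms, of x "\<lambda>s. scalar (- 1) * y s"] cochainD(3)[OF assms, of "- 1" y]
  by (simp add: scalar_uminus)

lemma cochain_cong:
  assumes "cochain p k F" "\<And>s. s \<in> J p \<Longrightarrow> x s - y s \<in> I"
  shows "F x as = F y as"
  using cochainD(4)[OF assms(1), of "\<lambda>s. x s - y s" as] assms(2) cochain_diff_arg[OF assms(1), of x y as] by simp

lemma cochain_sum_arg:
  assumes "cochain p k F" "finite S"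
  shows "F (\<lambda>s. \<Sum>i\<in>S. x i s) as = (\<Sum>i\<in>S. F (x i) as)"
  using assms(2)
proof (induction S rule: finite_induct)
  case empty
  then show ?case using cochainD(4)[OF assms(1), of "\<lambda>_. 0"] I_0 by simp
next
  case (insert i S)
  then show ?case using cochainD(2)[OF assms(1)] by simp
qed

lemma cochain_expand:
  assumes "cochain p k F"
  shows "F x as = (\<Sum>s\<in>J p. F (\<lambda>r. unit_vec_at s r * x s) as)"
proof -
  have "F x as = F (\<lambda>r. \<Sum>s\<in>J p. unit_vec_at s r * x s) as"
  proof (rule cochain_cong[OF assms])
    fix r assume "r \<in> J p"
    then have "(\<Sum>s\<in>J p. unit_vec_at s r * x s) = x r"
      by (simp add: unit_vec_at_def if_distrib[of "\<lambda>z. z * _"] finite_J cong: if_cong)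
    then show "x r - (\<Sum>s\<in>J p. unit_vec_at s r * x s) \<in> I" by (simp add: I_0)
  qed
  then show ?thesis by (simp add: cochain_sum_arg[OF assms finite_J])
qed

lemma cochain_diff: "cochain p k F \<Longrightarrow> cochain p k F' \<Longrightarrow> cochain p k (\<lambda>x as. F x as - F' x as)"
  by (auto simp: cochain_def algebra_simps intro: multilin_diff)

text \<open>The Hochschild differential in which an argument acts on a cochain from the left by
  composition with right multiplication on the free module.\<close>

definition dv :: "('s, 'g) cofun \<Rightarrow> ('s, 'g) cofun" where
  "dv F x as = (case as of [] \<Rightarrow> 0 | a # as' \<Rightarrow> F (\<lambda>s. x s * a) as' - rdiff \<tau> (F x) as)"

lemma dv_simps [simp]: "dv F x [] = 0" "dv F x (a # as) = F (\<lambda>s. x s * a) as - rdiff \<tau> (F x) (a # as)"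
  by (simp_all add: dv_def)

lemma dv_diff: "dv (\<lambda>x as. F x as - F' x as) x as = dv F x as - dv F' x as"
  by (cases as) (simp_all add: rdiff_diff)

lemma dv_dv: "dv (dv F) x as = 0"
proof (cases as)
  case (Cons a as')
  show ?thesis
  proof (cases as')
    case (Cons b bs)
    have "rdiff \<tau> (\<lambda>ys. dv F x (a # ys)) (b # bs) =
      rdiff \<tau> (F (\<lambda>s. x s * a)) (b # bs) - rdiff \<tau> (F x) ((a * b) # bs)"
      by (simp only: dv_simps rdiff_diff rdiff_rdiff[of \<tau>, OF \<tau>.\<tau>_mult])
    then show ?thesis by (simp add: \<open>as = a # as'\<close> Cons mult.assoc)
  qed (simp add: Cons)
qed simp

lemma cochain_dv:
  assumes "cochain p k F"
  shows "cochain p (Suc k) (dv F)"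
proof -
  note F = cochainD[OF assms]
  have m: "multilin I (Suc k) (rdiff \<tau> (F x))" for x
    by (rule \<tau>.multilin_rdiff[OF I_right I_left F(1)])
  have e: "dv F x (a # as) = F (\<lambda>s. x s * a) as - rdiff \<tau> (F x) (a # as)" for x a as by simp
  have "multilin I (Suc k) (dv F x)" for x
    using m[of x]
    by (auto intro!: multilin_diff F(1) simp: distrib_left F(2,3) F(4)[OF I_left] algebra_simps scalar_left_commute)
  moreover have "dv F (\<lambda>s. x s + y s) as = dv F x as + dv F y as" for x y as
  proof -
    have "F (\<lambda>s. x s + y s) = (\<lambda>as. F x as + F y as)" by (intro ext F(2))
    then show ?thesis by (cases as) (simp_all add: F(2) distrib_right rdiff_add)
  qed
  moreover have "dv F (\<lambda>s. scalar c * x s) as = c * dv F x as" for c x as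
  proof -
    have "F (\<lambda>s. scalar c * x s) = (\<lambda>as. c * F x as)" by (intro ext F(3))
    then show ?thesis by (cases as) (simp_all add: F(3) mult.assoc rdiff_scale right_diff_distrib)
  qed
  moreover have "dv F x as = 0" if "\<forall>s\<in>J p. x s \<in> I" for x as
  proof (cases as)
    case (Cons a as')
    have "F x = (\<lambda>_. 0)" by (intro ext F(4)) (use that in blast)
    moreover have "F (\<lambda>s. x s * a) = (\<lambda>_. 0)" by (intro ext F(4) I_right) (use that in blast)
    ultimately show ?thesis by (simp add: Cons)
  qed simp
  ultimately show ?thesis unfolding cochain_def by blast
qed

text \<open>The contracting homotopy that a basis provides: the coordinates of \<open>x\<close> are
  moved into the first argument.\<close>

definition sg :: "nat \<Rightarrow> ('s, 'g) cofun \<Rightarrow> ('s, 'g) cofun" where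
  "sg p F x as = (\<Sum>s\<in>J p. F (unit_vec_at s) (x s # as))"

lemma cochain_sg:
  assumes "cochain p (Suc k) F"
  shows "cochain p k (sg p F)"
proof -
  have m: "multilin I (Suc k) (F (unit_vec_at s))" for s by (rule cochainD(1)[OF assms])
  then have "multilin I k (sg p F x)" for x unfolding sg_def[abs_def] by (intro multilin_sum) simp
  then show ?thesis using m by (auto simp: cochain_def sg_def sum.distrib sum_distrib_left)
qed

text \<open>A column is acyclic in positive degrees because its module is free. Without arguments
  the defect is the map that is linear over the algebra and has the same values on the
  basis.\<close>

lemma homotopy:
  assumes "cochain p k F"
  shows "dv (sg p F) x as + sg p (dv F) x as =
    F x as - (if as = [] then (\<Sum>s\<in>J p. F (unit_vec_at s) [] * \<tau> (x s)) else 0)"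
proof (cases as)
  case Nil
  show ?thesis
    by (simp add: Nil sg_def sum_subtractf cochain_expand[OF assms, of x "[]"])
next
  case (Cons a as')
  have "sg p (dv F) x as = F x as - (\<Sum>s\<in>J p. F (unit_vec_at s) ((x s * a) # as') - rdiff \<tau> (\<lambda>ys. F (unit_vec_at s) (x s # ys)) (a # as'))"
    by (simp add: Cons sg_def sum_subtractf cochain_expand[OF assms, of x "a # as'"])
  moreover have "dv (sg p F) x as = (\<Sum>s\<in>J p. F (unit_vec_at s) ((x s * a) # as') - rdiff \<tau> (\<lambda>ys. F (unit_vec_at s) (x s # ys)) (a # as'))"
    by (simp add: Cons sg_def[abs_def] rdiff_sum sum_subtractf)
  ultimately show ?thesis using Cons by simp
qed

section \<open>The rows of the double complex\<close>

definition pull :: "nat \<Rightarrow> ('s, 'g) cofun \<Rightarrow> ('s, 'g) cofun" where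
  "pull p F y as = F (D (Suc p) y) as"

lemma cochain_pull:
  assumes "cochain p k F"
  shows "cochain (Suc p) k (pull p F)"
  using cochainD[OF assms] D_I unfolding cochain_def pull_def D_add D_scale by auto

lemma dv_pull: "dv (pull p F) = pull p (dv F)"
proof (intro ext)
  fix x as show "dv (pull p F) x as = pull p (dv F) x as"
    by (cases as) (simp_all add: pull_def[abs_def] D_right)
qed

text \<open>Cochains on the cokernel of the map that arrives at the \<open>p\<close>-th module. For
  \<open>p = 0\<close> the cokernel is the trivial module of \<open>\<epsilon>\<close>, and these
  are the Hochschild cochains, see \<open>zcochain_0_eq\<close>.\<close>

definition zcochain :: "nat \<Rightarrow> nat \<Rightarrow> ('s, 'g) cofun \<Rightarrow> bool" where
  "zcochain p k F \<longleftrightarrow> cochain p k F \<and> (\<forall>y as. pull p F y as = 0)"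

lemma pull_pull:
  assumes "cochain p k F"
  shows "pull (Suc p) (pull p F) y as = 0"
proof -
  have "\<exists>y'. \<forall>s\<in>J (Suc p). D (Suc (Suc p)) y s - D (Suc (Suc p)) y' s \<in> I"
    using I_0 by (intro exI[of _ y]) simp
  then have "\<forall>r\<in>J p. D (Suc p) (D (Suc (Suc p)) y) r \<in> I"
    using exact_Suc[of p "D (Suc (Suc p)) y"] unfolding D_def by blast
  then show ?thesis unfolding pull_def by (intro cochainD(4)[OF assms]) blast
qed

lemma zcochain_pull: "cochain p k F \<Longrightarrow> zcochain (Suc p) k (pull p F)"
  unfolding zcochain_def using cochain_pull pull_pull by blast

text \<open>A choice of preimages under \<open>D (Suc p)\<close> modulo \<open>I\<close>, wherever
  there are any, made linear over the complex numbers by choosing on a basis. Linearity over the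
  algebra is neither available nor needed, since cochains are only complex linear in
  \<open>x\<close>.\<close>

lemma section_exists:
  "\<exists>h. (\<forall>x y. h (\<lambda>s. x s + y s) = (\<lambda>s. h x s + h y s)) \<and>
    (\<forall>c x. h (\<lambda>s. scalar c * x s) = (\<lambda>s. scalar c * h x s)) \<and>
    (\<forall>x y. (\<forall>r\<in>J p. x r - D (Suc p) y r \<in> I) \<longrightarrow> (\<forall>r\<in>J p. x r - D (Suc p) (h x) r \<in> I))"
proof -
  define W where "W = {x. \<exists>y. \<forall>r\<in>J p. x r - D (Suc p) y r \<in> I}"
  define g where "g x = (SOME y. \<forall>r\<in>J p. x r - D (Suc p) y r \<in> I)" for x
  interpret vp: vector_space_pair "tscale :: _ \<Rightarrow> ('s \<Rightarrow> 'g free_algebra) \<Rightarrow> _" "tscale :: _ \<Rightarrow> ('s \<Rightarrow> 'g free_algebra) \<Rightarrow> _"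
    by unfold_locales
  obtain B where B: "B \<subseteq> W" "\<not> tvec.dependent B" "W \<subseteq> tvec.span B"
    using tvec.maximal_independent_subset[of W] by blast
  define h where "h = vp.construct B g"
  have h: "Vector_Spaces.linear tscale tscale h" unfolding h_def by (rule vp.linear_construct[OF B(2)])
  interpret h: Vector_Spaces.linear tscale tscale h by (rule h)
  have h_add: "h (\<lambda>s. x s + y s) = (\<lambda>s. h x s + h y s)" for x y
    using h.add[of x y] by (simp add: plus_fun_def)
  have h_scale: "h (\<lambda>s. scalar c * x s) = (\<lambda>s. scalar c * h x s)" for c x
    using h.scale[of c x] by (simp add: tscale_def)
  have gB: "\<forall>r\<in>J p. b r - D (Suc p) (h b) r \<in> I" if "b \<in> B" for b
  proof -
    have hb: "h b = g b" unfolding h_def by (rule vp.construct_basis[OF B(2) that])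
    have "\<exists>y. \<forall>r\<in>J p. b r - D (Suc p) y r \<in> I" using that B(1) by (auto simp: W_def)
    then show ?thesis unfolding hb g_def by (rule someI_ex)
  qed
  have "\<forall>r\<in>J p. x r - D (Suc p) (h x) r \<in> I" if "x \<in> tvec.span B" for x
  proof (rule tvec.span_induct[OF that, of "\<lambda>x. \<forall>r\<in>J p. x r - D (Suc p) (h x) r \<in> I"])
    show "tvec.subspace {x. \<forall>r\<in>J p. x r - D (Suc p) (h x) r \<in> I}"
    proof (rule tvec.subspaceI)
      have "h 0 = 0" by (rule h.zero)
      then show "0 \<in> {x. \<forall>r\<in>J p. x r - D (Suc p) (h x) r \<in> I}"
        by (simp add: D_def zero_fun_apply I_0)
    next
      fix x y assume *: "x \<in> {x. \<forall>r\<in>J p. x r - D (Suc p) (h x) r \<in> I}" "y \<in> {x. \<forall>r\<in>J p. x r - D (Suc p) (h x) r \<in> I}"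
      have "(x r + y r) - (D (Suc p) (h x) r + D (Suc p) (h y) r) \<in> I" if "r \<in> J p" for r
        using I_add[of "x r - D (Suc p) (h x) r" "y r - D (Suc p) (h y) r"] * that by (simp add: algebra_simps)
      then show "x + y \<in> {x. \<forall>r\<in>J p. x r - D (Suc p) (h x) r \<in> I}"
        unfolding plus_fun_def by (simp add: h_add D_add)
    next
      fix c x assume *: "x \<in> {x. \<forall>r\<in>J p. x r - D (Suc p) (h x) r \<in> I}"
      have "scalar c * x r - scalar c * D (Suc p) (h x) r \<in> I" if "r \<in> J p" for r
        using I_left[of "x r - D (Suc p) (h x) r" "scalar c"] * that by (simp add: algebra_simps)
      then show "tscale c x \<in> {x. \<forall>r\<in>J p. x r - D (Suc p) (h x) r \<in> I}"
        unfolding tscale_def by (simp add: h_scale D_scale)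
    qed
  qed (use gB in blast)
  then show ?thesis
    using h_add h_scale B(3) unfolding W_def by (intro exI[of _ h]) blast
qed

text \<open>The rows are exact. A cochain that vanishes on the image of the next map vanishes on the
  kernel of \<open>D (Suc p)\<close>, so composition with the section gives a factorization through
  \<open>D (Suc p)\<close>.\<close>

lemma horizontal_exact:
  assumes "zcochain (Suc p) k F"
  obtains E where "cochain p k E" "F = pull p E"
proof -
  have F: "cochain (Suc p) k F" and F0: "\<And>y as. F (D (Suc (Suc p)) y) as = 0"
    using assms by (auto simp: zcochain_def pull_def)
  obtain h where h': "\<forall>x y. h (\<lambda>s. x s + y s) = (\<lambda>s. h x s + h y s)"
    "\<forall>c x. h (\<lambda>s. scalar c * x s) = (\<lambda>s. scalar c * h x s)"
    "\<forall>x y. (\<forall>r\<in>J p. x r - D (Suc p) y r \<in> I) \<longrightarrow> (\<forall>r\<in>J p. x r - D (Suc p) (h x) r \<in> I)"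
    using section_exists[of p] by blast
  have h: "h (\<lambda>s. x s + y s) = (\<lambda>s. h x s + h y s)" "h (\<lambda>s. scalar c * x s) = (\<lambda>s. scalar c * h x s)"
    "(\<forall>r\<in>J p. x r - D (Suc p) y r \<in> I) \<Longrightarrow> (\<forall>r\<in>J p. x r - D (Suc p) (h x) r \<in> I)" for x y c
    using h' by blast+
  define E where "E x as = F (h x) as" for x as
  have ker: "F z as = 0" if "\<And>r. r \<in> J p \<Longrightarrow> D (Suc p) z r \<in> I" for z as
  proof -
    have "\<exists>y. \<forall>s\<in>J (Suc p). z s - D (Suc (Suc p)) y s \<in> I"
      using exact_Suc[of p z] that unfolding D_def by blast
    then obtain y where "\<forall>s\<in>J (Suc p). z s - D (Suc (Suc p)) y s \<in> I" by blast
    then show ?thesis using cochain_cong[OF F, of z "D (Suc (Suc p)) y" as] F0 by simp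
  qed
  have D0: "D (Suc p) (\<lambda>_. 0) = (\<lambda>_. 0)" by (simp add: D_def fun_eq_iff)
  have "E x as = 0" if "\<forall>s\<in>J p. x s \<in> I" for x as
    unfolding E_def
  proof (rule ker)
    fix r assume r: "r \<in> J p"
    have "x r - D (Suc p) (h x) r \<in> I"
      using h(3)[of x "\<lambda>_. 0"] that r by (simp add: D0)
    then show "D (Suc p) (h x) r \<in> I" using that r I_diff[of "x r" "x r - D (Suc p) (h x) r"] by simp
  qed
  then have "cochain p k E"
    unfolding cochain_def using cochainD(1-3)[OF F] by (auto simp: E_def[abs_def] h(1,2))
  moreover have "F y as = pull p E y as" for y as
  proof -
    have "F (\<lambda>s. y s - h (D (Suc p) y) s) as = 0"
    proof (rule ker)
      fix r assume r: "r \<in> J p"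
      have "D (Suc p) y r - D (Suc p) (h (D (Suc p) y)) r \<in> I"
        using h(3)[of "D (Suc p) y" y] r by (simp add: I_0)
      then show "D (Suc p) (\<lambda>s. y s - h (D (Suc p) y) s) r \<in> I"
        by (simp add: D_def right_diff_distrib sum_subtractf)
    qed
    then show ?thesis by (simp add: pull_def E_def cochain_diff_arg[OF F])
  qed
  ultimately show thesis using that[of E] by blast
qed

section \<open>Dimension shifting through the double complex\<close>

definition alpha :: "nat \<Rightarrow> ('s, 'g) cofun \<Rightarrow> ('s, 'g) cofun" where
  "alpha p F = pull p (sg p F)"

text \<open>The iterated connecting map: each step trades one argument for one step in the
  resolution. When no argument is left, only the values on the basis of the module in position
  \<open>p + q\<close> remain.\<close>

primrec psi :: "nat \<Rightarrow> nat \<Rightarrow> ('s, 'g) cofun \<Rightarrow> 's \<Rightarrow> complex" where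
  "psi 0 p F = (\<lambda>s. if s \<in> J p then F (unit_vec_at s) [] else 0)"
| "psi (Suc q) p F = psi q (Suc p) (alpha p F)"

definition delta :: "nat \<Rightarrow> ('s \<Rightarrow> complex) \<Rightarrow> 's \<Rightarrow> complex" where
  "delta p g = (\<lambda>s. if s \<in> J (Suc p) then (\<Sum>r\<in>J p. g r * \<tau> (M (Suc p) r s)) else 0)"

definition supp :: "nat \<Rightarrow> ('s \<Rightarrow> complex) set" where
  "supp p = {g. \<forall>s. s \<notin> J p \<longrightarrow> g s = 0}"

definition Ker :: "nat \<Rightarrow> ('s \<Rightarrow> complex) set" where
  "Ker p = {g \<in> supp p. delta p g = (\<lambda>_. 0)}"

primrec Im :: "nat \<Rightarrow> ('s \<Rightarrow> complex) set" where
  "Im 0 = {\<lambda>_. 0}"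
| "Im (Suc p) = delta p ` supp p"

lemma psi_add: "psi q p (\<lambda>x as. F x as + F' x as) = (\<lambda>s. psi q p F s + psi q p F' s)"
proof (induction q arbitrary: p F F')
  case (Suc q)
  have "alpha p (\<lambda>x as. F x as + F' x as) = (\<lambda>x as. alpha p F x as + alpha p F' x as)"
    by (simp add: alpha_def pull_def[abs_def] sg_def[abs_def] sum.distrib)
  then show ?case by (simp add: Suc)
qed auto

lemma psi_scale: "psi q p (\<lambda>x as. c * F x as) = (\<lambda>s. c * psi q p F s)"
proof (induction q arbitrary: p F)
  case (Suc q)
  have "alpha p (\<lambda>x as. c * F x as) = (\<lambda>x as. c * alpha p F x as)"
    by (simp add: alpha_def pull_def[abs_def] sg_def[abs_def] sum_distrib_left)
  then show ?case by (simp add: Suc)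
qed auto

lemma psi_diff: "psi q p (\<lambda>x as. F x as - F' x as) = (\<lambda>s. psi q p F s - psi q p F' s)"
  using psi_add[of q p F "\<lambda>x as. - 1 * F' x as"] by (simp only: psi_scale) simp

lemma delta_add: "delta p (\<lambda>s. g s + h s) = (\<lambda>s. delta p g s + delta p h s)"
  by (auto simp: delta_def fun_eq_iff distrib_right sum.distrib)

lemma delta_scale: "delta p (\<lambda>s. c * g s) = (\<lambda>s. c * delta p g s)"
  by (auto simp: delta_def fun_eq_iff sum_distrib_left mult.assoc)

lemma Im_add: "g \<in> Im p \<Longrightarrow> h \<in> Im p \<Longrightarrow> (\<lambda>s. g s + h s) \<in> Im p"
proof (cases p)
  case (Suc p')
  assume "g \<in> Im p" "h \<in> Im p"
  then obtain g' h' where "g' \<in> supp p'" "g = delta p' g'" "h' \<in> supp p'" "h = delta p' h'" by (auto simp: Suc)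
  then show ?thesis
    by (auto simp: Suc supp_def intro!: image_eqI[of _ _ "\<lambda>s. g' s + h' s"] simp: delta_add)
qed simp

lemma Im_scale: "g \<in> Im p \<Longrightarrow> (\<lambda>s. c * g s) \<in> Im p"
proof (cases p)
  case (Suc p')
  assume "g \<in> Im p"
  then obtain g' where "g' \<in> supp p'" "g = delta p' g'" by (auto simp: Suc)
  then show ?thesis
    by (auto simp: Suc supp_def intro!: image_eqI[of _ _ "\<lambda>s. c * g' s"] simp: delta_scale)
qed simp

definition cocycle :: "nat \<Rightarrow> nat \<Rightarrow> ('s, 'g) cofun \<Rightarrow> bool" where
  "cocycle p k F \<longleftrightarrow> zcochain p k F \<and> (\<forall>x as. dv F x as = 0)"

text \<open>The kernel of \<open>dv\<close> without arguments consists of the maps into the right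
  module of \<open>\<tau>\<close> that are linear over the algebra; this is \<open>homotopy\<close>
  with one term equal to zero.\<close>

lemma linear_cochain:
  assumes "cochain p 0 F" "\<And>x as. dv F x as = 0"
  shows "F x as = (if as = [] then (\<Sum>s\<in>J p. F (unit_vec_at s) [] * \<tau> (x s)) else 0)"
proof (cases as)
  case Nil
  have "sg p (dv F) x [] = 0" unfolding sg_def assms(2) by simp
  then show ?thesis using homotopy[OF assms(1), of x "[]"] Nil by simp
next
  case (Cons a as')
  then show ?thesis using cochainD(1)[OF assms(1), of x] by simp
qed

definition lin :: "nat \<Rightarrow> ('s \<Rightarrow> complex) \<Rightarrow> ('s, 'g) cofun" where
  "lin p g x as = (if as = [] then (\<Sum>s\<in>J p. g s * \<tau> (x s)) else 0)"

lemma linear_cochain_eq: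
  assumes "cochain p 0 F" "\<And>x as. dv F x as = 0"
  shows "F = lin p (psi 0 p F)"
proof (intro ext)
  fix x as
  have "(\<Sum>s\<in>J p. F (unit_vec_at s) [] * \<tau> (x s)) = (\<Sum>s\<in>J p. psi 0 p F s * \<tau> (x s))"
    by (rule sum.cong) simp_all
  then show "F x as = lin p (psi 0 p F) x as"
    unfolding lin_def linear_cochain[OF assms, of x as] by simp
qed

lemma cochain_lin: "cochain p 0 (lin p g)"
  unfolding cochain_def
  by (auto simp: lin_def \<tau>.\<tau>_add \<tau>.\<tau>_mult \<tau>.\<tau>_scalar \<tau>.\<tau>_I sum.distrib sum_distrib_left algebra_simps)

lemma dv_lin: "dv (lin p g) x as = 0"
proof (cases as)
  case (Cons a as')
  have "rdiff \<tau> (lin p g x) (a # b # bs) = 0" for b bs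
    by (simp add: lin_def)
  then show ?thesis
    by (cases as') (simp_all add: Cons lin_def[abs_def] \<tau>.\<tau>_mult sum_distrib_right mult.assoc)
qed simp

lemma pull_lin: "pull p (lin p g) = lin (Suc p) (delta p g)"
proof (intro ext)
  fix y as
  have "(\<Sum>r\<in>J p. g r * \<tau> (D (Suc p) y r)) = (\<Sum>s\<in>J (Suc p). delta p g s * \<tau> (y s))"
    unfolding D_def by (simp add: \<tau>.\<tau>_sum \<tau>.\<tau>_mult delta_def sum_distrib_left sum_distrib_right mult.assoc)
      (rule sum.swap)
  then show "pull p (lin p g) y as = lin (Suc p) (delta p g) y as"
    by (simp add: pull_def lin_def)
qed

lemma psi_lin: "g \<in> supp p \<Longrightarrow> psi 0 p (lin p g) = g"
  by (auto simp: lin_def fun_eq_iff supp_def unit_vec_at_def if_distrib[of \<tau>] \<tau>.\<tau>_0 \<tau>.\<tau>_1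
      if_distrib[of "\<lambda>x. _ * x"] finite_J cong: if_cong)

lemma psi_0_fun: "psi 0 p (\<lambda>_ _. 0) = (\<lambda>_. 0)" by auto

lemma cocycle_0:
  assumes "cocycle p 0 F"
  shows "F = lin p (psi 0 p F)" "psi 0 p F \<in> Ker p"
proof -
  have F: "cochain p 0 F" "\<And>x as. dv F x as = 0" and pull: "\<And>y as. pull p F y as = 0"
    using assms by (auto simp: cocycle_def zcochain_def)
  show *: "F = lin p (psi 0 p F)"
    by (rule linear_cochain_eq[OF F])
  have "psi 0 p F \<in> supp p" by (simp add: supp_def)
  moreover have "delta p (psi 0 p F) = (\<lambda>_. 0)"
  proof -
    have A: "lin (Suc p) (delta p (psi 0 p F)) = (\<lambda>_ _. 0)"
      unfolding pull_lin[symmetric] *[symmetric] using pull by (intro ext)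
    have "psi 0 (Suc p) (lin (Suc p) (delta p (psi 0 p F))) = delta p (psi 0 p F)"
      by (rule psi_lin) (simp add: supp_def delta_def)
    then show ?thesis unfolding A psi_0_fun by (rule sym)
  qed
  ultimately show "psi 0 p F \<in> Ker p" by (simp add: Ker_def)
qed

lemma cocycle_lin: "g \<in> Ker p \<Longrightarrow> cocycle p 0 (lin p g)"
  by (auto simp: cocycle_def zcochain_def cochain_lin dv_lin pull_lin Ker_def) (simp add: lin_def)

lemma dv_sg:
  assumes "cocycle p (Suc k) F"
  shows "dv (sg p F) x as = F x as"
proof -
  have F: "cochain p (Suc k) F" "dv F = (\<lambda>_ _. 0)" using assms by (auto simp: cocycle_def zcochain_def fun_eq_iff)
  have "F x [] = 0" for x using multilin_length[OF cochainD(1)[OF F(1)], of "[]"] by simp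
  then show ?thesis using homotopy[OF F(1), of x as] by (cases "as = []") (simp_all add: F(2) sg_def)
qed

lemma cocycle_alpha:
  assumes "cocycle p (Suc k) F"
  shows "cocycle (Suc p) k (alpha p F)"
proof -
  have F: "cochain p (Suc k) F" "\<And>y as. pull p F y as = 0" using assms by (auto simp: cocycle_def zcochain_def)
  have "dv (sg p F) = F" by (intro ext) (rule dv_sg[OF assms])
  then have "dv (alpha p F) x as = 0" for x as unfolding alpha_def dv_pull by (simp add: F(2))
  then show ?thesis using zcochain_pull[OF cochain_sg[OF F(1)]] by (simp add: cocycle_def alpha_def)
qed

lemma psi_Ker: "cocycle p q F \<Longrightarrow> psi q p F \<in> Ker (p + q)"
proof (induction q arbitrary: p F)
  case 0
  then show ?case using cocycle_0(2) by simp
next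
  case (Suc q)
  then show ?case using Suc.IH[OF cocycle_alpha[OF Suc.prems]] by simp
qed

text \<open>The shift is injective on cohomology. A vertical primitive of \<open>F\<close> always
  exists, namely \<open>sg p F\<close>; the question is whether a vertical cocycle corrects it so
  that it vanishes on the image of the next map. For one argument such corrections are the maps
  \<open>lin p g\<close>, whose pullbacks are the values of \<open>delta p\<close>. For more
  arguments they are themselves coboundaries, and the question passes to \<open>alpha p F\<close> by
  \<open>horizontal_exact\<close>.\<close>

lemma coboundary_iff:
  assumes "cocycle p (Suc q) F"
  shows "(\<exists>F'. zcochain p q F' \<and> F = dv F') \<longleftrightarrow> psi (Suc q) p F \<in> Im (Suc (p + q))"
  using assms
proof (induction q arbitrary: p F)
  case 0
  let ?G = "alpha p F"
  have F: "cochain p 1 F" "\<And>y as. pull p F y as = 0" and dF: "\<And>x as. dv F x as = 0"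
    using 0 by (auto simp: cocycle_def zcochain_def)
  have c: "cochain p 0 (sg p F)" using cochain_sg F(1) by simp
  have G: "cocycle (Suc p) 0 ?G" by (rule cocycle_alpha[OF 0])
  show ?case
  proof
    assume "\<exists>F'. zcochain p 0 F' \<and> F = dv F'"
    then obtain F' where F': "cochain p 0 F'" "\<And>y as. pull p F' y as = 0" "F = dv F'" by (auto simp: zcochain_def)
    define E where "E x as = sg p F x as - F' x as" for x as
    have E: "cochain p 0 E" unfolding E_def[abs_def] by (rule cochain_diff[OF c F'(1)])
    have dE: "dv E x as = 0" for x as
      unfolding E_def[abs_def] dv_diff dv_sg[OF 0] using fun_cong[OF fun_cong[OF F'(3), of x], of as] by simp
    have "E = lin p (psi 0 p E)" by (rule linear_cochain_eq[OF E dE])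
    moreover have "?G = pull p E"
      using F'(2) by (simp add: alpha_def pull_def[abs_def] E_def[abs_def])
    ultimately have "?G = pull p (lin p (psi 0 p E))" by (simp only:)
    then have "?G = lin (Suc p) (delta p (psi 0 p E))" unfolding pull_lin .
    moreover have "psi 0 (Suc p) (lin (Suc p) (delta p (psi 0 p E))) = delta p (psi 0 p E)"
      by (rule psi_lin) (simp add: supp_def delta_def)
    ultimately have "psi (Suc 0) p F = delta p (psi 0 p E)" by simp
    moreover have "psi 0 p E \<in> supp p" by (simp add: supp_def)
    ultimately show "psi (Suc 0) p F \<in> Im (Suc (p + 0))" by auto
  next
    assume "psi (Suc 0) p F \<in> Im (Suc (p + 0))"
    then obtain g where g: "g \<in> supp p" "psi 0 (Suc p) ?G = delta p g" by auto
    have "?G = lin (Suc p) (psi 0 (Suc p) ?G)" by (rule cocycle_0(1)[OF G])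
    then have G_eq: "?G = pull p (lin p g)" unfolding g(2) pull_lin .
    define F' where "F' x as = sg p F x as - lin p g x as" for x as
    have "cochain p 0 F'" unfolding F'_def[abs_def] by (rule cochain_diff[OF c cochain_lin])
    moreover have "pull p F' y as = 0" for y as
      using fun_cong[OF fun_cong[OF G_eq, of y], of as] by (simp add: alpha_def pull_def F'_def)
    moreover have "F = dv F'"
      by (intro ext) (simp add: F'_def[abs_def] dv_diff dv_sg[OF 0] dv_lin)
    ultimately show "\<exists>F'. zcochain p 0 F' \<and> F = dv F'" by (auto simp: zcochain_def)
  qed
next
  case (Suc q)
  let ?G = "alpha p F"
  have F: "cochain p (Suc (Suc q)) F" using Suc.prems by (auto simp: cocycle_def zcochain_def)
  have c: "cochain p (Suc q) (sg p F)" by (rule cochain_sg[OF F])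
  have G: "cocycle (Suc p) (Suc q) ?G" by (rule cocycle_alpha[OF Suc.prems])
  have IH: "(\<exists>F'. zcochain (Suc p) q F' \<and> ?G = dv F') \<longleftrightarrow> psi (Suc (Suc q)) p F \<in> Im (Suc (p + Suc q))"
    using Suc.IH[OF G] by simp
  have "(\<exists>F'. zcochain (Suc p) q F' \<and> ?G = dv F') \<longleftrightarrow> (\<exists>F'. zcochain p (Suc q) F' \<and> F = dv F')"
  proof
    assume "\<exists>F'. zcochain p (Suc q) F' \<and> F = dv F'"
    then obtain F' where F': "cochain p (Suc q) F'" "\<And>y as. pull p F' y as = 0" "F = dv F'" by (auto simp: zcochain_def)
    define E where "E x as = sg p F x as - F' x as" for x as
    have E: "cochain p (Suc q) E" unfolding E_def[abs_def] by (rule cochain_diff[OF c F'(1)])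
    have "dv E x as = 0" for x as
      unfolding E_def[abs_def] dv_diff dv_sg[OF Suc.prems] using fun_cong[OF fun_cong[OF F'(3), of x], of as] by simp
    then have dE: "dv E = (\<lambda>_ _. 0)" by (intro ext)
    have "E x [] = 0" for x using multilin_length[OF cochainD(1)[OF E], of "[]"] by simp
    then have "E = dv (sg p E)"
      using homotopy[OF E] by (intro ext) (auto simp: dE sg_def split: if_splits)
    moreover have "?G = pull p E"
      using F'(2) by (simp add: alpha_def pull_def[abs_def] E_def[abs_def])
    ultimately have "?G = dv (pull p (sg p E))" by (metis dv_pull)
    then show "\<exists>F'. zcochain (Suc p) q F' \<and> ?G = dv F'" using zcochain_pull[OF cochain_sg[OF E]] by blast
  next
    assume "\<exists>F'. zcochain (Suc p) q F' \<and> ?G = dv F'"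
    then obtain E' where E': "zcochain (Suc p) q E'" "?G = dv E'" by blast
    obtain E where E: "cochain p q E" "E' = pull p E" using horizontal_exact[OF E'(1)] .
    have G_eq: "?G = pull p (dv E)" unfolding E'(2) E(2) dv_pull ..
    define F' where "F' x as = sg p F x as - dv E x as" for x as
    have "cochain p (Suc q) F'" unfolding F'_def[abs_def] by (rule cochain_diff[OF c cochain_dv[OF E(1)]])
    moreover have "pull p F' y as = 0" for y as
      using fun_cong[OF fun_cong[OF G_eq, of y], of as] by (simp add: alpha_def pull_def F'_def)
    moreover have "F = dv F'"
      by (intro ext) (simp add: F'_def[abs_def] dv_diff dv_sg[OF Suc.prems] dv_dv)
    ultimately show "\<exists>F'. zcochain p (Suc q) F' \<and> F = dv F'" by (auto simp: zcochain_def)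
  qed
  with IH show ?case by simp
qed

text \<open>The shift is reversed: a cocycle \<open>G\<close> of the next column is
  \<open>pull p E\<close> by exactness of the rows, and \<open>dv E\<close> is the cocycle sought.
  Its image under \<open>alpha p\<close> differs from \<open>G\<close> by a coboundary, or for
  \<open>q = 0\<close> by the pullback of a linear map; both end up in \<open>Im\<close>, which
  explains the summand \<open>h\<close>.\<close>

lemma psi_surj:
  assumes "g \<in> Ker (p + q)"
  shows "\<exists>F h. cocycle p q F \<and> h \<in> (if q = 0 then {\<lambda>_. 0} else Im (p + q)) \<and> g = (\<lambda>s. psi q p F s + h s)"
  using assms
proof (induction q arbitrary: p)
  case 0
  then show ?case using cocycle_lin[of g p] psi_lin[of g p] by (intro exI[of _ "lin p g"] exI[of _ "\<lambda>_. 0"]) (auto simp: Ker_def)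
next
  case (Suc q)
  obtain G h where G: "cocycle (Suc p) q G" "h \<in> (if q = 0 then {\<lambda>_. 0} else Im (Suc p + q))" "g = (\<lambda>s. psi q (Suc p) G s + h s)"
    using Suc.IH[of "Suc p"] Suc.prems by auto
  obtain E where E: "cochain p q E" "G = pull p E" using horizontal_exact[of p q G] G(1) by (auto simp: cocycle_def)
  have dG: "dv G x as = 0" for x as using G(1) by (simp add: cocycle_def)
  have F: "cocycle p (Suc q) (dv E)"
  proof -
    have "pull p (dv E) y as = 0" for y as unfolding dv_pull[symmetric] E(2)[symmetric] by (rule dG)
    then show ?thesis using cochain_dv[OF E(1)] dv_dv by (auto simp: cocycle_def zcochain_def)
  qed
  show ?case
  proof (cases q)
    case 0
    have E0: "cochain p 0 E" using E(1) 0 by simp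
    define e where "e s = (if s \<in> J p then E (unit_vec_at s) [] else 0)" for s
    have e: "e \<in> supp p" by (simp add: supp_def e_def)
    have "sg p (dv E) x as = E x as - lin p e x as" for x as
    proof (cases "as = []")
      case True
      then show ?thesis using homotopy[OF E0, of x as] by (simp add: lin_def e_def)
    next
      case False
      have "multilin I 1 (dv E x)" for x using cochainD(1)[OF cochain_dv[OF E0]] by simp
      then have "sg p (dv E) x as = 0" unfolding sg_def using False by (intro sum.neutral) (auto intro!: multilin_length)
      moreover have "E x as = 0" using cochainD(1)[OF E0, of x] False by simp
      ultimately show ?thesis using False by (simp add: lin_def)
    qed
    then have "alpha p (dv E) = (\<lambda>x as. G x as - pull p (lin p e) x as)"
      unfolding alpha_def E(2) by (intro ext) (simp add: pull_def)
    then have "psi (Suc q) p (dv E) = (\<lambda>s. psi 0 (Suc p) G s - psi 0 (Suc p) (pull p (lin p e)) s)"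
      using psi_diff[of 0 "Suc p" G "pull p (lin p e)"] by (simp add: 0 del: psi.simps(1))
    moreover have "psi 0 (Suc p) (pull p (lin p e)) = delta p e"
      unfolding pull_lin by (rule psi_lin) (simp add: supp_def delta_def)
    ultimately have "g = (\<lambda>s. psi (Suc q) p (dv E) s + delta p e s)"
      using G(2,3) by (simp add: 0 fun_eq_iff del: psi.simps)
    moreover have "delta p e \<in> Im (p + Suc q)" using e 0 by simp
    ultimately show ?thesis using F by (intro exI[of _ "dv E"] exI[of _ "delta p e"]) simp
  next
    case (Suc q')
    have E': "cochain p (Suc q') E" using E(1) Suc by simp
    have "E x [] = 0" for x using multilin_length[OF cochainD(1)[OF E'], of "[]"] by simp
    then have "sg p (dv E) x as = E x as - dv (sg p E) x as" for x as
      using homotopy[OF E', of x as] by (auto simp: algebra_simps split: if_splits)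
    then have a: "alpha p (dv E) = (\<lambda>x as. G x as - dv (pull p (sg p E)) x as)"
      unfolding alpha_def E(2) dv_pull by (intro ext) (simp add: pull_def)
    define W where "W = pull p (sg p E)"
    have W: "zcochain (Suc p) q' W" unfolding W_def by (rule zcochain_pull[OF cochain_sg[OF E']])
    have "cocycle (Suc p) (Suc q') (dv W)"
      using W cochain_dv[of "Suc p" q' W] dv_dv unfolding cocycle_def zcochain_def
      by (metis cochain_dv cochain_pull dv_pull dv_dv pull_pull W_def E' cochain_sg)
    then have "psi (Suc q') (Suc p) (dv W) \<in> Im (Suc (Suc p + q'))"
      using coboundary_iff[of "Suc p" q' "dv W"] W by blast
    moreover have "psi (Suc q) p (dv E) = (\<lambda>s. psi q (Suc p) G s - psi q (Suc p) (dv W) s)"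
      using psi_diff[of q "Suc p" G "dv W"] unfolding psi.simps(2)[of q] a W_def[symmetric] .
    moreover have "h \<in> Im (p + Suc q)" using G(2) by (simp add: Suc)
    ultimately show ?thesis
      using F G(3) Im_add[of h "p + Suc q" "psi q (Suc p) (dv W)"]
      by (intro exI[of _ "dv E"] exI[of _ "\<lambda>s. h s + psi q (Suc p) (dv W) s"]) (simp add: Suc fun_eq_iff del: psi.simps)
  qed
qed

end

section \<open>Dimensions of vector spaces over carrier sets\<close>

text \<open>A linear bijection between a space given by a carrier set and a subspace of a type. The
  vector space axioms of \<open>V\<close> are not assumed but pulled back along
  \<open>\<beta>\<close>, and so are bases and the dimension.\<close>

locale coordinates = vector_space scale for scale :: "complex \<Rightarrow> 'b :: ab_group_add \<Rightarrow> 'b" +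
  fixes V :: "(complex, 'c, 'd) module_scheme" and \<beta> :: "'c \<Rightarrow> 'b" and W :: "'b set"
  assumes W: "subspace W" and bij: "bij_betw \<beta> (carrier V) W"
    and closed: "\<zero>\<^bsub>V\<^esub> \<in> carrier V" "\<And>x y. x \<in> carrier V \<Longrightarrow> y \<in> carrier V \<Longrightarrow> x \<oplus>\<^bsub>V\<^esub> y \<in> carrier V"
      "\<And>c x. x \<in> carrier V \<Longrightarrow> c \<odot>\<^bsub>V\<^esub> x \<in> carrier V"
    and hom: "\<beta> \<zero>\<^bsub>V\<^esub> = 0" "\<And>x y. x \<in> carrier V \<Longrightarrow> y \<in> carrier V \<Longrightarrow> \<beta> (x \<oplus>\<^bsub>V\<^esub> y) = \<beta> x + \<beta> y"
      "\<And>c x. x \<in> carrier V \<Longrightarrow> \<beta> (c \<odot>\<^bsub>V\<^esub> x) = scale c (\<beta> x)"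
begin

lemma eq_iff: "x \<in> carrier V \<Longrightarrow> y \<in> carrier V \<Longrightarrow> \<beta> x = \<beta> y \<longleftrightarrow> x = y"
  using bij by (auto simp: bij_betw_def inj_on_def)

lemma eqI: "\<beta> x = \<beta> y \<Longrightarrow> x \<in> carrier V \<Longrightarrow> y \<in> carrier V \<Longrightarrow> x = y"
  by (simp add: eq_iff)

lemma \<beta>_in_W: "x \<in> carrier V \<Longrightarrow> \<beta> x \<in> W"
  using bij by (auto simp: bij_betw_def)

lemma abelian_group: "abelian_group V"
proof (rule abelian_groupI)
  fix x assume x: "x \<in> carrier V"
  then show "\<exists>y\<in>carrier V. y \<oplus>\<^bsub>V\<^esub> x = \<zero>\<^bsub>V\<^esub>"
    by (intro bexI[of _ "(- 1) \<odot>\<^bsub>V\<^esub> x"] eqI) (simp_all add: closed hom)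
qed (auto intro!: eqI simp: closed hom algebra_simps)

lemma vectorspace: "vectorspace class_ring V"
proof -
  interpret abelian_group V by (rule abelian_group)
  have "module class_ring V"
  proof (intro Module.module.intro Module.module_axioms.intro)
    show "cring (class_ring :: complex ring)" using class_field by (rule field.is_ring[THEN cring.intro]) (unfold_locales, simp)
    show "abelian_group V" by (rule abelian_group)
  qed (auto intro!: eqI simp: closed hom scale_left_distrib scale_right_distrib)
  then show ?thesis using class_field by (simp add: vectorspace_def)
qed

interpretation JV: vectorspace class_ring V by (rule vectorspace)

lemma \<beta>_finsum:
  assumes "finite A" "f \<in> A \<rightarrow> carrier V"
  shows "\<beta> (finsum V f A) = (\<Sum>v\<in>A. \<beta> (f v))"
  using assms
proof (induction A rule: finite_induct)
  case (insert a A)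
  have "finsum V f A \<in> carrier V" using insert.prems by (intro JV.finsum_closed) auto
  then show ?case using insert by (simp add: Pi_def hom)
qed (simp add: hom)

lemma \<beta>_lincomb:
  assumes "finite A" "A \<subseteq> carrier V"
  shows "\<beta> (JV.lincomb a A) = (\<Sum>v\<in>A. scale (a v) (\<beta> v))" "JV.lincomb a A \<in> carrier V"
proof -
  have "\<beta> (JV.lincomb a A) = (\<Sum>v\<in>A. \<beta> (a v \<odot>\<^bsub>V\<^esub> v))"
    unfolding JV.lincomb_def using assms by (intro \<beta>_finsum) (auto simp: closed)
  also have "\<dots> = (\<Sum>v\<in>A. scale (a v) (\<beta> v))"
    using assms by (intro sum.cong) (auto simp: hom)
  finally show "\<beta> (JV.lincomb a A) = (\<Sum>v\<in>A. scale (a v) (\<beta> v))" .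
  show "JV.lincomb a A \<in> carrier V" using assms by (intro JV.lincomb_closed) auto
qed

lemma dim_eq:
  assumes "W \<subseteq> span S" "finite S"
  shows "vectorspace.fin_dim class_ring V \<and> vectorspace.dim class_ring V = dim W"
proof -
  obtain B where B: "B \<subseteq> W" "independent B" "W \<subseteq> span B" "card B = dim W" by (rule basis_exists)
  have finB: "finite B"
    using independent_span_bound[OF assms(2) B(2)] assms(1) B(1) by blast
  define A where "A = the_inv_into (carrier V) \<beta> ` B"
  have inj: "inj_on \<beta> (carrier V)" and im: "\<beta> ` carrier V = W" using bij by (simp_all add: bij_betw_def)
  have A: "A \<subseteq> carrier V"
    unfolding A_def by (intro image_subsetI the_inv_into_into[OF inj _ subset_refl]) (use B(1) im in blast)
  have \<beta>inv: "\<beta> (the_inv_into (carrier V) \<beta> b) = b" if "b \<in> B" for b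
    by (rule f_the_inv_into_f[OF inj]) (use that B(1) im in blast)
  have \<beta>A: "\<beta> ` A = B" unfolding A_def image_image by (simp add: \<beta>inv)
  have injA: "inj_on \<beta> A" using inj A by (rule inj_on_subset)
  have finA: "finite A" using finB by (simp add: A_def)
  have li: "\<not> JV.lin_dep A"
  proof
    assume "JV.lin_dep A"
    then obtain A' a v where *: "finite A'" "A' \<subseteq> A" "JV.lincomb a A' = \<zero>\<^bsub>V\<^esub>" "v \<in> A'" "a v \<noteq> 0"
      by (auto simp: JV.lin_dep_def)
    have inj': "inj_on \<beta> A'" using injA *(2) by (rule inj_on_subset)
    have "0 = \<beta> (JV.lincomb a A')" by (simp add: * hom)
    also have "\<dots> = (\<Sum>v\<in>A'. scale (a v) (\<beta> v))" using * A by (intro \<beta>_lincomb) auto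
    also have "\<dots> = (\<Sum>w\<in>\<beta> ` A'. scale (a (the_inv_into A' \<beta> w)) w)"
      by (subst sum.reindex[OF inj']) (simp add: the_inv_into_f_f[OF inj'])
    finally have z: "(\<Sum>w\<in>\<beta> ` A'. scale (a (the_inv_into A' \<beta> w)) w) = 0" by (rule sym)
    have "\<beta> ` A' \<subseteq> B" using *(2) \<beta>A by blast
    from independentD[OF B(2) finite_imageI[OF *(1)] this z imageI[OF *(4)]]
    show False using *(4,5) by (simp add: the_inv_into_f_f[OF inj'])
  qed
  have gen: "JV.span A = carrier V"
  proof
    show "JV.span A \<subseteq> carrier V" using A by (rule JV.span_is_subset2)
    show "carrier V \<subseteq> JV.span A"
    proof
      fix x assume x: "x \<in> carrier V"
      have "\<beta> x \<in> span B" by (rule subsetD[OF B(3) \<beta>_in_W[OF x]])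
      then obtain u where "\<beta> x = (\<Sum>b\<in>B. scale (u b) b)" unfolding span_finite[OF finB] by blast
      also have "\<dots> = (\<Sum>v\<in>A. scale (u (\<beta> v)) (\<beta> v))"
        unfolding \<beta>A[symmetric] by (simp add: sum.reindex[OF injA])
      also have "\<dots> = \<beta> (JV.lincomb (u \<circ> \<beta>) A)" using \<beta>_lincomb[OF finA A, of "u \<circ> \<beta>"] by simp
      finally have "x = JV.lincomb (u \<circ> \<beta>) A" using \<beta>_lincomb(2)[OF finA A] x by (intro eqI)
      then show "x \<in> JV.span A" using finA by (auto simp: JV.span_def)
    qed
  qed
  have "JV.basis A" using li gen A by (simp add: JV.basis_def)
  from JV.dim_basis[OF finA this] have "JV.dim = card A" .
  also have "\<dots> = card B" using card_image[OF injA] \<beta>A by simp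
  finally show ?thesis using finA A gen B(4) by (auto simp: JV.fin_dim_def)
qed

end

text \<open>The homomorphism theorem. The cosets are the fibres of \<open>\<theta>\<close>, so
  evaluating \<open>\<theta>\<close> at an arbitrary element of a coset is a coordinate map for the
  quotient.\<close>

lemma coordinates_quotient:
  fixes V :: "(complex, 'c) module" and scale :: "complex \<Rightarrow> 'b :: ab_group_add \<Rightarrow> 'b"
  assumes vs: "vector_space scale" and ab: "abelian_group V"
    and smult: "\<And>c x. x \<in> carrier V \<Longrightarrow> c \<odot>\<^bsub>V\<^esub> x \<in> carrier V"
    and W: "module.subspace scale W" and surj: "\<theta> ` carrier V = W"
    and add: "\<And>x y. x \<in> carrier V \<Longrightarrow> y \<in> carrier V \<Longrightarrow> \<theta> (x \<oplus>\<^bsub>V\<^esub> y) = \<theta> x + \<theta> y"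
    and scal: "\<And>c x. x \<in> carrier V \<Longrightarrow> \<theta> (c \<odot>\<^bsub>V\<^esub> x) = scale c (\<theta> x)"
    and N: "N = {x \<in> carrier V. \<theta> x = 0}"
  shows "coordinates scale (quotient_module V N) (\<lambda>X. \<theta> (SOME x. x \<in> X)) W"
proof -
  interpret vector_space scale by (rule vs)
  interpret V: abelian_group V by (rule ab)
  have \<theta>_zero: "\<theta> \<zero>\<^bsub>V\<^esub> = 0" using add[of "\<zero>\<^bsub>V\<^esub>" "\<zero>\<^bsub>V\<^esub>"] by simp
  have \<theta>_neg: "\<theta> (\<ominus>\<^bsub>V\<^esub> x) = - \<theta> x" if "x \<in> carrier V" for x
    using add[of x "\<ominus>\<^bsub>V\<^esub> x"] that by (simp add: V.r_neg \<theta>_zero eq_neg_iff_add_eq_0 add.commute)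
  define fib where "fib w = {x \<in> carrier V. \<theta> x = w}" for w
  have coset: "N +>\<^bsub>V\<^esub> x = fib (\<theta> x)" if x: "x \<in> carrier V" for x
  proof
    show "N +>\<^bsub>V\<^esub> x \<subseteq> fib (\<theta> x)"
      using x by (auto simp: a_r_coset_def' N fib_def add)
    show "fib (\<theta> x) \<subseteq> N +>\<^bsub>V\<^esub> x"
    proof
      fix y assume y: "y \<in> fib (\<theta> x)"
      then have yc: "y \<in> carrier V" by (simp add: fib_def)
      have "y = (y \<oplus>\<^bsub>V\<^esub> \<ominus>\<^bsub>V\<^esub> x) \<oplus>\<^bsub>V\<^esub> x" using yc x by (simp add: V.a_assoc V.l_neg)
      moreover have "y \<oplus>\<^bsub>V\<^esub> \<ominus>\<^bsub>V\<^esub> x \<in> N" using y yc x by (simp add: N add \<theta>_neg fib_def)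
      ultimately show "y \<in> N +>\<^bsub>V\<^esub> x" unfolding a_r_coset_def' by blast
    qed
  qed
  have car: "carrier (quotient_module V N) = fib ` W"
    by (auto simp: quotient_module_def FactRing_def A_RCOSETS_def' coset surj[symmetric])
  have some: "\<theta> (SOME x. x \<in> fib w) = w" if "w \<in> W" for w
  proof -
    have "\<exists>x. x \<in> fib w" using that surj by (auto simp: fib_def)
    then have "(SOME x. x \<in> fib w) \<in> fib w" by (rule someI_ex)
    then show ?thesis by (simp add: fib_def)
  qed
  have plus: "fib w \<oplus>\<^bsub>quotient_module V N\<^esub> fib w' = fib (w + w')" if w: "w \<in> W" "w' \<in> W" for w w'
  proof -
    have "fib w \<oplus>\<^bsub>quotient_module V N\<^esub> fib w' = (\<Union>x\<in>fib w. \<Union>y\<in>fib w'. {x \<oplus>\<^bsub>V\<^esub> y})"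
      by (simp add: quotient_module_def FactRing_def set_add_def')
    also have "\<dots> = fib (w + w')"
    proof
      show "(\<Union>x\<in>fib w. \<Union>y\<in>fib w'. {x \<oplus>\<^bsub>V\<^esub> y}) \<subseteq> fib (w + w')" by (auto simp: fib_def add)
      obtain x where x: "x \<in> carrier V" "\<theta> x = w" using w(1) surj by auto
      show "fib (w + w') \<subseteq> (\<Union>x\<in>fib w. \<Union>y\<in>fib w'. {x \<oplus>\<^bsub>V\<^esub> y})"
      proof
        fix z assume z: "z \<in> fib (w + w')"
        then have zc: "z \<in> carrier V" by (simp add: fib_def)
        have "z = x \<oplus>\<^bsub>V\<^esub> (\<ominus>\<^bsub>V\<^esub> x \<oplus>\<^bsub>V\<^esub> z)" using zc x by (simp add: V.a_assoc[symmetric] V.r_neg)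
        moreover have "\<ominus>\<^bsub>V\<^esub> x \<oplus>\<^bsub>V\<^esub> z \<in> fib w'" using z zc x by (simp add: fib_def add \<theta>_neg)
        ultimately show "z \<in> (\<Union>x\<in>fib w. \<Union>y\<in>fib w'. {x \<oplus>\<^bsub>V\<^esub> y})" using x by (auto simp: fib_def)
      qed
    qed
    finally show ?thesis .
  qed
  have sm: "c \<odot>\<^bsub>quotient_module V N\<^esub> fib w = fib (scale c w)" if w: "w \<in> W" for c w
  proof -
    have "c \<odot>\<^bsub>quotient_module V N\<^esub> fib w = (\<Union>x\<in>fib w. fib (scale c w))"
      unfolding quotient_module_def by (auto simp: fib_def coset smult scal)
    moreover have "fib w \<noteq> {}" using w surj by (auto simp: fib_def)
    ultimately show ?thesis by simp
  qed
  have zero: "\<zero>\<^bsub>quotient_module V N\<^esub> = fib 0" by (simp add: quotient_module_def FactRing_def N fib_def)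
  show ?thesis
  proof
    show "subspace W" by (rule W)
    show "bij_betw (\<lambda>X. \<theta> (SOME x. x \<in> X)) (carrier (quotient_module V N)) W"
      unfolding car by (rule bij_betw_byWitness[of _ fib]) (auto simp: some)
  qed (auto simp: car zero plus sm some subspace_0[OF W] subspace_add[OF W] subspace_scale[OF W])
qed

section \<open>Complements and rank-nullity inside a subspace\<close>

context vector_space
begin

text \<open>Realizes the quotient of \<open>C\<close> by \<open>A\<close> as a subspace, because
  coordinates must take values in one. The projection \<open>P\<close> kills a basis of
  \<open>A\<close> and fixes the vectors that extend it to a basis of \<open>C\<close>.\<close>

lemma complement_exists:
  assumes "subspace A" "subspace C" "A \<subseteq> C" "C \<subseteq> span S" "finite S"
  obtains P where "Vector_Spaces.linear scale scale P" "subspace (P ` C)" "P ` C \<subseteq> C"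
    "\<And>x. x \<in> C \<Longrightarrow> P x = 0 \<longleftrightarrow> x \<in> A" "\<And>x. x \<in> C \<Longrightarrow> P (P x) = P x" "\<And>x. x \<in> C \<Longrightarrow> x - P x \<in> A"
    "dim (P ` C) + dim A = dim C"
proof -
  interpret vp: vector_space_pair scale scale by unfold_locales
  obtain B1 where B1: "B1 \<subseteq> A" "independent B1" "A \<subseteq> span B1" "card B1 = dim A" by (rule basis_exists)
  obtain B where B: "B1 \<subseteq> B" "B \<subseteq> C" "independent B" "C \<subseteq> span B"
    using maximal_independent_subset_extend[OF _ B1(2), of C] B1(1) assms(3) by blast
  have finB: "finite B" using independent_span_bound[OF assms(5) B(3)] B(2) assms(4) by blast
  have spans: "span B1 = A" "span B = C"
    using B1(3) B(4) span_minimal[OF B1(1) assms(1)] span_minimal[OF B(2) assms(2)] by auto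
  define P where "P = vp.construct B (\<lambda>b. if b \<in> B1 then 0 else b)"
  have lin: "Vector_Spaces.linear scale scale P" unfolding P_def by (rule vp.linear_construct[OF B(3)])
  interpret P: Vector_Spaces.linear scale scale P by (rule lin)
  have Pb: "P b = (if b \<in> B1 then 0 else b)" if "b \<in> B" for b
    unfolding P_def by (rule vp.construct_basis[OF B(3) that])
  have P1: "P x = 0" if "x \<in> span B1" for x
    by (rule span_induct[OF that, of "\<lambda>x. P x = 0"]) (use Pb B(1) in \<open>auto simp: subspace_def P.add P.scale P.zero\<close>)
  have P2: "P x = x" if "x \<in> span (B - B1)" for x
    by (rule span_induct[OF that, of "\<lambda>x. P x = x"]) (use Pb in \<open>auto simp: subspace_def P.add P.scale P.zero\<close>)
  have decomp: "\<exists>a b. a \<in> span B1 \<and> b \<in> span (B - B1) \<and> x = a + b" if "x \<in> C" for x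
  proof -
    have "x \<in> span (B1 \<union> (B - B1))" using that B(1) by (simp add: Un_absorb1 spans)
    then show ?thesis unfolding span_Un by blast
  qed
  have imP: "P ` C = span (B - B1)"
  proof
    show "P ` C \<subseteq> span (B - B1)"
    proof
      fix y assume "y \<in> P ` C"
      then obtain x where "x \<in> C" "y = P x" by blast
      with decomp[of x] P1 P2 show "y \<in> span (B - B1)" by (auto simp: P.add)
    qed
    show "span (B - B1) \<subseteq> P ` C" using P2 span_mono[of "B - B1" B] spans(2) by force
  qed
  have indep: "independent (B - B1)" using B(3) by (rule independent_mono) auto
  have "dim (P ` C) = card (B - B1)"
    unfolding imP by (rule dim_span_eq_card_independent[OF indep])
  moreover have "card (B - B1) + card B1 = card B"
    using card_Diff_subset[of B1 B] card_mono[OF finB B(1)] finite_subset[OF B(1) finB] B(1) by simp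
  moreover have "card B = dim C" by (rule basis_card_eq_dim[OF B(2,4,3)])
  ultimately have dim: "dim (P ` C) + dim A = dim C" using B1(4) by simp
  have d: "x - P x \<in> A" if "x \<in> C" for x
    using decomp[OF that] P1 P2 by (auto simp: P.add spans)
  show thesis
  proof (rule that[OF lin])
    show "subspace (P ` C)" unfolding imP by (rule subspace_span)
    show "P ` C \<subseteq> C" unfolding imP using span_mono[of "B - B1" B] spans(2) by auto
    show "P x = 0 \<longleftrightarrow> x \<in> A" if "x \<in> C" for x
      using d[OF that] P1[of x] spans(1) by auto
    show "P (P x) = P x" if "x \<in> C" for x using imP that P2 by auto
  qed (rule d, assumption, rule dim)
qed

lemma rank_nullity:
  assumes f: "Vector_Spaces.linear scale scale f" and "subspace C" "C \<subseteq> span S" "finite S"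
  shows "dim {x \<in> C. f x = 0} + dim (f ` C) = dim C"
proof -
  interpret f: Vector_Spaces.linear scale scale f by (rule f)
  have A: "subspace {x \<in> C. f x = 0}"
    using assms(2) by (auto simp: subspace_def f.add f.scale f.zero)
  obtain P where P: "subspace (P ` C)" "P ` C \<subseteq> C"
    "\<And>x. x \<in> C \<Longrightarrow> P x = 0 \<longleftrightarrow> x \<in> {x \<in> C. f x = 0}" "\<And>x. x \<in> C \<Longrightarrow> P (P x) = P x"
    "\<And>x. x \<in> C \<Longrightarrow> x - P x \<in> {x \<in> C. f x = 0}" "dim (P ` C) + dim {x \<in> C. f x = 0} = dim C"
    by (rule complement_exists[OF A assms(2) _ assms(3,4)]) blast+
  obtain B where B: "B \<subseteq> P ` C" "independent B" "P ` C \<subseteq> span B" "card B = dim (P ` C)" by (rule basis_exists)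
  have span: "span B = P ` C" using B(3) span_minimal[OF B(1) P(1)] by auto
  have "f x = f (P x)" if "x \<in> C" for x using P(5)[OF that] by (simp add: f.diff)
  then have im: "f ` C = f ` (P ` C)" by (simp add: image_image)
  have inj: "inj_on f (span B)"
  proof (subst f.inj_on_iff_eq_0[OF subspace_span], intro ballI impI)
    fix y assume y: "y \<in> span B" "f y = 0"
    then obtain x where x: "x \<in> C" "y = P x" unfolding span by blast
    have "y \<in> C" using x P(2) by blast
    then have "P y = 0" using P(3) y(2) by blast
    then show "y = 0" using P(4)[OF x(1)] x(2) by simp
  qed
  have "dim (f ` C) = card (f ` B)"
    unfolding im span[symmetric] f.span_image[symmetric]
    by (rule dim_span_eq_card_independent[OF f.independent_injective_image[OF B(2) inj]])
  also have "\<dots> = card B" using inj span_superset by (intro card_image inj_on_subset[OF inj])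
  finally show ?thesis using P(6) B(4) by simp
qed

end

section \<open>Hochschild cohomology as the cohomology of \<open>delta\<close>\<close>

context resolution
begin

definition bdiff :: "('g free_algebra list \<Rightarrow> complex) \<Rightarrow> 'g free_algebra list \<Rightarrow> complex" where
  "bdiff f as = (case as of [] \<Rightarrow> 0 | a # as' \<Rightarrow> \<epsilon> a * f as' - rdiff \<tau> f as)"

definition ext :: "('g free_algebra list \<Rightarrow> complex) \<Rightarrow> ('s, 'g) cofun" where
  "ext f x as = \<epsilon> (x s0) * f as"

definition Z :: "nat \<Rightarrow> ('g free_algebra list \<Rightarrow> complex) set" where
  "Z k = {f. multilin I k f \<and> (\<forall>as. bdiff f as = 0)}"

definition B :: "nat \<Rightarrow> ('g free_algebra list \<Rightarrow> complex) set" where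
  "B k = (case k of 0 \<Rightarrow> {\<lambda>_. 0} | Suc k' \<Rightarrow> {bdiff f | f. multilin I k' f})"

definition Psi :: "nat \<Rightarrow> ('g free_algebra list \<Rightarrow> complex) \<Rightarrow> 's \<Rightarrow> complex" where
  "Psi k f = psi k 0 (ext f)"

lemma \<epsilon>_D: "\<epsilon> (D (Suc 0) y s0) = 0"
proof -
  have "\<exists>y'. D (Suc 0) y s0 - (\<Sum>s\<in>J 1. M 1 s0 s * y' s) \<in> I"
    by (rule exI[of _ y]) (simp add: D_def I_0)
  then show ?thesis using exact_0 by blast
qed

lemma zcochain_ext:
  assumes "multilin I k f"
  shows "zcochain 0 k (ext f)"
proof -
  have "multilin I k (ext f x)" for x unfolding ext_def[abs_def] by (rule multilin_scale[OF assms])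
  then have "cochain 0 k (ext f)"
    by (simp add: cochain_def ext_def \<epsilon>.\<tau>_add \<epsilon>.\<tau>_mult \<epsilon>.\<tau>_scalar \<epsilon>.\<tau>_I J_0 distrib_right mult.assoc)
  then show ?thesis by (simp add: zcochain_def pull_def ext_def \<epsilon>_D)
qed

text \<open>By \<open>exact_0\<close> every \<open>x\<close> differs from
  \<open>\<epsilon> (x s0)\<close> times the basis vector only by an element of the image, where
  \<open>F\<close> vanishes.\<close>

lemma zcochain_0_eq:
  assumes "zcochain 0 k F"
  shows "F = ext (F (unit_vec_at s0))" "multilin I k (F (unit_vec_at s0))"
proof -
  have F: "cochain 0 k F" and p: "\<And>y as. F (D (Suc 0) y) as = 0"
    using assms by (auto simp: zcochain_def pull_def)
  show "multilin I k (F (unit_vec_at s0))" by (rule cochainD(1)[OF F])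
  show "F = ext (F (unit_vec_at s0))"
  proof (intro ext)
    fix x as
    let ?x = "\<lambda>s. scalar (\<epsilon> (x s0)) * unit_vec_at s0 s"
    have "\<epsilon> (x s0 - ?x s0) = 0"
      by (simp add: \<epsilon>.\<tau>_diff \<epsilon>.\<tau>_scalar \<epsilon>.\<tau>_mult \<epsilon>.\<tau>_1 unit_vec_at_def)
    then obtain y where y: "(x s0 - ?x s0) - D (Suc 0) y s0 \<in> I" unfolding exact_0 D_def by auto
    have "F (\<lambda>s. x s - ?x s) as = F (D (Suc 0) y) as"
      by (rule cochain_cong[OF F]) (use y in \<open>simp add: J_0\<close>)
    then have "F x as = F ?x as" by (simp add: p cochain_diff_arg[OF F])
    also have "\<dots> = \<epsilon> (x s0) * F (unit_vec_at s0) as" by (rule cochainD(3)[OF F])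
    finally show "F x as = local.ext (F (unit_vec_at s0)) x as" by (simp add: ext_def)
  qed
qed

lemma dv_ext: "dv (ext f) = ext (bdiff f)"
proof (intro ext)
  fix x as show "dv (local.ext f) x as = local.ext (bdiff f) x as"
    by (cases as) (simp_all add: ext_def[abs_def] bdiff_def rdiff_scale \<epsilon>.\<tau>_mult right_diff_distrib mult.assoc)
qed

lemma ext_inj: "ext f = ext g \<Longrightarrow> f = g"
proof
  fix as assume "local.ext f = local.ext g"
  then have "local.ext f (\<lambda>_. 1) as = local.ext g (\<lambda>_. 1) as" by simp
  then show "f as = g as" by (simp add: ext_def \<epsilon>.\<tau>_1)
qed

lemma cocycle_ext:
  assumes "f \<in> Z k"
  shows "cocycle 0 k (ext f)"
proof -
  have "multilin I k f" "bdiff f = (\<lambda>_. 0)" using assms by (auto simp: Z_def)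
  then show ?thesis unfolding cocycle_def dv_ext by (simp add: zcochain_ext ext_def)
qed

lemma Psi_Ker: "f \<in> Z k \<Longrightarrow> Psi k f \<in> Ker k"
  using psi_Ker[OF cocycle_ext] by (simp add: Psi_def)

text \<open>Injectivity on cohomology. In positive degrees this is \<open>coboundary_iff\<close> for
  the column 0; in degree 0 both sides say that the only value of \<open>f\<close> is zero.\<close>

lemma Psi_Im:
  assumes "f \<in> Z k"
  shows "Psi k f \<in> Im k \<longleftrightarrow> f \<in> B k"
proof (cases k)
  case 0
  have "f as = 0" if "as \<noteq> []" for as using that assms by (auto simp: Z_def 0)
  then have "f = (\<lambda>_. 0) \<longleftrightarrow> f [] = 0" by (metis (full_types))
  moreover have "Psi 0 f = (\<lambda>s. if s = s0 then f [] else 0)"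
    by (auto simp: Psi_def ext_def J_0 unit_vec_at_def \<epsilon>.\<tau>_1)
  ultimately show ?thesis by (auto simp: 0 B_def fun_eq_iff)
next
  case (Suc k')
  have "Psi k f \<in> Im k \<longleftrightarrow> (\<exists>F'. zcochain 0 k' F' \<and> ext f = dv F')"
    using coboundary_iff[of 0 k' "ext f"] cocycle_ext[OF assms] by (simp add: Suc Psi_def)
  also have "\<dots> \<longleftrightarrow> (\<exists>f'. multilin I k' f' \<and> f = bdiff f')"
  proof
    assume "\<exists>F'. zcochain 0 k' F' \<and> ext f = dv F'"
    then obtain F' where F': "zcochain 0 k' F'" "ext f = dv F'" by blast
    have "ext f = ext (bdiff (F' (unit_vec_at s0)))"
      unfolding dv_ext[symmetric] zcochain_0_eq(1)[OF F'(1), symmetric] by (rule F'(2))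
    then show "\<exists>f'. multilin I k' f' \<and> f = bdiff f'" using ext_inj zcochain_0_eq(2)[OF F'(1)] by blast
  next
    assume "\<exists>f'. multilin I k' f' \<and> f = bdiff f'"
    then show "\<exists>F'. zcochain 0 k' F' \<and> ext f = dv F'" using dv_ext zcochain_ext by metis
  qed
  finally show ?thesis by (auto simp: B_def Suc)
qed

lemma bdiff_bdiff:
  assumes "multilin I k f"
  shows "bdiff (bdiff f) as = 0"
proof -
  have "ext (bdiff (bdiff f)) (\<lambda>_. 1) as = dv (dv (ext f)) (\<lambda>_. 1) as" by (simp only: dv_ext)
  then show ?thesis by (simp add: dv_dv ext_def \<epsilon>.\<tau>_1)
qed

lemma multilin_bdiff:
  assumes "multilin I k f"
  shows "multilin I (Suc k) (bdiff f)"
proof -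
  have "cochain 0 (Suc k) (ext (bdiff f))"
    using cochain_dv[of 0 k "ext f"] zcochain_ext[OF assms] by (simp add: dv_ext zcochain_def)
  from cochainD(1)[OF this, of "\<lambda>_. 1"] show ?thesis by (simp add: ext_def[abs_def] \<epsilon>.\<tau>_1)
qed

lemma Psi_surj:
  assumes "g \<in> Ker k"
  obtains f h where "f \<in> Z k" "h \<in> Im k" "g = (\<lambda>s. Psi k f s + h s)"
proof -
  have "Ker (0 + k) = Ker k" by simp
  then obtain F h where F: "cocycle 0 k F" and h: "h \<in> (if k = 0 then {\<lambda>_. 0} else Im (0 + k))"
    and g: "g = (\<lambda>s. psi k 0 F s + h s)"
    using psi_surj[of g 0 k] assms by metis
  define f where "f = F (unit_vec_at s0)"
  have zF: "zcochain 0 k F" and dF: "\<And>x as. dv F x as = 0" using F by (auto simp: cocycle_def)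
  have Ff: "F = ext f" and m: "multilin I k f" unfolding f_def by (rule zcochain_0_eq[OF zF])+
  have "ext (bdiff f) (\<lambda>_. 1) as = 0" for as unfolding dv_ext[symmetric] Ff[symmetric] by (rule dF)
  then have "f \<in> Z k" using m by (simp add: Z_def ext_def \<epsilon>.\<tau>_1)
  moreover have "h \<in> Im k" using h by (cases k) simp_all
  ultimately show thesis using that g by (simp add: Psi_def Ff)
qed

lemma Psi_add: "Psi k (\<lambda>as. f as + g as) = (\<lambda>s. Psi k f s + Psi k g s)"
proof -
  have "ext (\<lambda>as. f as + g as) = (\<lambda>x as. ext f x as + ext g x as)"
    by (simp add: ext_def fun_eq_iff distrib_left)
  then show ?thesis by (simp add: Psi_def psi_add del: psi.simps)
qed

lemma Psi_scale: "Psi k (\<lambda>as. c * f as) = (\<lambda>s. c * Psi k f s)"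
proof -
  have "ext (\<lambda>as. c * f as) = (\<lambda>x as. c * ext f x as)"
    by (simp add: ext_def fun_eq_iff)
  then show ?thesis by (simp add: Psi_def psi_scale del: psi.simps)
qed

lemma subspace_supp: "fvec.subspace (supp p)"
  by (auto simp: fvec.subspace_def supp_def fscale_def zero_fun_apply plus_fun_apply)

lemma linear_delta: "Vector_Spaces.linear fscale fscale (delta p)"
  unfolding Vector_Spaces.linear_iff
proof (intro conjI allI)
  show "vector_space (fscale :: _ \<Rightarrow> ('s \<Rightarrow> complex) \<Rightarrow> _)" by unfold_locales
  then show "vector_space (fscale :: _ \<Rightarrow> ('s \<Rightarrow> complex) \<Rightarrow> _)" .
  show "delta p (x + y) = delta p x + delta p y" for x y unfolding plus_fun_def by (rule delta_add)
  show "delta p (fscale c x) = fscale c (delta p x)" for c x unfolding fscale_def by (rule delta_scale)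
qed

lemma supp_span: "supp p \<subseteq> fvec.span (unit_vec_at ` J p)"
proof
  fix g assume g: "g \<in> supp p"
  have "g = (\<Sum>s\<in>J p. fscale (g s) (unit_vec_at s))"
  proof
    fix r
    have "(\<Sum>s\<in>J p. g s * unit_vec_at s r) = g r"
      using g by (auto simp: supp_def unit_vec_at_def finite_J if_distrib[of "\<lambda>x. _ * x"] cong: if_cong)
    then show "g r = (\<Sum>s\<in>J p. fscale (g s) (unit_vec_at s)) r"
      by (simp add: sum_fun_apply fscale_def)
  qed
  also have "\<dots> \<in> fvec.span (unit_vec_at ` J p)"
    by (intro fvec.span_sum fvec.span_scale fvec.span_base imageI)
  finally show "g \<in> fvec.span (unit_vec_at ` J p)" .
qed

lemma dim_supp: "fvec.dim (supp p) = card (J p)"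
proof -
  let ?e = "unit_vec_at :: 's \<Rightarrow> 's \<Rightarrow> complex"
  have inj: "inj ?e" by (rule injI) (metis unit_vec_at_def zero_neq_one)
  have "fvec.independent (?e ` J p)"
  proof (subst fvec.dependent_finite)
    show "finite (?e ` J p)" using finite_J by simp
    show "\<not> (\<exists>u. (\<exists>v\<in>?e ` J p. u v \<noteq> 0) \<and> (\<Sum>v\<in>?e ` J p. fscale (u v) v) = 0)"
    proof
      assume "\<exists>u. (\<exists>v\<in>?e ` J p. u v \<noteq> 0) \<and> (\<Sum>v\<in>?e ` J p. fscale (u v) v) = 0"
      then obtain u s where s: "s \<in> J p" "u (?e s) \<noteq> 0" and 0: "(\<Sum>v\<in>?e ` J p. fscale (u v) v) = 0" by blast
      have "(\<Sum>v\<in>?e ` J p. fscale (u v) v) s = (\<Sum>r\<in>J p. fscale (u (?e r)) (?e r)) s"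
        by (subst sum.reindex[OF inj_on_subset[OF inj]]) simp_all
      also have "\<dots> = u (?e s)"
        using s(1) by (simp add: sum_fun_apply fscale_def unit_vec_at_def finite_J if_distrib[of "\<lambda>x. _ * x"] cong: if_cong)
      finally show False using 0 s(2) by (simp add: zero_fun_apply)
    qed
  qed
  moreover have "?e ` J p \<subseteq> supp p" by (auto simp: supp_def unit_vec_at_def)
  ultimately have "fvec.dim (supp p) = card (?e ` J p)"
    by (metis fvec.basis_card_eq_dim supp_span)
  then show ?thesis using card_image[OF inj_on_subset[OF inj subset_UNIV]] by simp
qed

lemma dim_Ker_Im: "fvec.dim (Ker p) + fvec.dim (Im (Suc p)) = card (J p)"
proof -
  have "Ker p = {x \<in> supp p. delta p x = 0}" by (simp add: Ker_def zero_fun_def)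
  then show ?thesis
    using fvec.rank_nullity[OF linear_delta subspace_supp supp_span finite_imageI[OF finite_J], of p]
    by (simp add: dim_supp)
qed

lemma subspace_Ker: "fvec.subspace (Ker p)"
proof -
  interpret d: Vector_Spaces.linear fscale fscale "delta p" by (rule linear_delta)
  have "Ker p = {x \<in> supp p. delta p x = 0}" by (simp add: Ker_def zero_fun_def)
  then show ?thesis using subspace_supp[of p]
    by (auto simp: fvec.subspace_def d.zero d.add d.scale)
qed

lemma subspace_Im: "fvec.subspace (Im p)"
proof (rule fvec.subspaceI)
  show "0 \<in> Im p" by (cases p) (use subspace_supp in \<open>auto simp: zero_fun_def fvec.subspace_def delta_def intro!: image_eqI[of _ _ "\<lambda>_. 0"]\<close>)
  show "x + y \<in> Im p" if "x \<in> Im p" "y \<in> Im p" for x y unfolding plus_fun_def by (rule Im_add[OF that])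
  show "fscale c x \<in> Im p" if "x \<in> Im p" for c x unfolding fscale_def by (rule Im_scale[OF that])
qed

lemma Im_subset_Ker: "Im p \<subseteq> Ker p"
proof (cases p)
  case 0
  then show ?thesis by (auto simp: Ker_def supp_def delta_def)
next
  case (Suc p')
  have "delta (Suc p') (delta p' g) = (\<lambda>_. 0)" for g
  proof -
    have A: "lin (Suc (Suc p')) (delta (Suc p') (delta p' g)) = (\<lambda>_ _. 0)"
      unfolding pull_lin[symmetric] by (intro ext pull_pull[OF cochain_lin])
    have "psi 0 (Suc (Suc p')) (lin (Suc (Suc p')) (delta (Suc p') (delta p' g))) = delta (Suc p') (delta p' g)"
      by (rule psi_lin) (simp add: supp_def delta_def)
    then show ?thesis unfolding A psi_0_fun by (rule sym)
  qed
  then show ?thesis by (auto simp: Suc Ker_def) (simp add: supp_def delta_def)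
qed

text \<open>The quotient of \<open>Ker k\<close> by \<open>Im k\<close> is realized by a projection
  \<open>P\<close> with kernel \<open>Im k\<close>. The composite of \<open>P\<close> with
  \<open>Psi k\<close> kills exactly the coboundaries and is onto, so
  \<open>coordinates_quotient\<close> applies. The sum on the left avoids subtraction of natural
  numbers.\<close>

lemma cohomology_dim:
  fixes V :: "(complex, 'c) module"
  assumes ab: "coordinates fscale V tf (Z k)"
    and N: "N = {x \<in> carrier V. tf x \<in> B k}"
  shows "vectorspace.fin_dim class_ring (quotient_module V N) \<and>
    vectorspace.dim class_ring (quotient_module V N) + fvec.dim (Im k) = fvec.dim (Ker k)"
proof -
  interpret V: coordinates fscale V tf "Z k" by (rule ab)
  have fin: "Ker k \<subseteq> fvec.span (unit_vec_at ` J k)" "finite (unit_vec_at ` J k :: ('s \<Rightarrow> complex) set)"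
    using supp_span[of k] finite_J[of k] by (auto simp: Ker_def)
  obtain P where P: "Vector_Spaces.linear fscale fscale P" "fvec.subspace (P ` Ker k)" "P ` Ker k \<subseteq> Ker k"
    "\<And>x. x \<in> Ker k \<Longrightarrow> P x = 0 \<longleftrightarrow> x \<in> Im k" "\<And>x. x \<in> Ker k \<Longrightarrow> P (P x) = P x"
    "\<And>x. x \<in> Ker k \<Longrightarrow> x - P x \<in> Im k" "fvec.dim (P ` Ker k) + fvec.dim (Im k) = fvec.dim (Ker k)"
    by (rule fvec.complement_exists[OF subspace_Im subspace_Ker Im_subset_Ker fin]) blast
  interpret P: Vector_Spaces.linear fscale fscale P by (rule P(1))
  define \<theta> where "\<theta> x = P (Psi k (tf x))" for x
  have tf: "tf x \<in> Z k" if "x \<in> carrier V" for x using V.\<beta>_in_W[OF that] .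
  have im: "tf ` carrier V = Z k" using V.bij by (simp add: bij_betw_def)
  have "coordinates fscale (quotient_module V N) (\<lambda>X. \<theta> (SOME x. x \<in> X)) (P ` Ker k)"
  proof (rule coordinates_quotient)
    show "vector_space (fscale :: _ \<Rightarrow> ('s \<Rightarrow> complex) \<Rightarrow> _)" by unfold_locales
    show "abelian_group V" by (rule V.abelian_group)
    show "c \<odot>\<^bsub>V\<^esub> x \<in> carrier V" if "x \<in> carrier V" for c x by (rule V.closed(3)[OF that])
    show "Modules.module.subspace fscale (P ` Ker k)" by (rule P(2))
    show "\<theta> (x \<oplus>\<^bsub>V\<^esub> y) = \<theta> x + \<theta> y" if "x \<in> carrier V" "y \<in> carrier V" for x y
      unfolding \<theta>_def V.hom(2)[OF that] P.add[symmetric] unfolding plus_fun_def Psi_add ..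
    show "\<theta> (c \<odot>\<^bsub>V\<^esub> x) = fscale c (\<theta> x)" if "x \<in> carrier V" for c x
      unfolding \<theta>_def V.hom(3)[OF that] P.scale[symmetric] unfolding fscale_def Psi_scale ..
    show "N = {x \<in> carrier V. \<theta> x = 0}"
      unfolding N \<theta>_def using P(4)[OF Psi_Ker[OF tf]] Psi_Im[OF tf] by blast
    show "\<theta> ` carrier V = P ` Ker k"
    proof
      show "\<theta> ` carrier V \<subseteq> P ` Ker k" unfolding \<theta>_def using Psi_Ker[OF tf] by blast
      show "P ` Ker k \<subseteq> \<theta> ` carrier V"
      proof
        fix w assume "w \<in> P ` Ker k"
        then obtain g where g: "g \<in> Ker k" "w = P g" by blast
        obtain f h where f: "f \<in> Z k" "h \<in> Im k" "g = (\<lambda>s. Psi k f s + h s)" by (rule Psi_surj[OF g(1)])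
        have "P h = 0" using P(4) f(2) Im_subset_Ker by blast
        then have "P (Psi k f + h) = P (Psi k f)" by (simp only: P.add add_0_right)
        then have "w = P (Psi k f)" using g(2) f(3) by (simp add: plus_fun_def)
        moreover obtain x where "x \<in> carrier V" "f = tf x" using f(1) im by blast
        ultimately show "w \<in> \<theta> ` carrier V" by (auto simp: \<theta>_def)
      qed
    qed
  qed
  then interpret Q: coordinates fscale "quotient_module V N" "\<lambda>X. \<theta> (SOME x. x \<in> X)" "P ` Ker k" .
  show ?thesis using Q.dim_eq[OF order_trans[OF P(3) fin(1)] fin(2)] P(7) by simp
qed

end

section \<open>Cochains of the quotient algebra\<close>

text \<open>The form with an arbitrary slot, which matches \<open>multilinear\<close>; the recursive
  form serves the inductions.\<close>

lemma multilin_iff: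
  "multilin I k f \<longleftrightarrow> (\<forall>as. length as \<noteq> k \<longrightarrow> f as = 0) \<and>
     (\<forall>xs ys a b. f (xs @ (a + b) # ys) = f (xs @ a # ys) + f (xs @ b # ys)) \<and>
     (\<forall>xs ys c a. f (xs @ (scalar c * a) # ys) = c * f (xs @ a # ys)) \<and>
     (\<forall>xs ys. \<forall>a\<in>I. f (xs @ a # ys) = 0)" (is "_ \<longleftrightarrow> ?R k f")
proof
  show "?R k f" if "multilin I k f"
  proof (intro conjI allI impI ballI)
    show "f as = 0" if "length as \<noteq> k" for as by (rule multilin_length[OF \<open>multilin I k f\<close> that])
    have *: "f (xs @ (a + b) # ys) = f (xs @ a # ys) + f (xs @ b # ys) \<and>
       f (xs @ (scalar c * a) # ys) = c * f (xs @ a # ys) \<and> (a \<in> I \<longrightarrow> f (xs @ a # ys) = 0)"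
      if "multilin I k f" for xs ys a b c
      using that
    proof (induction xs arbitrary: k f)
      case Nil
      then show ?case by (cases k) simp_all
    next
      case (Cons x xs)
      show ?case
      proof (cases k)
        case 0
        then show ?thesis using Cons.prems by simp
      next
        case (Suc k')
        have "multilin I k' (\<lambda>as. f (x # as))" using Cons.prems Suc by simp
        from Cons.IH[OF this] show ?thesis by simp
      qed
    qed
    show "f (xs @ (a + b) # ys) = f (xs @ a # ys) + f (xs @ b # ys)" for xs ys a b using *[OF that] by blast
    show "f (xs @ (scalar c * a) # ys) = c * f (xs @ a # ys)" for xs ys c a using *[OF that] by blast
    show "f (xs @ a # ys) = 0" if "a \<in> I" for xs ys a using *[OF \<open>multilin I k f\<close>] that by blast
  qed
  show "multilin I k f" if "?R k f"
    using that
  proof (induction k arbitrary: f)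
    case (Suc k)
    then have l: "\<And>as. length as \<noteq> Suc k \<Longrightarrow> f as = 0"
      and a: "\<And>xs ys a b. f (xs @ (a + b) # ys) = f (xs @ a # ys) + f (xs @ b # ys)"
      and s: "\<And>xs ys c a. f (xs @ (scalar c * a) # ys) = c * f (xs @ a # ys)"
      and i: "\<And>xs ys a. a \<in> I \<Longrightarrow> f (xs @ a # ys) = 0" by blast+
    have "multilin I k (\<lambda>as. f (x # as))" for x
      by (rule Suc.IH) (use l a[of "x # _"] s[of "x # _"] i[of _ "x # _"] in simp)
    then show ?case using l[of "[]"] a[of "[]"] s[of "[]"] i[of _ "[]"] by simp
  qed simp
qed

lemma multilin_cong:
  assumes "multilin I k f" "list_all2 (\<lambda>x y. x - y \<in> I) xs ys"
  shows "f xs = f ys"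
  using assms(2,1)
proof (induction xs ys arbitrary: k f rule: list_all2_induct)
  case (Cons x xs y ys)
  show ?case
  proof (cases k)
    case 0
    then show ?thesis using Cons.prems by simp
  next
    case (Suc k')
    then have m: "multilin I k' (\<lambda>as. f (y # as))" using Cons.prems by simp
    have add: "f ((a + b) # xs) = f (a # xs) + f (b # xs)" and I: "a \<in> I \<Longrightarrow> f (a # xs) = 0" for a b
      using Cons.prems by (simp_all add: Suc)
    have "f (x # xs) = f (y # xs)"
      using add[of "x - y" y] I[OF Cons.hyps(1)] by simp
    also have "\<dots> = f (y # ys)" by (rule Cons.IH[OF m])
    finally show ?thesis .
  qed
qed simp

text \<open>All signs are opposite to those in \<open>hochschild_d\<close>, since
  \<open>rdiff\<close> is subtracted from the term with the left action.\<close>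

lemma rdiff_eq_sum:
  "length as = Suc k \<Longrightarrow> rdiff \<tau> f as =
    (\<Sum>i<k. (-1) ^ i * f (take i as @ (as ! i * as ! Suc i) # drop (i + 2) as)) + (-1) ^ k * f (butlast as) * \<tau> (last as)"
proof (induction \<tau> f as arbitrary: k rule: rdiff.induct)
  case (3 \<tau> f a b cs)
  then obtain k' where k: "k = Suc k'" "length (b # cs) = Suc k'" by (cases k) auto
  have IH: "rdiff \<tau> (\<lambda>ys. f (a # ys)) (b # cs) =
    (\<Sum>i<k'. (-1) ^ i * f (a # take i (b # cs) @ ((b # cs) ! i * (b # cs) ! Suc i) # drop (i + 2) (b # cs))) +
    (-1) ^ k' * f (a # butlast (b # cs)) * \<tau> (last (b # cs))"
    by (rule "3.IH"[OF k(2)])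
  show ?case
    unfolding rdiff.simps IH k(1) sum.lessThan_Suc_shift
    by (simp add: sum_negf)
qed simp_all

lemma coset_of_eq_iff: "coset_of F x = coset_of F y \<longleftrightarrow> x - y \<in> rel_ideal F"
proof -
  interpret I: ideal "rel_ideal F" free_algebra by (rule ideal_rel_ideal)
  have mem: "x \<in> coset_of F y \<longleftrightarrow> x - y \<in> rel_ideal F"
  proof
    assume "x \<in> coset_of F y"
    then obtain i where "i \<in> rel_ideal F" "x = i + y" unfolding a_r_coset_def' by auto
    then show "x - y \<in> rel_ideal F" by simp
  next
    assume "x - y \<in> rel_ideal F"
    then have "(x - y) \<oplus>\<^bsub>free_algebra\<^esub> y \<in> coset_of F y" unfolding a_r_coset_def' by blast
    then show "x \<in> coset_of F y" by simp
  qed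
  show ?thesis
  proof
    assume "coset_of F x = coset_of F y"
    then show "x - y \<in> rel_ideal F" using coset_of_self[of x F] mem by blast
  next
    assume "x - y \<in> rel_ideal F"
    then show "coset_of F x = coset_of F y" using mem by (intro I.a_repr_independence'[symmetric]) auto
  qed
qed

lemma tuples_\<H>: "Xs \<in> tuples (\<H> F) k \<longleftrightarrow> (\<exists>as. Xs = map (coset_of F) as \<and> length as = k)"
proof
  assume "Xs \<in> tuples (\<H> F) k"
  then have *: "\<forall>X\<in>set Xs. \<exists>x. X = coset_of F x" "length Xs = k"
    unfolding tuples_def \<H>_simps(1) by blast+
  obtain as where "Xs = map (coset_of F) as" using *(1) unfolding ex_map_conv[symmetric] by blast
  then show "\<exists>as. Xs = map (coset_of F) as \<and> length as = k" using *(2) by (intro exI[of _ as]) simp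
next
  assume "\<exists>as. Xs = map (coset_of F) as \<and> length as = k"
  then show "Xs \<in> tuples (\<H> F) k" by (auto simp: tuples_def \<H>_simps(1))
qed

lemma map_coset_in_tuples [simp]: "map (coset_of F) as \<in> tuples (\<H> F) k \<longleftrightarrow> length as = k"
  by (auto simp: tuples_def \<H>_simps(1))

definition to_free :: "complex ^ 'n ^ 'n \<Rightarrow> nat \<Rightarrow> ('n generator free_algebra set list \<Rightarrow> complex) \<Rightarrow>
    'n generator free_algebra list \<Rightarrow> complex" where
  "to_free F k \<phi> as = (if length as = k then \<phi> (map (coset_of F) as) else 0)"

lemma to_free_inj:
  assumes "\<phi> \<in> extensional (tuples (\<H> F) k)" "\<psi> \<in> extensional (tuples (\<H> F) k)" "to_free F k \<phi> = to_free F k \<psi>"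
  shows "\<phi> = \<psi>"
proof (rule extensionalityI[OF assms(1,2)])
  fix Xs assume "Xs \<in> tuples (\<H> F) k"
  then obtain as where "Xs = map (coset_of F) as" "length as = k" unfolding tuples_\<H> by blast
  then show "\<phi> Xs = \<psi> Xs" using fun_cong[OF assms(3), of as] by (simp add: to_free_def)
qed

lemma character_bimodule_simps [simp]:
  "carrier (character_bimodule \<sigma> \<tau>) = UNIV" "x \<oplus>\<^bsub>character_bimodule \<sigma> \<tau>\<^esub> y = x + y"
  "\<zero>\<^bsub>character_bimodule \<sigma> \<tau>\<^esub> = 0" "c \<odot>\<^bsub>character_bimodule \<sigma> \<tau>\<^esub> x = c * x"
  "lact (character_bimodule \<sigma> \<tau>) a x = \<sigma> a * x" "ract (character_bimodule \<sigma> \<tau>) x a = x * \<tau> a"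
  by (simp_all add: character_bimodule_def)

lemma finsum_character_bimodule: "finite A \<Longrightarrow> finsum (character_bimodule \<sigma> \<tau>) f A = sum f A"
proof -
  interpret abelian_monoid "character_bimodule \<sigma> \<tau>"
    by (rule abelian_monoidI) (simp_all add: ac_simps)
  show "finite A \<Longrightarrow> finsum (character_bimodule \<sigma> \<tau>) f A = sum f A"
    by (induction A rule: finite_induct) simp_all
qed

lemma mem_cochains:
  fixes F :: "complex ^ 'a ^ 'a"
  shows "\<phi> \<in> carrier (cochains (\<H> F) (character_bimodule \<sigma> \<tau>) k) \<longleftrightarrow>
    \<phi> \<in> extensional (tuples (\<H> F) k) \<and> multilin (rel_ideal F) k (to_free F k \<phi>)"
proof -
  let ?q = "coset_of F"
  have "multilinear (\<H> F) (character_bimodule \<sigma> \<tau>) k \<phi> \<longleftrightarrow>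
    (\<forall>xs ys a b c. length xs + 1 + length ys = k \<longrightarrow>
      \<phi> (map ?q xs @ ?q (a + b) # map ?q ys) = \<phi> (map ?q xs @ ?q a # map ?q ys) + \<phi> (map ?q xs @ ?q b # map ?q ys) \<and>
      \<phi> (map ?q xs @ ?q (scalar c * a) # map ?q ys) = c * \<phi> (map ?q xs @ ?q a # map ?q ys))"
    (is "_ \<longleftrightarrow> ?R")
  proof
    assume L: "multilinear (\<H> F) (character_bimodule \<sigma> \<tau>) k \<phi>"
    show ?R
    proof (intro allI impI)
      fix xs ys :: "'a generator free_algebra list" and a b c assume l: "length xs + 1 + length ys = k"
      have "set (map ?q xs) \<subseteq> carrier (\<H> F) \<and> set (map ?q ys) \<subseteq> carrier (\<H> F) \<and> ?q a \<in> carrier (\<H> F) \<and> ?q b \<in> carrier (\<H> F) \<and>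
        length (map ?q xs) + 1 + length (map ?q ys) = k"
        using l by (auto simp: \<H>_simps(1))
      from L[unfolded multilinear_def, rule_format, OF this, of c]
      show "\<phi> (map ?q xs @ ?q (a + b) # map ?q ys) = \<phi> (map ?q xs @ ?q a # map ?q ys) + \<phi> (map ?q xs @ ?q b # map ?q ys) \<and>
        \<phi> (map ?q xs @ ?q (scalar c * a) # map ?q ys) = c * \<phi> (map ?q xs @ ?q a # map ?q ys)"
        by (simp add: \<H>_simps)
    qed
  next
    assume R: ?R
    show "multilinear (\<H> F) (character_bimodule \<sigma> \<tau>) k \<phi>"
      unfolding multilinear_def
    proof (intro allI impI)
      fix xs ys a b c
      assume *: "set xs \<subseteq> carrier (\<H> F) \<and> set ys \<subseteq> carrier (\<H> F) \<and> a \<in> carrier (\<H> F) \<and> b \<in> carrier (\<H> F) \<and>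
        length xs + 1 + length ys = k"
      then have "xs \<in> tuples (\<H> F) (length xs)" "ys \<in> tuples (\<H> F) (length ys)" by (auto simp: tuples_def)
      then obtain as bs where "xs = map ?q as" "ys = map ?q bs" unfolding tuples_\<H> by blast
      moreover obtain a' b' where "a = ?q a'" "b = ?q b'" using * by (auto simp: \<H>_simps(1))
      ultimately show "\<phi> (xs @ (a \<oplus>\<^bsub>\<H> F\<^esub> b) # ys) = \<phi> (xs @ a # ys) \<oplus>\<^bsub>character_bimodule \<sigma> \<tau>\<^esub> \<phi> (xs @ b # ys) \<and>
        \<phi> (xs @ (c \<odot>\<^bsub>\<H> F\<^esub> a) # ys) = c \<odot>\<^bsub>character_bimodule \<sigma> \<tau>\<^esub> \<phi> (xs @ a # ys)"
        using R * by (simp add: \<H>_simps)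
    qed
  qed
  also have "?R \<longleftrightarrow> multilin (rel_ideal F) k (to_free F k \<phi>)"
  proof
    assume R: ?R
    show "multilin (rel_ideal F) k (to_free F k \<phi>)"
      unfolding multilin_iff
    proof (intro conjI allI ballI impI)
      show "to_free F k \<phi> (xs @ (a + b) # ys) = to_free F k \<phi> (xs @ a # ys) + to_free F k \<phi> (xs @ b # ys)" for xs ys a b
        using R by (simp add: to_free_def)
      show s: "to_free F k \<phi> (xs @ (scalar c * a) # ys) = c * to_free F k \<phi> (xs @ a # ys)" for xs ys c a
        using R by (simp add: to_free_def)
      show "to_free F k \<phi> (xs @ a # ys) = 0" if "a \<in> rel_ideal F" for xs ys a
      proof -
        have "coset_of F a = coset_of F 0" using that by (simp add: coset_of_eq_iff)
        then have "to_free F k \<phi> (xs @ a # ys) = to_free F k \<phi> (xs @ (scalar 0 * a) # ys)"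
          by (simp add: to_free_def)
        then show ?thesis unfolding s by simp
      qed
    qed (simp add: to_free_def)
  next
    assume *: "multilin (rel_ideal F) k (to_free F k \<phi>)"
    show ?R
    proof (intro allI impI)
      fix xs ys :: "'a generator free_algebra list" and a b c assume "length xs + 1 + length ys = k"
      then show "\<phi> (map ?q xs @ ?q (a + b) # map ?q ys) = \<phi> (map ?q xs @ ?q a # map ?q ys) + \<phi> (map ?q xs @ ?q b # map ?q ys) \<and>
        \<phi> (map ?q xs @ ?q (scalar c * a) # map ?q ys) = c * \<phi> (map ?q xs @ ?q a # map ?q ys)"
        using *[unfolded multilin_iff, THEN conjunct2, THEN conjunct1, rule_format, of xs a b ys]
          *[unfolded multilin_iff, THEN conjunct2, THEN conjunct2, THEN conjunct1, rule_format, of xs c a ys]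
        by (simp add: to_free_def)
    qed
  qed
  finally show ?thesis by (auto simp: cochains_def PiE_def)
qed

lemma to_free_surj:
  assumes "multilin (rel_ideal F) k f"
  obtains \<phi> where "\<phi> \<in> carrier (cochains (\<H> F) (character_bimodule \<sigma> \<tau>) k)" "to_free F k \<phi> = f"
proof -
  define rep where "rep X = (SOME x. coset_of F x = X)" for X
  have rep: "coset_of F (rep (coset_of F x)) = coset_of F x" for x
    unfolding rep_def by (rule someI) (rule refl)
  define \<phi> where "\<phi> = (\<lambda>Xs \<in> tuples (\<H> F) k. f (map rep Xs))"
  have "to_free F k \<phi> as = f as" for as
  proof (cases "length as = k")
    case True
    have "f (map rep (map (coset_of F) as)) = f as"
      by (rule multilin_cong[OF assms]) (simp add: list_all2_conv_all_nth coset_of_eq_iff[symmetric] rep)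
    then show ?thesis using True by (simp add: to_free_def \<phi>_def)
  qed (simp add: to_free_def multilin_length[OF assms])
  then have *: "to_free F k \<phi> = f" by (rule ext)
  moreover have "\<phi> \<in> extensional (tuples (\<H> F) k)" by (simp add: \<phi>_def)
  ultimately show thesis using that assms by (simp add: mem_cochains)
qed

lemma to_free_hochschild_d:
  "to_free F (Suc k) (hochschild_d (\<H> F) (character_bimodule \<sigma> \<tau>) k \<phi>) as =
    (case as of [] \<Rightarrow> 0 | a # as' \<Rightarrow> \<sigma> (coset_of F a) * to_free F k \<phi> as' - rdiff (\<lambda>x. \<tau> (coset_of F x)) (to_free F k \<phi>) as)"
proof (cases "length as = Suc k")
  case False
  have "rdiff (\<lambda>x. \<tau> (coset_of F x)) f as = 0" if "\<And>as. length as \<noteq> k \<Longrightarrow> f as = 0" "length as \<noteq> Suc k" for f :: "'a generator free_algebra list \<Rightarrow> complex" and as k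
    using that
  proof (induction "\<lambda>x. \<tau> (coset_of F x)" f as arbitrary: k rule: rdiff.induct)
    case (3 f a b cs)
    have "rdiff (\<lambda>x. \<tau> (coset_of F x)) (\<lambda>ys. f (a # ys)) (b # cs) = 0"
      by (cases k) (use 3 in \<open>auto intro!: "3.hyps"[of "k - 1"]\<close>)
    then show ?case using 3 by simp
  qed auto
  from this[of k "to_free F k \<phi>" as] False show ?thesis by (auto simp: to_free_def split: list.split)
next
  case True
  then obtain a as' where as: "as = a # as'" "length as' = k" by (cases as) auto
  let ?q = "coset_of F"
  let ?f = "to_free F k \<phi>"
  have Xs: "map ?q as \<in> tuples (\<H> F) (Suc k)" using True by simp
  have t: "\<phi> (take i (map ?q as) @ (map ?q as ! i \<otimes>\<^bsub>\<H> F\<^esub> map ?q as ! Suc i) # drop (i + 2) (map ?q as)) =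
      ?f (take i as @ (as ! i * as ! Suc i) # drop (i + 2) as)" if "i < k" for i
  proof -
    have "map ?q as ! i \<otimes>\<^bsub>\<H> F\<^esub> map ?q as ! Suc i = ?q (as ! i * as ! Suc i)"
      using that True by (simp add: \<H>_simps)
    then show ?thesis using that True by (simp add: to_free_def take_map drop_map)
  qed
  have S: "(\<Sum>i=1..k. (-1) ^ i * \<phi> (take (i - 1) (map ?q as) @ (map ?q as ! (i - 1) \<otimes>\<^bsub>\<H> F\<^esub> map ?q as ! i) # drop (i + 1) (map ?q as))) =
    - (\<Sum>i<k. (-1) ^ i * ?f (take i as @ (as ! i * as ! Suc i) # drop (i + 2) as))"
    unfolding One_nat_def sum.atLeast1_atMost_eq sum_negf[symmetric] using t by (intro sum.cong) simp_all
  have "to_free F (Suc k) (hochschild_d (\<H> F) (character_bimodule \<sigma> \<tau>) k \<phi>) as =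
    \<sigma> (?q a) * \<phi> (map ?q as') - (\<Sum>i<k. (-1) ^ i * ?f (take i as @ (as ! i * as ! Suc i) # drop (i + 2) as)) +
    (-1) ^ (k + 1) * (\<phi> (butlast (map ?q as)) * \<tau> (last (map ?q as)))"
    unfolding to_free_def[of F "Suc k"] hochschild_d_def restrict_apply
    using Xs S by (simp add: True finsum_character_bimodule as(1)[symmetric]) (simp add: as(1))
  moreover have "\<phi> (butlast (map ?q as)) = ?f (butlast as)" using True by (simp add: to_free_def map_butlast)
  moreover have "last (map ?q as) = ?q (last as)" using as(1) by (simp add: last_map)
  moreover have "\<phi> (map ?q as') = ?f as'" using as(2) by (simp add: to_free_def)
  ultimately have "to_free F (Suc k) (hochschild_d (\<H> F) (character_bimodule \<sigma> \<tau>) k \<phi>) as =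
    \<sigma> (?q a) * ?f as' - rdiff (\<lambda>x. \<tau> (?q x)) ?f as"
    unfolding rdiff_eq_sum[OF True] by simp
  then show ?thesis by (simp add: as(1))
qed

locale \<H>_resolution = resolution "rel_ideal F" "\<lambda>x. \<tau> (coset_of F x)" "\<lambda>x. \<sigma> (coset_of F x)" J M s0
  for F :: "complex ^ 'n ^ 'n" and \<sigma> \<tau> :: "'n generator free_algebra set \<Rightarrow> complex"
    and J :: "nat \<Rightarrow> 's set" and M s0
begin

abbreviation "A \<equiv> \<H> F"
abbreviation "N \<equiv> character_bimodule \<sigma> \<tau>"

lemma to_free_d: "to_free F (Suc k) (hochschild_d A N k \<phi>) = bdiff (to_free F k \<phi>)"
  by (intro HOL.ext) (simp add: to_free_hochschild_d bdiff_def)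

lemma hochschild_d_extensional: "hochschild_d A N k \<phi> \<in> extensional (tuples A (Suc k))"
  by (simp add: hochschild_d_def)

lemma zero_cochain: "\<zero>\<^bsub>cochains A N k\<^esub> \<in> extensional (tuples A k)" "to_free F k \<zero>\<^bsub>cochains A N k\<^esub> = (\<lambda>_. 0)"
  by (auto simp: cochains_def to_free_def)

lemma mem_cocycles: "\<phi> \<in> cocycles A N k \<longleftrightarrow> \<phi> \<in> extensional (tuples A k) \<and> to_free F k \<phi> \<in> Z k"
proof -
  have "hochschild_d A N k \<phi> = \<zero>\<^bsub>cochains A N (Suc k)\<^esub> \<longleftrightarrow> bdiff (to_free F k \<phi>) = (\<lambda>_. 0)"
    (is "?l \<longleftrightarrow> ?r")
  proof
    show ?r if ?l using arg_cong[OF that, of "to_free F (Suc k)"] by (simp only: to_free_d zero_cochain(2))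
    show ?l if ?r
      by (rule to_free_inj[OF hochschild_d_extensional zero_cochain(1)]) (simp only: to_free_d zero_cochain(2) that)
  qed
  then show ?thesis by (auto simp: cocycles_def mem_cochains Z_def)
qed

lemma coordinates_cocycles:
  "coordinates fscale (cochains A N k \<lparr>carrier := cocycles A N k\<rparr>) (to_free F k) (Z k)"
proof -
  let ?V = "cochains A N k \<lparr>carrier := cocycles A N k\<rparr>"
  have bd: "bdiff (\<lambda>as. f as + g as) as = bdiff f as + bdiff g as" "bdiff (\<lambda>as. c * f as) as = c * bdiff f as" for f g c as
    by (cases as; simp add: bdiff_def rdiff_add rdiff_scale algebra_simps)+
  have Z: "g \<in> Z k \<Longrightarrow> (\<lambda>as. f as + g as) \<in> Z k" "(\<lambda>as. c * f as) \<in> Z k" if "f \<in> Z k" for f g c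
    using that by (auto simp: Z_def bd multilin_add multilin_scale)
  have Z0: "(\<lambda>_. 0) \<in> Z k" by (auto simp: Z_def multilin_0 bdiff_def split: list.split)
  have tf: "to_free F k (x \<oplus>\<^bsub>cochains A N k\<^esub> y) = (\<lambda>as. to_free F k x as + to_free F k y as)"
    "to_free F k (c \<odot>\<^bsub>cochains A N k\<^esub> x) = (\<lambda>as. c * to_free F k x as)" for x y c
    by (auto simp: to_free_def cochains_def)
  have e: "x \<oplus>\<^bsub>cochains A N k\<^esub> y \<in> extensional (tuples A k)" "c \<odot>\<^bsub>cochains A N k\<^esub> x \<in> extensional (tuples A k)" for x y c
    by (auto simp: cochains_def)
  show ?thesis
  proof
    show "fvec.subspace (Z k)"
      using Z Z0 by (simp add: fvec.subspace_def plus_fun_def zero_fun_def fscale_def)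
    show "bij_betw (to_free F k) (carrier ?V) (Z k)"
    proof (rule bij_betw_imageI)
      show "inj_on (to_free F k) (carrier ?V)" by (rule inj_onI) (auto simp: mem_cocycles intro: to_free_inj)
      show "to_free F k ` carrier ?V = Z k"
      proof
        show "Z k \<subseteq> to_free F k ` carrier ?V"
        proof
          fix f assume f: "f \<in> Z k"
          then have "multilin (rel_ideal F) k f" by (simp add: Z_def)
          then obtain \<phi> where "\<phi> \<in> carrier (cochains A N k)" "to_free F k \<phi> = f" by (rule to_free_surj)
          then show "f \<in> to_free F k ` carrier ?V" using f by (auto simp: mem_cocycles mem_cochains)
        qed
      qed (auto simp: mem_cocycles)
    qed
    show "\<zero>\<^bsub>?V\<^esub> \<in> carrier ?V" using zero_cochain Z0 by (simp add: mem_cocycles)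
    show "to_free F k \<zero>\<^bsub>?V\<^esub> = 0" using zero_cochain by (simp add: zero_fun_def)
    show "x \<oplus>\<^bsub>?V\<^esub> y \<in> carrier ?V" if "x \<in> carrier ?V" "y \<in> carrier ?V" for x y
      using that e(1)[of x y] Z(1) by (simp add: mem_cocycles tf)
    show "c \<odot>\<^bsub>?V\<^esub> x \<in> carrier ?V" if "x \<in> carrier ?V" for c x
      using that e(2)[of c x] Z(2) by (simp add: mem_cocycles tf)
    show "to_free F k (x \<oplus>\<^bsub>?V\<^esub> y) = to_free F k x + to_free F k y" for x y
      by (simp add: tf plus_fun_def)
    show "to_free F k (c \<odot>\<^bsub>?V\<^esub> x) = fscale c (to_free F k x)" for c x
      by (simp add: tf fscale_def)
  qed
qed

lemma coboundaries_eq: "coboundaries A N k = {\<phi> \<in> cocycles A N k. to_free F k \<phi> \<in> B k}"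
proof (cases k)
  case 0
  have "to_free F 0 \<phi> = (\<lambda>_. 0) \<longleftrightarrow> \<phi> = \<zero>\<^bsub>cochains A N 0\<^esub>" if "\<phi> \<in> extensional (tuples A 0)" for \<phi>
    using to_free_inj[OF that zero_cochain(1)] by (auto simp: zero_cochain(2))
  moreover have "\<zero>\<^bsub>cochains A N 0\<^esub> \<in> cocycles A N 0"
    by (auto simp: mem_cocycles zero_cochain Z_def bdiff_def split: list.split)
  ultimately show ?thesis using mem_cocycles[of _ 0] zero_cochain by (auto simp: 0 B_def)
next
  case (Suc k')
  have "\<phi> \<in> coboundaries A N (Suc k') \<longleftrightarrow> \<phi> \<in> cocycles A N (Suc k') \<and> to_free F (Suc k') \<phi> \<in> B (Suc k')" for \<phi>
  proof
    assume "\<phi> \<in> coboundaries A N (Suc k')"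
    then obtain \<psi> where "\<psi> \<in> carrier (cochains A N k')" and \<phi>: "\<phi> = hochschild_d A N k' \<psi>" by auto
    then have m: "multilin (rel_ideal F) k' (to_free F k' \<psi>)" by (simp add: mem_cochains)
    have "bdiff (to_free F k' \<psi>) \<in> Z (Suc k')"
      using multilin_bdiff[OF m] bdiff_bdiff[OF m] by (simp add: Z_def)
    then show "\<phi> \<in> cocycles A N (Suc k') \<and> to_free F (Suc k') \<phi> \<in> B (Suc k')"
      using m hochschild_d_extensional by (auto simp: \<phi> mem_cocycles to_free_d B_def)
  next
    assume *: "\<phi> \<in> cocycles A N (Suc k') \<and> to_free F (Suc k') \<phi> \<in> B (Suc k')"
    then obtain f where f: "to_free F (Suc k') \<phi> = bdiff f" "multilin (rel_ideal F) k' f" by (auto simp: B_def)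
    obtain \<psi> where \<psi>: "\<psi> \<in> carrier (cochains A N k')" "to_free F k' \<psi> = f" using to_free_surj[OF f(2)] .
    have "\<phi> = hochschild_d A N k' \<psi>"
      by (rule to_free_inj[of _ F "Suc k'"]) (use * f \<psi> in \<open>simp_all add: mem_cocycles to_free_d hochschild_d_extensional\<close>)
    then show "\<phi> \<in> coboundaries A N (Suc k')" using \<psi> by simp
  qed
  then show ?thesis unfolding Suc by blast
qed

lemma hochschild_cohomology_dim:
  "vectorspace.fin_dim class_ring (hochschild_cohomology A N k) \<and>
   vectorspace.dim class_ring (hochschild_cohomology A N k) + fvec.dim (Im k) = fvec.dim (Ker k)"
  unfolding hochschild_cohomology_def
  by (rule cohomology_dim[OF coordinates_cocycles]) (simp add: coboundaries_eq)

end

section \<open>The resolution of the counit\<close>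

lemma UNIV_generator: "(UNIV :: 'n :: finite generator set) = (\<lambda>(c, i, j). letter c i j) ` UNIV"
proof -
  have "g \<in> (\<lambda>(c, i, j). letter c i j) ` UNIV" for g :: "'n generator"
    using generator_exhaust[of g] by (metis case_prod_conv rangeI)
  then show ?thesis by blast
qed

lemma finite_generator [simp]: "finite (UNIV :: 'n :: finite generator set)"
  unfolding UNIV_generator by simp

lemma card_generator: "card (UNIV :: 'n :: finite generator set) = 2 * CARD('n)\<^sup>2"
proof -
  have "inj (\<lambda>(c, i, j). letter c i j :: 'n generator)" by (auto intro!: injI)
  then show ?thesis unfolding UNIV_generator by (simp add: card_image power2_eq_square)
qed

definition gcase :: "(bool \<Rightarrow> 'n \<Rightarrow> 'n \<Rightarrow> 'a) \<Rightarrow> 'n generator \<Rightarrow> 'a" where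
  "gcase f g = (case g of U i j \<Rightarrow> f True i j | V i j \<Rightarrow> f False i j)"

lemma gcase_letter [simp]: "gcase f (letter c i j) = f c i j"
  by (simp add: gcase_def letter_def)

lemma eq_unit_vec_sum:
  assumes "finite S" "r \<in> S"
  shows "(\<Sum>s\<in>S. unit_vec_at s r * x s) = (x r :: 'a :: ring_1)"
  using assms by (simp add: unit_vec_at_def if_distrib[of "\<lambda>z. z * _"] cong: if_cong)

lemma scalar_assoc: "scalar a * (scalar b * x) = scalar (a * b) * x"
  by (simp add: scalar_mult mult.assoc)

locale counit_character = generic_matrix F + \<epsilon>: free_algebra_character "rel_ideal F" \<epsilon>
  for F :: "complex ^ 'n :: finite ^ 'n" and \<epsilon> :: "'n generator free_algebra \<Rightarrow> complex" +
  assumes \<epsilon>_lt: "\<epsilon> (lt c i j) = (if i = j then 1 else 0)"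
begin

section \<open>Fox calculus with respect to the counit\<close>

primrec fox_word :: "'n generator list \<Rightarrow> 'n generator \<Rightarrow> 'n generator free_algebra" where
  "fox_word [] g = 0"
| "fox_word (x # w) g = scalar (\<epsilon> (gen x)) * fox_word w g + unit_vec_at x g * prod_list (map gen w)"

text \<open>The Fox derivative, that is, the derivation into the free right module on the generators with
  respect to the left action through the counit.\<close>

definition fox :: "'n generator free_algebra \<Rightarrow> 'n generator \<Rightarrow> 'n generator free_algebra" where
  "fox x g = (\<Sum>w\<in>Poly_Mapping.keys x. scalar (Poly_Mapping.lookup x w) * fox_word (letters w) g)"

lemma fox_add: "fox (x + y) g = fox x g + fox y g"
  unfolding fox_def by (rule setsum_keys_plus_distrib) (auto simp: scalar_add distrib_right)

lemma fox_0 [simp]: "fox 0 g = 0"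
  by (simp add: fox_def)

lemma fox_word_eq: "fox (scalar a * prod_list (map gen gs)) g = scalar a * fox_word gs g"
  unfolding single_Word[symmetric] by (cases "a = 0") (simp_all add: fox_def)

lemma fox_scalar [simp]: "fox (scalar a) g = 0"
  using fox_word_eq[of a "[]" g] by simp

lemma fox_word_append:
  "fox_word (gs @ hs) g = scalar (\<epsilon> (prod_list (map gen gs))) * fox_word hs g + fox_word gs g * prod_list (map gen hs)"
  by (induction gs) (simp_all add: \<epsilon>.\<tau>_1 \<epsilon>.\<tau>_mult scalar_mult algebra_simps)

lemma fox_mult: "fox (x * y) g = scalar (\<epsilon> x) * fox y g + fox x g * y"
proof (induction x rule: free_algebra_induct)
  case zero
  then show ?case by (simp add: \<epsilon>.\<tau>_0)
next
  case (add x x')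
  then show ?case by (simp add: distrib_right fox_add \<epsilon>.\<tau>_add scalar_add)
next
  case (mult a gs)
  let ?x = "scalar a * prod_list (map gen gs)"
  show ?case
  proof (induction y rule: free_algebra_induct)
    case (add y y')
    then show ?case by (simp add: distrib_left fox_add)
  next
    case (mult b hs)
    have "?x * (scalar b * prod_list (map gen hs)) = scalar (a * b) * prod_list (map gen (gs @ hs))"
      by (simp add: scalar_assoc mult.assoc scalar_left_commute[of "prod_list _"])
    then have "fox (?x * (scalar b * prod_list (map gen hs))) g = scalar (a * b) * fox_word (gs @ hs) g"
      by (simp only: fox_word_eq)
    also have "\<dots> = scalar (\<epsilon> ?x) * (scalar b * fox_word hs g) + scalar a * fox_word gs g * (scalar b * prod_list (map gen hs))"
      unfolding fox_word_append
      by (simp add: \<epsilon>.\<tau>_mult \<epsilon>.\<tau>_scalar distrib_left scalar_assoc mult.assoc scalar_left_commute[of "fox_word _ _"] mult.left_commute[of _ b] mult.commute[of _ b])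
    finally show ?case unfolding fox_word_eq .
  qed simp
qed

lemma fox_scale: "fox (scalar a * x) g = scalar a * fox x g"
  by (simp add: fox_mult \<epsilon>.\<tau>_scalar)

lemma fox_uminus: "fox (- x) g = - fox x g"
  using fox_scale[of "- 1" x] by (simp add: scalar_uminus)

lemma fox_diff: "fox (x - y) g = fox x g - fox y g"
  using fox_add[of x "- y"] by (simp add: fox_uminus)

lemma fox_sum: "fox (sum h A) g = (\<Sum>x\<in>A. fox (h x) g)"
  by (induction A rule: infinite_finite_induct) (simp_all add: fox_add)

lemma fox_gen: "fox (gen x) g = unit_vec_at x g"
  using fox_word_eq[of 1 "[x]" g] by simp

definition bd1 :: "('n generator \<Rightarrow> 'n generator free_algebra) \<Rightarrow> 'n generator free_algebra" where
  "bd1 v = (\<Sum>g\<in>UNIV. (gen g - scalar (\<epsilon> (gen g))) * v g)"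

text \<open>The matrix of Fox derivatives of the relations \<open>xrel\<close>, see
  \<open>fox_xrel\<close>: the column \<open>letter c i j\<close> belongs to
  \<open>xrel F c i j\<close>, so generators also serve as indices of relations.\<close>

definition bd2 :: "('n generator \<Rightarrow> 'n generator free_algebra) \<Rightarrow> 'n generator \<Rightarrow> 'n generator free_algebra" where
  "bd2 v = gcase (\<lambda>c k i. (\<Sum>l\<in>UNIV. \<Sum>j\<in>UNIV. scalar (E c $ k $ l) * (lt (\<not> c) l j * v (letter c i j))) +
     (\<Sum>m\<in>UNIV. scalar (E (\<not> c) $ m $ k) * v (letter (\<not> c) m i)))"

lemma bd1_add: "bd1 (\<lambda>g. v g + w g) = bd1 v + bd1 w"
  by (simp add: bd1_def distrib_left sum.distrib)

lemma bd1_scale: "bd1 (\<lambda>g. scalar a * v g) = scalar a * bd1 v"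
  by (simp add: bd1_def sum_distrib_left scalar_left_commute)

lemma bd1_right: "bd1 (\<lambda>g. v g * a) = bd1 v * a"
  by (simp add: bd1_def sum_distrib_right mult.assoc)

lemma bd1_unit: "bd1 (\<lambda>g. unit_vec_at x g * a) = (gen x - scalar (\<epsilon> (gen x))) * a"
  by (simp add: bd1_def unit_vec_at_def if_distrib[of "\<lambda>z. z * _"] if_distrib[of "\<lambda>z. _ * z"] cong: if_cong)

lemma bd1_eqv: "(\<And>g. v g \<doteq> w g) \<Longrightarrow> bd1 v \<doteq> bd1 w"
  unfolding bd1_def by (intro eqv_sum eqv_mult_left)

text \<open>The fundamental formula of Fox calculus. It shows that the kernel of the counit is the
  image of \<open>bd1\<close>.\<close>

lemma bd1_fox: "bd1 (fox x) = x - scalar (\<epsilon> x)"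
proof (induction x rule: free_algebra_induct)
  case zero
  then show ?case by (simp add: bd1_def \<epsilon>.\<tau>_0)
next
  case (add x y)
  have "fox (x + y) = (\<lambda>g. fox x g + fox y g)" by (intro ext fox_add)
  then show ?case using add by (simp add: bd1_add \<epsilon>.\<tau>_add scalar_add)
next
  case (mult a gs)
  have "bd1 (fox_word gs) = prod_list (map gen gs) - scalar (\<epsilon> (prod_list (map gen gs)))"
  proof (induction gs)
    case Nil
    then show ?case by (simp add: bd1_def \<epsilon>.\<tau>_1)
  next
    case (Cons x gs)
    have "fox_word (x # gs) = (\<lambda>g. scalar (\<epsilon> (gen x)) * fox_word gs g + unit_vec_at x g * prod_list (map gen gs))"
      by (intro ext) simp
    then show ?case by (simp add: bd1_add bd1_scale bd1_unit Cons \<epsilon>.\<tau>_mult scalar_mult algebra_simps)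
  qed
  moreover have "fox (scalar a * prod_list (map gen gs)) = (\<lambda>g. scalar a * fox_word gs g)" by (intro ext fox_word_eq)
  ultimately show ?case by (simp add: bd1_scale \<epsilon>.\<tau>_mult \<epsilon>.\<tau>_scalar scalar_mult right_diff_distrib)
qed

text \<open>In the free algebra the augmentation ideal is a free right module on the elements
  \<open>gen g - scalar (\<epsilon> (gen g))\<close>, and the Fox derivatives are its
  coordinates.\<close>

lemma fox_bd1: "fox (bd1 v) g = v g"
proof -
  have "fox (bd1 v) g = (\<Sum>x\<in>UNIV. unit_vec_at x g * v x)"
    unfolding bd1_def fox_sum
    by (intro sum.cong refl) (simp add: fox_mult fox_diff fox_gen \<epsilon>.\<tau>_diff \<epsilon>.\<tau>_scalar)
  then show ?thesis by (simp add: eq_unit_vec_sum)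
qed

lemma bd2_letter: "bd2 v (letter c k i) = (\<Sum>l\<in>UNIV. \<Sum>j\<in>UNIV. scalar (E c $ k $ l) * (lt (\<not> c) l j * v (letter c i j))) +
     (\<Sum>m\<in>UNIV. scalar (E (\<not> c) $ m $ k) * v (letter (\<not> c) m i))"
  by (simp add: bd2_def)

lemma bd2_add: "bd2 (\<lambda>g. v g + w g) g = bd2 v g + bd2 w g"
  by (cases rule: generator_exhaust[of g]) (simp add: bd2_letter distrib_left sum.distrib)

lemma bd2_scale: "bd2 (\<lambda>g. scalar a * v g) g = scalar a * bd2 v g"
  by (cases rule: generator_exhaust[of g])
    (simp add: bd2_letter distrib_left sum_distrib_left scalar_left_commute[of _ a])

lemma bd2_right: "bd2 (\<lambda>g. v g * a) g = bd2 v g * a"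
  by (cases rule: generator_exhaust[of g])
    (simp add: bd2_letter distrib_right sum_distrib_right mult.assoc)

lemma bd2_0: "bd2 (\<lambda>g. 0) g = 0"
  using bd2_scale[of 0 "\<lambda>_. 0" g] by simp

lemma bd2_sum: "bd2 (\<lambda>g. \<Sum>x\<in>A. v x g) g = (\<Sum>x\<in>A. bd2 (v x) g)"
  by (induction A rule: infinite_finite_induct) (simp_all add: bd2_0 bd2_add)

lemma bd2_expand: "bd2 v g = (\<Sum>x\<in>UNIV. bd2 (unit_vec_at x) g * v x)"
proof -
  have "v = (\<lambda>g. \<Sum>x\<in>UNIV. unit_vec_at x g * v x)" by (simp add: eq_unit_vec_sum)
  then have "bd2 v g = bd2 (\<lambda>g. \<Sum>x\<in>UNIV. unit_vec_at x g * v x) g" by (rule arg_cong)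
  also have "\<dots> = (\<Sum>x\<in>UNIV. bd2 (unit_vec_at x) g * v x)" unfolding bd2_sum bd2_right ..
  finally show ?thesis .
qed

lemma \<epsilon>_xrel: "\<epsilon> (xrel F c i j) = 0"
  by (rule \<epsilon>.\<tau>_I) (rule xrel_yrel_in_rel_ideal(1)[OF inv])

lemma fox_lt_lt: "fox (lt c k i * lt d l j) g =
    (if k = i then unit_vec_at (letter d l j) g else 0) + unit_vec_at (letter c k i) g * lt d l j"
  by (simp add: fox_mult fox_gen \<epsilon>_lt)

lemma fox_xrel: "fox (xrel F c i j) g = bd2 (unit_vec_at (letter c i j)) g"
proof (cases rule: generator_exhaust[of g])
  case (1 c' k i')
  show ?thesis
    unfolding 1 xrel_def fox_diff fox_sum fox_scale fox_lt_lt bd2_letter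
    by (cases "c' = c"; cases "i' = i"; cases "i' = j")
      (simp_all add: unit_vec_at_def distrib_left sum.distrib if_distrib[of "\<lambda>z. _ * z"] if_distrib[of "\<lambda>z. z * _"] sum.If_cases if_distrib[of "sum f" for f] cong: if_cong)
qed

text \<open>On a column of \<open>bd2\<close> the fundamental formula returns the relation itself,
  whose counit is zero.\<close>

lemma bd1_bd2: "bd1 (bd2 v) \<in> rel_ideal F"
proof -
  have "bd1 (\<lambda>g. bd2 (unit_vec_at x) g * a) \<in> rel_ideal F" for x a
  proof (cases rule: generator_exhaust[of x])
    case (1 c i j)
    have "bd1 (\<lambda>g. bd2 (unit_vec_at x) g * a) = bd1 (fox (xrel F c i j)) * a"
      unfolding 1 fox_xrel[symmetric] by (rule bd1_right)
    then show ?thesis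
      by (simp add: bd1_fox \<epsilon>_xrel xrel_yrel_in_rel_ideal(1)[OF inv] rel_ideal_mult_right)
  qed
  moreover have "bd2 v = (\<lambda>g. \<Sum>x\<in>UNIV. bd2 (unit_vec_at x) g * v x)" by (intro ext bd2_expand)
  moreover have "bd1 (\<lambda>g. \<Sum>x\<in>A. w x g) = (\<Sum>x\<in>A. bd1 (w x))" for A :: "'n generator set" and w
    by (induction A rule: infinite_finite_induct) (simp_all add: bd1_add, simp_all add: bd1_def)
  ultimately show ?thesis by (auto intro!: rel_ideal_sum)
qed

section \<open>Fox derivatives of relations are boundaries\<close>

definition bdry :: "('n generator \<Rightarrow> 'n generator free_algebra) \<Rightarrow> bool" where
  "bdry v \<longleftrightarrow> (\<exists>y. \<forall>g. v g \<doteq> bd2 y g)"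

lemma bdry_cong: "bdry v \<Longrightarrow> (\<And>g. w g \<doteq> v g) \<Longrightarrow> bdry w"
  unfolding bdry_def using eqv_trans by blast

lemma bdry_add:
  assumes "bdry v" "bdry w"
  shows "bdry (\<lambda>g. v g + w g)"
proof -
  obtain y z where "\<And>g. v g \<doteq> bd2 y g" "\<And>g. w g \<doteq> bd2 z g" using assms unfolding bdry_def by blast
  then have "v g + w g \<doteq> bd2 (\<lambda>g. y g + z g) g" for g unfolding bd2_add by (intro eqv_add)
  then show ?thesis unfolding bdry_def by blast
qed

lemma bdry_scale:
  assumes "bdry v"
  shows "bdry (\<lambda>g. scalar a * v g)"
proof -
  obtain y where "\<And>g. v g \<doteq> bd2 y g" using assms unfolding bdry_def by blast
  then have "scalar a * v g \<doteq> bd2 (\<lambda>g. scalar a * y g) g" for g unfolding bd2_scale by (intro eqv_mult_left)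
  then show ?thesis unfolding bdry_def by blast
qed

lemma bdry_right:
  assumes "bdry v"
  shows "bdry (\<lambda>g. v g * a)"
proof -
  obtain y where "\<And>g. v g \<doteq> bd2 y g" using assms unfolding bdry_def by blast
  then have "v g * a \<doteq> bd2 (\<lambda>g. y g * a) g" for g unfolding bd2_right by (intro eqv_mult_right)
  then show ?thesis unfolding bdry_def by blast
qed

text \<open>By the product rule this set is a two-sided ideal: for a factor in the ideal of
  relations, a multiplier on the left acts on the derivative through the counit modulo relations,
  and a multiplier on the right acts by multiplication. So only the generating relations have to be
  checked.\<close>

definition rel_bdry :: "'n generator free_algebra set" where
  "rel_bdry = {x \<in> rel_ideal F. bdry (fox x)}"

lemma rel_bdry_0: "0 \<in> rel_bdry"
proof -
  have "bdry (fox 0)" unfolding bdry_def by (rule exI[of _ "\<lambda>_. 0"]) (simp add: bd2_0)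
  then show ?thesis by (simp add: rel_bdry_def)
qed

lemma rel_bdry_add: "x \<in> rel_bdry \<Longrightarrow> y \<in> rel_bdry \<Longrightarrow> x + y \<in> rel_bdry"
  unfolding rel_bdry_def by (auto simp: rel_ideal_add fox_add intro: bdry_cong[OF bdry_add])

lemma rel_bdry_sum: "(\<And>k. k \<in> A \<Longrightarrow> h k \<in> rel_bdry) \<Longrightarrow> sum h A \<in> rel_bdry"
  by (induction A rule: infinite_finite_induct) (auto intro: rel_bdry_add rel_bdry_0)

lemma eqv_0: "x \<in> rel_ideal F \<Longrightarrow> x \<doteq> 0"
  by (simp add: eqv_def)

lemma rel_bdry_left: "x \<in> rel_bdry \<Longrightarrow> a * x \<in> rel_bdry"
proof -
  assume x: "x \<in> rel_bdry"
  have "fox (a * x) g \<doteq> scalar (\<epsilon> a) * fox x g" for g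
    using eqv_add[OF eqv_refl eqv_0[OF rel_ideal_mult_left]] x by (simp add: fox_mult rel_bdry_def)
  then show ?thesis
    using x bdry_cong[OF bdry_scale, of "fox x" "fox (a * x)" "\<epsilon> a"] by (simp add: rel_bdry_def rel_ideal_mult_left)
qed

lemma rel_bdry_right: "x \<in> rel_bdry \<Longrightarrow> x * a \<in> rel_bdry"
proof -
  assume x: "x \<in> rel_bdry"
  have "fox (x * a) = (\<lambda>g. fox x g * a)" using x by (auto simp: fun_eq_iff fox_mult rel_bdry_def \<epsilon>.\<tau>_I)
  then show ?thesis
    using x bdry_right[of "fox x" a] by (simp add: rel_bdry_def rel_ideal_mult_right)
qed

lemma xrel_bdry: "xrel F c i j \<in> rel_bdry"
  unfolding rel_bdry_def bdry_def
  using fox_xrel xrel_yrel_in_rel_ideal(1)[OF inv] by (auto intro!: exI[of _ "unit_vec_at (letter c i j)"])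

text \<open>Both sides are a product of three generators with the colours \<open>\<not> c\<close>,
  \<open>c\<close>, \<open>\<not> c\<close>, contracted by \<open>E\<close> on the first two and by
  \<open>G\<close> on the last two, minus the same generator. They differ only in the
  bracketing.\<close>

lemma xrel_yrel:
  "(\<Sum>k\<in>UNIV. \<Sum>l\<in>UNIV. scalar (E (\<not> c) $ k $ l) * (lt (\<not> c) k i * yrel F c l j)) =
   (\<Sum>m\<in>UNIV. \<Sum>r\<in>UNIV. scalar (G c $ m $ r) * (xrel F (\<not> c) i m * lt (\<not> c) j r))"
proof -
  let ?t = "\<lambda>k l m r. scalar (E (\<not> c) $ k $ l * G c $ m $ r) * (lt (\<not> c) k i * (lt c l m * lt (\<not> c) j r))"
  have "(\<Sum>k\<in>UNIV. \<Sum>l\<in>UNIV. scalar (E (\<not> c) $ k $ l) * (lt (\<not> c) k i * yrel F c l j)) =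
    (\<Sum>k\<in>UNIV. \<Sum>l\<in>UNIV. \<Sum>m\<in>UNIV. \<Sum>r\<in>UNIV. ?t k l m r) -
    (\<Sum>k\<in>UNIV. scalar (\<Sum>l\<in>UNIV. E (\<not> c) $ k $ l * G c $ l $ j) * lt (\<not> c) k i)"
    by (simp add: yrel_def right_diff_distrib sum_subtractf sum_distrib_left sum_distrib_right scalar_sum scalar_assoc
        scalar_left_commute[of "lt _ _ _"] mult.assoc scalar_commute[of "lt _ _ _"])
  also have "\<dots> = (\<Sum>k\<in>UNIV. \<Sum>l\<in>UNIV. \<Sum>m\<in>UNIV. \<Sum>r\<in>UNIV. ?t k l m r) - lt (\<not> c) j i"
    using EG[of "\<not> c"] by (simp add: if_distrib[of scalar] if_distrib[of "\<lambda>x. x * _"] cong: if_cong)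
  finally have 1: "(\<Sum>k\<in>UNIV. \<Sum>l\<in>UNIV. scalar (E (\<not> c) $ k $ l) * (lt (\<not> c) k i * yrel F c l j)) =
    (\<Sum>k\<in>UNIV. \<Sum>l\<in>UNIV. \<Sum>m\<in>UNIV. \<Sum>r\<in>UNIV. ?t k l m r) - lt (\<not> c) j i" .
  have "(\<Sum>m\<in>UNIV. \<Sum>r\<in>UNIV. scalar (G c $ m $ r) * (xrel F (\<not> c) i m * lt (\<not> c) j r)) =
    (\<Sum>m\<in>UNIV. \<Sum>r\<in>UNIV. \<Sum>k\<in>UNIV. \<Sum>l\<in>UNIV. ?t k l m r) -
    (\<Sum>m\<in>UNIV. \<Sum>r\<in>UNIV. scalar (E (\<not> c) $ i $ m * G c $ m $ r) * lt (\<not> c) j r)"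
    by (simp add: xrel_def left_diff_distrib right_diff_distrib sum_subtractf sum_distrib_left sum_distrib_right scalar_assoc
        mult.assoc mult.commute[of "G c $ _ $ _"])
  also have "(\<Sum>m\<in>UNIV. \<Sum>r\<in>UNIV. scalar (E (\<not> c) $ i $ m * G c $ m $ r) * lt (\<not> c) j r) =
    (\<Sum>r\<in>UNIV. scalar (\<Sum>m\<in>UNIV. E (\<not> c) $ i $ m * G c $ m $ r) * lt (\<not> c) j r)"
    unfolding scalar_sum sum_distrib_right by (rule sum.swap)
  also have "\<dots> = lt (\<not> c) j i"
    using EG[of "\<not> c"] by (simp add: if_distrib[of scalar] if_distrib[of "\<lambda>x. x * _"] cong: if_cong)
  also have "(\<Sum>m\<in>UNIV. \<Sum>r\<in>UNIV. \<Sum>k\<in>UNIV. \<Sum>l\<in>UNIV. ?t k l m r) = (\<Sum>k\<in>UNIV. \<Sum>l\<in>UNIV. \<Sum>m\<in>UNIV. \<Sum>r\<in>UNIV. ?t k l m r)"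
  proof -
    have "(\<Sum>m\<in>UNIV. \<Sum>r\<in>UNIV. \<Sum>k\<in>UNIV. \<Sum>l\<in>UNIV. ?t k l m r) =
      (\<Sum>p\<in>UNIV \<times> UNIV. \<Sum>q\<in>UNIV \<times> UNIV. ?t (fst q) (snd q) (fst p) (snd p))"
      by (simp only: sum.cartesian_product' case_prod_beta fst_conv snd_conv)
    also have "\<dots> = (\<Sum>q\<in>UNIV \<times> UNIV. \<Sum>p\<in>UNIV \<times> UNIV. ?t (fst q) (snd q) (fst p) (snd p))" by (rule sum.swap)
    also have "\<dots> = (\<Sum>k\<in>UNIV. \<Sum>l\<in>UNIV. \<Sum>m\<in>UNIV. \<Sum>r\<in>UNIV. ?t k l m r)"
      by (simp only: sum.cartesian_product' case_prod_beta fst_conv snd_conv)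
    finally show ?thesis .
  qed
  finally show ?thesis using 1 by simp
qed

text \<open>The reason why the column relations add no generators to the resolution. In
  \<open>xrel_yrel\<close> the generators to the left of \<open>yrel\<close> enter the Fox
  derivative only through their counit, a Kronecker delta, so the left side has the same derivative
  as the linear combination \<open>z i\<close>; the right side lies in the ideal generated by row
  relations. Since \<open>G c\<close> inverts \<open>E (\<not> c)\<close>, each \<open>yrel\<close>
  is recovered.\<close>

lemma yrel_bdry: "yrel F c n j \<in> rel_bdry"
proof -
  define z where "z i = (\<Sum>l\<in>UNIV. scalar (E (\<not> c) $ i $ l) * yrel F c l j)" for i
  have y: "yrel F c l j \<in> rel_ideal F" for l by (rule xrel_yrel_in_rel_ideal(2)[OF inv])
  have z: "z i \<in> rel_bdry" for i
  proof -
    let ?x = "\<Sum>k\<in>UNIV. \<Sum>l\<in>UNIV. scalar (E (\<not> c) $ k $ l) * (lt (\<not> c) k i * yrel F c l j)"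
    have "?x \<in> rel_bdry"
      unfolding xrel_yrel by (intro rel_bdry_sum rel_bdry_left rel_bdry_right xrel_bdry)
    moreover have "fox (z i) g \<doteq> fox ?x g" for g
    proof -
      have "fox ?x g = (\<Sum>k\<in>UNIV. \<Sum>l\<in>UNIV. scalar (E (\<not> c) $ k $ l) * ((if k = i then fox (yrel F c l j) g else 0) +
          fox (lt (\<not> c) k i) g * yrel F c l j))"
        unfolding fox_sum fox_scale fox_mult \<epsilon>_lt by (intro sum.cong refl) (simp add: \<epsilon>.\<tau>_scalar)
      also have "\<dots> \<doteq> (\<Sum>k\<in>UNIV. \<Sum>l\<in>UNIV. scalar (E (\<not> c) $ k $ l) * ((if k = i then fox (yrel F c l j) g else 0) + 0))"
        by (intro eqv_sum eqv_mult_left eqv_add eqv_refl eqv_0 rel_ideal_mult_left y)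
      also have "\<dots> = fox (z i) g"
        unfolding z_def fox_sum fox_scale by (subst sum.swap) (simp add: if_distrib[of "\<lambda>x. _ * x"] cong: if_cong)
      finally show ?thesis by (rule eqv_sym)
    qed
    moreover have "z i \<in> rel_ideal F" unfolding z_def by (intro rel_ideal_sum rel_ideal_mult_left y)
    ultimately show ?thesis unfolding rel_bdry_def using bdry_cong by blast
  qed
  have "(\<Sum>i\<in>UNIV. scalar (G c $ n $ i) * z i) = (\<Sum>l\<in>UNIV. scalar (\<Sum>i\<in>UNIV. G c $ n $ i * E (\<not> c) $ i $ l) * yrel F c l j)"
    unfolding z_def scalar_sum sum_distrib_left sum_distrib_right
    by (subst sum.swap) (simp add: scalar_mult mult.assoc)
  also have "\<dots> = yrel F c n j"
    by (simp add: GE if_distrib[of scalar] if_distrib[of "\<lambda>x. x * _"] cong: if_cong)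
  finally show ?thesis using rel_bdry_sum[of UNIV "\<lambda>i. scalar (G c $ n $ i) * z i"] rel_bdry_left[OF z] by simp
qed

lemma rel_ideal_bdry: "x \<in> rel_ideal F \<Longrightarrow> bdry (fox x)"
proof -
  have "rel_ideal F \<subseteq> rel_bdry"
  proof (rule rel_ideal_minimal)
    show "relations F \<subseteq> rel_bdry"
    proof
      fix r assume "r \<in> relations F"
      with inv show "r \<in> rel_bdry"
        by (cases rule: relations_cases) (auto intro!: rel_bdry_sum xrel_bdry yrel_bdry intro: rel_bdry_left rel_bdry_right)
    qed
  qed (use rel_bdry_0 rel_bdry_add rel_bdry_left rel_bdry_right in auto)
  then show "x \<in> rel_ideal F \<Longrightarrow> bdry (fox x)" unfolding rel_bdry_def by blast
qed

text \<open>By \<open>fox_bd1\<close> the vector \<open>v\<close> is the Fox derivative of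
  \<open>bd1 v\<close>, so if the latter lies in the ideal, \<open>rel_ideal_bdry\<close>
  applies.\<close>

lemma bd1_exact: "bd1 v \<in> rel_ideal F \<longleftrightarrow> bdry v"
proof
  assume "bd1 v \<in> rel_ideal F"
  from rel_ideal_bdry[OF this] show "bdry v" unfolding fox_bd1 .
next
  assume "bdry v"
  then obtain y where "\<And>g. v g \<doteq> bd2 y g" unfolding bdry_def by blast
  then have "bd1 v \<doteq> bd1 (bd2 y)" by (rule bd1_eqv)
  then show "bd1 v \<in> rel_ideal F"
    using rel_ideal_add[OF _ bd1_bd2[of y], of "bd1 v - bd1 (bd2 y)"] by (simp add: eqv_def)
qed

lemma \<epsilon>_exact: "\<epsilon> z = 0 \<longleftrightarrow> (\<exists>y. z \<doteq> bd1 y)"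
proof
  assume "\<epsilon> z = 0"
  then show "\<exists>y. z \<doteq> bd1 y" using bd1_fox[of z] by (intro exI[of _ "fox z"]) simp
next
  assume "\<exists>y. z \<doteq> bd1 y"
  then obtain y where "\<epsilon> (z - bd1 y) = 0" unfolding eqv_def using \<epsilon>.\<tau>_I by blast
  moreover have "\<epsilon> (bd1 y) = 0" by (simp add: bd1_def \<epsilon>.\<tau>_sum \<epsilon>.\<tau>_mult \<epsilon>.\<tau>_diff \<epsilon>.\<tau>_scalar)
  ultimately show "\<epsilon> z = 0" by (simp add: \<epsilon>.\<tau>_diff)
qed

lemma bd2_exact: "(\<forall>g. bd2 v g \<in> rel_ideal F) \<longleftrightarrow>
  (\<exists>y. \<forall>c m i. v (letter c m i) \<doteq> syzygy_elt y c m i)"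
proof -
  \<comment> \<open>This is \<open>bd2\<close> multiplied by \<open>G (\<not> c)\<close>, the
    inverse of \<open>E c\<close>. It has the shape required by \<open>exact_elt\<close>, and it is
    where \<open>syz\<close> comes from.\<close>
  define h where "h w c i l = (\<Sum>j\<in>UNIV. lt (\<not> c) l j * w (letter c i j)) +
      (\<Sum>m\<in>UNIV. scalar (syz E G c l m) * w (letter (\<not> c) m i))"
    for w :: "'n generator \<Rightarrow> 'n generator free_algebra" and c i l
  have bd2_h: "bd2 w (letter c k i) = (\<Sum>l\<in>UNIV. scalar (E c $ k $ l) * h w c i l)" for w c k i
  proof -
    have "(\<Sum>l\<in>UNIV. scalar (E c $ k $ l) * (\<Sum>m\<in>UNIV. scalar (syz E G c l m) * w (letter (\<not> c) m i))) =
      (\<Sum>m\<in>UNIV. scalar (\<Sum>l\<in>UNIV. E c $ k $ l * syz E G c l m) * w (letter (\<not> c) m i))"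
      unfolding scalar_sum sum_distrib_left sum_distrib_right
      by (subst sum.swap) (simp add: scalar_mult mult.assoc)
    moreover have "(\<Sum>l\<in>UNIV. E c $ k $ l * syz E G c l m) = E (\<not> c) $ m $ k" for m
    proof -
      have "(\<Sum>l\<in>UNIV. E c $ k $ l * syz E G c l m) = (\<Sum>k'\<in>UNIV. (\<Sum>l\<in>UNIV. E c $ k $ l * G (\<not> c) $ l $ k') * E (\<not> c) $ m $ k')"
        unfolding syz_def sum_distrib_left sum_distrib_right by (subst sum.swap) (simp add: mult.assoc)
      then show ?thesis by (simp add: EG if_distrib[of "\<lambda>x. x * _"] cong: if_cong)
    qed
    ultimately show ?thesis by (simp add: bd2_letter h_def distrib_left sum.distrib sum_distrib_left)
  qed
  have h_bd2: "h w c i l = (\<Sum>k\<in>UNIV. scalar (G (\<not> c) $ l $ k) * bd2 w (letter c k i))" for w c i l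
  proof -
    have "(\<Sum>k\<in>UNIV. scalar (G (\<not> c) $ l $ k) * bd2 w (letter c k i)) =
      (\<Sum>l'\<in>UNIV. scalar (\<Sum>k\<in>UNIV. G (\<not> c) $ l $ k * E c $ k $ l') * h w c i l')"
      unfolding bd2_h scalar_sum sum_distrib_left sum_distrib_right
      by (subst sum.swap) (simp add: scalar_mult mult.assoc)
    also have "\<dots> = h w c i l"
      using GE[of "\<not> c"] by (simp add: if_distrib[of scalar] if_distrib[of "\<lambda>x. x * _"] cong: if_cong)
    finally show ?thesis by (rule sym)
  qed
  show ?thesis
  proof
    assume *: "\<forall>g. bd2 v g \<in> rel_ideal F"
    have "h v c i l \<in> rel_ideal F" for c i l
      unfolding h_bd2 using * by (intro rel_ideal_sum rel_ideal_mult_left) blast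
    then show "\<exists>y. \<forall>c m i. v (letter c m i) \<doteq> syzygy_elt y c m i"
      using exact_elt[of "\<lambda>c i j. v (letter c i j)"] unfolding h_def by blast
  next
    assume "\<exists>y. \<forall>c m i. v (letter c m i) \<doteq> syzygy_elt y c m i"
    then obtain y where y: "\<And>c m i. v (letter c m i) \<doteq> syzygy_elt y c m i" by blast
    define w where "w = gcase (syzygy_elt y)"
    have w: "h w c i l \<in> rel_ideal F" for c i l
      unfolding h_def w_def gcase_letter by (rule syzygy_elt_equation)
    have "h v c i l \<doteq> h w c i l" for c i l
      unfolding h_def by (intro eqv_add eqv_sum eqv_mult_left) (simp_all add: w_def y)
    then have "h v c i l \<in> rel_ideal F" for c i l
      using rel_ideal_add[OF _ w, of "h v c i l - h w c i l" c i l] by (simp add: eqv_def)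
    then have "bd2 v (letter c k i) \<in> rel_ideal F" for c k i
      unfolding bd2_h by (intro rel_ideal_sum rel_ideal_mult_left)
    then show "\<forall>g. bd2 v g \<in> rel_ideal F" using generator_exhaust by metis
  qed
qed

lemma syzygy_elt_exact: "(\<forall>c m i. syzygy_elt v c m i \<in> rel_ideal F) \<longleftrightarrow> (\<forall>c. v c \<in> rel_ideal F)"
proof
  assume "\<forall>c. v c \<in> rel_ideal F"
  then show "\<forall>c m i. syzygy_elt v c m i \<in> rel_ideal F"
    unfolding syzygy_elt_def by (intro allI rel_ideal_diff rel_ideal_sum rel_ideal_mult_left) blast+
qed (use syzygy_elt_inj in blast)

end

section \<open>The cohomology of \<open>\<H>(F)\<close>\<close>

lemma sum_generator: "(\<Sum>g\<in>UNIV. f g) = (\<Sum>c\<in>UNIV. \<Sum>i\<in>UNIV. \<Sum>j\<in>UNIV. f (letter c i (j :: 'n :: finite)))"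
proof -
  have inj: "inj (\<lambda>(c, i, j). letter c i j :: 'n generator)" by (auto intro!: injI)
  have "(\<Sum>g\<in>UNIV. f g) = (\<Sum>x\<in>UNIV \<times> UNIV \<times> UNIV. case x of (c, i, j) \<Rightarrow> f (letter c i j))"
    unfolding UNIV_generator sum.reindex[OF inj] by (simp add: o_def case_prod_beta)
  then show ?thesis unfolding sum.cartesian_product' by (simp only: prod.case)
qed

text \<open>All modules of the resolution are indexed by one sum type, while the exactness
  statements speak of functions on one summand; values on the other summand are arbitrary.\<close>

lemma ex_Inl: "(\<exists>y. Q y) \<longleftrightarrow> (\<exists>y. Q (\<lambda>g. y (Inl g :: 'a + 'b)))"
proof
  assume "\<exists>y. Q y"
  then obtain y where "Q y" ..
  then have "Q (\<lambda>g. (case_sum y undefined) (Inl g :: 'a + 'b))" by simp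
  then show "\<exists>y. Q (\<lambda>g. y (Inl g :: 'a + 'b))" by (rule exI[of _ "case_sum y undefined"])
qed blast

lemma ex_Inr: "(\<exists>y. Q y) \<longleftrightarrow> (\<exists>y. Q (\<lambda>g. y (Inr g :: 'a + 'b)))"
proof
  assume "\<exists>y. Q y"
  then obtain y where "Q y" ..
  then have "Q (\<lambda>g. (case_sum undefined y) (Inr g :: 'a + 'b))" by simp
  then show "\<exists>y. Q (\<lambda>g. y (Inr g :: 'a + 'b))" by (rule exI[of _ "case_sum undefined y"])
qed blast

locale character_pair = counit_character F "\<lambda>x. \<sigma> (coset_of F x)" +
  \<tau>: free_algebra_character "rel_ideal F" "\<lambda>x. \<tau> (coset_of F x)"
  for F :: "complex ^ 'n :: finite ^ 'n" and \<sigma> \<tau> :: "'n generator free_algebra set \<Rightarrow> complex"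
begin

section \<open>The resolution in matrix form\<close>

definition boundary :: "nat \<Rightarrow> ('n generator + bool \<Rightarrow> 'n generator free_algebra) \<Rightarrow> 'n generator + bool \<Rightarrow> 'n generator free_algebra" where
  "boundary p x r =
    (if p = 1 then bd1 (\<lambda>g. x (Inl g))
     else if p = 2 then (case r of Inl g \<Rightarrow> bd2 (\<lambda>g. x (Inl g)) g | Inr _ \<Rightarrow> 0)
     else if p = 3 then (case r of Inl g \<Rightarrow> gcase (syzygy_elt (\<lambda>c. x (Inr c))) g | Inr _ \<Rightarrow> 0)
     else 0)"

definition bd_entry :: "nat \<Rightarrow> 'n generator + bool \<Rightarrow> 'n generator + bool \<Rightarrow> 'n generator free_algebra" where
  "bd_entry p r s = boundary p (unit_vec_at s) r"

text \<open>For \<open>n = CARD('n)\<close> the ranks are 1, \<open>2 n^2\<close>,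
  \<open>2 n^2\<close>, 2 and then 0. The index of the module of rank 1 is an arbitrary element of
  the sum type.\<close>

definition idx :: "nat \<Rightarrow> ('n generator + bool) set" where
  "idx p = (if p = 0 then {Inr False} else if p = 1 \<or> p = 2 then range Inl else if p = 3 then range Inr else {})"

lemma unit_vec_at_Inl: "(\<lambda>g. unit_vec_at (Inl x) (Inl g)) = unit_vec_at x"
  and unit_vec_at_Inr: "(\<lambda>g. unit_vec_at (Inr y) (Inr g)) = unit_vec_at y"
  by (auto simp: unit_vec_at_def fun_eq_iff)

lemma bd1_expand: "bd1 v = (\<Sum>x\<in>UNIV. bd1 (unit_vec_at x) * v x)"
  using bd1_unit[of _ 1] by (simp add: bd1_def)

lemma syzygy_elt_expand: "syzygy_elt y c m i = (\<Sum>d\<in>UNIV. syzygy_elt (unit_vec_at d) c m i * y d)"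
  by (cases c)
    (simp_all add: syzygy_elt_def UNIV_bool unit_vec_at_def sum_distrib_right mult.assoc)

lemma boundary_eq:
  assumes "p \<noteq> 0"
  shows "(\<Sum>s\<in>idx p. bd_entry p r s * x s) = boundary p x r"
proof -
  consider "p = 1" | "p = 2" | "p = 3" | "p > 3" using assms by linarith
  then show ?thesis
  proof cases
    case 1
    then show ?thesis
      using bd1_expand[of "\<lambda>g. x (Inl g)"]
      by (simp add: idx_def bd_entry_def boundary_def sum.reindex unit_vec_at_Inl)
  next
    case 2
    then show ?thesis
      using bd2_expand[of "\<lambda>g. x (Inl g)"]
      by (cases r) (simp_all add: idx_def bd_entry_def boundary_def sum.reindex unit_vec_at_Inl)
  next
    case 3
    show ?thesis
    proof (cases r)
      case (Inl g)
      obtain c m i where "g = letter c m i" by (rule generator_exhaust)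
      then show ?thesis using syzygy_elt_expand[of "\<lambda>c. x (Inr c)" c m i]
        by (simp add: 3 Inl idx_def bd_entry_def boundary_def sum.reindex unit_vec_at_Inr)
    qed (simp add: 3 bd_entry_def boundary_def)
  next
    case 4
    then show ?thesis by (simp add: idx_def boundary_def)
  qed
qed

lemma all_letter: "(\<forall>g. P g) \<longleftrightarrow> (\<forall>c i j. P (letter c i j))"
  using generator_exhaust by metis

sublocale R: \<H>_resolution F \<sigma> \<tau> idx bd_entry "Inr False"
proof
  show "(0 :: 'n generator free_algebra) \<in> rel_ideal F" by simp
  show "finite (idx p)" for p by (auto simp: idx_def)
  show "idx 0 = {Inr False}" by (simp add: idx_def)
  show "\<sigma> (coset_of F z) = 0 \<longleftrightarrow> (\<exists>y. z - (\<Sum>s\<in>idx 1. bd_entry 1 (Inr False) s * y s) \<in> rel_ideal F)" for z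
  proof -
    have "(\<exists>y. z \<doteq> bd1 y) \<longleftrightarrow> (\<exists>y. z \<doteq> bd1 (\<lambda>g. y (Inl g :: 'n generator + bool)))"
      by (rule ex_Inl)
    then show ?thesis unfolding \<epsilon>_exact by (simp add: boundary_eq) (simp add: boundary_def eqv_def)
  qed
  show "(\<forall>r\<in>idx p. (\<Sum>s\<in>idx (Suc p). bd_entry (Suc p) r s * v s) \<in> rel_ideal F) \<longleftrightarrow>
     (\<exists>y. \<forall>s\<in>idx (Suc p). v s - (\<Sum>s'\<in>idx (Suc (Suc p)). bd_entry (Suc (Suc p)) s s' * y s') \<in> rel_ideal F)" for p v
  proof -
    consider "p = 0" | "p = 1" | "p = 2" | "p > 2" by linarith
    then show ?thesis
    proof cases
      case 1
      have "(\<exists>y. \<forall>g. v (Inl g) \<doteq> bd2 y g) \<longleftrightarrow> (\<exists>y. \<forall>g. v (Inl g) \<doteq> bd2 (\<lambda>g. y (Inl g :: 'n generator + bool)) g)"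
        by (rule ex_Inl)
      then show ?thesis
        using bd1_exact[of "\<lambda>g. v (Inl g)"] unfolding bdry_def
        by (simp add: boundary_eq 1) (simp add: boundary_def idx_def eqv_def numeral_2_eq_2)
    next
      case 2
      have "(\<exists>y. \<forall>c m i. v (Inl (letter c m i)) \<doteq> syzygy_elt y c m i) \<longleftrightarrow>
        (\<exists>y. \<forall>c m i. v (Inl (letter c m i)) \<doteq> syzygy_elt (\<lambda>c. y (Inr c :: 'n generator + bool)) c m i)"
        by (rule ex_Inr)
      then show ?thesis
        using bd2_exact[of "\<lambda>g. v (Inl g)"]
        by (simp add: boundary_eq 2) (simp add: boundary_def idx_def eqv_def numeral_2_eq_2 numeral_3_eq_3 all_letter)
    next
      case 3
      then show ?thesis
        using syzygy_elt_exact[of "\<lambda>c. v (Inr c)"]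
        by (simp add: boundary_eq) (simp add: boundary_def idx_def all_letter)
    next
      case 4
      then show ?thesis by (simp add: idx_def)
    qed
  qed
qed (auto intro: rel_ideal_intros)

section \<open>Dimensions of kernels and images after applying the character\<close>

definition S :: "complex ^ 'n ^ 'n" where "S = (\<chi> i j. \<tau> (coset_of F (lt True i j)))"
definition T :: "complex ^ 'n ^ 'n" where "T = (\<chi> i j. \<tau> (coset_of F (lt False i j)))"

lemma \<tau>_lt: "\<tau> (coset_of F (lt c i j)) = (if c then S else T) $ i $ j"
  by (simp add: S_def T_def)

lemma T_S: "transpose T ** S = mat 1" "S ** transpose T = mat 1"
proof -
  have "\<tau> (coset_of F (xrel F False i j)) = 0" for i j
    by (rule \<tau>.\<tau>_I) (rule xrel_yrel_in_rel_ideal(1)[OF inv])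
  then have "(\<Sum>k\<in>UNIV. T $ k $ i * S $ k $ j) = mat 1 $ i $ j" for i j
    unfolding xrel_def by (simp add: \<tau>.\<tau>_diff \<tau>.\<tau>_sum \<tau>.\<tau>_mult \<tau>.\<tau>_scalar \<tau>_lt cup_def mat_1_entry
        if_distrib[of "\<lambda>x. x * _"] cong: if_cong)
  then show *: "transpose T ** S = mat 1" by (simp add: vec_eq_iff mult_entry transpose_def)
  then show "S ** transpose T = mat 1" by (simp add: matrix_left_right_inverse)
qed

lemma card_idx: "card (idx 0) = 1" "card (idx 1) = 2 * CARD('n)\<^sup>2" "card (idx 2) = 2 * CARD('n)\<^sup>2"
  "card (idx 3) = 2" "k \<ge> 4 \<Longrightarrow> card (idx k) = 0"
  by (simp_all add: idx_def card_image card_generator UNIV_bool)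

lemma dim_Im_0: "fvec.dim (R.Im 0) = 0"
proof -
  have "R.Im 0 = fvec.span {}" by (simp add: zero_fun_def)
  then show ?thesis by (simp only: fvec.dim_span_eq_card_independent[OF fvec.independent_empty] card.empty)
qed

text \<open>The differential multiplies the only coordinate by the difference of the character and
  the counit on each generator, so the kernel is everything or zero.\<close>

lemma dim_Ker_0: "fvec.dim (R.Ker 0) = (if S = mat 1 \<and> T = mat 1 then 1 else 0)"
proof -
  have d: "R.delta 0 g (Inl x) = g (Inr False) * (\<tau> (coset_of F (gen x)) - \<sigma> (coset_of F (gen x)))" for g x
    using bd1_unit[of x 1]
    by (simp add: R.delta_def idx_def bd_entry_def boundary_def unit_vec_at_Inl \<tau>.\<tau>_diff \<tau>.\<tau>_scalar)
  have eq: "(\<forall>x. \<tau> (coset_of F (gen x)) = \<sigma> (coset_of F (gen x))) \<longleftrightarrow> S = mat 1 \<and> T = mat 1"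
    unfolding all_letter by (auto simp: \<tau>_lt \<epsilon>_lt vec_eq_iff mat_1_entry)
  have Inr: "R.delta 0 g (Inr c) = 0" for g c by (auto simp: R.delta_def idx_def)
  show ?thesis
  proof (cases "S = mat 1 \<and> T = mat 1")
    case True
    then have "R.delta 0 g s = 0" for g s using eq d Inr by (cases s) auto
    then have "R.Ker 0 = R.supp 0" by (auto simp: R.Ker_def)
    then show ?thesis using True by (simp add: R.dim_supp card_idx)
  next
    case False
    then obtain x where x: "\<tau> (coset_of F (gen x)) \<noteq> \<sigma> (coset_of F (gen x))" using eq by blast
    have "R.Ker 0 = R.Im 0"
    proof
      show "R.Ker 0 \<subseteq> R.Im 0"
      proof
        fix g assume g: "g \<in> R.Ker 0"
        then have "g (Inr False) = 0" using d[of g x] x by (simp add: R.Ker_def)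
        then have "g s = 0" for s using g by (cases "s = Inr False") (auto simp: R.Ker_def R.supp_def idx_def)
        then show "g \<in> R.Im 0" by auto
      qed
    qed (rule R.Im_subset_Ker)
    then show ?thesis using False dim_Im_0 by auto
  qed
qed

lemma delta_1:
  "R.delta 1 g (Inl (letter c i j)) =
    (\<Sum>k\<in>UNIV. g (Inl (letter c k i)) * (\<Sum>l\<in>UNIV. E c $ k $ l * (if c then T else S) $ l $ j)) +
    (\<Sum>k\<in>UNIV. g (Inl (letter (\<not> c) k j)) * E c $ i $ k)"
proof -
  have b: "bd2 (unit_vec_at (letter c i j)) (letter c' k i') =
      (if c' = c \<and> i' = i then \<Sum>l\<in>UNIV. scalar (E c $ k $ l) * lt (\<not> c) l j else 0) +
      (if c' = (\<not> c) \<and> i' = j then scalar (E c $ i $ k) else 0)" for c' k i'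
    unfolding bd2_letter
    by (cases "c' = c"; cases "i' = i"; cases "i' = j")
      (simp_all add: unit_vec_at_def if_distrib[of "\<lambda>z. _ * z"] sum.If_cases if_distrib[of "sum f" for f] cong: if_cong)
  have "R.delta 1 g (Inl (letter c i j)) =
    (\<Sum>c'\<in>UNIV. \<Sum>k\<in>UNIV. \<Sum>i'\<in>UNIV. g (Inl (letter c' k i')) * \<tau> (coset_of F (bd2 (unit_vec_at (letter c i j)) (letter c' k i'))))"
    by (simp add: R.delta_def idx_def sum.reindex bd_entry_def boundary_def numeral_2_eq_2 unit_vec_at_Inl sum_generator)
  also have "\<dots> = (\<Sum>c'\<in>UNIV. \<Sum>k\<in>UNIV. \<Sum>i'\<in>UNIV.
      (if c' = c \<and> i' = i then g (Inl (letter c k i)) * (\<Sum>l\<in>UNIV. E c $ k $ l * (if c then T else S) $ l $ j) else 0) +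
      (if c' = (\<not> c) \<and> i' = j then g (Inl (letter (\<not> c) k j)) * E c $ i $ k else 0))"
    unfolding b by (intro sum.cong refl)
      (auto simp: \<tau>.\<tau>_add \<tau>.\<tau>_sum \<tau>.\<tau>_mult \<tau>.\<tau>_scalar \<tau>.\<tau>_0 \<tau>_lt)
  also have "\<dots> = (\<Sum>k\<in>UNIV. g (Inl (letter c k i)) * (\<Sum>l\<in>UNIV. E c $ k $ l * (if c then T else S) $ l $ j)) +
    (\<Sum>k\<in>UNIV. g (Inl (letter (\<not> c) k j)) * E c $ i $ k)"
    by (cases c) (simp_all add: UNIV_bool sum.distrib)
  finally show ?thesis .
qed

definition vec_of :: "complex ^ 'n ^ 'n \<Rightarrow> complex ^ 'n ^ 'n \<Rightarrow> 'n generator + bool \<Rightarrow> complex" where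
  "vec_of P Q s = (case s of Inl g \<Rightarrow> gcase (\<lambda>c i j. (if c then P else Q) $ i $ j) g | Inr _ \<Rightarrow> 0)"

text \<open>The equations of colour \<open>False\<close> read \<open>Q^t S + P = 0\<close> and
  determine \<open>Q\<close>, because \<open>T^t\<close> inverts \<open>S\<close>. Substituted into
  those of colour \<open>True\<close>, they say that \<open>P\<close> commutes with the transpose of
  \<open>F^{-1} T\<close>. This matrix is the inverse of \<open>F^t S\<close> and has the same
  commutant.\<close>

lemma Ker_1: "R.Ker 1 = {vec_of P (- (T ** transpose P)) | P. P ** (transpose F ** S) = (transpose F ** S) ** P}"
proof -
  have supp: "g \<in> R.supp 1 \<longleftrightarrow> (\<exists>P Q. g = vec_of P Q)" for g
  proof
    assume g: "g \<in> R.supp 1"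
    have "g s = vec_of (\<chi> i j. g (Inl (letter True i j))) (\<chi> i j. g (Inl (letter False i j))) s" for s
    proof (cases s)
      case (Inl x)
      obtain c i j where "x = letter c i j" by (rule generator_exhaust)
      then show ?thesis by (cases c) (simp_all add: Inl vec_of_def)
    next
      case (Inr b)
      then show ?thesis using g by (auto simp: R.supp_def idx_def vec_of_def)
    qed
    then show "\<exists>P Q. g = vec_of P Q" by blast
  qed (auto simp: R.supp_def idx_def vec_of_def split: sum.split)
  let ?F' = "matrix_inv F"
  have mF: "F ** ?F' = mat 1" "?F' ** F = mat 1" by (rule matrix_inv_mult[OF inv])+
  have "vec_of P Q \<in> R.Ker 1 \<longleftrightarrow> Q = - (T ** transpose P) \<and> P ** (transpose F ** S) = (transpose F ** S) ** P" for P Q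
  proof -
    have F: "R.delta 1 (vec_of P Q) (Inl (letter False i j)) = (transpose Q ** S + P) $ i $ j" for i j
      unfolding delta_1
      by (simp add: vec_of_def cup_def mat_1_entry mult_entry transpose_def if_distrib[of "\<lambda>x. _ * x"] if_distrib[of "\<lambda>x. x * _"] cong: if_cong)
    have T: "R.delta 1 (vec_of P Q) (Inl (letter True i j)) = (transpose P ** (?F' ** T) + ?F' ** Q) $ i $ j" for i j
      unfolding delta_1
      by (simp add: vec_of_def cup_def mult_entry transpose_def mult.commute)
    have I: "R.delta 1 (vec_of P Q) (Inr b) = 0" for b
      by (auto simp: R.delta_def idx_def)
    have "R.delta 1 (vec_of P Q) = (\<lambda>_. 0) \<longleftrightarrow> (\<forall>g. R.delta 1 (vec_of P Q) (Inl g) = 0)"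
      using I by (metis sum.exhaust)
    also have "\<dots> \<longleftrightarrow> transpose Q ** S + P = 0 \<and> transpose P ** (?F' ** T) + ?F' ** Q = 0"
      unfolding all_letter all_bool_eq F T by (auto simp: vec_eq_iff)
    also have "\<dots> \<longleftrightarrow> Q = - (T ** transpose P) \<and> P ** (transpose F ** S) = (transpose F ** S) ** P"
    proof -
      have neg: "(- A) ** B = - (A ** B)" "A ** (- B) = - (A ** B)" "transpose (- A) = - transpose A" for A B :: "complex ^ 'n ^ 'n"
        by (simp_all add: vec_eq_iff mult_entry transpose_def sum_negf)
      have 1: "transpose Q ** S + P = 0 \<longleftrightarrow> Q = - (T ** transpose P)"
      proof
        assume "transpose Q ** S + P = 0"
        then have "transpose Q ** S = - P" by (simp add: eq_neg_iff_add_eq_0)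
        then have "transpose Q ** (S ** transpose T) = - (P ** transpose T)" by (simp add: matrix_mul_assoc neg)
        then have "transpose (transpose Q) = transpose (- (P ** transpose T))" by (simp add: T_S)
        then show "Q = - (T ** transpose P)" by (simp add: neg matrix_transpose_mul)
      next
        assume "Q = - (T ** transpose P)"
        then have "transpose Q ** S = - (P ** (transpose T ** S))"
          by (simp add: neg matrix_transpose_mul matrix_mul_assoc)
        then show "transpose Q ** S + P = 0" by (simp add: T_S)
      qed
      let ?K = "transpose F ** S" and ?K' = "transpose (?F' ** T)"
      have K: "?K ** ?K' = mat 1"
      proof -
        have "?K ** ?K' = transpose F ** (S ** transpose T) ** transpose ?F'"
          by (simp add: matrix_transpose_mul matrix_mul_assoc)
        also have "\<dots> = transpose (?F' ** F)" by (simp add: T_S matrix_transpose_mul)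
        finally show ?thesis by (simp add: mF transpose_mat)
      qed
      then have K': "?K' ** ?K = mat 1" by (simp add: matrix_left_right_inverse)
      have "transpose P ** (?F' ** T) = ?F' ** (T ** transpose P) \<longleftrightarrow> ?K' ** P = P ** ?K'"
      proof -
        have "transpose P ** (?F' ** T) = transpose (?K' ** P)" "?F' ** (T ** transpose P) = transpose (P ** ?K')"
          by (simp_all add: matrix_transpose_mul matrix_mul_assoc)
        then show ?thesis by (metis transpose_transpose)
      qed
      also have "\<dots> \<longleftrightarrow> P ** ?K = ?K ** P"
      proof
        assume *: "?K' ** P = P ** ?K'"
        have "P ** ?K = ?K ** (?K' ** P) ** ?K" using K by (simp add: matrix_mul_assoc)
        also have "\<dots> = ?K ** P ** (?K' ** ?K)" unfolding * by (simp only: matrix_mul_assoc)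
        finally show "P ** ?K = ?K ** P" by (simp only: K' matrix_mul_rid)
      next
        assume *: "P ** ?K = ?K ** P"
        have "?K' ** P = ?K' ** (P ** ?K) ** ?K'" using K by (simp only: matrix_mul_assoc[symmetric] matrix_mul_rid)
        also have "\<dots> = (?K' ** ?K) ** P ** ?K'" unfolding * by (simp only: matrix_mul_assoc)
        finally show "?K' ** P = P ** ?K'" by (simp only: K' matrix_mul_lid)
      qed
      finally show ?thesis unfolding 1 by (auto simp: neg)
    qed
    finally show ?thesis using supp by (auto simp: R.Ker_def)
  qed
  note * = this
  show ?thesis
  proof (intro equalityI subsetI)
    fix g assume g: "g \<in> R.Ker 1"
    then obtain P Q where PQ: "g = vec_of P Q" using supp unfolding R.Ker_def by blast
    have "Q = - (T ** transpose P)" "P ** (transpose F ** S) = (transpose F ** S) ** P"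
      using g unfolding PQ * by blast+
    then show "g \<in> {vec_of P (- (T ** transpose P)) | P. P ** (transpose F ** S) = (transpose F ** S) ** P}"
      unfolding PQ by blast
  next
    fix g assume "g \<in> {vec_of P (- (T ** transpose P)) | P. P ** (transpose F ** S) = (transpose F ** S) ** P}"
    then show "g \<in> R.Ker 1" by (elim CollectE exE conjE) (simp only: * simp_thms)
  qed
qed

lemma mat_scale_entry: "mat_scale a A $ i $ j = a * A $ i $ j"
  by (simp add: mat_scale_def)

lemma mat_scale_mult: "mat_scale a A ** B = mat_scale a (A ** B)" "A ** mat_scale a B = mat_scale a (A ** B)"
  and transpose_mat_scale: "transpose (mat_scale a A) = mat_scale a (transpose A)"
  by (simp_all add: vec_eq_iff mult_entry mat_scale_entry transpose_def sum_distrib_left mult.assoc mult.left_commute)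

lemma dim_Ker_1: "fvec.dim (R.Ker 1) = vectorspace.dim class_ring (commutant (transpose F ** S))"
proof -
  let ?C = "commutant (transpose F ** S)" and ?\<beta> = "\<lambda>P. vec_of P (- (T ** transpose P))"
  have vec_add: "vec_of (P + P') (Q + Q') = vec_of P Q + vec_of P' Q'" for P P' Q Q'
  proof
    fix s show "vec_of (P + P') (Q + Q') s = (vec_of P Q + vec_of P' Q') s"
      by (cases s) (auto simp: vec_of_def gcase_def plus_fun_apply split: generator.split)
  qed
  have vec_scale: "vec_of (mat_scale a P) (mat_scale a Q) = fscale a (vec_of P Q)" for a P Q
  proof
    fix s show "vec_of (mat_scale a P) (mat_scale a Q) s = fscale a (vec_of P Q) s"
      by (cases s) (auto simp: vec_of_def gcase_def fscale_def mat_scale_entry split: generator.split)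
  qed
  have inj: "P = P'" if "vec_of P Q = vec_of P' Q'" for P P' Q Q'
  proof -
    have "P $ i $ j = P' $ i $ j" for i j
      using fun_cong[OF that, of "Inl (letter True i j)"] by (simp add: vec_of_def)
    then show ?thesis by (simp add: vec_eq_iff)
  qed
  have t_add: "- (T ** transpose (P + P')) = - (T ** transpose P) + - (T ** transpose P')" for P P'
    by (simp add: vec_eq_iff mult_entry transpose_def distrib_left sum.distrib)
  have t_scale: "- (T ** transpose (mat_scale a P)) = mat_scale a (- (T ** transpose P))" for a P
    by (simp add: transpose_mat_scale mat_scale_mult vec_eq_iff mat_scale_entry)
  have "coordinates fscale ?C ?\<beta> (R.Ker 1)"
  proof
    show "fvec.subspace (R.Ker 1)" by (rule R.subspace_Ker)
    show "bij_betw ?\<beta> (carrier ?C) (R.Ker 1)"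
      unfolding bij_betw_def Ker_1 by (auto simp: commutant_def intro!: inj_onI dest: inj)
    show "\<zero>\<^bsub>?C\<^esub> \<in> carrier ?C" by (simp add: commutant_def)
    have "(A + B) ** C = A ** C + B ** C" for A B C :: "complex ^ 'n ^ 'n"
      by (simp add: vec_eq_iff mult_entry distrib_right sum.distrib)
    then show "P \<oplus>\<^bsub>?C\<^esub> P' \<in> carrier ?C" if "P \<in> carrier ?C" "P' \<in> carrier ?C" for P P'
      using that by (simp add: commutant_def matrix_add_ldistrib)
    show "a \<odot>\<^bsub>?C\<^esub> P \<in> carrier ?C" if "P \<in> carrier ?C" for a P
      using that by (simp add: commutant_def mat_scale_mult)
    show "?\<beta> (P \<oplus>\<^bsub>?C\<^esub> P') = ?\<beta> P + ?\<beta> P'" for P P'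
      unfolding vec_add[symmetric] t_add[symmetric] by (simp add: commutant_def)
    show "?\<beta> (a \<odot>\<^bsub>?C\<^esub> P) = fscale a (?\<beta> P)" for a P
      unfolding vec_scale[symmetric] t_scale[symmetric] by (simp add: commutant_def)
    have z: "mat_scale 0 P = 0" "- (T ** transpose (0 :: complex ^ 'n ^ 'n)) = 0" for P :: "complex ^ 'n ^ 'n"
      by (simp_all add: vec_eq_iff mat_scale_entry mult_entry transpose_def)
    show "?\<beta> \<zero>\<^bsub>?C\<^esub> = 0"
      using vec_scale[of 0 0 0] z by (simp add: commutant_def zero_fun_def fscale_def)
  qed
  then interpret C: coordinates fscale ?C ?\<beta> "R.Ker 1" .
  have "R.Ker 1 \<subseteq> fvec.span (unit_vec_at ` idx 1)"
    using R.supp_span[of 1] unfolding R.Ker_def by (rule order_trans[rotated]) blast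
  from C.dim_eq[OF this finite_imageI[OF R.finite_J]] show ?thesis by (rule conjunct2[THEN sym])
qed

lemma \<tau>_syzygy:
  "\<tau> (coset_of F (syzygy_elt (unit_vec_at d) c m i)) =
    (if c then (if d then - mat 1 else transpose F ** S ** transpose F) else (if d then matrix_inv F ** T else - F)) $ m $ i"
proof -
  have "(transpose F ** S ** transpose F) $ m $ i = (\<Sum>l\<in>UNIV. F $ l $ m * (\<Sum>r\<in>UNIV. F $ i $ r * S $ l $ r))"
    unfolding mult_entry transpose_def sum_distrib_left sum_distrib_right
    by (subst sum.swap) (simp add: mult_ac)
  then show ?thesis
    by (cases c; cases d)
      (simp_all add: syzygy_elt_def unit_vec_at_def \<tau>.\<tau>_diff \<tau>.\<tau>_uminus \<tau>.\<tau>_sum \<tau>.\<tau>_mult \<tau>.\<tau>_scalar \<tau>.\<tau>_1 \<tau>.\<tau>_0 \<tau>_lt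
        syz_inv_def cap_def cup_def mat_1_entry mult_entry[of "matrix_inv F"]
        if_distrib[of "\<lambda>x. _ * x"] if_distrib[of "\<lambda>x. x * _"] cong: if_cong)
qed

lemma delta_2: "R.delta 2 g (Inr d) = (\<Sum>x\<in>UNIV. g (Inl x) * \<tau> (coset_of F (gcase (syzygy_elt (unit_vec_at d)) x)))"
  "R.delta 2 g (Inl x) = 0"
  by (auto simp: R.delta_def idx_def sum.reindex bd_entry_def boundary_def unit_vec_at_Inr)

lemma delta_2_unit: "R.delta 2 (unit_vec_at (Inl (letter c m i))) (Inr d) =
    (if c then (if d then - mat 1 else transpose F ** S ** transpose F) else (if d then matrix_inv F ** T else - F)) $ m $ i"
  by (simp add: delta_2 unit_vec_at_def if_distrib[of "\<lambda>z. z * _"] \<tau>_syzygy cong: if_cong del: if_cong)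

lemma Im_3: "R.Im 3 = R.delta 2 ` R.supp 2"
  by (simp add: numeral_3_eq_3 numeral_2_eq_2)

text \<open>The image is spanned by the pairs of corresponding entries of the matrices
  \<open>(-1, F^t S F^t)\<close> and \<open>(F^{-1} T, -F)\<close>, coordinate \<open>True\<close>
  being listed before \<open>False\<close>. The entry -1 excludes rank 0. The rank is 1 iff the
  second coordinate is a fixed multiple of the first; the second pair of matrices then says
  \<open>F^2 = \<alpha> T\<close>, and conversely this implies \<open>F^t S F^t = \<alpha>\<close>,
  so the first pair imposes nothing more.\<close>

lemma dim_Im_3: "fvec.dim (R.Im 3) = (if \<exists>\<alpha>. F ** F = mat_scale \<alpha> T then 1 else 2)"
proof -
  let ?F' = "matrix_inv F"
  have mF: "F ** ?F' = mat 1" "?F' ** F = mat 1" by (rule matrix_inv_mult[OF inv])+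
  define v where "v c m i = R.delta 2 (unit_vec_at (Inl (letter c m i)))" for c m i
  have v: "v c m i (Inl x) = 0" "v c m i (Inr d) =
      (if c then (if d then - mat 1 else transpose F ** S ** transpose F) else (if d then ?F' ** T else - F)) $ m $ i" for c m i d x
    unfolding v_def by (rule delta_2(2), rule delta_2_unit)
  have vIm: "v c m i \<in> R.Im 3" for c m i
    unfolding Im_3 v_def by (rule imageI) (auto simp: R.supp_def idx_def unit_vec_at_def)
  \<comment> \<open>Any index serves: the diagonal entry -1 gives a vector of the image that is not
    zero.\<close>
  fix i0 :: 'n
  have v0: "v True i0 i0 (Inr True) = - 1" by (simp add: v mat_1_entry)
  show ?thesis
  proof (cases "\<exists>\<alpha>. F ** F = mat_scale \<alpha> T")
    case True
    then obtain \<alpha> where \<alpha>: "F ** F = mat_scale \<alpha> T" by blast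
    have 1: "F = mat_scale \<alpha> (?F' ** T)"
    proof -
      have "F = ?F' ** (F ** F)" by (simp add: matrix_mul_assoc mF)
      then show ?thesis by (simp add: \<alpha> mat_scale_mult)
    qed
    have 2: "transpose F ** S ** transpose F = mat_scale \<alpha> (mat 1)"
    proof -
      have "transpose F ** transpose F = mat_scale \<alpha> (transpose T)"
        unfolding matrix_transpose_mul[symmetric] \<alpha> by (rule transpose_mat_scale)
      then have SFF: "S ** transpose F ** transpose F = mat_scale \<alpha> (mat 1)"
        by (simp add: matrix_mul_assoc[symmetric] mat_scale_mult T_S)
      have FF': "transpose F ** transpose ?F' = mat 1"
        unfolding matrix_transpose_mul[symmetric] mF by (rule transpose_mat)
      have "transpose F ** S ** transpose F = transpose F ** (S ** transpose F ** transpose F) ** transpose ?F'"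
        by (simp add: matrix_mul_assoc[symmetric] FF')
      then show ?thesis by (simp add: SFF mat_scale_mult FF')
    qed
    have \<tau>\<alpha>: "\<tau> (coset_of F (gcase (syzygy_elt (unit_vec_at False)) x)) =
        - \<alpha> * \<tau> (coset_of F (gcase (syzygy_elt (unit_vec_at True)) x))" for x
    proof -
      obtain c m i where x: "x = letter c m i" by (rule generator_exhaust)
      have "F $ m $ i = \<alpha> * (?F' ** T) $ m $ i"
        using arg_cong[OF 1, of "\<lambda>A. A $ m $ i"] by (simp add: mat_scale_entry)
      then show ?thesis by (cases c) (simp_all add: x \<tau>_syzygy 2 mat_scale_entry)
    qed
    have rel: "h (Inr False) = - \<alpha> * h (Inr True)" "h (Inl x) = 0" if "h \<in> R.Im 3" for h x
      using that unfolding Im_3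
      by (auto simp: delta_2 \<tau>\<alpha> sum_distrib_left mult.left_commute sum_negf)
    have "h = fscale (- h (Inr True)) (v True i0 i0)" if h: "h \<in> R.Im 3" for h
    proof
      fix s show "h s = fscale (- h (Inr True)) (v True i0 i0) s"
      proof (cases s)
        case (Inr d)
        then show ?thesis using rel(1)[OF h] rel(1)[OF vIm, of True i0 i0] v0 by (cases d) (simp_all add: fscale_def)
      qed (simp add: rel(2)[OF h] v fscale_def)
    qed
    then have "R.Im 3 \<subseteq> fvec.span {v True i0 i0}"
      by (metis fvec.span_base fvec.span_scale insertI1 subsetI)
    moreover have "fvec.span {v True i0 i0} \<subseteq> R.Im 3"
      using vIm by (intro fvec.span_minimal R.subspace_Im) simp
    ultimately have "R.Im 3 = fvec.span {v True i0 i0}" by (rule equalityI)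
    moreover have "v True i0 i0 \<noteq> 0" using v0 by (auto simp: zero_fun_apply)
    then have "\<not> fvec.dependent {v True i0 i0}" by (simp add: fvec.dependent_single)
    from fvec.dim_span_eq_card_independent[OF this]
    have "fvec.dim (fvec.span {v True i0 i0}) = card {v True i0 i0}" .
    ultimately have "fvec.dim (R.Im 3) = card {v True i0 i0}" by (simp only:)
    then show ?thesis using True by simp
  next
    case False
    \<comment> \<open>Since \<open>v0\<close> has first coordinate -1, rank 1 would force every
      vector of the image to have second coordinate \<open>- \<mu>\<close> times the first, and then
      \<open>F^2 = \<mu> T\<close>.\<close>
    define \<mu> where "\<mu> = v True i0 i0 (Inr False)"
    have "\<exists>m k. F $ m $ k \<noteq> \<mu> * (?F' ** T) $ m $ k"
    proof (rule ccontr)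
      assume "\<not> ?thesis"
      then have "F = mat_scale \<mu> (?F' ** T)" by (simp add: vec_eq_iff mat_scale_entry)
      then have "F ** F = F ** mat_scale \<mu> (?F' ** T)" by simp
      also have "\<dots> = mat_scale \<mu> T" by (simp add: mat_scale_mult matrix_mul_assoc mF)
      finally show False using False by blast
    qed
    then obtain m k where mk: "F $ m $ k \<noteq> \<mu> * (?F' ** T) $ m $ k" by blast
    let ?p = "(?F' ** T) $ m $ k" and ?q = "- F $ m $ k"
    have v1: "v False m k (Inr True) = ?p" "v False m k (Inr False) = ?q" by (simp_all add: v)
    have nz: "?q + \<mu> * ?p \<noteq> 0" using mk by (simp add: eq_neg_iff_add_eq_0)
    have "h \<in> R.Im 3" if h: "h \<in> R.supp 3" for h
    proof -
      \<comment> \<open>The coefficients solve a linear system of two equations for the vectors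
        \<open>(-1, \<mu>)\<close> and \<open>(?p, ?q)\<close>; the denominator is its determinant
        up to sign.\<close>
      define y where "y = (h (Inr False) + \<mu> * h (Inr True)) / (?q + \<mu> * ?p)"
      define x where "x = y * ?p - h (Inr True)"
      have "y * (?q + \<mu> * ?p) = h (Inr False) + \<mu> * h (Inr True)" using nz by (simp add: y_def)
      then have y: "x * \<mu> + y * ?q = h (Inr False)" by (simp add: x_def algebra_simps)
      have "h = fscale x (v True i0 i0) + fscale y (v False m k)"
      proof
        fix s show "h s = (fscale x (v True i0 i0) + fscale y (v False m k)) s"
        proof (cases s)
          case (Inl g)
          then have "h s = 0" using h by (auto simp: R.supp_def idx_def)
          then show ?thesis by (simp add: Inl v plus_fun_apply fscale_def)
        next
          case (Inr d)
          then show ?thesis using y v0 v1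
            by (cases d) (simp_all add: plus_fun_apply fscale_def \<mu>_def[symmetric] x_def)
        qed
      qed
      then show ?thesis
        using fvec.subspace_add[OF R.subspace_Im fvec.subspace_scale[OF R.subspace_Im vIm] fvec.subspace_scale[OF R.subspace_Im vIm]]
        by simp
    qed
    moreover have "R.Im 3 \<subseteq> R.supp 3" using R.Im_subset_Ker by (auto simp: R.Ker_def)
    ultimately have "R.Im 3 = R.supp 3" by blast
    then show ?thesis using False by (simp add: R.dim_supp card_idx)
  qed
qed

text \<open>Linear arithmetic from rank-nullity in each degree, with \<open>dim_Ker_0\<close>,
  \<open>dim_Ker_1\<close> and \<open>dim_Im_3\<close> as the only nontrivial input. The rank
  \<open>2 n^2\<close> of both middle modules cancels in degree 2. Sums avoid truncated
  subtraction.\<close>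

lemma cohomology_dims:
  defines "HH \<equiv> hochschild_cohomology (\<H> F) (character_bimodule \<sigma> \<tau>)"
    and "d \<equiv> vectorspace.dim class_ring (commutant (transpose F ** S))"
    and "p \<equiv> if S = mat 1 \<and> T = mat 1 then 1 else 0 :: nat"
    and "t \<equiv> if \<exists>\<alpha>. F ** F = mat_scale \<alpha> T then 1 else 2 :: nat"
  shows "vectorspace.fin_dim class_ring (HH k)"
    "vectorspace.dim class_ring (HH 0) = p"
    "vectorspace.dim class_ring (HH 1) + 1 = d + p"
    "vectorspace.dim class_ring (HH 2) + t = d"
    "vectorspace.dim class_ring (HH 3) + t = 2"
    "k \<ge> 4 \<Longrightarrow> vectorspace.dim class_ring (HH k) = 0"
proof -
  note HH = R.hochschild_cohomology_dim[folded HH_def]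
  have rank: "fvec.dim (R.Ker 0) + fvec.dim (R.Im 1) = 1"
    "fvec.dim (R.Ker 1) + fvec.dim (R.Im 2) = 2 * CARD('n)\<^sup>2"
    "fvec.dim (R.Ker 2) + fvec.dim (R.Im 3) = 2 * CARD('n)\<^sup>2"
    "fvec.dim (R.Ker 3) + fvec.dim (R.Im 4) = 2"
    using R.dim_Ker_Im[of 0] R.dim_Ker_Im[of 1] R.dim_Ker_Im[of 2] R.dim_Ker_Im[of 3] card_idx
    by (simp_all add: numeral_2_eq_2 numeral_3_eq_3 eval_nat_numeral)
  have Ker0: "fvec.dim (R.Ker k) = 0" if "k \<ge> 4" for k
    using R.dim_Ker_Im[of k] card_idx(5)[OF that] by simp
  have "fvec.dim (R.Im 4) = 0" using HH[of 4] Ker0[of 4] by simp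
  note dims = rank this dim_Ker_0[folded p_def] dim_Im_0 dim_Ker_1[folded d_def] dim_Im_3[folded t_def]
  show "vectorspace.fin_dim class_ring (HH k)" using HH by blast
  show "vectorspace.dim class_ring (HH 0) = p" using HH[of 0] dims by linarith
  show "vectorspace.dim class_ring (HH 1) + 1 = d + p" using HH[of 1] dims by linarith
  show "vectorspace.dim class_ring (HH 2) + t = d" using HH[of 2] dims by linarith
  show "vectorspace.dim class_ring (HH 3) + t = 2" using HH[of 3] dims by linarith
  show "k \<ge> 4 \<Longrightarrow> vectorspace.dim class_ring (HH k) = 0" using HH[of k] Ker0[of k] by simp
qed

end

lemma character_free:
  assumes "character (\<H> F) \<phi>"
  shows "free_algebra_character (rel_ideal F) (\<lambda>x. \<phi> (coset_of F x))"
proof -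
  obtain h where rel: "\<And>r. r \<in> relations F \<Longrightarrow> eval_free h r = 0"
    and h: "\<And>x. \<phi> (coset_of F x) = eval_free h x"
    using assms unfolding character_\<H>_iff by blast
  show ?thesis
    by standard (simp_all add: h eval_free_add eval_free_mult eval_free_rel_ideal[OF rel])
qed

text \<open>Finite dimensionality is part of the conclusion because \<open>dim\<close> is
  informative only together with it. The dimensions are compared as integers, so the differences are
  genuine.\<close>

theorem theorem2:
  fixes F S T :: "complex ^ 'n ^ 'n"
    and \<tau> :: "'n generator free_algebra set \<Rightarrow> complex"
    and d p t :: nat
  assumes "CARD('n) \<ge> 2"
    and "invertible F"
    and "generic F"
    and "character (\<H> F) \<tau>"
    and "S = map_matrix \<tau> (\<H>_u F)"
    and "T = map_matrix \<tau> (\<H>_v F)"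
    and "d = vectorspace.dim class_ring (commutant (transpose F ** S))"
    and "p = (if S = mat 1 \<and> T = mat 1 then 1 else 0)"
    and "t = (if \<exists>\<alpha>. F ** F = mat_scale \<alpha> T then 1 else 2)"
  defines "HH \<equiv> hochschild_cohomology (\<H> F) (character_bimodule (counit F) \<tau>)"
  shows "(\<forall>k. vectorspace.fin_dim class_ring (HH k)) \<and>
    int (vectorspace.dim class_ring (HH 0)) = int p \<and>
    int (vectorspace.dim class_ring (HH 1)) = int d + int p - 1 \<and>
    int (vectorspace.dim class_ring (HH 2)) = int d - int t \<and>
    int (vectorspace.dim class_ring (HH 3)) = 2 - int t \<and>
    (\<forall>k\<ge>4. vectorspace.dim class_ring (HH k) = 0)"
proof -
  note \<epsilon> = counit[OF assms(2)]
  have char: "character (\<H> F) (counit F)" and uv: "map_matrix (counit F) (\<H>_u F) = mat 1" "map_matrix (counit F) (\<H>_v F) = mat 1"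
    using \<epsilon> by blast+
  interpret C: character_pair F "counit F" \<tau>
  proof (intro character_pair.intro counit_character.intro counit_character_axioms.intro character_free assms(4) char)
    show "generic_matrix F" using assms(2,3) by unfold_locales
    fix c and i j :: 'n
    have "counit F (coset_of F (lt c i j)) = (if c then map_matrix (counit F) (\<H>_u F) else map_matrix (counit F) (\<H>_v F)) $ i $ j"
      by (simp add: \<H>_u_def \<H>_v_def u_mat_def v_mat_def letter_def)
    also have "\<dots> = (if i = j then 1 else 0)" unfolding uv by (simp add: mat_def)
    finally show "counit F (coset_of F (lt c i j)) = (if i = j then 1 else 0)" .
  qed
  have ST: "C.S = S" "C.T = T"
    unfolding assms(5,6) by (simp_all add: vec_eq_iff C.S_def C.T_def \<H>_u_def \<H>_v_def u_mat_def v_mat_def letter_def)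
  note dims = C.cohomology_dims[unfolded ST, folded HH_def assms(7-9)]
  show ?thesis
    using dims(1) dims(2,3,4,5) dims(6) by auto
qed

end
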